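(* Let $w$ be a weight structure on a triangulated category $\mathcal{C}$, where $\mathcal{C}$ is smashing and satisfies the Brown representability property. Then there exists a $t$-structure $t^l$ on $\mathcal{C}$ left adjacent to $w$ if and only if $w$ is smashing. Moreover, $t^l$ is cosmashing (if it exists) and its heart is equivalent to the category of those additive functors $\underline{Hw}^{op}\to \mathrm{Ab}$ that respect products.
   Context: Conventions: all products and coproducts are small; $X\perp Y$ means $\mathcal{C}(X,Y)=0$, and for classes $D,E$ of objects $D\perp E$ means $X\perp Y$ for all $X\in D$, $Y\in E$. A triangulated category is (co)smashing if it has all small coproducts (resp. products). A smashing $\mathcal{C}$ satisfies the Brown representability property if any cohomological functor $\mathcal{C}^{op}\to\mathrm{Ab}$ that converts all $\mathcal{C}$-coproducts into products is representable. A weight structure $w=(\mathcal{C}_{w\le 0},\mathcal{C}_{w\ge 0})$ on $\mathcal{C}$ is a pair of classes of objects closed under retracts such that $\mathcal{C}_{w\le 0}\subset \mathcal{C}_{w\le 0}[1]$, $\mathcal{C}_{w\ge 0}[1]\subset \mathcal{C}_{w\ge 0}$, $\mathcal{C}_{w\le 0}\perp \mathcal{C}_{w\ge 0}[1]$, and every object $M$ fits into a distinguished triangle $L_wM\to M\to R_wM\to L_wM[1]$ with $L_wM\in \mathcal{C}_{w\le 0}$, $R_wM\in\mathcal{C}_{w\ge 0}[1]$. Its heart $\underline{Hw}$ is the full subcategory with object class $\mathcal{C}_{w\le 0}\cap \mathcal{C}_{w\ge 0}$. $w$ is smashing if $\mathcal{C}$ is smashing and $\mathcal{C}_{w\ge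 0}$ is closed under $\mathcal{C}$-coproducts. A $t$-structure $t=(\mathcal{C}_{t\le 0},\mathcal{C}_{t\ge 0})$ on $\mathcal{C}$ (homological convention) is a pair of classes of objects closed under isomorphism such that $\mathcal{C}_{t\le 0}\subset \mathcal{C}_{t\le 0}[1]$, $\mathcal{C}_{t\ge 0}[1]\subset \mathcal{C}_{t\ge 0}$, $\mathcal{C}_{t\ge 0}[1]\perp \mathcal{C}_{t\le 0}$, and every object $M$ fits into a distinguished triangle $L_tM\to M\to R_tM\to L_tM[1]$ with $L_tM\in \mathcal{C}_{t\ge 0}$, $R_tM\in\mathcal{C}_{t\le 0}[-1]$. Its heart is the full subcategory with object class $\mathcal{C}_{t\le 0}\cap \mathcal{C}_{t\ge 0}$. $t$ is cosmashing if $\mathcal{C}$ is cosmashing and $\mathcal{C}_{t\ge 0}$ is closed under $\mathcal{C}$-products. Write $\mathcal{C}_{t\le i}=\mathcal{C}_{t\le 0}[i]$, $\mathcal{C}_{t\ge i}=\mathcal{C}_{t\ge 0}[i]$. $t$ is left adjacent to $w$ if $\mathcal{C}_{w\le 0}\perp\mathcal{C}_{t\ge 1}$ and $\mathcal{C}_{w\ge 0}\perp\mathcal{C}_{t\le -1}$ (equivalently, if $\mathcal{C}_{t\ge 0}=\mathcal{C}_{w\ge 0}$). *)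

theory Defs
  imports "HOL-Library.Equipollence" "HOL-Library.FuncSet" "HOL-Algebra.Coset"
begin

text \<open>
  Size conventions.  Smallness is relative to a Grothendieck universe, presented by a type
  \<open>'u\<close> whose cardinality is infinite, regular and a strong limit: a set (of any type) is small
  if it is strictly smaller than \<open>'u\<close>.  As in SGA 4 the countable universe is not excluded, so
  that \<open>'u = nat\<close> is admissible; an uncountable \<open>'u\<close> gives the usual notion.  Small index sets
  and the carriers of small groups can then be taken inside \<open>'u\<close> without loss of generality.
  Classes are plain sets, of arbitrary type.
\<close>

definition small :: "'u itself \<Rightarrow> 'a set \<Rightarrow> bool" where
  "small U S \<longleftrightarrow> S \<prec> (UNIV :: 'u set)"

definition universe :: "'u itself \<Rightarrow> bool" where
  "universe U \<longleftrightarrow>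
     infinite (UNIV :: 'u set) \<and>
     (\<forall>S :: 'u set. small U S \<longrightarrow> small U (Pow S)) \<and>
     (\<forall>(I :: 'u set) (A :: 'u \<Rightarrow> 'u set).
        small U I \<and> (\<forall>i\<in>I. small U (A i)) \<longrightarrow> small U (\<Union>i\<in>I. A i))"


section \<open>Categories and functors\<close>

record ('o, 'm) category =
  Obj :: "'o set"
  Arr :: "'m set"
  Dom :: "'m \<Rightarrow> 'o"
  Cod :: "'m \<Rightarrow> 'o"
  Id :: "'o \<Rightarrow> 'm"
  Comp :: "'m \<Rightarrow> 'm \<Rightarrow> 'm"  (infixl "\<cdot>\<index>" 70)

definition Hom :: "('o, 'm, 'z) category_scheme \<Rightarrow> 'o \<Rightarrow> 'o \<Rightarrow> 'm set" where
  "Hom C X Y = {f \<in> Arr C. Dom C f = X \<and> Cod C f = Y}"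

definition is_category :: "('o, 'm, 'z) category_scheme \<Rightarrow> bool" where
  "is_category C \<longleftrightarrow>
     (\<forall>f\<in>Arr C. Dom C f \<in> Obj C \<and> Cod C f \<in> Obj C) \<and>
     (\<forall>X\<in>Obj C. Id C X \<in> Hom C X X) \<and>
     (\<forall>f\<in>Arr C. \<forall>g\<in>Arr C. Cod C f = Dom C g \<longrightarrow> g \<cdot>\<^bsub>C\<^esub> f \<in> Hom C (Dom C f) (Cod C g)) \<and>
     (\<forall>f\<in>Arr C. f \<cdot>\<^bsub>C\<^esub> Id C (Dom C f) = f \<and> Id C (Cod C f) \<cdot>\<^bsub>C\<^esub> f = f) \<and>
     (\<forall>f\<in>Arr C. \<forall>g\<in>Arr C. \<forall>h\<in>Arr C. Cod C f = Dom C g \<and> Cod C g = Dom C h \<longrightarrow>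
        h \<cdot>\<^bsub>C\<^esub> (g \<cdot>\<^bsub>C\<^esub> f) = (h \<cdot>\<^bsub>C\<^esub> g) \<cdot>\<^bsub>C\<^esub> f)"

definition locally_small :: "'u itself \<Rightarrow> ('o, 'm, 'z) category_scheme \<Rightarrow> bool" where
  "locally_small U C \<longleftrightarrow> (\<forall>X\<in>Obj C. \<forall>Y\<in>Obj C. small U (Hom C X Y))"

definition is_iso_arr :: "('o, 'm, 'z) category_scheme \<Rightarrow> 'm \<Rightarrow> bool" where
  "is_iso_arr C f \<longleftrightarrow> f \<in> Arr C \<and>
     (\<exists>g\<in>Hom C (Cod C f) (Dom C f). g \<cdot>\<^bsub>C\<^esub> f = Id C (Dom C f) \<and> f \<cdot>\<^bsub>C\<^esub> g = Id C (Cod C f))"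

definition isomorphic :: "('o, 'm, 'z) category_scheme \<Rightarrow> 'o \<Rightarrow> 'o \<Rightarrow> bool" where
  "isomorphic C X Y \<longleftrightarrow> (\<exists>f\<in>Hom C X Y. is_iso_arr C f)"

definition is_retract :: "('o, 'm, 'z) category_scheme \<Rightarrow> 'o \<Rightarrow> 'o \<Rightarrow> bool" where
  "is_retract C X Y \<longleftrightarrow> X \<in> Obj C \<and> Y \<in> Obj C \<and>
     (\<exists>i\<in>Hom C X Y. \<exists>p\<in>Hom C Y X. p \<cdot>\<^bsub>C\<^esub> i = Id C X)"

definition is_product ::
  "('o, 'm, 'z) category_scheme \<Rightarrow> 'i set \<Rightarrow> ('i \<Rightarrow> 'o) \<Rightarrow> 'o \<Rightarrow> ('i \<Rightarrow> 'm) \<Rightarrow> bool" where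
  "is_product C I X P \<pi> \<longleftrightarrow>
     P \<in> Obj C \<and> (\<forall>i\<in>I. X i \<in> Obj C \<and> \<pi> i \<in> Hom C P (X i)) \<and>
     (\<forall>Q\<in>Obj C. \<forall>\<sigma>. (\<forall>i\<in>I. \<sigma> i \<in> Hom C Q (X i)) \<longrightarrow>
        (\<exists>!h. h \<in> Hom C Q P \<and> (\<forall>i\<in>I. \<pi> i \<cdot>\<^bsub>C\<^esub> h = \<sigma> i)))"

definition is_coproduct ::
  "('o, 'm, 'z) category_scheme \<Rightarrow> 'i set \<Rightarrow> ('i \<Rightarrow> 'o) \<Rightarrow> 'o \<Rightarrow> ('i \<Rightarrow> 'm) \<Rightarrow> bool" where
  "is_coproduct C I X P \<iota> \<longleftrightarrow>
     P \<in> Obj C \<and> (\<forall>i\<in>I. X i \<in> Obj C \<and> \<iota> i \<in> Hom C (X i) P) \<and>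
     (\<forall>Q\<in>Obj C. \<forall>\<sigma>. (\<forall>i\<in>I. \<sigma> i \<in> Hom C (X i) Q) \<longrightarrow>
        (\<exists>!h. h \<in> Hom C P Q \<and> (\<forall>i\<in>I. h \<cdot>\<^bsub>C\<^esub> \<iota> i = \<sigma> i)))"

definition cosmashing :: "'u itself \<Rightarrow> ('o, 'm, 'z) category_scheme \<Rightarrow> bool" where
  "cosmashing U C \<longleftrightarrow> (\<forall>(I :: 'u set) X. small U I \<and> (\<forall>i\<in>I. X i \<in> Obj C) \<longrightarrow>
     (\<exists>P \<pi>. is_product C I X P \<pi>))"

definition smashing :: "'u itself \<Rightarrow> ('o, 'm, 'z) category_scheme \<Rightarrow> bool" where
  "smashing U C \<longleftrightarrow> (\<forall>(I :: 'u set) X. small U I \<and> (\<forall>i\<in>I. X i \<in> Obj C) \<longrightarrow>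
     (\<exists>P \<iota>. is_coproduct C I X P \<iota>))"

definition closed_under_products ::
  "'u itself \<Rightarrow> ('o, 'm, 'z) category_scheme \<Rightarrow> 'o set \<Rightarrow> bool" where
  "closed_under_products U C D \<longleftrightarrow> (\<forall>(I :: 'u set) X P \<pi>.
     small U I \<and> (\<forall>i\<in>I. X i \<in> D) \<and> is_product C I X P \<pi> \<longrightarrow> P \<in> D)"

definition closed_under_coproducts ::
  "'u itself \<Rightarrow> ('o, 'm, 'z) category_scheme \<Rightarrow> 'o set \<Rightarrow> bool" where
  "closed_under_coproducts U C D \<longleftrightarrow> (\<forall>(I :: 'u set) X P \<iota>.
     small U I \<and> (\<forall>i\<in>I. X i \<in> D) \<and> is_coproduct C I X P \<iota> \<longrightarrow> P \<in> D)"

record ('o, 'm, 'p, 'n) ftor =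
  FO :: "'o \<Rightarrow> 'p"
  FA :: "'m \<Rightarrow> 'n"

definition is_functor ::
  "('o, 'm, 'y) category_scheme \<Rightarrow> ('p, 'n, 'z) category_scheme \<Rightarrow> ('o, 'm, 'p, 'n) ftor \<Rightarrow> bool" where
  "is_functor A B F \<longleftrightarrow>
     (\<forall>X\<in>Obj A. FO F X \<in> Obj B) \<and>
     (\<forall>f\<in>Arr A. FA F f \<in> Hom B (FO F (Dom A f)) (FO F (Cod A f))) \<and>
     (\<forall>X\<in>Obj A. FA F (Id A X) = Id B (FO F X)) \<and>
     (\<forall>f\<in>Arr A. \<forall>g\<in>Arr A. Cod A f = Dom A g \<longrightarrow> FA F (g \<cdot>\<^bsub>A\<^esub> f) = FA F g \<cdot>\<^bsub>B\<^esub> FA F f)"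

definition id_functor :: "('o, 'm, 'o, 'm) ftor" where
  "id_functor = \<lparr>FO = (\<lambda>X. X), FA = (\<lambda>f. f)\<rparr>"

definition comp_functor ::
  "('p, 'n, 'q, 'k) ftor \<Rightarrow> ('o, 'm, 'p, 'n) ftor \<Rightarrow> ('o, 'm, 'q, 'k) ftor" where
  "comp_functor G F = \<lparr>FO = FO G \<circ> FO F, FA = FA G \<circ> FA F\<rparr>"

definition nat_trans ::
  "('o, 'm, 'y) category_scheme \<Rightarrow> ('p, 'n, 'z) category_scheme \<Rightarrow>
   ('o, 'm, 'p, 'n) ftor \<Rightarrow> ('o, 'm, 'p, 'n) ftor \<Rightarrow> ('o \<Rightarrow> 'n) \<Rightarrow> bool" where
  "nat_trans A B F G \<eta> \<longleftrightarrow>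
     (\<forall>X\<in>Obj A. \<eta> X \<in> Hom B (FO F X) (FO G X)) \<and>
     (\<forall>f\<in>Arr A. \<eta> (Cod A f) \<cdot>\<^bsub>B\<^esub> FA F f = FA G f \<cdot>\<^bsub>B\<^esub> \<eta> (Dom A f))"

definition nat_isomorphic ::
  "('o, 'm, 'y) category_scheme \<Rightarrow> ('p, 'n, 'z) category_scheme \<Rightarrow>
   ('o, 'm, 'p, 'n) ftor \<Rightarrow> ('o, 'm, 'p, 'n) ftor \<Rightarrow> bool" where
  "nat_isomorphic A B F G \<longleftrightarrow> (\<exists>\<eta>. nat_trans A B F G \<eta> \<and> (\<forall>X\<in>Obj A. is_iso_arr B (\<eta> X)))"

definition equivalent_categories ::
  "('o, 'm, 'y) category_scheme \<Rightarrow> ('p, 'n, 'z) category_scheme \<Rightarrow> bool" where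
  "equivalent_categories A B \<longleftrightarrow> (\<exists>F G. is_functor A B F \<and> is_functor B A G \<and>
     nat_isomorphic A A (comp_functor G F) id_functor \<and>
     nat_isomorphic B B (comp_functor F G) id_functor)"

definition preserves_products ::
  "'u itself \<Rightarrow> ('o, 'm, 'y) category_scheme \<Rightarrow> ('p, 'n, 'z) category_scheme \<Rightarrow>
   ('o, 'm, 'p, 'n) ftor \<Rightarrow> bool" where
  "preserves_products U A B F \<longleftrightarrow> (\<forall>(I :: 'u set) X P \<pi>. small U I \<and> is_product A I X P \<pi> \<longrightarrow>
     is_product B I (\<lambda>i. FO F (X i)) (FO F P) (\<lambda>i. FA F (\<pi> i)))"

text \<open>
  The full subcategory, on a set \<open>S\<close> of functors, of the category of functors from \<open>A\<close> to \<open>B\<close>.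
  Natural transformations carry their source and target and are extensional, so that equality
  of arrows is equality on objects of \<open>A\<close>.
\<close>

definition functor_category ::
  "('o, 'm, 'y) category_scheme \<Rightarrow> ('p, 'n, 'z) category_scheme \<Rightarrow> ('o, 'm, 'p, 'n) ftor set \<Rightarrow>
   (('o, 'm, 'p, 'n) ftor, ('o, 'm, 'p, 'n) ftor \<times> ('o \<Rightarrow> 'n) \<times> ('o, 'm, 'p, 'n) ftor) category" where
  "functor_category A B S =
     \<lparr>Obj = {F \<in> S. is_functor A B F \<and> FO F \<in> extensional (Obj A) \<and> FA F \<in> extensional (Arr A)},
      Arr = {(F, \<eta>, G). {F, G} \<subseteq> S \<and>
               (\<forall>H\<in>{F, G}. is_functor A B H \<and> FO H \<in> extensional (Obj A) \<and> FA H \<in> extensional (Arr A)) \<and>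
               nat_trans A B F G \<eta> \<and> \<eta> \<in> extensional (Obj A)},
      Dom = (\<lambda>(F, \<eta>, G). F),
      Cod = (\<lambda>(F, \<eta>, G). G),
      Id = (\<lambda>F. (F, \<lambda>X\<in>Obj A. Id B (FO F X), F)),
      Comp = (\<lambda>(G', \<theta>, H) (F, \<eta>, G). (F, \<lambda>X\<in>Obj A. \<theta> X \<cdot>\<^bsub>B\<^esub> \<eta> X, H))\<rparr>"


section \<open>Additive categories and abelian groups\<close>

record ('o, 'm) preadditive = "('o, 'm) category" +
  Add :: "'m \<Rightarrow> 'm \<Rightarrow> 'm"  (infixl "\<boxplus>\<index>" 65)
  Zero :: "'o \<Rightarrow> 'o \<Rightarrow> 'm"

definition hom_group :: "('o, 'm, 'z) preadditive_scheme \<Rightarrow> 'o \<Rightarrow> 'o \<Rightarrow> 'm monoid" where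
  "hom_group C X Y = \<lparr>carrier = Hom C X Y, mult = Add C, one = Zero C X Y\<rparr>"

definition neg_arr :: "('o, 'm, 'z) preadditive_scheme \<Rightarrow> 'm \<Rightarrow> 'm" where
  "neg_arr C f = inv\<^bsub>hom_group C (Dom C f) (Cod C f)\<^esub> f"

definition is_preadditive :: "('o, 'm, 'z) preadditive_scheme \<Rightarrow> bool" where
  "is_preadditive C \<longleftrightarrow> is_category C \<and>
     (\<forall>X\<in>Obj C. \<forall>Y\<in>Obj C. comm_group (hom_group C X Y)) \<and>
     (\<forall>X\<in>Obj C. \<forall>Y\<in>Obj C. \<forall>Z\<in>Obj C. \<forall>f\<in>Hom C X Y. \<forall>f'\<in>Hom C X Y. \<forall>g\<in>Hom C Y Z. \<forall>g'\<in>Hom C Y Z.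
        g \<cdot>\<^bsub>C\<^esub> (f \<boxplus>\<^bsub>C\<^esub> f') = (g \<cdot>\<^bsub>C\<^esub> f) \<boxplus>\<^bsub>C\<^esub> (g \<cdot>\<^bsub>C\<^esub> f') \<and>
        (g \<boxplus>\<^bsub>C\<^esub> g') \<cdot>\<^bsub>C\<^esub> f = (g \<cdot>\<^bsub>C\<^esub> f) \<boxplus>\<^bsub>C\<^esub> (g' \<cdot>\<^bsub>C\<^esub> f))"

text \<open>Finite products, including the empty one (a zero object); they are automatically biproducts.\<close>

definition is_additive :: "('o, 'm, 'z) preadditive_scheme \<Rightarrow> bool" where
  "is_additive C \<longleftrightarrow> is_preadditive C \<and>
     (\<forall>(I :: nat set) X. finite I \<and> (\<forall>i\<in>I. X i \<in> Obj C) \<longrightarrow> (\<exists>P \<pi>. is_product C I X P \<pi>))"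

definition zero_object :: "('o, 'm, 'z) preadditive_scheme \<Rightarrow> 'o \<Rightarrow> bool" where
  "zero_object C X \<longleftrightarrow> X \<in> Obj C \<and> Id C X = Zero C X X"

definition op_cat :: "('o, 'm, 'z) preadditive_scheme \<Rightarrow> ('o, 'm) preadditive" where
  "op_cat C = \<lparr>Obj = Obj C, Arr = Arr C, Dom = Cod C, Cod = Dom C, Id = Id C,
     Comp = (\<lambda>g f. f \<cdot>\<^bsub>C\<^esub> g), Add = Add C, Zero = (\<lambda>X Y. Zero C Y X)\<rparr>"

definition full_subcat :: "('o, 'm, 'z) preadditive_scheme \<Rightarrow> 'o set \<Rightarrow> ('o, 'm) preadditive" where
  "full_subcat C D = \<lparr>Obj = Obj C \<inter> D, Arr = {f \<in> Arr C. Dom C f \<in> D \<and> Cod C f \<in> D},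
     Dom = Dom C, Cod = Cod C, Id = Id C, Comp = Comp C, Add = Add C, Zero = Zero C\<rparr>"

definition additive_functor ::
  "('o, 'm, 'y) preadditive_scheme \<Rightarrow> ('p, 'n, 'z) preadditive_scheme \<Rightarrow> ('o, 'm, 'p, 'n) ftor \<Rightarrow> bool" where
  "additive_functor A B F \<longleftrightarrow> is_functor A B F \<and>
     (\<forall>X\<in>Obj A. \<forall>Y\<in>Obj A. \<forall>f\<in>Hom A X Y. \<forall>g\<in>Hom A X Y. FA F (f \<boxplus>\<^bsub>A\<^esub> g) = FA F f \<boxplus>\<^bsub>B\<^esub> FA F g)"

type_synonym 'u ab_arr = "'u monoid \<times> ('u \<Rightarrow> 'u) \<times> 'u monoid"

definition ab_fun :: "'u ab_arr \<Rightarrow> 'u \<Rightarrow> 'u" where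
  "ab_fun a = fst (snd a)"

text \<open>
  The category of small abelian groups.  The library writes groups multiplicatively.  Two records
  that differ only outside the carrier are distinct but isomorphic objects.
\<close>

definition Ab :: "('u monoid, 'u ab_arr) preadditive" where
  "Ab = \<lparr>Obj = {G. comm_group G \<and> small TYPE('u) (carrier G)},
     Arr = {(G, f, H). comm_group G \<and> small TYPE('u) (carrier G) \<and>
              comm_group H \<and> small TYPE('u) (carrier H) \<and> f \<in> hom G H \<and> f \<in> extensional (carrier G)},
     Dom = (\<lambda>(G, f, H). G),
     Cod = (\<lambda>(G, f, H). H),
     Id = (\<lambda>G. (G, \<lambda>x\<in>carrier G. x, G)),
     Comp = (\<lambda>(H', g, K) (G, f, H). (G, compose (carrier G) g f, K)),
     Add = (\<lambda>(G, f, H) (G', f', H'). (G, \<lambda>x\<in>carrier G. f x \<otimes>\<^bsub>H\<^esub> f' x, H)),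
     Zero = (\<lambda>G H. (G, \<lambda>x\<in>carrier G. \<one>\<^bsub>H\<^esub>, H))\<rparr>"


section \<open>Triangulated categories\<close>

text \<open>
  The shift \<open>[1]\<close> is an additive automorphism of the category.  A triangle
  \<open>X \<rightarrow> Y \<rightarrow> Z \<rightarrow> X[1]\<close> is the triple of its arrows.
\<close>

record ('o, 'm) tricat = "('o, 'm) preadditive" +
  Sh :: "('o, 'm, 'o, 'm) ftor"
  Tri :: "('m \<times> 'm \<times> 'm) set"

definition is_triangle :: "('o, 'm, 'z) tricat_scheme \<Rightarrow> 'm \<Rightarrow> 'm \<Rightarrow> 'm \<Rightarrow> bool" where
  "is_triangle C f g h \<longleftrightarrow> f \<in> Arr C \<and> g \<in> Arr C \<and> h \<in> Arr C \<and>
     Cod C f = Dom C g \<and> Cod C g = Dom C h \<and> Cod C h = FO (Sh C) (Dom C f)"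

definition triangle_morphism ::
  "('o, 'm, 'z) tricat_scheme \<Rightarrow> 'm \<times> 'm \<times> 'm \<Rightarrow> 'm \<times> 'm \<times> 'm \<Rightarrow> 'm \<Rightarrow> 'm \<Rightarrow> 'm \<Rightarrow> bool" where
  "triangle_morphism C = (\<lambda>(f, g, h) (f', g', h') a b c.
     a \<in> Hom C (Dom C f) (Dom C f') \<and> b \<in> Hom C (Dom C g) (Dom C g') \<and> c \<in> Hom C (Dom C h) (Dom C h') \<and>
     b \<cdot>\<^bsub>C\<^esub> f = f' \<cdot>\<^bsub>C\<^esub> a \<and> c \<cdot>\<^bsub>C\<^esub> g = g' \<cdot>\<^bsub>C\<^esub> b \<and> FA (Sh C) a \<cdot>\<^bsub>C\<^esub> h = h' \<cdot>\<^bsub>C\<^esub> c)"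

definition octahedral_axiom :: "('o, 'm, 'z) tricat_scheme \<Rightarrow> bool" where
  "octahedral_axiom C \<longleftrightarrow>
     (\<forall>f f1 f2 g g1 g2 h1 h2.
        Cod C f = Dom C g \<and> (f, f1, f2) \<in> Tri C \<and> (g, g1, g2) \<in> Tri C \<and> (g \<cdot>\<^bsub>C\<^esub> f, h1, h2) \<in> Tri C \<longrightarrow>
        (\<exists>u\<in>Hom C (Cod C f1) (Cod C h1). \<exists>v\<in>Hom C (Cod C h1) (Cod C g1).
           (u, v, FA (Sh C) f1 \<cdot>\<^bsub>C\<^esub> g2) \<in> Tri C \<and>
           u \<cdot>\<^bsub>C\<^esub> f1 = h1 \<cdot>\<^bsub>C\<^esub> g \<and> h2 \<cdot>\<^bsub>C\<^esub> u = f2 \<and>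
           v \<cdot>\<^bsub>C\<^esub> h1 = g1 \<and> g2 \<cdot>\<^bsub>C\<^esub> v = FA (Sh C) f \<cdot>\<^bsub>C\<^esub> h2))"

definition is_triangulated :: "('o, 'm, 'z) tricat_scheme \<Rightarrow> bool" where
  "is_triangulated C \<longleftrightarrow>
     is_additive C \<and>
     additive_functor C C (Sh C) \<and> bij_betw (FO (Sh C)) (Obj C) (Obj C) \<and>
     bij_betw (FA (Sh C)) (Arr C) (Arr C) \<and>
     (\<forall>(f, g, h) \<in> Tri C. is_triangle C f g h) \<and>
     (\<forall>f g h f' g' h' a b c. (f, g, h) \<in> Tri C \<and> is_triangle C f' g' h' \<and>
        triangle_morphism C (f, g, h) (f', g', h') a b c \<and>
        is_iso_arr C a \<and> is_iso_arr C b \<and> is_iso_arr C c \<longrightarrow> (f', g', h') \<in> Tri C) \<and>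
     (\<forall>X\<in>Obj C. \<forall>Z. zero_object C Z \<longrightarrow> (Id C X, Zero C X Z, Zero C Z (FO (Sh C) X)) \<in> Tri C) \<and>
     (\<forall>f\<in>Arr C. \<exists>g h. (f, g, h) \<in> Tri C) \<and>
     (\<forall>f g h. is_triangle C f g h \<longrightarrow>
        ((f, g, h) \<in> Tri C \<longleftrightarrow> (g, h, neg_arr C (FA (Sh C) f)) \<in> Tri C)) \<and>
     (\<forall>f g h f' g' h' a b. (f, g, h) \<in> Tri C \<and> (f', g', h') \<in> Tri C \<and>
        a \<in> Hom C (Dom C f) (Dom C f') \<and> b \<in> Hom C (Cod C f) (Cod C f') \<and> b \<cdot>\<^bsub>C\<^esub> f = f' \<cdot>\<^bsub>C\<^esub> a \<longrightarrow>
        (\<exists>c. triangle_morphism C (f, g, h) (f', g', h') a b c)) \<and>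
     octahedral_axiom C"

text \<open>The class \<open>D[i]\<close>; for negative \<open>i\<close> these are the objects whose shift by \<open>-i\<close> lies in \<open>D\<close>.\<close>

definition shift_class :: "('o, 'm, 'z) tricat_scheme \<Rightarrow> 'o set \<Rightarrow> int \<Rightarrow> 'o set" where
  "shift_class C D i =
     (if 0 \<le> i then (FO (Sh C) ^^ nat i) ` D
      else {X \<in> Obj C. (FO (Sh C) ^^ nat (- i)) X \<in> D})"

definition orthogonal :: "('o, 'm, 'z) preadditive_scheme \<Rightarrow> 'o set \<Rightarrow> 'o set \<Rightarrow> bool" where
  "orthogonal C D E \<longleftrightarrow> (\<forall>X\<in>D. \<forall>Y\<in>E. Hom C X Y = {Zero C X Y})"

definition closed_under_retracts :: "('o, 'm, 'z) category_scheme \<Rightarrow> 'o set \<Rightarrow> bool" where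
  "closed_under_retracts C D \<longleftrightarrow> (\<forall>X Y. is_retract C X Y \<and> Y \<in> D \<longrightarrow> X \<in> D)"

definition closed_under_isos :: "('o, 'm, 'z) category_scheme \<Rightarrow> 'o set \<Rightarrow> bool" where
  "closed_under_isos C D \<longleftrightarrow> (\<forall>X Y. isomorphic C X Y \<and> Y \<in> D \<longrightarrow> X \<in> D)"

definition cohomological :: "('o, 'm, 'z) tricat_scheme \<Rightarrow> ('o, 'm, 'u monoid, 'u ab_arr) ftor \<Rightarrow> bool" where
  "cohomological C F \<longleftrightarrow> additive_functor (op_cat C) Ab F \<and>
     (\<forall>(f, g, h) \<in> Tri C.
        ab_fun (FA F g) ` carrier (FO F (Cod C g)) =
        kernel (FO F (Cod C f)) (FO F (Dom C f)) (ab_fun (FA F f)))"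

definition representable ::
  "('o, 'm, 'z) preadditive_scheme \<Rightarrow> ('o, 'm, 'u monoid, 'u ab_arr) ftor \<Rightarrow> bool" where
  "representable C F \<longleftrightarrow> (\<exists>M\<in>Obj C. \<exists>\<phi>.
     (\<forall>X\<in>Obj C. \<phi> X \<in> Group.iso (hom_group C X M) (FO F X)) \<and>
     (\<forall>f\<in>Arr C. \<forall>g\<in>Hom C (Cod C f) M.
        \<phi> (Dom C f) (g \<cdot>\<^bsub>C\<^esub> f) = ab_fun (FA F f) (\<phi> (Cod C f) g)))"

text \<open>Coproducts in \<open>C\<close> are the products of the opposite category.\<close>

definition brown_representability :: "'u itself \<Rightarrow> ('o, 'm, 'z) tricat_scheme \<Rightarrow> bool" where
  "brown_representability U C \<longleftrightarrow>
     (\<forall>F :: ('o, 'm, 'u monoid, 'u ab_arr) ftor.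
        cohomological C F \<and> preserves_products U (op_cat C) Ab F \<longrightarrow> representable C F)"


section \<open>Weight structures and t-structures\<close>

definition weight_structure :: "('o, 'm, 'z) tricat_scheme \<Rightarrow> 'o set \<Rightarrow> 'o set \<Rightarrow> bool" where
  "weight_structure C wle wge \<longleftrightarrow>
     wle \<subseteq> Obj C \<and> wge \<subseteq> Obj C \<and>
     closed_under_retracts C wle \<and> closed_under_retracts C wge \<and>
     wle \<subseteq> shift_class C wle 1 \<and> shift_class C wge 1 \<subseteq> wge \<and>
     orthogonal C wle (shift_class C wge 1) \<and>
     (\<forall>M\<in>Obj C. \<exists>(f, g, h) \<in> Tri C. Cod C f = M \<and> Dom C f \<in> wle \<and> Cod C g \<in> shift_class C wge 1)"

definition smashing_weight_structure ::
  "'u itself \<Rightarrow> ('o, 'm, 'z) tricat_scheme \<Rightarrow> 'o set \<Rightarrow> 'o set \<Rightarrow> bool" where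
  "smashing_weight_structure U C wle wge \<longleftrightarrow>
     weight_structure C wle wge \<and> smashing U C \<and> closed_under_coproducts U C wge"

text \<open>Homological convention.\<close>

definition t_structure :: "('o, 'm, 'z) tricat_scheme \<Rightarrow> 'o set \<Rightarrow> 'o set \<Rightarrow> bool" where
  "t_structure C tle tge \<longleftrightarrow>
     tle \<subseteq> Obj C \<and> tge \<subseteq> Obj C \<and>
     closed_under_isos C tle \<and> closed_under_isos C tge \<and>
     tle \<subseteq> shift_class C tle 1 \<and> shift_class C tge 1 \<subseteq> tge \<and>
     orthogonal C (shift_class C tge 1) tle \<and>
     (\<forall>M\<in>Obj C. \<exists>(f, g, h) \<in> Tri C. Cod C f = M \<and> Dom C f \<in> tge \<and> Cod C g \<in> shift_class C tle (-1))"

definition cosmashing_t_structure ::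
  "'u itself \<Rightarrow> ('o, 'm, 'z) tricat_scheme \<Rightarrow> 'o set \<Rightarrow> 'o set \<Rightarrow> bool" where
  "cosmashing_t_structure U C tle tge \<longleftrightarrow>
     t_structure C tle tge \<and> cosmashing U C \<and> closed_under_products U C tge"

definition left_adjacent ::
  "('o, 'm, 'z) tricat_scheme \<Rightarrow> 'o set \<Rightarrow> 'o set \<Rightarrow> 'o set \<Rightarrow> 'o set \<Rightarrow> bool" where
  "left_adjacent C tle tge wle wge \<longleftrightarrow>
     orthogonal C wle (shift_class C tge 1) \<and> orthogonal C wge (shift_class C tle (-1))"

definition heart :: "('o, 'm, 'z) preadditive_scheme \<Rightarrow> 'o set \<Rightarrow> 'o set \<Rightarrow> ('o, 'm) preadditive" where
  "heart C D E = full_subcat C (D \<inter> E)"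

definition additive_product_functors ::
  "'u itself \<Rightarrow> ('o, 'm, 'z) preadditive_scheme \<Rightarrow>
   (('o, 'm, 'u monoid, 'u ab_arr) ftor,
    ('o, 'm, 'u monoid, 'u ab_arr) ftor \<times> ('o \<Rightarrow> 'u ab_arr) \<times> ('o, 'm, 'u monoid, 'u ab_arr) ftor) category" where
  "additive_product_functors U A =
     functor_category A Ab {F. additive_functor A Ab F \<and> preserves_products U A Ab F}"

end

theory Submission
  imports Defs "HOL-Algebra.Product_Groups"
begin

text \<open>
  Write \<open>wge\<close> and \<open>wle\<close> for the classes of the weight structure.  Orthogonality leaves only one
  candidate for an adjacent t-structure: its positive part is \<open>wge\<close> and its negative part is the
  right orthogonal \<open>tle_of\<close> of \<open>wge[1]\<close> (\<open>adjacent_unique\<close>).  If it exists, \<open>wge\<close> is a left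
  orthogonal and so is closed under coproducts (\<open>adjacent_coproducts\<close>).  It is closed under products as well,
  because it is the right orthogonal of \<open>wle[-1]\<close>; and products exist in \<open>C\<close> because Brown
  representability applies to products of representable functors (\<open>brown_cosmashing\<close>).

  The existence of the t-structure and the description of its heart both come from the fact
  that, when \<open>wge\<close> is closed under coproducts, it inherits Brown representability from \<open>C\<close>: an
  additive presheaf \<open>N\<close> on \<open>wge\<close>, exact on triangles inside \<open>wge\<close> and taking coproducts to
  products, is represented by an object of \<open>wge\<close> (\<open>wge_representable\<close>).  To see this, extend \<open>N\<close>
  to \<open>C\<close> by left Kan extension: an element over \<open>X\<close> is an arrow \<open>e : X \<rightarrow> T\<close> with \<open>T\<close> in \<open>wge\<close> and
  an element \<open>\<psi>\<close> of \<open>N T\<close>, where \<open>(g \<cdot> e, \<psi>)\<close> is identified with \<open>(e, act g \<psi>)\<close>.  Weight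
  decompositions give a weakly initial arrow from \<open>X\<close> to \<open>wge\<close>, so this extension is small and takes
  coproducts to products.  It is cohomological because \<open>wge\<close> contains the cones of its arrows:
  a germ over \<open>Y\<close> that vanishes on \<open>X\<close> is represented on an object \<open>cov Y \<oplus> T\<close> in such a way that
  it vanishes on \<open>cov X\<close>, and it extends to the cone of \<open>cov X \<rightarrow> cov Y \<oplus> T\<close>, which receives the cone
  of \<open>X \<rightarrow> Y\<close>.  So the extension is representable in \<open>C\<close>, and as it vanishes on \<open>wle[-1]\<close> the
  representing object lies in \<open>wge\<close>.

  For \<open>N = Hom(-, M)\<close> this says that \<open>wge\<close> is coreflective.  A coreflective class closed under
  extensions and under the shift is the positive part of a t-structure (\<open>coreflection\<close>,
  \<open>adjacent_exists\<close>).

  For a functor \<open>A\<close> on the heart of the weight structure that respects products, let \<open>N T\<close> be the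
  group of natural transformations from \<open>Hom(-, T)\<close> to \<open>A\<close>.  An object \<open>T\<close> of \<open>wge\<close> is the cone of an
  arrow \<open>D \<rightarrow> E\<close> with \<open>E\<close> in the heart and \<open>D\<close> in \<open>wge\<close>, and the heart is orthogonal to \<open>D[1]\<close>; this
  makes \<open>N\<close> exact and compatible with coproducts (\<open>nat_exact\<close>, \<open>nat_coproducts\<close>).  The object that
  represents \<open>N\<close> lies in the heart of the t-structure and restricts to \<open>A\<close> on the heart of the
  weight structure (\<open>heart_representable\<close>), so the restricted Yoneda functor is essentially
  surjective.  The same presentations show that it is fully faithful (\<open>heart_dense\<close>,
  \<open>heart_detects\<close>).
\<close>

section \<open>Smallness\<close>


lemma small_image: "small U A \<Longrightarrow> small U (f ` A)"
  unfolding small_def using lesspoll_trans1 image_lepoll by blast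

lemma small_inj:
  assumes "inj_on f A" "f ` A \<subseteq> B" "small U B"
  shows "small U A"
  using assms unfolding small_def lepoll_def lesspoll_def
  by (meson lepoll_def lesspoll_def lesspoll_trans1)

text \<open>
  Smallness is used through an injection into \<open>'u\<close>; this is also what allows groups on any type
  to be moved to the universe later on.
\<close>

lemma small_enc:
  assumes "small TYPE('u) A"
  obtains f :: "'a \<Rightarrow> 'u" where "inj_on f A"
  using assms unfolding small_def lesspoll_def lepoll_def by blast

context
  fixes U :: "'u itself"
  assumes univ: "universe U"
begin

lemma small_UN:
  assumes "small U (I :: 'u set)" and "\<And>i. i \<in> I \<Longrightarrow> small U (A i :: 'u set)"
  shows "small U (\<Union>i\<in>I. A i)"
proof -
  have "\<forall>(I :: 'u set) (A :: 'u \<Rightarrow> 'u set).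
      small U I \<and> (\<forall>i\<in>I. small U (A i)) \<longrightarrow> small U (\<Union>i\<in>I. A i)"
    using univ unfolding universe_def by (elim conjE)
  then have "small U I \<and> (\<forall>i\<in>I. small U (A i)) \<longrightarrow> small U (\<Union>i\<in>I. A i)"
    by (elim allE)
  then show ?thesis using assms by simp
qed

lemma small_Times:
  assumes I: "small U (I :: 'u set)" and J: "small U (J :: 'u set)"
  shows "small U (I \<times> J)"
proof -
  have "infinite (UNIV :: 'u set)" using univ by (simp add: universe_def)
  then have "ordIso2 (card_of ((UNIV :: 'u set) \<times> (UNIV :: 'u set))) (card_of (UNIV :: 'u set))"
    by (rule card_of_Times_same_infinite)
  then have "(UNIV :: 'u set) \<times> (UNIV :: 'u set) \<approx> (UNIV :: 'u set)"
    by (simp add: eqpoll_iff_card_of_ordIso)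
  then obtain p :: "'u \<times> 'u \<Rightarrow> 'u" where p: "inj p"
    unfolding eqpoll_def bij_betw_def by auto
  have "small U (\<Union>i\<in>I. p ` ({i} \<times> J))"
  proof -
    have s: "small U (p ` ({i} \<times> J))" for i
    proof -
      have "p ` ({i} \<times> J) = (\<lambda>j. p (i, j)) ` J" by auto
      then show ?thesis using small_image[OF J] by simp
    qed
    show ?thesis by (rule small_UN[OF I s])
  qed
  moreover have "p ` (I \<times> J) = (\<Union>i\<in>I. p ` ({i} \<times> J))" by auto
  ultimately have "small U (p ` (I \<times> J))" by simp
  then show ?thesis
    by (rule small_inj[of p, rotated 2]) (use p in \<open>auto intro: inj_on_subset\<close>)
qed

lemma small_Pow:
  assumes "small U A"
  shows "small U (Pow A)"
proof -
  obtain e :: "_ \<Rightarrow> 'u" where e: "inj_on e A"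
    using assms unfolding small_def lesspoll_def lepoll_def by blast
  have "small U (Pow (e ` A))"
    using univ small_image[OF assms, of e] unfolding universe_def by simp
  moreover have "inj_on (image e) (Pow A)" using e by (rule inj_on_image_Pow)
  ultimately show ?thesis
    by (rule small_inj[of "image e", rotated 2]) auto
qed

text \<open>A choice function on a small family is determined by its graph, a subset of a small set.\<close>

lemma small_PiE:
  assumes I: "small U (I :: 'u set)" and A: "\<And>i. i \<in> I \<Longrightarrow> small U (A i)"
  shows "small U (PiE I A)"
proof -
  define e where "e i = (SOME e :: _ \<Rightarrow> 'u. inj_on e (A i))" for i
  have "inj_on (e i) (A i)" if i: "i \<in> I" for i
  proof -
    obtain f :: "_ \<Rightarrow> 'u" where "inj_on f (A i)"
      using A[OF i] unfolding small_def lesspoll_def lepoll_def by blast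
    then show ?thesis unfolding e_def by (rule someI[of "\<lambda>e. inj_on e (A i)"])
  qed
  then have e: "\<forall>i\<in>I. inj_on (e i) (A i)" by blast
  define J where "J = (\<Union>i\<in>I. e i ` A i)"
  have "\<forall>i\<in>I. small U (e i ` A i)" using A small_image by blast
  then have J: "small U J"
    unfolding J_def by (intro small_UN[OF I]) simp
  have "small U (Pow (I \<times> J))" by (rule small_Pow) (rule small_Times[OF I J])
  then show ?thesis
  proof (rule small_inj[of "\<lambda>x. {(i, e i (x i)) | i. i \<in> I}", rotated 2])
    show "inj_on (\<lambda>x. {(i, e i (x i)) | i. i \<in> I}) (PiE I A)"
    proof (rule inj_onI)
      fix x y
      assume x: "x \<in> PiE I A" and y: "y \<in> PiE I A"
        and eq: "{(i, e i (x i)) | i. i \<in> I} = {(i, e i (y i)) | i. i \<in> I}"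
      have "x i = y i" if i: "i \<in> I" for i
      proof -
        have "e i (x i) = e i (y i)" using eq i by auto
        then show ?thesis using bspec[OF e i] x y i by (auto simp: inj_on_def PiE_iff)
      qed
      then show "x = y" by (rule PiE_ext[OF x y])
    qed
    show "(\<lambda>x. {(i, e i (x i)) | i. i \<in> I}) ` PiE I A \<subseteq> Pow (I \<times> J)"
      unfolding J_def by (auto simp: PiE_iff)
  qed
qed

end


section \<open>Preadditive categories\<close>

lemma in_Hom: "f \<in> Hom C X Y \<longleftrightarrow> f \<in> Arr C \<and> Dom C f = X \<and> Cod C f = Y"
  by (simp add: Hom_def)

locale precat =
  fixes C :: "('o, 'm, 'z) category_scheme" (structure)
  assumes cat: "is_category C"
begin

lemma Arr_obj [simp]: "f \<in> Arr C \<Longrightarrow> Dom C f \<in> Obj C" "f \<in> Arr C \<Longrightarrow> Cod C f \<in> Obj C"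
  using cat by (auto simp: is_category_def)

lemma hom_obj: "f \<in> Hom C X Y \<Longrightarrow> X \<in> Obj C \<and> Y \<in> Obj C"
  by (auto simp: in_Hom)

lemma id_in [simp]: "X \<in> Obj C \<Longrightarrow> Id C X \<in> Hom C X X"
  using cat by (auto simp: is_category_def)

lemma id_arr [simp]: "X \<in> Obj C \<Longrightarrow> Id C X \<in> Arr C \<and> Dom C (Id C X) = X \<and> Cod C (Id C X) = X"
  using id_in by (simp add: in_Hom del: id_in)

lemma comp_arr [simp]:
  assumes "f \<in> Arr C" "g \<in> Arr C" "Cod C f = Dom C g"
  shows "g \<cdot> f \<in> Arr C" "Dom C (g \<cdot> f) = Dom C f" "Cod C (g \<cdot> f) = Cod C g"
  using assms cat by (auto simp: is_category_def in_Hom)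

lemma comp_in [intro]: "f \<in> Hom C X Y \<Longrightarrow> g \<in> Hom C Y Z \<Longrightarrow> g \<cdot> f \<in> Hom C X Z"
  by (auto simp: in_Hom)

lemma id_left [simp]: "f \<in> Arr C \<Longrightarrow> Cod C f = Y \<Longrightarrow> Id C Y \<cdot> f = f"
  using cat by (auto simp: is_category_def)

lemma id_right [simp]: "f \<in> Arr C \<Longrightarrow> Dom C f = X \<Longrightarrow> f \<cdot> Id C X = f"
  using cat by (auto simp: is_category_def)

lemma assoc:
  "f \<in> Arr C \<Longrightarrow> g \<in> Arr C \<Longrightarrow> h \<in> Arr C \<Longrightarrow> Cod C f = Dom C g \<Longrightarrow> Cod C g = Dom C h \<Longrightarrow>
    (h \<cdot> g) \<cdot> f = h \<cdot> (g \<cdot> f)"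
  using cat by (auto simp: is_category_def)

end

locale preadd =
  fixes C :: "('o, 'm, 'z) preadditive_scheme" (structure)
  assumes pre: "is_preadditive C"

sublocale preadd \<subseteq> precat C
  using pre by (unfold_locales) (simp add: is_preadditive_def)

definition diff_arr :: "('o, 'm, 'z) preadditive_scheme \<Rightarrow> 'm \<Rightarrow> 'm \<Rightarrow> 'm" where
  "diff_arr C f g = Add C f (neg_arr C g)"

context preadd
begin

lemma hom_group [simp]: "X \<in> Obj C \<Longrightarrow> Y \<in> Obj C \<Longrightarrow> comm_group (hom_group C X Y)"
  using pre by (auto simp: is_preadditive_def)

lemma hom_group_simps [simp]:
  "carrier (hom_group C X Y) = Hom C X Y" "mult (hom_group C X Y) = Add C"
  "one (hom_group C X Y) = Zero C X Y"
  by (auto simp: hom_group_def)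

lemma zero_in [simp]: "X \<in> Obj C \<Longrightarrow> Y \<in> Obj C \<Longrightarrow> Zero C X Y \<in> Hom C X Y"
  using comm_group.axioms(1)[OF hom_group] monoid.one_closed comm_monoid.axioms(1)
  by (metis comm_group.axioms(2) group.is_monoid hom_group hom_group_simps(1,3))

lemma zero_arr [simp]:
  "X \<in> Obj C \<Longrightarrow> Y \<in> Obj C \<Longrightarrow> Zero C X Y \<in> Arr C \<and> Dom C (Zero C X Y) = X \<and> Cod C (Zero C X Y) = Y"
  using zero_in by (simp add: in_Hom del: zero_in)

lemma group_hom_group: "f \<in> Hom C X Y \<Longrightarrow> group (hom_group C X Y)"
  using hom_obj comm_group.axioms(2) hom_group by blast

lemma add_in [intro]: "f \<in> Hom C X Y \<Longrightarrow> g \<in> Hom C X Y \<Longrightarrow> f \<boxplus> g \<in> Hom C X Y"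
  using monoid.m_closed[of "hom_group C X Y" f g] group_hom_group group.is_monoid by auto

lemma neg_eq: "f \<in> Hom C X Y \<Longrightarrow> neg_arr C f = inv\<^bsub>hom_group C X Y\<^esub> f"
  by (simp add: neg_arr_def in_Hom)

lemma neg_in [intro]: "f \<in> Hom C X Y \<Longrightarrow> neg_arr C f \<in> Hom C X Y"
  using group.inv_closed[of "hom_group C X Y" f] group_hom_group neg_eq by auto

lemma add_arr [simp]:
  assumes "f \<in> Arr C" "g \<in> Arr C" "Dom C g = Dom C f" "Cod C g = Cod C f"
  shows "f \<boxplus> g \<in> Arr C" "Dom C (f \<boxplus> g) = Dom C f" "Cod C (f \<boxplus> g) = Cod C f"
  using assms add_in by (auto simp: in_Hom)

lemma neg_arr' [simp]:
  assumes "f \<in> Arr C"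
  shows "neg_arr C f \<in> Arr C" "Dom C (neg_arr C f) = Dom C f" "Cod C (neg_arr C f) = Cod C f"
  using assms neg_in by (auto simp: in_Hom)

lemma add_zero [simp]:
  assumes "f \<in> Arr C" "Dom C f = X" "Cod C f = Y"
  shows "f \<boxplus> Zero C X Y = f" "Zero C X Y \<boxplus> f = f"
proof -
  have f: "f \<in> Hom C X Y" using assms by (simp add: in_Hom)
  interpret group "hom_group C X Y" using f by (rule group_hom_group)
  show "f \<boxplus> Zero C X Y = f" "Zero C X Y \<boxplus> f = f" using r_one l_one f by auto
qed

lemma add_comm: "f \<in> Hom C X Y \<Longrightarrow> g \<in> Hom C X Y \<Longrightarrow> f \<boxplus> g = g \<boxplus> f"
  using comm_monoid.m_comm[of "hom_group C X Y" f g] hom_group hom_obj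
  by (metis comm_group.axioms(1) hom_group_simps(1,2))

lemma add_assoc:
  "f \<in> Hom C X Y \<Longrightarrow> g \<in> Hom C X Y \<Longrightarrow> h \<in> Hom C X Y \<Longrightarrow> (f \<boxplus> g) \<boxplus> h = f \<boxplus> (g \<boxplus> h)"
  using monoid.m_assoc[of "hom_group C X Y" f g h] group_hom_group group.is_monoid by auto

lemma add_neg [simp]:
  assumes "f \<in> Arr C"
  shows "f \<boxplus> neg_arr C f = Zero C (Dom C f) (Cod C f)" "neg_arr C f \<boxplus> f = Zero C (Dom C f) (Cod C f)"
proof -
  have f: "f \<in> Hom C (Dom C f) (Cod C f)" using assms by (simp add: in_Hom)
  interpret group "hom_group C (Dom C f) (Cod C f)" using f by (rule group_hom_group)
  show "f \<boxplus> neg_arr C f = Zero C (Dom C f) (Cod C f)" "neg_arr C f \<boxplus> f = Zero C (Dom C f) (Cod C f)"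
    using r_inv l_inv f by (auto simp: neg_arr_def)
qed

lemma neg_unique:
  assumes "f \<in> Hom C X Y" "g \<in> Hom C X Y" "f \<boxplus> g = Zero C X Y"
  shows "g = neg_arr C f"
proof -
  interpret group "hom_group C X Y" using assms(1) by (rule group_hom_group)
  show ?thesis using inv_equality[of g f] assms add_comm[of f X Y g] neg_eq by auto
qed

lemma comp_add:
  assumes "f \<in> Hom C X Y" "f' \<in> Hom C X Y" "g \<in> Hom C Y Z"
  shows "g \<cdot> (f \<boxplus> f') = (g \<cdot> f) \<boxplus> (g \<cdot> f')"
  using assms pre hom_obj unfolding is_preadditive_def by meson

lemma add_comp:
  assumes "f \<in> Hom C X Y" "g \<in> Hom C Y Z" "g' \<in> Hom C Y Z"
  shows "(g \<boxplus> g') \<cdot> f = (g \<cdot> f) \<boxplus> (g' \<cdot> f)"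
  using assms pre hom_obj unfolding is_preadditive_def by meson

lemma idem_zero:
  assumes "f \<in> Hom C X Y" "f \<boxplus> f = f"
  shows "f = Zero C X Y"
proof -
  interpret group "hom_group C X Y" using assms(1) by (rule group_hom_group)
  show ?thesis using assms l_cancel_one[of f f] by simp
qed

lemma comp_zero [simp]:
  assumes "g \<in> Arr C" "Dom C g = Y" "X \<in> Obj C"
  shows "g \<cdot> Zero C X Y = Zero C X (Cod C g)"
proof -
  have Y: "Y \<in> Obj C" using assms by auto
  have z: "Zero C X Y \<in> Hom C X Y" using Y assms by simp
  have g: "g \<in> Hom C Y (Cod C g)" using assms by (simp add: in_Hom)
  have "Zero C X Y \<boxplus> Zero C X Y = Zero C X Y" using z by (simp add: in_Hom)
  then have "(g \<cdot> Zero C X Y) \<boxplus> (g \<cdot> Zero C X Y) = g \<cdot> Zero C X Y"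
    using comp_add[OF z z g] by simp
  then show ?thesis using idem_zero z g by blast
qed

lemma zero_comp [simp]:
  assumes "f \<in> Arr C" "Cod C f = Y" "Z \<in> Obj C"
  shows "Zero C Y Z \<cdot> f = Zero C (Dom C f) Z"
proof -
  have Y: "Y \<in> Obj C" using assms by auto
  have z: "Zero C Y Z \<in> Hom C Y Z" using Y assms by simp
  have f: "f \<in> Hom C (Dom C f) Y" using assms by (simp add: in_Hom)
  have "Zero C Y Z \<boxplus> Zero C Y Z = Zero C Y Z" using z by (simp add: in_Hom)
  then have "(Zero C Y Z \<cdot> f) \<boxplus> (Zero C Y Z \<cdot> f) = Zero C Y Z \<cdot> f"
    using add_comp[OF f z z] by simp
  then show ?thesis using idem_zero z f by blast
qed

lemma comp_neg:
  assumes f: "f \<in> Hom C X Y" and g: "g \<in> Hom C Y Z"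
  shows "g \<cdot> neg_arr C f = neg_arr C (g \<cdot> f)" "neg_arr C g \<cdot> f = neg_arr C (g \<cdot> f)"
proof -
  have "(g \<cdot> f) \<boxplus> (g \<cdot> neg_arr C f) = Zero C X Z"
    using comp_add[OF f neg_in[OF f] g, symmetric] f g by (auto simp: in_Hom)
  then show "g \<cdot> neg_arr C f = neg_arr C (g \<cdot> f)"
    using f g neg_in by (intro neg_unique[of _ X Z]) blast+
  have "(g \<cdot> f) \<boxplus> (neg_arr C g \<cdot> f) = Zero C X Z"
    using add_comp[OF f g neg_in[OF g], symmetric] f g by (auto simp: in_Hom)
  then show "neg_arr C g \<cdot> f = neg_arr C (g \<cdot> f)"
    using f g neg_in by (intro neg_unique[of _ X Z]) blast+
qed

lemma neg_neg [simp]: "f \<in> Arr C \<Longrightarrow> neg_arr C (neg_arr C f) = f"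
  using neg_unique[of "neg_arr C f" "Dom C f" "Cod C f" f] by (simp add: in_Hom)

lemma neg_zero [simp]:
  assumes "X \<in> Obj C" "Y \<in> Obj C"
  shows "neg_arr C (Zero C X Y) = Zero C X Y"
  using neg_unique[of "Zero C X Y" X Y "Zero C X Y"] assms by simp

lemma neg_eq_zero:
  assumes "f \<in> Hom C X Y" "neg_arr C f = Zero C X Y"
  shows "f = Zero C X Y"
  using assms hom_obj[OF assms(1)] neg_neg[of f] by (auto simp: in_Hom)

lemma diff_in [intro]: "f \<in> Hom C X Y \<Longrightarrow> g \<in> Hom C X Y \<Longrightarrow> diff_arr C f g \<in> Hom C X Y"
  unfolding diff_arr_def by blast

lemma diff_zero_iff:
  assumes f: "f \<in> Hom C X Y" and g: "g \<in> Hom C X Y"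
  shows "diff_arr C f g = Zero C X Y \<longleftrightarrow> f = g"
proof
  assume "diff_arr C f g = Zero C X Y"
  then have "neg_arr C g \<boxplus> f = Zero C X Y"
    using add_comm[OF f neg_in[OF g]] by (simp add: diff_arr_def)
  then have "f = neg_arr C (neg_arr C g)" using neg_unique f g neg_in by blast
  then show "f = g" using g by (simp add: in_Hom)
qed (use g in \<open>auto simp: diff_arr_def in_Hom\<close>)

lemma diff_add:
  assumes f: "f \<in> Hom C X Y" and g: "g \<in> Hom C X Y"
  shows "diff_arr C f g \<boxplus> g = f"
  unfolding diff_arr_def using f g add_assoc[OF f neg_in[OF g] g] by (simp add: in_Hom)

lemma comp_diff:
  assumes "f \<in> Hom C X Y" "f' \<in> Hom C X Y" "g \<in> Hom C Y Z"
  shows "g \<cdot> diff_arr C f f' = diff_arr C (g \<cdot> f) (g \<cdot> f')"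
  unfolding diff_arr_def using comp_add[OF assms(1) neg_in[OF assms(2)] assms(3)] comp_neg[OF assms(2,3)]
  by simp

lemma diff_comp:
  assumes "f \<in> Hom C X Y" "g \<in> Hom C Y Z" "g' \<in> Hom C Y Z"
  shows "diff_arr C g g' \<cdot> f = diff_arr C (g \<cdot> f) (g' \<cdot> f)"
  unfolding diff_arr_def using add_comp[OF assms(1,2) neg_in[OF assms(3)]] comp_neg[OF assms(1,3)]
  by simp

lemma comp_eq_iff:
  assumes "f \<in> Hom C X Y" "f' \<in> Hom C X Y" "g \<in> Hom C Y Z"
  shows "g \<cdot> f = g \<cdot> f' \<longleftrightarrow> g \<cdot> diff_arr C f f' = Zero C X Z"
  using comp_diff[OF assms] diff_zero_iff[of "g \<cdot> f" X Z "g \<cdot> f'"] assms by auto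

lemma eq_comp_iff:
  assumes "f \<in> Hom C X Y" "g \<in> Hom C Y Z" "g' \<in> Hom C Y Z"
  shows "g \<cdot> f = g' \<cdot> f \<longleftrightarrow> diff_arr C g g' \<cdot> f = Zero C X Z"
  using diff_comp[OF assms] diff_zero_iff[of "g \<cdot> f" X Z "g' \<cdot> f"] assms by auto

lemma additive_map_zero:
  assumes "F \<in> Hom C X Y \<rightarrow> Hom C X' Y'" "X \<in> Obj C" "Y \<in> Obj C"
    and "\<And>f g. f \<in> Hom C X Y \<Longrightarrow> g \<in> Hom C X Y \<Longrightarrow> F (f \<boxplus> g) = F f \<boxplus> F g"
  shows "F (Zero C X Y) = Zero C X' Y'"
proof (rule idem_zero)
  have z: "Zero C X Y \<in> Hom C X Y" using assms by simp
  then show "F (Zero C X Y) \<in> Hom C X' Y'" using assms by blast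
  have "Zero C X Y \<boxplus> Zero C X Y = Zero C X Y" using assms by simp
  then show "F (Zero C X Y) \<boxplus> F (Zero C X Y) = F (Zero C X Y)" using assms(4)[OF z z] by simp
qed

end


section \<open>Triangulated categories\<close>

locale tri_cat =
  fixes C :: "('o, 'm, 'z) tricat_scheme" (structure)
  assumes tri: "is_triangulated C"

sublocale tri_cat \<subseteq> preadd C
  using tri by unfold_locales (simp add: is_triangulated_def is_additive_def)

context precat
begin

lemma isoI:
  assumes "f \<in> Hom C X Y" "g \<in> Hom C Y X" "g \<cdot> f = Id C X" "f \<cdot> g = Id C Y"
  shows "is_iso_arr C f"
  using assms by (auto simp: is_iso_arr_def in_Hom)

lemma isoE:
  assumes "is_iso_arr C f" "f \<in> Hom C X Y"
  obtains g where "g \<in> Hom C Y X" "g \<cdot> f = Id C X" "f \<cdot> g = Id C Y"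
  using assms by (auto simp: is_iso_arr_def in_Hom)

lemma iso_id [simp]: "X \<in> Obj C \<Longrightarrow> is_iso_arr C (Id C X)"
  by (rule isoI[of _ X X "Id C X"]) auto

lemma coproductD:
  assumes "is_coproduct C I X P \<iota>"
  shows "P \<in> Obj C" "\<And>i. i \<in> I \<Longrightarrow> X i \<in> Obj C" "\<And>i. i \<in> I \<Longrightarrow> \<iota> i \<in> Hom C (X i) P"
  using assms by (auto simp: is_coproduct_def)

lemma coproduct_ex1:
  assumes "is_coproduct C I X P \<iota>" "Q \<in> Obj C" "\<forall>i\<in>I. \<sigma> i \<in> Hom C (X i) Q"
  shows "\<exists>!h. h \<in> Hom C P Q \<and> (\<forall>i\<in>I. h \<cdot> \<iota> i = \<sigma> i)"
proof -
  have "\<forall>Q\<in>Obj C. \<forall>\<sigma>. (\<forall>i\<in>I. \<sigma> i \<in> Hom C (X i) Q) \<longrightarrow>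
        (\<exists>!h. h \<in> Hom C P Q \<and> (\<forall>i\<in>I. h \<cdot> \<iota> i = \<sigma> i))"
    using assms(1) unfolding is_coproduct_def by (elim conjE)
  from bspec[OF this assms(2)] assms(3) show ?thesis by (elim allE impE)
qed

lemma coproduct_ex:
  assumes "is_coproduct C I X P \<iota>" "Q \<in> Obj C" "\<And>i. i \<in> I \<Longrightarrow> \<sigma> i \<in> Hom C (X i) Q"
  obtains h where "h \<in> Hom C P Q" "\<And>i. i \<in> I \<Longrightarrow> h \<cdot> \<iota> i = \<sigma> i"
proof -
  have "\<forall>i\<in>I. \<sigma> i \<in> Hom C (X i) Q" using assms(3) by blast
  from coproduct_ex1[OF assms(1,2) this] show thesis using that by blast
qed

lemma coproduct_unique:
  assumes P: "is_coproduct C I X P \<iota>" and f: "f \<in> Hom C P Q" and g: "g \<in> Hom C P Q"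
    and eq: "\<And>i. i \<in> I \<Longrightarrow> f \<cdot> \<iota> i = g \<cdot> \<iota> i"
  shows "f = g"
proof -
  have Q: "Q \<in> Obj C" using f hom_obj by blast
  have "\<forall>i\<in>I. g \<cdot> \<iota> i \<in> Hom C (X i) Q" using coproductD(3)[OF P] g by blast
  then have "\<exists>!h. h \<in> Hom C P Q \<and> (\<forall>i\<in>I. h \<cdot> \<iota> i = g \<cdot> \<iota> i)"
    by (rule coproduct_ex1[OF P Q])
  then show ?thesis using f g eq by blast
qed

lemma coproduct_iso:
  assumes P: "is_coproduct C I X P \<iota>" and Q: "is_coproduct C I X Q \<kappa>"
  obtains h where "h \<in> Hom C P Q" "is_iso_arr C h" "\<And>i. i \<in> I \<Longrightarrow> h \<cdot> \<iota> i = \<kappa> i"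
proof -
  obtain h where h: "h \<in> Hom C P Q" "\<And>i. i \<in> I \<Longrightarrow> h \<cdot> \<iota> i = \<kappa> i"
    using coproduct_ex[OF P coproductD(1)[OF Q], of \<kappa>] coproductD(3)[OF Q] by blast
  obtain k where k: "k \<in> Hom C Q P" "\<And>i. i \<in> I \<Longrightarrow> k \<cdot> \<kappa> i = \<iota> i"
    using coproduct_ex[OF Q coproductD(1)[OF P], of \<iota>] coproductD(3)[OF P] by blast
  have "k \<cdot> h = Id C P"
  proof (rule coproduct_unique[OF P, of _ P])
    show "k \<cdot> h \<in> Hom C P P" using h k by blast
    show "Id C P \<in> Hom C P P" using coproductD(1)[OF P] by simp
    show "(k \<cdot> h) \<cdot> \<iota> i = Id C P \<cdot> \<iota> i" if "i \<in> I" for i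
      using h(1) h(2)[OF that] k(1) k(2)[OF that] coproductD(3)[OF P that] by (simp add: assoc in_Hom)
  qed
  moreover have "h \<cdot> k = Id C Q"
  proof (rule coproduct_unique[OF Q, of _ Q])
    show "h \<cdot> k \<in> Hom C Q Q" using h k by blast
    show "Id C Q \<in> Hom C Q Q" using coproductD(1)[OF Q] by simp
    show "(h \<cdot> k) \<cdot> \<kappa> i = Id C Q \<cdot> \<kappa> i" if "i \<in> I" for i
      using h(1) h(2)[OF that] k(1) k(2)[OF that] coproductD(3)[OF Q that] by (simp add: assoc in_Hom)
  qed
  ultimately show thesis using that h isoI[OF h(1) k(1)] by blast
qed

lemma coproduct_via_iso:
  assumes P: "is_coproduct C I X P \<iota>" and h: "h \<in> Hom C P Q" "is_iso_arr C h"
    and \<kappa>: "\<And>i. i \<in> I \<Longrightarrow> h \<cdot> \<iota> i = \<kappa> i"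
  shows "is_coproduct C I X Q \<kappa>"
proof -
  obtain k where k: "k \<in> Hom C Q P" "k \<cdot> h = Id C P" "h \<cdot> k = Id C Q" by (rule isoE[OF h(2,1)])
  have \<kappa>i: "\<kappa> i \<in> Hom C (X i) Q" if "i \<in> I" for i
    using comp_in[OF coproductD(3)[OF P that] h(1)] \<kappa>[OF that] by simp
  have "\<exists>!p. p \<in> Hom C Q W \<and> (\<forall>i\<in>I. p \<cdot> \<kappa> i = \<sigma> i)"
    if W: "W \<in> Obj C" and \<sigma>: "\<forall>i\<in>I. \<sigma> i \<in> Hom C (X i) W" for W \<sigma>
  proof -
    obtain q where q: "q \<in> Hom C P W" "\<And>i. i \<in> I \<Longrightarrow> q \<cdot> \<iota> i = \<sigma> i"
      using coproduct_ex[OF P W, of \<sigma>] \<sigma> by blast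
    show ?thesis
    proof (rule ex1I[of _ "q \<cdot> k"])
      have "k \<cdot> \<kappa> i = \<iota> i" if "i \<in> I" for i
        using \<kappa>[OF that, symmetric] h k coproductD(3)[OF P that] by (simp add: assoc[symmetric] in_Hom)
      then have "(q \<cdot> k) \<cdot> \<kappa> i = \<sigma> i" if "i \<in> I" for i
        using q k \<kappa>i that by (simp add: assoc in_Hom)
      then show "q \<cdot> k \<in> Hom C Q W \<and> (\<forall>i\<in>I. (q \<cdot> k) \<cdot> \<kappa> i = \<sigma> i)" using q k by blast
    next
      fix p assume p: "p \<in> Hom C Q W \<and> (\<forall>i\<in>I. p \<cdot> \<kappa> i = \<sigma> i)"
      have "p \<cdot> h = q"
      proof (rule coproduct_unique[OF P])
        show "p \<cdot> h \<in> Hom C P W" using p h by blast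
        show "q \<in> Hom C P W" by (rule q)
        show "(p \<cdot> h) \<cdot> \<iota> i = q \<cdot> \<iota> i" if "i \<in> I" for i
          using p h \<kappa>[OF that] q(2)[OF that] coproductD(3)[OF P that] that by (simp add: assoc in_Hom)
      qed
      then have "q \<cdot> k = p \<cdot> (h \<cdot> k)" using p h k by (auto simp: assoc in_Hom)
      then show "p = q \<cdot> k" using k p by (simp add: in_Hom)
    qed
  qed
  moreover have "Q \<in> Obj C" using h(1) hom_obj by blast
  ultimately show ?thesis
    unfolding is_coproduct_def using \<kappa>i coproductD(2)[OF P] by simp
qed

end

abbreviation shO :: "('o, 'm, 'z) tricat_scheme \<Rightarrow> 'o \<Rightarrow> 'o" where "shO C \<equiv> FO (Sh C)"
abbreviation shA :: "('o, 'm, 'z) tricat_scheme \<Rightarrow> 'm \<Rightarrow> 'm" where "shA C \<equiv> FA (Sh C)"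

context tri_cat
begin

lemma sh_functor: "is_functor C C (Sh C)"
  using tri by (simp add: is_triangulated_def additive_functor_def)

lemma sh_obj [simp]: "X \<in> Obj C \<Longrightarrow> shO C X \<in> Obj C"
  using sh_functor by (simp add: is_functor_def)

lemma sh_in [intro]: "f \<in> Hom C X Y \<Longrightarrow> shA C f \<in> Hom C (shO C X) (shO C Y)"
  using sh_functor by (auto simp: is_functor_def in_Hom)

lemma sh_arr [simp]:
  assumes "f \<in> Arr C"
  shows "shA C f \<in> Arr C" "Dom C (shA C f) = shO C (Dom C f)" "Cod C (shA C f) = shO C (Cod C f)"
  using sh_in[of f "Dom C f" "Cod C f"] assms by (auto simp: in_Hom)

lemma sh_comp: "f \<in> Hom C X Y \<Longrightarrow> g \<in> Hom C Y Z \<Longrightarrow> shA C (g \<cdot> f) = shA C g \<cdot> shA C f"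
  using sh_functor by (auto simp: is_functor_def in_Hom)

lemma sh_id [simp]: "X \<in> Obj C \<Longrightarrow> shA C (Id C X) = Id C (shO C X)"
  using sh_functor by (auto simp: is_functor_def)

lemma sh_add: "f \<in> Hom C X Y \<Longrightarrow> g \<in> Hom C X Y \<Longrightarrow> shA C (f \<boxplus> g) = shA C f \<boxplus> shA C g"
proof -
  have "additive_functor C C (Sh C)" using tri unfolding is_triangulated_def by (elim conjE)
  then show "f \<in> Hom C X Y \<Longrightarrow> g \<in> Hom C X Y \<Longrightarrow> shA C (f \<boxplus> g) = shA C f \<boxplus> shA C g"
    using hom_obj unfolding additive_functor_def by blast
qed

lemma sh_zero [simp]:
  "X \<in> Obj C \<Longrightarrow> Y \<in> Obj C \<Longrightarrow> shA C (Zero C X Y) = Zero C (shO C X) (shO C Y)"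
  by (rule additive_map_zero[of "shA C" X Y]) (auto intro: sh_add)


lemma sh_obj_inj: "X \<in> Obj C \<Longrightarrow> Y \<in> Obj C \<Longrightarrow> shO C X = shO C Y \<longleftrightarrow> X = Y"
proof -
  have "inj_on (shO C) (Obj C)"
    using tri unfolding is_triangulated_def bij_betw_def by (elim conjE)
  then show "X \<in> Obj C \<Longrightarrow> Y \<in> Obj C \<Longrightarrow> shO C X = shO C Y \<longleftrightarrow> X = Y" by (auto simp: inj_on_def)
qed

lemma sh_arr_inj: "f \<in> Arr C \<Longrightarrow> g \<in> Arr C \<Longrightarrow> shA C f = shA C g \<longleftrightarrow> f = g"
proof -
  have "inj_on (shA C) (Arr C)"
    using tri unfolding is_triangulated_def bij_betw_def by (elim conjE)
  then show "f \<in> Arr C \<Longrightarrow> g \<in> Arr C \<Longrightarrow> shA C f = shA C g \<longleftrightarrow> f = g" by (auto simp: inj_on_def)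
qed

lemma unsh_obj:
  assumes "Y \<in> Obj C"
  obtains X where "X \<in> Obj C" "shO C X = Y"
proof -
  have "shO C ` Obj C = Obj C"
    using tri unfolding is_triangulated_def bij_betw_def by (elim conjE)
  then have "Y \<in> shO C ` Obj C" using assms by simp
  then obtain X where "X \<in> Obj C" "Y = shO C X" by (rule imageE) simp
  then show thesis using that by simp
qed

lemma unsh_arr:
  assumes g: "g \<in> Hom C (shO C X) (shO C Y)" and X: "X \<in> Obj C" "Y \<in> Obj C"
  obtains f where "f \<in> Hom C X Y" "shA C f = g"
proof -
  have "shA C ` Arr C = Arr C"
    using tri unfolding is_triangulated_def bij_betw_def by (elim conjE)
  then have "g \<in> shA C ` Arr C" using g by (simp add: in_Hom)
  then obtain f where f: "f \<in> Arr C" "shA C f = g" by blast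
  then have "Dom C f = X" "Cod C f = Y"
    using g X sh_obj_inj[of "Dom C f" X] sh_obj_inj[of "Cod C f" Y] by (auto simp: in_Hom)
  then show thesis using that f by (auto simp: in_Hom)
qed

lemma sh_zero_iff:
  assumes "f \<in> Hom C X Y"
  shows "shA C f = Zero C (shO C X) (shO C Y) \<longleftrightarrow> f = Zero C X Y"
  using sh_arr_inj[of f "Zero C X Y"] assms hom_obj[OF assms] by (auto simp: in_Hom)

text \<open>
  The shift is an automorphism of the category, so that every cocone under the shifted family is
  the shift of a cocone.
\<close>

lemma sh_coproduct:
  assumes "is_coproduct C I X P \<iota>"
  shows "is_coproduct C I (\<lambda>i. shO C (X i)) (shO C P) (\<lambda>i. shA C (\<iota> i))"
proof -
  note P = assms
  have "\<exists>!h. h \<in> Hom C (shO C P) Q \<and> (\<forall>i\<in>I. h \<cdot> shA C (\<iota> i) = \<sigma> i)"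
    if Q: "Q \<in> Obj C" and \<sigma>: "\<forall>i\<in>I. \<sigma> i \<in> Hom C (shO C (X i)) Q" for Q \<sigma>
  proof -
    obtain Q' where Q': "Q' \<in> Obj C" "shO C Q' = Q" using unsh_obj[OF Q] .
    have "\<forall>i\<in>I. \<exists>\<tau>. \<tau> \<in> Hom C (X i) Q' \<and> shA C \<tau> = \<sigma> i"
      using \<sigma> Q' coproductD(2)[OF P] unsh_arr by metis
    from bchoice[OF this] obtain \<tau> where \<tau>: "\<forall>i\<in>I. \<tau> i \<in> Hom C (X i) Q' \<and> shA C (\<tau> i) = \<sigma> i" ..
    obtain h where h: "h \<in> Hom C P Q'" "\<And>i. i \<in> I \<Longrightarrow> h \<cdot> \<iota> i = \<tau> i"
      using coproduct_ex[OF P Q'(1), of \<tau>] \<tau> by blast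
    show ?thesis
    proof (rule ex1I[of _ "shA C h"])
      show "shA C h \<in> Hom C (shO C P) Q \<and> (\<forall>i\<in>I. shA C h \<cdot> shA C (\<iota> i) = \<sigma> i)"
        using h Q' \<tau> sh_comp[OF coproductD(3)[OF P] h(1)] by auto
    next
      fix k assume k: "k \<in> Hom C (shO C P) Q \<and> (\<forall>i\<in>I. k \<cdot> shA C (\<iota> i) = \<sigma> i)"
      obtain k' where k': "k' \<in> Hom C P Q'" "shA C k' = k"
        using k Q' unsh_arr[of k P Q'] coproductD(1)[OF P] by auto
      have "k' = h"
      proof (rule coproduct_unique[OF P k'(1) h(1)])
        fix i assume i: "i \<in> I"
        have "shA C (k' \<cdot> \<iota> i) = shA C (h \<cdot> \<iota> i)"
          using sh_comp[OF coproductD(3)[OF P i] k'(1)] k k' h(2)[OF i] \<tau> i by auto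
        then show "k' \<cdot> \<iota> i = h \<cdot> \<iota> i"
          using sh_arr_inj[of "k' \<cdot> \<iota> i" "h \<cdot> \<iota> i"] k'(1) h(1) coproductD(3)[OF P i] by (simp add: in_Hom)
      qed
      then show "k = shA C h" using k' by simp
    qed
  qed
  then show ?thesis
    unfolding is_coproduct_def using coproductD[OF P] sh_in by auto
qed

lemma tri_in:
  assumes "(f, g, h) \<in> Tri C"
  shows "f \<in> Hom C (Dom C f) (Cod C f)" "g \<in> Hom C (Cod C f) (Cod C g)"
    "h \<in> Hom C (Cod C g) (shO C (Dom C f))" "Dom C f \<in> Obj C" "Cod C f \<in> Obj C" "Cod C g \<in> Obj C"
proof -
  have "\<forall>(f, g, h) \<in> Tri C. is_triangle C f g h"
    using tri unfolding is_triangulated_def by (elim conjE)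
  then have "is_triangle C f g h" using assms by blast
  then show "f \<in> Hom C (Dom C f) (Cod C f)" "g \<in> Hom C (Cod C f) (Cod C g)"
    "h \<in> Hom C (Cod C g) (shO C (Dom C f))" "Dom C f \<in> Obj C" "Cod C f \<in> Obj C" "Cod C g \<in> Obj C"
    by (auto simp: is_triangle_def in_Hom)
qed
lemma tri_arr:
  assumes "(f, g, h) \<in> Tri C"
  shows "f \<in> Arr C" "g \<in> Arr C" "h \<in> Arr C" "Dom C g = Cod C f" "Dom C h = Cod C g"
    "Cod C h = shO C (Dom C f)"
  using tri_in[OF assms] by (auto simp: in_Hom)

lemma tri_isos:
  assumes "(f, g, h) \<in> Tri C" "is_triangle C f' g' h'"
    "triangle_morphism C (f, g, h) (f', g', h') a b c"
    "is_iso_arr C a" "is_iso_arr C b" "is_iso_arr C c"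
  shows "(f', g', h') \<in> Tri C"
proof -
  have *: "\<forall>f g h f' g' h' a b c. (f, g, h) \<in> Tri C \<and> is_triangle C f' g' h' \<and>
        triangle_morphism C (f, g, h) (f', g', h') a b c \<and>
        is_iso_arr C a \<and> is_iso_arr C b \<and> is_iso_arr C c \<longrightarrow> (f', g', h') \<in> Tri C"
    using tri unfolding is_triangulated_def by (elim conjE)
  show ?thesis by (rule *[rule_format, OF conjI[OF assms(1) conjI[OF assms(2) conjI[OF assms(3)
    conjI[OF assms(4) conjI[OF assms(5,6)]]]]]])
qed

lemma tri_id: "X \<in> Obj C \<Longrightarrow> zero_object C Z \<Longrightarrow> (Id C X, Zero C X Z, Zero C Z (shO C X)) \<in> Tri C"
proof -
  have "\<forall>X\<in>Obj C. \<forall>Z. zero_object C Z \<longrightarrow> (Id C X, Zero C X Z, Zero C Z (FO (Sh C) X)) \<in> Tri C"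
    using tri unfolding is_triangulated_def by (elim conjE)
  then show "X \<in> Obj C \<Longrightarrow> zero_object C Z \<Longrightarrow> (Id C X, Zero C X Z, Zero C Z (shO C X)) \<in> Tri C"
    by blast
qed

lemma tri_cone: "f \<in> Arr C \<Longrightarrow> \<exists>g h. (f, g, h) \<in> Tri C"
proof -
  have "\<forall>f\<in>Arr C. \<exists>g h. (f, g, h) \<in> Tri C"
    using tri unfolding is_triangulated_def by (elim conjE)
  then show "f \<in> Arr C \<Longrightarrow> \<exists>g h. (f, g, h) \<in> Tri C" by blast
qed

lemma tri_rot_iff:
  assumes "is_triangle C f g h"
  shows "(f, g, h) \<in> Tri C \<longleftrightarrow> (g, h, neg_arr C (shA C f)) \<in> Tri C"
proof -
  have "\<forall>f g h. is_triangle C f g h \<longrightarrow>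
        ((f, g, h) \<in> Tri C \<longleftrightarrow> (g, h, neg_arr C (FA (Sh C) f)) \<in> Tri C)"
    using tri unfolding is_triangulated_def by (elim conjE)
  from this[rule_format, OF assms] show ?thesis .
qed

lemma tri_rot: "(f, g, h) \<in> Tri C \<Longrightarrow> (g, h, neg_arr C (shA C f)) \<in> Tri C"
proof -
  assume t: "(f, g, h) \<in> Tri C"
  have "is_triangle C f g h" using tri_arr[OF t] by (simp add: is_triangle_def)
  from tri_rot_iff[OF this] t show ?thesis by simp
qed

lemma tri_fill:
  assumes "(f, g, h) \<in> Tri C" "(f', g', h') \<in> Tri C" "a \<in> Hom C (Dom C f) (Dom C f')"
    "b \<in> Hom C (Cod C f) (Cod C f')" "b \<cdot> f = f' \<cdot> a"
  obtains c where "c \<in> Hom C (Cod C g) (Cod C g')" "c \<cdot> g = g' \<cdot> b" "shA C a \<cdot> h = h' \<cdot> c"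
proof -
  have *: "\<forall>f g h f' g' h' a b. (f, g, h) \<in> Tri C \<and> (f', g', h') \<in> Tri C \<and>
        a \<in> Hom C (Dom C f) (Dom C f') \<and> b \<in> Hom C (Cod C f) (Cod C f') \<and> b \<cdot> f = f' \<cdot> a \<longrightarrow>
        (\<exists>c. triangle_morphism C (f, g, h) (f', g', h') a b c)"
    using tri unfolding is_triangulated_def by (elim conjE)
  have "\<exists>c. triangle_morphism C (f, g, h) (f', g', h') a b c"
    by (rule *[rule_format, OF conjI[OF assms(1) conjI[OF assms(2) conjI[OF assms(3)
      conjI[OF assms(4,5)]]]]])
  then show thesis
    using that tri_arr[OF assms(1)] tri_arr[OF assms(2)] by (auto simp: triangle_morphism_def)
qed

lemma zero_object_ex: "\<exists>Z. zero_object C Z"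
proof -
  have "\<forall>(I :: nat set) X. finite I \<and> (\<forall>i\<in>I. X i \<in> Obj C) \<longrightarrow> (\<exists>P \<pi>. is_product C I X P \<pi>)"
    using tri unfolding is_triangulated_def is_additive_def by (elim conjE)
  then have "\<exists>P \<pi>. is_product C ({} :: nat set) (\<lambda>_. undefined) P \<pi>" by simp
  then obtain P \<pi> where P: "is_product C ({} :: nat set) (\<lambda>_. undefined) P \<pi>" by blast
  then have o: "P \<in> Obj C" by (simp add: is_product_def)
  have "\<exists>!h. h \<in> Hom C P P" using P o unfolding is_product_def by auto
  then have "Id C P = Zero C P P" using o id_in zero_in by blast
  then show ?thesis using o by (auto simp: zero_object_def)
qed

lemma zero_object_sh: "zero_object C Z \<Longrightarrow> zero_object C (shO C Z)"
  using sh_id[of Z] by (simp add: zero_object_def)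

text \<open>
  The identity of the first vertex and \<open>f\<close> extend to a morphism from the triangle on the identity,
  whose third vertex is zero.
\<close>

lemma tri_comp_zero:
  assumes t: "(f, g, h) \<in> Tri C"
  shows "g \<cdot> f = Zero C (Dom C f) (Cod C g)"
proof -
  obtain Z where Z: "zero_object C Z" using zero_object_ex by blast
  have Zo: "Z \<in> Obj C" using Z by (simp add: zero_object_def)
  note a = tri_arr[OF t]
  have X: "Dom C f \<in> Obj C" using a by simp
  obtain c where c: "c \<in> Hom C (Cod C (Zero C (Dom C f) Z)) (Cod C g)"
      "c \<cdot> Zero C (Dom C f) Z = g \<cdot> f"
    by (rule tri_fill[OF tri_id[OF X Z] t, of "Id C (Dom C f)" f]) (use a X Zo in \<open>auto simp: in_Hom\<close>)
  then show ?thesis using Zo X by (simp add: in_Hom)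
qed


lemma tri_comp_zero3:
  assumes t: "(f, g, h) \<in> Tri C"
  shows "shA C f \<cdot> h = Zero C (Cod C g) (shO C (Cod C f))"
proof -
  note a = tri_in[OF t]
  have s: "shA C f \<in> Hom C (shO C (Dom C f)) (shO C (Cod C f))" using a by blast
  have "neg_arr C (shA C f \<cdot> h) = Zero C (Cod C g) (shO C (Cod C f))"
    using tri_comp_zero[OF tri_rot[OF tri_rot[OF t]]] tri_arr[OF t] comp_neg[OF a(3) s] by simp
  then show ?thesis using neg_eq_zero comp_in[OF a(3) s] by blast
qed

text \<open>
  Exactness of \<open>Hom(-, W)\<close> and of \<open>Hom(W, -)\<close> at the second vertex: \<open>p\<close> is one arrow of a morphism
  of triangles to, respectively from, a rotation of the triangle on the identity of \<open>W\<close>, and the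
  axioms complete that morphism.  Exactness at the other vertices follows by rotation.
\<close>

lemma tri_extend:
  assumes t: "(f, g, h) \<in> Tri C" and p: "p \<in> Hom C (Cod C f) W"
    and pf: "p \<cdot> f = Zero C (Dom C f) W"
  obtains q where "q \<in> Hom C (Cod C g) W" "q \<cdot> g = p"
proof -
  obtain Z where Z: "zero_object C Z" using zero_object_ex by blast
  have Zo: "Z \<in> Obj C" using Z by (simp add: zero_object_def)
  have W: "W \<in> Obj C" using p hom_obj by blast
  note a = tri_arr[OF t]
  have t0: "(Zero C Z W, Id C W, Zero C W (shO C Z)) \<in> Tri C"
    using tri_rot_iff[of "Zero C Z W" "Id C W" "Zero C W (shO C Z)"] Zo W
      tri_id[OF W zero_object_sh[OF Z]] by (simp add: is_triangle_def)
  obtain c where "c \<in> Hom C (Cod C g) (Cod C (Id C W))" "c \<cdot> g = Id C W \<cdot> p"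
    by (rule tri_fill[OF t t0, of "Zero C (Dom C f) Z" p])
      (use a p pf Zo W tri_in[OF t] in \<open>auto simp: in_Hom\<close>)
  then show thesis using that p W by (simp add: in_Hom)
qed

lemma tri_lift:
  assumes t: "(f, g, h) \<in> Tri C" and p: "p \<in> Hom C W (Cod C f)"
    and gp: "g \<cdot> p = Zero C W (Cod C g)"
  obtains q where "q \<in> Hom C W (Dom C f)" "f \<cdot> q = p"
proof -
  obtain Z where Z: "zero_object C Z" using zero_object_ex by blast
  have Zo: "Z \<in> Obj C" using Z by (simp add: zero_object_def)
  have W: "W \<in> Obj C" using p hom_obj by blast
  note a = tri_arr[OF t]
  obtain c where c: "c \<in> Hom C (shO C W) (shO C (Dom C f))"
      "shA C p \<cdot> neg_arr C (Id C (shO C W)) = neg_arr C (shA C f) \<cdot> c"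
    by (rule tri_fill[OF tri_rot[OF tri_id[OF W Z]] tri_rot[OF t], of p "Zero C Z (Cod C g)"])
      (use a p gp Zo W tri_in[OF t] in \<open>auto simp: in_Hom\<close>)
  obtain q where q: "q \<in> Hom C W (Dom C f)" "shA C q = c"
    using unsh_arr[OF c(1) W] a by auto
  have p': "shA C p \<in> Hom C (shO C W) (shO C (Cod C f))" using p by blast
  have f': "shA C f \<in> Hom C (shO C (Dom C f)) (shO C (Cod C f))" using tri_in[OF t] by blast
  have i: "Id C (shO C W) \<in> Hom C (shO C W) (shO C W)" using W by simp
  have "neg_arr C (shA C p) = neg_arr C (shA C f \<cdot> c)"
    using c(2) comp_neg[OF i p'] comp_neg[OF c(1) f'] p' by (simp add: in_Hom)
  then have "shA C p = shA C f \<cdot> c"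
    using neg_neg p' f' c(1) by (metis comp_arr(1) in_Hom)
  then have "shA C p = shA C (f \<cdot> q)" using sh_comp[OF q(1) tri_in(1)[OF t]] q by simp
  then have "f \<cdot> q = p" using sh_arr_inj[of p "f \<cdot> q"] p q a by (simp add: in_Hom)
  then show thesis using that q by blast
qed

lemma tri_extend2:
  assumes t: "(f, g, h) \<in> Tri C" and p: "p \<in> Hom C (Cod C g) W"
    and pg: "p \<cdot> g = Zero C (Cod C f) W"
  obtains q where "q \<in> Hom C (shO C (Dom C f)) W" "q \<cdot> h = p"
  using tri_extend[OF tri_rot[OF t] p] pg tri_arr[OF t] by metis

lemma tri_lift2:
  assumes t: "(f, g, h) \<in> Tri C" and p: "p \<in> Hom C W (Cod C g)"
    and hp: "h \<cdot> p = Zero C W (shO C (Dom C f))"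
  obtains q where "q \<in> Hom C W (Cod C f)" "g \<cdot> q = p"
  using tri_lift[OF tri_rot[OF t] p] hp tri_arr[OF t] by metis


lemma tri_extend3:
  assumes t: "(f, g, h) \<in> Tri C" and p: "p \<in> Hom C (shO C (Dom C f)) W"
    and ph: "p \<cdot> h = Zero C (Cod C g) W"
  obtains q where "q \<in> Hom C (shO C (Cod C f)) W" "q \<cdot> shA C f = p"
proof -
  have f': "shA C f \<in> Hom C (shO C (Dom C f)) (shO C (Cod C f))" using tri_in[OF t] by blast
  obtain q where q: "q \<in> Hom C (shO C (Cod C f)) W" "q \<cdot> neg_arr C (shA C f) = p"
    using tri_extend[OF tri_rot[OF tri_rot[OF t]], of p W] p ph tri_arr[OF t] by auto
  have "neg_arr C q \<cdot> shA C f = p" using comp_neg[OF f' q(1)] q(2) by simp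
  then show thesis using that neg_in[OF q(1)] by blast
qed

text \<open>
  A triangle can be rotated backwards once its third vertex is written as a shift, because every
  arrow between shifts is a shift; the sign in the rotation axiom is absorbed into \<open>d\<close>.
\<close>

lemma tri_unrot:
  assumes t: "(l, r, s) \<in> Tri C" and D: "Cod C r = shO C D" "D \<in> Obj C"
  obtains d where "d \<in> Hom C D (Dom C l)" "(d, l, r) \<in> Tri C"
proof -
  note a = tri_in[OF t]
  have "neg_arr C s \<in> Hom C (shO C D) (shO C (Dom C l))" using a(3) D by auto
  then obtain d where d: "d \<in> Hom C D (Dom C l)" "shA C d = neg_arr C s"
    using unsh_arr[OF _ D(2) a(4)] by metis
  have "is_triangle C d l r" using d a D by (simp add: is_triangle_def in_Hom)
  then have "(d, l, r) \<in> Tri C" using tri_rot_iff[of d l r] d t a by (simp add: in_Hom)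
  then show thesis using that d by blast
qed

lemma retract_of_third:
  assumes t: "(f, g, h) \<in> Tri C" and f: "f = Zero C (Dom C f) (Cod C f)"
  shows "is_retract C (Cod C f) (Cod C g)"
proof -
  note a = tri_in[OF t]
  obtain q where "q \<in> Hom C (Cod C g) (Cod C f)" "q \<cdot> g = Id C (Cod C f)"
    by (rule tri_extend[OF t id_in[OF a(5)]]) (use f a in \<open>auto simp: in_Hom\<close>)
  then show ?thesis unfolding is_retract_def using a by blast
qed

lemma retract_of_first:
  assumes t: "(f, g, h) \<in> Tri C" and g: "g = Zero C (Cod C f) (Cod C g)"
  obtains q where "q \<in> Hom C (Cod C f) (Dom C f)" "f \<cdot> q = Id C (Cod C f)"
  by (rule tri_lift[OF t id_in[OF tri_in(5)[OF t]]]) (use g tri_in[OF t] in \<open>auto simp: in_Hom\<close>)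

text \<open>
  Only a product of the two objects is given.  Its universal property yields the injections, and
  its uniqueness part yields the decomposition of the identity, as both sides have the same
  components.
\<close>

lemma biproduct:
  assumes X: "X \<in> Obj C" and Y: "Y \<in> Obj C"
  obtains S i j p q where "i \<in> Hom C X S" "j \<in> Hom C Y S" "p \<in> Hom C S X" "q \<in> Hom C S Y"
    "p \<cdot> i = Id C X" "q \<cdot> j = Id C Y" "q \<cdot> i = Zero C X Y" "p \<cdot> j = Zero C Y X"
    "(i \<cdot> p) \<boxplus> (j \<cdot> q) = Id C S"
proof -
  define F where "F n = (if n = (0::nat) then X else Y)" for n
  have "\<forall>(I :: nat set) X. finite I \<and> (\<forall>i\<in>I. X i \<in> Obj C) \<longrightarrow> (\<exists>P \<pi>. is_product C I X P \<pi>)"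
    using tri unfolding is_triangulated_def is_additive_def by (elim conjE)
  then have "\<exists>P \<pi>. is_product C {0, 1::nat} F P \<pi>" using X Y by (simp add: F_def)
  then obtain S \<pi> where S: "is_product C {0, 1::nat} F S \<pi>" by blast
  have So: "S \<in> Obj C" and p: "\<pi> 0 \<in> Hom C S X" and q: "\<pi> 1 \<in> Hom C S Y"
    using S by (auto simp: is_product_def F_def)
  have ex: "\<exists>!h. h \<in> Hom C Q S \<and> (\<pi> 0 \<cdot> h = a \<and> \<pi> 1 \<cdot> h = b)"
    if "Q \<in> Obj C" "a \<in> Hom C Q X" "b \<in> Hom C Q Y" for Q a b
  proof -
    have *: "\<forall>Q\<in>Obj C. \<forall>\<sigma>. (\<forall>i\<in>{0, 1::nat}. \<sigma> i \<in> Hom C Q (F i)) \<longrightarrow>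
        (\<exists>!h. h \<in> Hom C Q S \<and> (\<forall>i\<in>{0, 1::nat}. \<pi> i \<cdot> h = \<sigma> i))"
      using S by (simp add: is_product_def)
    show ?thesis
      using *[rule_format, of Q "\<lambda>n. if n = 0 then a else b"] that by (simp add: F_def)
  qed
  obtain i where i: "i \<in> Hom C X S" "\<pi> 0 \<cdot> i = Id C X" "\<pi> 1 \<cdot> i = Zero C X Y"
    using ex[OF X id_in[OF X] zero_in[OF X Y]] by blast
  obtain j where j: "j \<in> Hom C Y S" "\<pi> 0 \<cdot> j = Zero C Y X" "\<pi> 1 \<cdot> j = Id C Y"
    using ex[OF Y zero_in[OF Y X] id_in[OF Y]] by blast
  have ip: "i \<cdot> \<pi> 0 \<in> Hom C S S" and jq: "j \<cdot> \<pi> 1 \<in> Hom C S S" using i j p q by blast+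
  have "\<pi> 0 \<cdot> ((i \<cdot> \<pi> 0) \<boxplus> (j \<cdot> \<pi> 1)) = \<pi> 0"
    using comp_add[OF ip jq p] i j p q X Y So by (simp add: assoc[symmetric] in_Hom)
  moreover have "\<pi> 1 \<cdot> ((i \<cdot> \<pi> 0) \<boxplus> (j \<cdot> \<pi> 1)) = \<pi> 1"
    using comp_add[OF ip jq q] i j p q X Y So by (simp add: assoc[symmetric] in_Hom)
  ultimately have "(i \<cdot> \<pi> 0) \<boxplus> (j \<cdot> \<pi> 1) = Id C S"
    using ex[OF So p q] add_in[OF ip jq] id_in[OF So] p q by (metis id_right in_Hom)
  then show thesis using that[of i S j "\<pi> 0" "\<pi> 1"] i j p q by simp
qed

text \<open>
  The cone of a coproduct of arrows has the universal property of the coproduct of the cones: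
  this is the five lemma for \<open>Hom(-, W)\<close>, applied to a product of exact sequences.
\<close>

lemma coproduct_of_triangles:
  assumes t: "\<And>i. i \<in> I \<Longrightarrow> (f i, g i, h i) \<in> Tri C"
    and A: "\<And>i. i \<in> I \<Longrightarrow> f i \<in> Hom C (X i) (Y i)" and B: "\<And>i. i \<in> I \<Longrightarrow> g i \<in> Hom C (Y i) (Z i)"
    and P: "is_coproduct C I X P \<iota>" and Q: "is_coproduct C I Y Q \<kappa>" and R: "is_coproduct C I Z R \<rho>"
    and ph: "\<phi> \<in> Hom C P Q" "\<And>i. i \<in> I \<Longrightarrow> \<phi> \<cdot> \<iota> i = \<kappa> i \<cdot> f i"
    and ps: "\<psi> \<in> Hom C Q R" "\<And>i. i \<in> I \<Longrightarrow> \<psi> \<cdot> \<kappa> i = \<rho> i \<cdot> g i"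
  shows "\<exists>\<chi>. (\<phi>, \<psi>, \<chi>) \<in> Tri C"
proof -
  have "\<phi> \<in> Arr C" using ph(1) by (simp add: in_Hom)
  then obtain g' h' where t': "(\<phi>, g', h') \<in> Tri C" using tri_cone by blast
  define R' where "R' = Cod C g'"
  have D: "Dom C \<phi> = P" "Cod C \<phi> = Q" using ph by (auto simp: in_Hom)
  have g': "g' \<in> Hom C Q R'" and h': "h' \<in> Hom C R' (shO C P)"
    using tri_in[OF t'] D R'_def by auto
  have R'o: "R' \<in> Obj C" using g' hom_obj by blast
  have h: "h i \<in> Hom C (Z i) (shO C (X i))" if "i \<in> I" for i
    using tri_in(3)[OF t[OF that]] A[OF that] B[OF that] by (simp add: in_Hom)
  note \<iota> = coproductD(3)[OF P] and \<kappa> = coproductD(3)[OF Q]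
  have "\<exists>r. r \<in> Hom C (Z i) R' \<and> r \<cdot> g i = g' \<cdot> \<kappa> i \<and> shA C (\<iota> i) \<cdot> h i = h' \<cdot> r" if i: "i \<in> I" for i
    by (rule tri_fill[OF t[OF i] t', of "\<iota> i" "\<kappa> i"])
      (use D \<iota>[OF i] \<kappa>[OF i] A[OF i] B[OF i] ph(2)[OF i] R'_def in \<open>auto simp: in_Hom\<close>)
  then obtain r where r: "\<And>i. i \<in> I \<Longrightarrow> r i \<in> Hom C (Z i) R'" "\<And>i. i \<in> I \<Longrightarrow> r i \<cdot> g i = g' \<cdot> \<kappa> i"
      "\<And>i. i \<in> I \<Longrightarrow> shA C (\<iota> i) \<cdot> h i = h' \<cdot> r i"
    by metis
  note sP = sh_coproduct[OF P] and sQ = sh_coproduct[OF Q]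
  note s = coproductD(3)[OF sP] coproductD(3)[OF sQ]
  (* Injectivity of the comparison of Hom(R', W) with the product of the Hom(Z i, W): a map that
     dies on every Z i factors through the connecting map, and that factor extends along the
     shift of phi, so that the composite is zero. *)
  have zero: "p = Zero C R' W" if p: "p \<in> Hom C R' W" and pr: "\<forall>i\<in>I. p \<cdot> r i = Zero C (Z i) W" for p W
  proof -
    have W: "W \<in> Obj C" using p hom_obj by blast
    have "p \<cdot> g' = Zero C Q W"
    proof (rule coproduct_unique[OF Q])
      show "p \<cdot> g' \<in> Hom C Q W" "Zero C Q W \<in> Hom C Q W" using p g' W hom_obj by auto
      fix i assume i: "i \<in> I"
      have "(p \<cdot> g') \<cdot> \<kappa> i = (p \<cdot> r i) \<cdot> g i"
        using r(1,2)[OF i] p g' \<kappa>[OF i] B[OF i] by (simp add: assoc in_Hom)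
      then show "(p \<cdot> g') \<cdot> \<kappa> i = Zero C Q W \<cdot> \<kappa> i" using pr i B[OF i] \<kappa>[OF i] W by (simp add: in_Hom)
    qed
    then obtain u where u: "u \<in> Hom C (shO C P) W" "u \<cdot> h' = p"
      using tri_extend2[OF t', of p W] p D R'_def by auto
    have "\<exists>v. v \<in> Hom C (shO C (Y i)) W \<and> v \<cdot> shA C (f i) = u \<cdot> shA C (\<iota> i)" if i: "i \<in> I" for i
    proof -
      have "(u \<cdot> shA C (\<iota> i)) \<cdot> h i = p \<cdot> r i"
        using r(1,3)[OF i] u s(1)[OF i] h[OF i] h' by (auto simp: assoc in_Hom)
      then have z: "(u \<cdot> shA C (\<iota> i)) \<cdot> h i = Zero C (Z i) W" using pr i by simp
      have us: "u \<cdot> shA C (\<iota> i) \<in> Hom C (shO C (X i)) W" using u s(1)[OF i] by blast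
      show ?thesis
        by (rule tri_extend3[OF t[OF i], of "u \<cdot> shA C (\<iota> i)" W])
          (use us z A[OF i] B[OF i] in \<open>auto simp: in_Hom\<close>)
    qed
    then have "\<exists>v. \<forall>i\<in>I. v i \<in> Hom C (shO C (Y i)) W \<and> v i \<cdot> shA C (f i) = u \<cdot> shA C (\<iota> i)" by metis
    then obtain v where v: "\<And>i. i \<in> I \<Longrightarrow> v i \<in> Hom C (shO C (Y i)) W"
        "\<And>i. i \<in> I \<Longrightarrow> v i \<cdot> shA C (f i) = u \<cdot> shA C (\<iota> i)" by blast
    obtain w where w: "w \<in> Hom C (shO C Q) W" "\<And>i. i \<in> I \<Longrightarrow> w \<cdot> shA C (\<kappa> i) = v i"
      using coproduct_ex[OF sQ W v(1)] by metis
    have sp: "shA C \<phi> \<in> Hom C (shO C P) (shO C Q)" using ph by blast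
    have "u = w \<cdot> shA C \<phi>"
    proof (rule coproduct_unique[OF sP u(1)])
      show "w \<cdot> shA C \<phi> \<in> Hom C (shO C P) W" using w(1) sp by blast
      fix i assume i: "i \<in> I"
      have "(w \<cdot> shA C \<phi>) \<cdot> shA C (\<iota> i) = w \<cdot> shA C (\<phi> \<cdot> \<iota> i)"
        using w(1) sp s(1)[OF i] sh_comp[OF \<iota>[OF i] ph(1)] by (simp add: assoc in_Hom)
      also have "\<dots> = w \<cdot> (shA C (\<kappa> i) \<cdot> shA C (f i))"
        using ph(2)[OF i] sh_comp[OF A[OF i] \<kappa>[OF i]] by simp
      also have "\<dots> = v i \<cdot> shA C (f i)"
        using w(1) w(2)[OF i, symmetric] s(2)[OF i] sh_in[OF A[OF i]] by (simp add: assoc in_Hom)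
      finally show "u \<cdot> shA C (\<iota> i) = (w \<cdot> shA C \<phi>) \<cdot> shA C (\<iota> i)" using v(2)[OF i] by simp
    qed
    then have "p = w \<cdot> (shA C \<phi> \<cdot> h')" using u w(1) sp h' by (auto simp: assoc in_Hom)
    then show ?thesis using tri_comp_zero3[OF t'] D R'_def w(1) R'o by (simp add: in_Hom)
  qed
  have "is_coproduct C I Z R' r"
    unfolding is_coproduct_def
  proof (intro conjI ballI allI impI R'o)
    fix i assume i: "i \<in> I"
    show "Z i \<in> Obj C" using coproductD(2)[OF R i] .
    show "r i \<in> Hom C (Z i) R'" by (rule r(1)[OF i])
  next
    fix W \<sigma> assume W: "W \<in> Obj C" and \<sigma>: "\<forall>i\<in>I. \<sigma> i \<in> Hom C (Z i) W"
    have sg: "\<sigma> i \<cdot> g i \<in> Hom C (Y i) W" if "i \<in> I" for i using \<sigma> B that by blast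
    obtain y where y: "y \<in> Hom C Q W" "\<And>i. i \<in> I \<Longrightarrow> y \<cdot> \<kappa> i = \<sigma> i \<cdot> g i"
      using coproduct_ex[OF Q W sg] by metis
    have "y \<cdot> \<phi> = Zero C P W"
    proof (rule coproduct_unique[OF P])
      show "y \<cdot> \<phi> \<in> Hom C P W" "Zero C P W \<in> Hom C P W" using y ph W hom_obj by auto
      fix i assume i: "i \<in> I"
      have si: "\<sigma> i \<in> Hom C (Z i) W" using \<sigma> i by blast
      have "(y \<cdot> \<phi>) \<cdot> \<iota> i = y \<cdot> (\<kappa> i \<cdot> f i)"
        using y(1) ph(1) ph(2)[OF i] \<iota>[OF i] by (simp add: assoc in_Hom)
      also have "\<dots> = (\<sigma> i \<cdot> g i) \<cdot> f i"
        using y(1) y(2)[OF i, symmetric] A[OF i] \<kappa>[OF i] by (simp add: assoc in_Hom)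
      also have "\<dots> = \<sigma> i \<cdot> (g i \<cdot> f i)"
        using A[OF i] B[OF i] si by (simp add: assoc in_Hom)
      finally have "(y \<cdot> \<phi>) \<cdot> \<iota> i = \<sigma> i \<cdot> (g i \<cdot> f i)" .
      then show "(y \<cdot> \<phi>) \<cdot> \<iota> i = Zero C P W \<cdot> \<iota> i"
        using tri_comp_zero[OF t[OF i]] A[OF i] B[OF i] \<iota>[OF i] \<sigma> i W coproductD(2)[OF P i]
        by (simp add: in_Hom)
    qed
    then obtain p where p: "p \<in> Hom C R' W" "p \<cdot> g' = y"
      using tri_extend[OF t', of y W] y D R'_def by auto
    have "\<exists>e. e \<in> Hom C (shO C (X i)) W \<and> e \<cdot> h i = diff_arr C (\<sigma> i) (p \<cdot> r i)" if i: "i \<in> I" for i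
    proof -
      have si: "\<sigma> i \<in> Hom C (Z i) W" and pr: "p \<cdot> r i \<in> Hom C (Z i) W"
        using \<sigma> i p r(1)[OF i] by auto
      have "(p \<cdot> r i) \<cdot> g i = p \<cdot> (g' \<cdot> \<kappa> i)"
        using p(1) r(1,2)[OF i] B[OF i] by (simp add: assoc in_Hom)
      also have "\<dots> = y \<cdot> \<kappa> i"
        using p(1) p(2)[symmetric] \<kappa>[OF i] g' by (simp add: assoc in_Hom)
      finally have "(p \<cdot> r i) \<cdot> g i = \<sigma> i \<cdot> g i" using y(2)[OF i] by simp
      then have "diff_arr C (\<sigma> i) (p \<cdot> r i) \<cdot> g i = Zero C (Y i) W"
        using eq_comp_iff[OF B[OF i] si pr] by simp
      then show ?thesis
        using tri_extend2[OF t[OF i], of "diff_arr C (\<sigma> i) (p \<cdot> r i)" W] diff_in[OF si pr] A[OF i] B[OF i]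
        by (auto simp: in_Hom)
    qed
    then have "\<exists>e. \<forall>i\<in>I. e i \<in> Hom C (shO C (X i)) W \<and> e i \<cdot> h i = diff_arr C (\<sigma> i) (p \<cdot> r i)" by metis
    then obtain e where e: "\<And>i. i \<in> I \<Longrightarrow> e i \<in> Hom C (shO C (X i)) W"
        "\<And>i. i \<in> I \<Longrightarrow> e i \<cdot> h i = diff_arr C (\<sigma> i) (p \<cdot> r i)" by blast
    obtain s' where s': "s' \<in> Hom C (shO C P) W" "\<And>i. i \<in> I \<Longrightarrow> s' \<cdot> shA C (\<iota> i) = e i"
      using coproduct_ex[OF sP W e(1)] by metis
    (* p is right on the second vertices only; the correction through the connecting map repairs it. *)
    define k where "k = (s' \<cdot> h') \<boxplus> p"
    have sh': "s' \<cdot> h' \<in> Hom C R' W" using s'(1) h' by blast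
    have k: "k \<in> Hom C R' W" unfolding k_def using sh' p by blast
    have kr: "k \<cdot> r i = \<sigma> i" if i: "i \<in> I" for i
    proof -
      have si: "\<sigma> i \<in> Hom C (Z i) W" and pr: "p \<cdot> r i \<in> Hom C (Z i) W"
        using \<sigma> i p r(1)[OF i] by auto
      have "(s' \<cdot> h') \<cdot> r i = s' \<cdot> (shA C (\<iota> i) \<cdot> h i)"
        using s'(1) h' r(1,3)[OF i] by (simp add: assoc in_Hom)
      also have "\<dots> = diff_arr C (\<sigma> i) (p \<cdot> r i)"
        using s'(1) s'(2)[OF i] e(2)[OF i] s(1)[OF i] h[OF i] by (simp add: assoc[symmetric] in_Hom)
      finally show ?thesis
        unfolding k_def using add_comp[OF r(1)[OF i] sh' p(1)] diff_add[OF si pr] by simp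
    qed
    show "\<exists>!k. k \<in> Hom C R' W \<and> (\<forall>i\<in>I. k \<cdot> r i = \<sigma> i)"
    proof (rule ex1I[of _ k])
      show "k \<in> Hom C R' W \<and> (\<forall>i\<in>I. k \<cdot> r i = \<sigma> i)" using k kr by blast
    next
      fix l assume l: "l \<in> Hom C R' W \<and> (\<forall>i\<in>I. l \<cdot> r i = \<sigma> i)"
      have "diff_arr C l k = Zero C R' W"
      proof (rule zero)
        show "diff_arr C l k \<in> Hom C R' W" using l k by blast
        show "\<forall>i\<in>I. diff_arr C l k \<cdot> r i = Zero C (Z i) W"
          using eq_comp_iff[OF r(1) _ k] l kr by auto
      qed
      then show "l = k" using diff_zero_iff l k by blast
    qed
  qed
  then obtain \<theta> where \<theta>: "\<theta> \<in> Hom C R' R" "is_iso_arr C \<theta>" "\<And>i. i \<in> I \<Longrightarrow> \<theta> \<cdot> r i = \<rho> i"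
    using coproduct_iso[OF _ R] by metis
  obtain \<theta>' where \<theta>': "\<theta>' \<in> Hom C R R'" "\<theta>' \<cdot> \<theta> = Id C R'" "\<theta> \<cdot> \<theta>' = Id C R"
    by (rule isoE[OF \<theta>(2,1)])
  have "\<psi> = \<theta> \<cdot> g'"
  proof (rule coproduct_unique[OF Q ps(1)])
    show "\<theta> \<cdot> g' \<in> Hom C Q R" using \<theta> g' by blast
    fix i assume i: "i \<in> I"
    show "\<psi> \<cdot> \<kappa> i = (\<theta> \<cdot> g') \<cdot> \<kappa> i"
      using ps(2)[OF i] \<theta>(1) \<theta>(3)[OF i, symmetric] r(1,2)[OF i] B[OF i] g' \<kappa>[OF i]
      by (simp add: assoc in_Hom)
  qed
  then have "(\<phi>, \<psi>, h' \<cdot> \<theta>') \<in> Tri C"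
  proof (intro tri_isos[OF t', of \<phi> \<psi> "h' \<cdot> \<theta>'" "Id C P" "Id C Q" \<theta>])
    have Po: "P \<in> Obj C" "Q \<in> Obj C" using coproductD(1) P Q by auto
    show "is_triangle C \<phi> \<psi> (h' \<cdot> \<theta>')"
      using ph(1) ps(1) h' \<theta>' by (simp add: is_triangle_def in_Hom)
    show "is_iso_arr C (Id C P)" "is_iso_arr C (Id C Q)" "is_iso_arr C \<theta>" using Po \<theta> by auto
    assume "\<psi> = \<theta> \<cdot> g'"
    moreover have "h' = (h' \<cdot> \<theta>') \<cdot> \<theta>" using \<theta> \<theta>' h' by (simp add: assoc in_Hom)
    ultimately show "triangle_morphism C (\<phi>, g', h') (\<phi>, \<psi>, h' \<cdot> \<theta>') (Id C P) (Id C Q) \<theta>"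
      using ph(1) ps(1) h' g' \<theta> Po \<theta>' by (simp add: triangle_morphism_def in_Hom)
  qed
  then show ?thesis by blast
qed

end


section \<open>Weight structures and adjacent t-structures\<close>

context tri_cat
begin

lemma shift_class_1: "shift_class C D 1 = shO C ` D"
  by (simp add: shift_class_def)

lemma shift_class_minus_1: "shift_class C D (- 1) = {X \<in> Obj C. shO C X \<in> D}"
  by (simp add: shift_class_def)

lemma orthogonal_iff:
  assumes "D \<subseteq> Obj C" "E \<subseteq> Obj C"
  shows "orthogonal C D E \<longleftrightarrow> (\<forall>X\<in>D. \<forall>Y\<in>E. \<forall>f\<in>Hom C X Y. f = Zero C X Y)"
proof -
  have "Hom C X Y = {Zero C X Y} \<longleftrightarrow> (\<forall>f\<in>Hom C X Y. f = Zero C X Y)" if "X \<in> D" "Y \<in> E" for X Y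
    using zero_in[of X Y] that assms by blast
  then show ?thesis unfolding orthogonal_def by simp
qed

lemma sh_image_obj: "D \<subseteq> Obj C \<Longrightarrow> shO C ` D \<subseteq> Obj C"
  by auto

lemma sh_image_iff: "D \<subseteq> Obj C \<Longrightarrow> X \<in> Obj C \<Longrightarrow> shO C X \<in> shO C ` D \<longleftrightarrow> X \<in> D"
  using sh_obj_inj by auto

lemma unsh_retract:
  assumes "is_retract C (shO C X) (shO C Y)" and X: "X \<in> Obj C" "Y \<in> Obj C"
  shows "is_retract C X Y"
proof -
  obtain i p where ip: "i \<in> Hom C (shO C X) (shO C Y)" "p \<in> Hom C (shO C Y) (shO C X)"
      "p \<cdot> i = Id C (shO C X)"
    using assms(1) unfolding is_retract_def by blast
  obtain i' where i': "i' \<in> Hom C X Y" "shA C i' = i" using unsh_arr[OF ip(1) X] .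
  obtain p' where p': "p' \<in> Hom C Y X" "shA C p' = p" using unsh_arr[OF ip(2) X(2,1)] .
  have "shA C (p' \<cdot> i') = shA C (Id C X)" using sh_comp[OF i'(1) p'(1)] i' p' ip X by simp
  then have "p' \<cdot> i' = Id C X" using sh_arr_inj[of "p' \<cdot> i'" "Id C X"] i' p' X by (simp add: in_Hom)
  then show ?thesis unfolding is_retract_def using i' p' X by blast
qed

end

locale weighted = tri_cat C for C :: "('o, 'm, 'z) tricat_scheme" (structure) +
  fixes wle wge :: "'o set"
  assumes w: "weight_structure C wle wge"
begin

lemma wle_obj: "X \<in> wle \<Longrightarrow> X \<in> Obj C" and wge_obj: "X \<in> wge \<Longrightarrow> X \<in> Obj C"
  using w by (auto simp: weight_structure_def)

lemma wge_sub: "wge \<subseteq> Obj C" and wle_sub: "wle \<subseteq> Obj C"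
  using wge_obj wle_obj by auto

lemma wge_sh: "X \<in> wge \<Longrightarrow> shO C X \<in> wge"
  using w by (auto simp: weight_structure_def shift_class_1)


lemma w_orth: "X \<in> wle \<Longrightarrow> Y \<in> wge \<Longrightarrow> f \<in> Hom C X (shO C Y) \<Longrightarrow> f = Zero C X (shO C Y)"
  using w orthogonal_iff[OF wle_sub sh_image_obj[OF wge_sub]]
  by (auto simp: weight_structure_def shift_class_1)

lemma w_decomposition:
  assumes M: "M \<in> Obj C"
  obtains f g h D where "(f, g, h) \<in> Tri C" "Cod C f = M" "Dom C f \<in> wle" "D \<in> wge" "Cod C g = shO C D"
proof -
  have "\<forall>M\<in>Obj C. \<exists>(f, g, h) \<in> Tri C. Cod C f = M \<and> Dom C f \<in> wle \<and> Cod C g \<in> shift_class C wge 1"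
    using w unfolding weight_structure_def by (elim conjE)
  from bspec[OF this M] show thesis using that by (auto simp: shift_class_1)
qed

lemma wgeD: "X \<in> Obj C \<Longrightarrow> shO C X \<in> wle \<Longrightarrow> Y \<in> wge \<Longrightarrow> f \<in> Hom C X Y \<Longrightarrow> f = Zero C X Y"
  using w_orth[of "shO C X" Y "shA C f"] sh_zero_iff[of f X Y] sh_in[of f X Y] by blast

text \<open>
  The two classes of a weight structure determine each other by orthogonality: if \<open>wle\<close> is
  orthogonal to \<open>Y[1]\<close>, then the first arrow of a weight decomposition of \<open>Y[1]\<close> vanishes, so that
  \<open>Y[1]\<close> is a retract of an object of \<open>wge[1]\<close>.
\<close>

lemma wgeI:
  assumes Y: "Y \<in> Obj C"
    and orth: "\<And>X f. X \<in> Obj C \<Longrightarrow> shO C X \<in> wle \<Longrightarrow> f \<in> Hom C X Y \<Longrightarrow> f = Zero C X Y"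
  shows "Y \<in> wge"
proof -
  obtain f g h D where t: "(f, g, h) \<in> Tri C" "Cod C f = shO C Y" "Dom C f \<in> wle" "D \<in> wge"
      "Cod C g = shO C D"
    using w_decomposition[OF sh_obj[OF Y]] .
  obtain X where X: "X \<in> Obj C" "shO C X = Dom C f" using unsh_obj[OF wle_obj[OF t(3)]] .
  have "f \<in> Hom C (shO C X) (shO C Y)" using tri_in(1)[OF t(1)] X t(2) by simp
  then obtain f' where f': "f' \<in> Hom C X Y" "shA C f' = f" using unsh_arr X(1) Y by blast
  have "f' = Zero C X Y" using orth[OF X(1) _ f'(1)] X(2) t(3) by simp
  then have "f = Zero C (Dom C f) (Cod C f)" using f' X Y t(2) by auto
  then have "is_retract C (shO C Y) (shO C D)" using retract_of_third[OF t(1)] t by simp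
  then have "is_retract C Y D" using unsh_retract Y wge_obj t by blast
  then show ?thesis using w t unfolding weight_structure_def closed_under_retracts_def by blast
qed

lemma wleI:
  assumes X: "X \<in> Obj C"
    and orth: "\<And>Y f. Y \<in> wge \<Longrightarrow> f \<in> Hom C X (shO C Y) \<Longrightarrow> f = Zero C X (shO C Y)"
  shows "X \<in> wle"
proof -
  obtain f g h D where t: "(f, g, h) \<in> Tri C" "Cod C f = X" "Dom C f \<in> wle" "D \<in> wge"
      "Cod C g = shO C D"
    using w_decomposition[OF X] .
  note a = tri_in[OF t(1)]
  have "g = Zero C (Cod C f) (Cod C g)" using orth[OF t(4), of g] a(2) t by simp
  then obtain q where "q \<in> Hom C (Cod C f) (Dom C f)" "f \<cdot> q = Id C (Cod C f)"
    by (rule retract_of_first[OF t(1)])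
  then have "is_retract C X (Dom C f)" unfolding is_retract_def using a t by blast
  then show ?thesis using w t unfolding weight_structure_def closed_under_retracts_def by blast
qed

text \<open>
  As a right orthogonal, \<open>wge\<close> inherits its closure properties from the exactness of \<open>Hom(X, -)\<close>.
\<close>

lemma wge_cone:
  assumes t: "(f, g, h) \<in> Tri C" and X: "Dom C f \<in> wge" and Y: "Cod C f \<in> wge"
  shows "Cod C g \<in> wge"
proof (rule wgeI)
  note a = tri_in[OF t]
  show "Cod C g \<in> Obj C" by (rule a)
  fix W k assume W: "W \<in> Obj C" "shO C W \<in> wle" and k: "k \<in> Hom C W (Cod C g)"
  have "h \<cdot> k = Zero C W (shO C (Dom C f))"
    using comp_in[OF k a(3)] wgeD[OF W wge_sh[OF X]] by simp
  then obtain q where q: "q \<in> Hom C W (Cod C f)" "g \<cdot> q = k" using tri_lift2[OF t k] by blast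
  have "q = Zero C W (Cod C f)" using wgeD[OF W Y q(1)] .
  then show "k = Zero C W (Cod C g)" using q a W tri_arr[OF t] by (auto simp: in_Hom)
qed

lemma wge_extension:
  assumes t: "(f, g, h) \<in> Tri C" and X: "Dom C f \<in> wge" and Z: "Cod C g \<in> wge"
  shows "Cod C f \<in> wge"
proof (rule wgeI)
  note a = tri_in[OF t]
  show "Cod C f \<in> Obj C" by (rule a)
  fix W k assume W: "W \<in> Obj C" "shO C W \<in> wle" and k: "k \<in> Hom C W (Cod C f)"
  have "g \<cdot> k = Zero C W (Cod C g)" using comp_in[OF k a(2)] wgeD[OF W Z] by simp
  then obtain q where q: "q \<in> Hom C W (Dom C f)" "f \<cdot> q = k" using tri_lift[OF t k] by blast
  have "q = Zero C W (Dom C f)" using wgeD[OF W X q(1)] .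
  then show "k = Zero C W (Cod C f)" using q a W tri_arr[OF t] by (auto simp: in_Hom)
qed

lemma wge_biproduct:
  assumes X: "X \<in> wge" and Y: "Y \<in> wge"
  obtains S i j p q where "S \<in> wge" "i \<in> Hom C X S" "j \<in> Hom C Y S" "p \<in> Hom C S X" "q \<in> Hom C S Y"
    "p \<cdot> i = Id C X" "q \<cdot> j = Id C Y" "q \<cdot> i = Zero C X Y" "p \<cdot> j = Zero C Y X"
    "(i \<cdot> p) \<boxplus> (j \<cdot> q) = Id C S"
proof -
  obtain S i j p q where S: "i \<in> Hom C X S" "j \<in> Hom C Y S" "p \<in> Hom C S X" "q \<in> Hom C S Y"
    "p \<cdot> i = Id C X" "q \<cdot> j = Id C Y" "q \<cdot> i = Zero C X Y" "p \<cdot> j = Zero C Y X"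
    "(i \<cdot> p) \<boxplus> (j \<cdot> q) = Id C S"
    using biproduct[OF wge_obj[OF X] wge_obj[OF Y]] .
  have So: "S \<in> Obj C" using S(1) hom_obj by blast
  have "S \<in> wge"
  proof (rule wgeI[OF So])
    fix W k assume W: "W \<in> Obj C" "shO C W \<in> wle" and k: "k \<in> Hom C W S"
    have "p \<cdot> k = Zero C W X" "q \<cdot> k = Zero C W Y"
      using wgeD[OF W X comp_in[OF k S(3)]] wgeD[OF W Y comp_in[OF k S(4)]] by auto
    then have "i \<cdot> p \<cdot> k = Zero C W S" "j \<cdot> q \<cdot> k = Zero C W S"
      using S(1-4) k W by (simp_all add: assoc in_Hom)
    then have "Id C S \<cdot> k = Zero C W S"
      using add_comp[OF k comp_in[OF S(3,1)] comp_in[OF S(4,2)]] S(9) W So by simp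
    then show "k = Zero C W S" using k by (simp add: in_Hom)
  qed
  then show thesis using that S by blast
qed

lemma product_unique:
  assumes P: "is_product C I X P \<pi>" and f: "f \<in> Hom C Q P" and g: "g \<in> Hom C Q P"
    and eq: "\<And>i. i \<in> I \<Longrightarrow> \<pi> i \<cdot> f = \<pi> i \<cdot> g"
  shows "f = g"
proof -
  have Q: "Q \<in> Obj C" using f hom_obj by blast
  have *: "\<forall>Q\<in>Obj C. \<forall>\<sigma>. (\<forall>i\<in>I. \<sigma> i \<in> Hom C Q (X i)) \<longrightarrow> (\<exists>!h. h \<in> Hom C Q P \<and> (\<forall>i\<in>I. \<pi> i \<cdot> h = \<sigma> i))"
    using P unfolding is_product_def by (elim conjE)
  have "\<forall>i\<in>I. \<pi> i \<cdot> g \<in> Hom C Q (X i)" using P g unfolding is_product_def by blast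
  then have "\<exists>!h. h \<in> Hom C Q P \<and> (\<forall>i\<in>I. \<pi> i \<cdot> h = \<pi> i \<cdot> g)"
    using *[rule_format, OF Q, of "\<lambda>i. \<pi> i \<cdot> g"] by blast
  then show ?thesis using f g eq by blast
qed

lemma wge_products: "closed_under_products U C wge"
  unfolding closed_under_products_def
proof (intro allI impI, elim conjE)
  fix I X P \<pi> assume X: "\<forall>i\<in>I. X i \<in> wge" and P: "is_product C I X P \<pi>"
  have Po: "P \<in> Obj C" and \<pi>: "\<And>i. i \<in> I \<Longrightarrow> \<pi> i \<in> Hom C P (X i)" using P by (auto simp: is_product_def)
  show "P \<in> wge"
  proof (rule wgeI[OF Po])
    fix W k assume W: "W \<in> Obj C" "shO C W \<in> wle" and k: "k \<in> Hom C W P"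
    show "k = Zero C W P"
    proof (rule product_unique[OF P k zero_in[OF W(1) Po]])
      fix i assume i: "i \<in> I"
      then have "X i \<in> wge" using X by blast
      then have "\<pi> i \<cdot> k = Zero C W (X i)" using wgeD[OF W _ comp_in[OF k \<pi>[OF i]]] by simp
      then show "\<pi> i \<cdot> k = \<pi> i \<cdot> Zero C W P" using \<pi>[OF i] W Po by (simp add: in_Hom)
    qed
  qed
qed

lemma wle_coproduct:
  assumes X: "\<And>i. i \<in> I \<Longrightarrow> X i \<in> wle" and P: "is_coproduct C I X P \<iota>"
  shows "P \<in> wle"
proof (rule wleI)
  show Po: "P \<in> Obj C" using coproductD(1)[OF P] .
  fix Y f assume Y: "Y \<in> wge" and f: "f \<in> Hom C P (shO C Y)"
  have Yo: "shO C Y \<in> Obj C" using Y wge_obj by simp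
  show "f = Zero C P (shO C Y)"
  proof (rule coproduct_unique[OF P f zero_in[OF Po Yo]])
    fix i assume i: "i \<in> I"
    have "f \<cdot> \<iota> i = Zero C (X i) (shO C Y)"
      using w_orth[OF X[OF i] Y] comp_in[OF coproductD(3)[OF P i] f] by simp
    then show "f \<cdot> \<iota> i = Zero C P (shO C Y) \<cdot> \<iota> i" using coproductD(3)[OF P i] Yo by (simp add: in_Hom)
  qed
qed

text \<open>
  Shifting a weight decomposition of \<open>X[1]\<close> by \<open>-1\<close> gives an arrow \<open>X \<rightarrow> X\<^sub>0\<close> through
  which every arrow from \<open>X\<close> to the class \<open>wge\<close> factors: the fibre lies in \<open>wle[-1]\<close>.
\<close>

lemma weak_reflection:
  assumes X: "X \<in> Obj C"
  shows "\<exists>X0 a. X0 \<in> wge \<and> a \<in> Hom C X X0 \<and> (\<forall>T\<in>wge. \<forall>e\<in>Hom C X T. \<exists>h\<in>Hom C X0 T. h \<cdot> a = e)"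
proof -
  obtain f g h D where t: "(f, g, h) \<in> Tri C" "Cod C f = shO C X" "Dom C f \<in> wle" "D \<in> wge"
      "Cod C g = shO C D"
    using w_decomposition[OF sh_obj[OF X]] .
  note a = tri_in[OF t(1)]
  have D: "D \<in> Obj C" using t(4) wge_obj by blast
  have "g \<in> Hom C (shO C X) (shO C D)" using a(2) t by simp
  then obtain a where a': "a \<in> Hom C X D" "shA C a = g" using unsh_arr X D by blast
  have "\<exists>h\<in>Hom C D T. h \<cdot> a = e" if T: "T \<in> wge" and e: "e \<in> Hom C X T" for T e
  proof -
    have To: "T \<in> Obj C" using T wge_obj by blast
    have se: "shA C e \<in> Hom C (Cod C f) (shO C T)" using e t(2) by auto
    have "shA C e \<cdot> f = Zero C (Dom C f) (shO C T)"
      using w_orth[OF t(3) T] comp_in[OF a(1) se] by simp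
    then obtain q where q: "q \<in> Hom C (Cod C g) (shO C T)" "q \<cdot> g = shA C e"
      using tri_extend[OF t(1) se] by blast
    obtain k where k: "k \<in> Hom C D T" "shA C k = q" using unsh_arr[of q D T] q D To t(5) by auto
    have "shA C (k \<cdot> a) = shA C e" using sh_comp[OF a'(1) k(1)] a' k q by simp
    then have "k \<cdot> a = e" using sh_arr_inj[of "k \<cdot> a" e] a' k e by (simp add: in_Hom)
    then show ?thesis using k by blast
  qed
  then show ?thesis using t(4) a'(1) by blast
qed

text \<open>
  Dually, an object of \<open>wge\<close> is presented by an object of the heart, with relations again
  in \<open>wge\<close>.
\<close>

lemma heart_presentation:
  assumes T: "T \<in> wge"
  shows "\<exists>D E d l r. D \<in> wge \<and> E \<in> wle \<inter> wge \<and> (d, l, r) \<in> Tri C \<and> d \<in> Hom C D E \<and> l \<in> Hom C E T"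
proof -
  obtain f g h D where t: "(f, g, h) \<in> Tri C" "Cod C f = T" "Dom C f \<in> wle" "D \<in> wge"
      "Cod C g = shO C D"
    using w_decomposition[OF wge_obj[OF T]] .
  obtain d where d: "d \<in> Hom C D (Dom C f)" "(d, f, g) \<in> Tri C"
    using tri_unrot[OF t(1,5) wge_obj[OF t(4)]] .
  have "Dom C f \<in> wge" using wge_extension[OF d(2)] d(1) t T by (simp add: in_Hom)
  then show ?thesis using d t tri_in(1)[OF t(1)] by blast
qed

lemma heart_lifts:
  assumes t: "(d, l, r) \<in> Tri C" and D: "Dom C d \<in> wge" and Q: "Q \<in> wle" and q: "q \<in> Hom C Q (Cod C l)"
  obtains q' where "q' \<in> Hom C Q (Cod C d)" "l \<cdot> q' = q"
proof -
  have "r \<cdot> q = Zero C Q (shO C (Dom C d))" using w_orth[OF Q D comp_in[OF q tri_in(3)[OF t]]] .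
  then show thesis using tri_lift2[OF t q] that by blast
qed

text \<open>
  The right orthogonal of \<open>wge[1]\<close>, the only possible negative part of a t-structure whose
  positive part is \<open>wge\<close>.
\<close>

definition tle_of :: "'o set" where
  "tle_of = {Y \<in> Obj C. \<forall>X\<in>wge. \<forall>f\<in>Hom C (shO C X) Y. f = Zero C (shO C X) Y}"

lemma tle_of_sub: "tle_of \<subseteq> Obj C"
  by (auto simp: tle_of_def)

text \<open>
  An adjacent t-structure is determined by \<open>w\<close>: orthogonality gives one inclusion, and an
  object of \<open>wge\<close> is a retract of its connective cover, hence isomorphic to it.
\<close>

lemma adjacent_unique:
  assumes t: "t_structure C tle tge" and adj: "left_adjacent C tle tge wle wge"
  shows "tge = wge" "tle = tle_of"
proof -
  have sub: "tle \<subseteq> Obj C" "tge \<subseteq> Obj C" using t by (auto simp: t_structure_def)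
  have sub1: "shift_class C tle (- 1) \<subseteq> Obj C" by (auto simp: shift_class_minus_1)
  have torth: "f = Zero C (shO C X) Y" if "X \<in> tge" "Y \<in> tle" "f \<in> Hom C (shO C X) Y" for X Y f
    using t orthogonal_iff[OF sh_image_obj[OF sub(2)] sub(1)] that
    unfolding t_structure_def shift_class_1 by blast
  have tle_unsh: "X \<in> tle" if "shO C X \<in> tle" "X \<in> Obj C" for X
  proof -
    have "tle \<subseteq> shO C ` tle" using t by (simp add: t_structure_def shift_class_1)
    then have "shO C X \<in> shO C ` tle" using that(1) by (rule subsetD)
    then show ?thesis using sh_image_iff[OF sub(1) that(2)] by simp
  qed
  have dec: "\<exists>f g h R. (f, g, h) \<in> Tri C \<and> Cod C f = M \<and> Dom C f \<in> tge \<and> Cod C g = R \<and> R \<in> Obj C \<and> shO C R \<in> tle"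
    if "M \<in> Obj C" for M
  proof -
    have "\<forall>M\<in>Obj C. \<exists>(f, g, h) \<in> Tri C. Cod C f = M \<and> Dom C f \<in> tge \<and> Cod C g \<in> shift_class C tle (-1)"
      using t unfolding t_structure_def by (elim conjE)
    from bspec[OF this that] show ?thesis by (auto simp: shift_class_minus_1)
  qed
  have adj1: "f = Zero C X (shO C Y)" if "X \<in> wle" "Y \<in> tge" "f \<in> Hom C X (shO C Y)" for X Y f
    using adj orthogonal_iff[OF wle_sub sh_image_obj[OF sub(2)]] that
    unfolding left_adjacent_def shift_class_1 by blast
  have adj2: "f = Zero C X Y" if "X \<in> wge" "Y \<in> Obj C" "shO C Y \<in> tle" "f \<in> Hom C X Y" for X Y f
    using adj orthogonal_iff[OF wge_sub sub1] that
    unfolding left_adjacent_def by (auto simp: shift_class_minus_1)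
  have "tge \<subseteq> wge"
  proof
    fix Y assume Y: "Y \<in> tge"
    show "Y \<in> wge"
    proof (rule wgeI)
      show "Y \<in> Obj C" using Y sub by blast
      fix X f assume X: "X \<in> Obj C" "shO C X \<in> wle" and f: "f \<in> Hom C X Y"
      then show "f = Zero C X Y" using adj1[OF X(2) Y sh_in[OF f]] sh_zero_iff[OF f] by simp
    qed
  qed
  moreover have "wge \<subseteq> tge"
  proof
    fix M assume M: "M \<in> wge"
    obtain f g h R where d: "(f, g, h) \<in> Tri C" "Cod C f = M" "Dom C f \<in> tge" "Cod C g = R"
        "R \<in> Obj C" "shO C R \<in> tle"
      using dec[OF wge_obj[OF M]] by blast
    note a = tri_in[OF d(1)]
    have "g = Zero C (Cod C f) (Cod C g)" using adj2[OF M d(5,6), of g] a(2) d by simp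
    then obtain q where q: "q \<in> Hom C M (Dom C f)" "f \<cdot> q = Id C M"
      using retract_of_first[OF d(1)] d(2) by blast
    obtain R' where R': "R' \<in> Obj C" "shO C R' = R" using unsh_obj[OF d(5)] .
    obtain e where e: "e \<in> Hom C R' (Dom C f)" "(e, f, g) \<in> Tri C"
      using tri_unrot[OF d(1) _ R'(1)] R'(2) d(4) by metis
    have f: "f \<in> Hom C (Dom C f) M" using a(1) d(2) by simp
    have L: "Dom C f \<in> Obj C" by (rule a)
    have qf: "q \<cdot> f \<in> Hom C (Dom C f) (Dom C f)" using q f by blast
    (* The complementary projection of the connective cover factors through R[-1], to which the
       cover is orthogonal; hence it is zero and M is isomorphic to its cover. *)
    define k where "k = diff_arr C (Id C (Dom C f)) (q \<cdot> f)"
    have k: "k \<in> Hom C (Dom C f) (Dom C f)" unfolding k_def by (rule diff_in[OF id_in[OF L] qf])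
    have "f \<cdot> k = Zero C (Dom C f) M"
    proof -
      have "f \<cdot> (q \<cdot> f) = f" using q f by (simp add: assoc[symmetric] in_Hom)
      then have "f \<cdot> Id C (Dom C f) = f \<cdot> (q \<cdot> f)" using f by (simp add: in_Hom)
      then show ?thesis unfolding k_def using comp_eq_iff[OF id_in[OF L] qf f] by blast
    qed
    then obtain j where j: "j \<in> Hom C (Dom C f) R'" "e \<cdot> j = k"
      using tri_lift[OF e(2), of k "Dom C f"] k e(1) d(2) by (auto simp: in_Hom)
    have "shO C R' \<in> tle" using tle_unsh[of R] d R' by simp
    then have "j = Zero C (Dom C f) R'"
      using torth[OF d(3) _ sh_in[OF j(1)]] sh_zero_iff[OF j(1)] by simp
    then have "k = Zero C (Dom C f) (Dom C f)" using j e L by (auto simp: in_Hom)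
    then have "Id C (Dom C f) = q \<cdot> f" using diff_zero_iff[OF id_in[OF L] qf] k_def by simp
    then have "is_iso_arr C q" using isoI[OF q(1) f] q(2) by simp
    then have "isomorphic C M (Dom C f)" unfolding isomorphic_def using q by blast
    then show "M \<in> tge" using t d(3) unfolding t_structure_def closed_under_isos_def by blast
  qed
  ultimately show tge: "tge = wge" by blast
  show "tle = tle_of"
  proof
    show "tle \<subseteq> tle_of" using torth sub tge unfolding tle_of_def by blast
    show "tle_of \<subseteq> tle"
    proof
      fix Y assume Y: "Y \<in> tle_of"
      then have Yo: "Y \<in> Obj C" by (simp add: tle_of_def)
      obtain M where M: "M \<in> Obj C" "shO C M = Y" using unsh_obj[OF Yo] .
      obtain f g h R where d: "(f, g, h) \<in> Tri C" "Cod C f = M" "Dom C f \<in> tge" "Cod C g = R"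
          "R \<in> Obj C" "shO C R \<in> tle"
        using dec[OF M(1)] by blast
      note a = tri_in[OF d(1)]
      have "shA C f = Zero C (shO C (Dom C f)) Y"
        using Y sh_in[OF a(1)] d M tge by (auto simp: tle_of_def)
      then have f0: "f = Zero C (Dom C f) (Cod C f)" using sh_zero_iff[OF a(1)] d M by simp
      obtain s where s: "s \<in> Hom C R M" "s \<cdot> g = Id C M"
        by (rule tri_extend[OF d(1) id_in[OF a(5)]]) (use f0 a d in \<open>auto simp: in_Hom\<close>)
      have g: "g \<in> Hom C M R" using a(2) d by simp
      have Ro: "R \<in> Obj C" by (rule d)
      have gs: "g \<cdot> s \<in> Hom C R R" using g s by blast
      define k where "k = diff_arr C (Id C R) (g \<cdot> s)"
      have k: "k \<in> Hom C R R" unfolding k_def by (rule diff_in[OF id_in[OF Ro] gs])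
      have "k \<cdot> g = Zero C M R"
      proof -
        have "(g \<cdot> s) \<cdot> g = g" using s g by (simp add: assoc in_Hom)
        then have "Id C R \<cdot> g = (g \<cdot> s) \<cdot> g" using g by (simp add: in_Hom)
        then show ?thesis unfolding k_def using eq_comp_iff[OF g id_in[OF Ro] gs] by blast
      qed
      then obtain j where j: "j \<in> Hom C (shO C (Dom C f)) R" "j \<cdot> h = k"
        using tri_extend2[OF d(1), of k R] k d by auto
      have "R \<in> tle" using tle_unsh d by blast
      then have "j = Zero C (shO C (Dom C f)) R" using torth d j by blast
      then have "k = Zero C R R" using j a Ro d by (auto simp: in_Hom)
      then have "Id C R = g \<cdot> s" using diff_zero_iff[OF id_in[OF Ro] gs] k_def by simp
      then have "shA C g \<cdot> shA C s = Id C (shO C R)" "shA C s \<cdot> shA C g = Id C Y"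
        using sh_comp[OF s(1) g] sh_comp[OF g s(1)] s Ro M by (simp_all, metis sh_id)
      then have "isomorphic C Y (shO C R)"
        using isoI[OF sh_in[OF g] sh_in[OF s(1)]] sh_in[OF g] M unfolding isomorphic_def by auto
      then show "Y \<in> tle" using t d(6) unfolding t_structure_def closed_under_isos_def by blast
    qed
  qed
qed

text \<open>
  For an adjacent t-structure \<open>wge\<close> is the left orthogonal of \<open>tle[-1]\<close>, and left orthogonals are
  closed under coproducts.  Concretely, the coconnective part of a coproduct of objects of \<open>wge\<close>
  receives only the zero arrow from each summand, so that the coproduct is a retract of its
  connective cover.
\<close>

lemma adjacent_coproducts:
  assumes t: "t_structure C tle tge" and adj: "left_adjacent C tle tge wle wge"
  shows "closed_under_coproducts U C wge"
  unfolding closed_under_coproducts_def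
proof (intro allI impI, elim conjE)
  fix I X P \<iota> assume X: "\<forall>i\<in>I. X i \<in> wge" and P: "is_coproduct C I X P \<iota>"
  have Po: "P \<in> Obj C" using coproductD(1)[OF P] .
  have eq: "tge = wge" "tle = tle_of" using adjacent_unique[OF t adj] by auto
  have "\<forall>M\<in>Obj C. \<exists>(f, g, h) \<in> Tri C. Cod C f = M \<and> Dom C f \<in> tge \<and> Cod C g \<in> shift_class C tle (-1)"
    using t unfolding t_structure_def by (elim conjE)
  from bspec[OF this Po] obtain f g h where d: "(f, g, h) \<in> Tri C" "Cod C f = P" "Dom C f \<in> wge"
      "Cod C g \<in> Obj C" "shO C (Cod C g) \<in> tle_of"
    by (auto simp: shift_class_minus_1 eq)
  note a = tri_in[OF d(1)]
  have orth: "k = Zero C Y (Cod C g)" if "Y \<in> wge" "k \<in> Hom C Y (Cod C g)" for Y k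
  proof -
    have "shA C k = Zero C (shO C Y) (shO C (Cod C g))"
      using d(5) that sh_in[OF that(2)] unfolding tle_of_def by blast
    then show ?thesis using sh_zero_iff[OF that(2)] by simp
  qed
  have gP: "g \<in> Hom C P (Cod C g)" using a(2) d by simp
  have "g = Zero C P (Cod C g)"
  proof (rule coproduct_unique[OF P gP zero_in[OF Po d(4)]])
    fix i assume i: "i \<in> I"
    have "g \<cdot> \<iota> i = Zero C (X i) (Cod C g)" using orth[of "X i"] X i comp_in[OF coproductD(3)[OF P i] gP] by blast
    then show "g \<cdot> \<iota> i = Zero C P (Cod C g) \<cdot> \<iota> i" using coproductD(3)[OF P i] d(4) by (simp add: in_Hom)
  qed
  then obtain q where q: "q \<in> Hom C P (Dom C f)" "f \<cdot> q = Id C P"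
    using retract_of_first[OF d(1)] d(2) by metis
  have "is_retract C P (Dom C f)" unfolding is_retract_def using q a(1,4) d Po by blast
  then show "P \<in> wge" using w d(3) unfolding weight_structure_def closed_under_retracts_def by blast
qed

end


section \<open>Small abelian groups\<close>

lemma Ab_obj [simp]: "G \<in> Obj (Ab :: ('u monoid, 'u ab_arr) preadditive) \<longleftrightarrow>
    comm_group G \<and> small TYPE('u) (carrier G)"
  by (simp add: Ab_def)

lemma Ab_hom_iff: "a \<in> Hom (Ab :: ('u monoid, 'u ab_arr) preadditive) G H \<longleftrightarrow>
    a = (G, ab_fun a, H) \<and> comm_group G \<and> small TYPE('u) (carrier G) \<and>
    comm_group H \<and> small TYPE('u) (carrier H) \<and> ab_fun a \<in> hom G H \<and> ab_fun a \<in> extensional (carrier G)"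
  by (cases a) (auto simp: Ab_def in_Hom ab_fun_def)

lemma Ab_homI:
  fixes G H :: "'u monoid"
  assumes "comm_group G" "small TYPE('u) (carrier G)" "comm_group H" "small TYPE('u) (carrier H)"
    "f \<in> hom G H"
  shows "(G, restrict f (carrier G), H) \<in> Hom Ab G H"
  using assms comm_group.axioms(2)[OF assms(1)]
  by (auto simp: Ab_hom_iff ab_fun_def hom_def Pi_iff monoid.m_closed group.is_monoid)

lemma Ab_hom_fun:
  assumes "a \<in> Hom Ab G H"
  shows "ab_fun a \<in> hom G H" "x \<in> carrier G \<Longrightarrow> ab_fun a x \<in> carrier H"
    "x \<in> carrier G \<Longrightarrow> y \<in> carrier G \<Longrightarrow> ab_fun a (x \<otimes>\<^bsub>G\<^esub> y) = ab_fun a x \<otimes>\<^bsub>H\<^esub> ab_fun a y"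
  using assms by (auto simp: Ab_hom_iff hom_def)

lemma Ab_hom_obj:
  assumes "a \<in> Hom Ab G H"
  shows "G \<in> Obj Ab" "H \<in> Obj Ab"
  using assms by (auto simp: Ab_hom_iff)

lemma Ab_hom_eq:
  assumes "a \<in> Hom Ab G H" "b \<in> Hom Ab G H" "\<And>x. x \<in> carrier G \<Longrightarrow> ab_fun a x = ab_fun b x"
  shows "a = b"
proof -
  have "ab_fun a = ab_fun b"
    using assms by (intro extensionalityI[of _ "carrier G"]) (auto simp: Ab_hom_iff)
  then show ?thesis using assms(1,2) by (metis Ab_hom_iff)
qed

lemma ab_fun_comp:
  assumes "a \<in> Hom Ab G H" "b \<in> Hom Ab H K" "x \<in> carrier G"
  shows "ab_fun (b \<cdot>\<^bsub>Ab\<^esub> a) x = ab_fun b (ab_fun a x)"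
  using assms by (cases a; cases b) (auto simp: Ab_def in_Hom ab_fun_def compose_def)

lemma ab_fun_add:
  assumes "a \<in> Hom Ab G H" "b \<in> Hom Ab G H" "x \<in> carrier G"
  shows "ab_fun (a \<boxplus>\<^bsub>Ab\<^esub> b) x = ab_fun a x \<otimes>\<^bsub>H\<^esub> ab_fun b x"
  using assms by (cases a; cases b) (auto simp: Ab_def in_Hom ab_fun_def)

lemma ab_fun_id: "x \<in> carrier G \<Longrightarrow> ab_fun (Id Ab G) x = x"
  by (simp add: Ab_def ab_fun_def)

lemma Ab_comp_in:
  assumes a: "a \<in> Hom Ab G H" and b: "b \<in> Hom Ab H K"
  shows "b \<cdot>\<^bsub>Ab\<^esub> a \<in> Hom Ab G K"
proof -
  have eq: "b \<cdot>\<^bsub>Ab\<^esub> a = (G, restrict (\<lambda>x. ab_fun b (ab_fun a x)) (carrier G), K)"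
    using a b by (cases a; cases b) (auto simp: Ab_def in_Hom ab_fun_def compose_def)
  have "(\<lambda>x. ab_fun b (ab_fun a x)) \<in> hom G K"
    using Ab_hom_fun[OF a] Ab_hom_fun[OF b] by (auto simp: hom_def)
  then show ?thesis unfolding eq using a b by (intro Ab_homI) (auto simp: Ab_hom_iff)
qed

lemma Ab_id_in:
  assumes "G \<in> Obj Ab"
  shows "Id Ab G \<in> Hom Ab G G"
proof -
  have "(G, restrict (\<lambda>x. x) (carrier G), G) \<in> Hom Ab G G"
    using assms by (intro Ab_homI) (auto simp: hom_def)
  then show ?thesis by (simp add: Ab_def)
qed

lemma Ab_add_in:
  assumes a: "a \<in> Hom Ab G H" and b: "b \<in> Hom Ab G H"
  shows "a \<boxplus>\<^bsub>Ab\<^esub> b \<in> Hom Ab G H"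
proof -
  have H: "comm_group H" using a by (auto simp: Ab_hom_iff)
  interpret H: comm_group H by (rule H)
  have eq: "a \<boxplus>\<^bsub>Ab\<^esub> b = (G, restrict (\<lambda>x. ab_fun a x \<otimes>\<^bsub>H\<^esub> ab_fun b x) (carrier G), H)"
    using a b by (cases a; cases b) (auto simp: Ab_def in_Hom ab_fun_def)
  have "(\<lambda>x. ab_fun a x \<otimes>\<^bsub>H\<^esub> ab_fun b x) \<in> hom G H"
    using Ab_hom_fun[OF a] Ab_hom_fun[OF b] by (auto simp: hom_def H.m_ac)
  then show ?thesis unfolding eq using a b by (intro Ab_homI) (auto simp: Ab_hom_iff)
qed

lemma Ab_arr_hom: "a \<in> Arr C \<Longrightarrow> a \<in> Hom C (Dom C a) (Cod C a)"
  by (simp add: in_Hom)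

lemma Ab_category: "is_category (Ab :: ('u monoid, 'u ab_arr) preadditive)"
  unfolding is_category_def
proof (intro conjI ballI impI)
  fix a :: "'u ab_arr" assume "a \<in> Arr Ab"
  then have a: "a \<in> Hom Ab (Dom Ab a) (Cod Ab a)" by (rule Ab_arr_hom)
  show "Dom Ab a \<in> Obj Ab" "Cod Ab a \<in> Obj Ab" using Ab_hom_obj[OF a] by auto
  note i = Ab_id_in[OF Ab_hom_obj(1)[OF a]] Ab_id_in[OF Ab_hom_obj(2)[OF a]]
  show "a \<cdot>\<^bsub>Ab\<^esub> Id Ab (Dom Ab a) = a"
    by (rule Ab_hom_eq[OF Ab_comp_in[OF i(1) a] a]) (simp add: ab_fun_comp[OF i(1) a] ab_fun_id)
  show "Id Ab (Cod Ab a) \<cdot>\<^bsub>Ab\<^esub> a = a"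
    by (rule Ab_hom_eq[OF Ab_comp_in[OF a i(2)] a])
      (simp add: ab_fun_comp[OF a i(2)] ab_fun_id Ab_hom_fun(2)[OF a])
  fix b :: "'u ab_arr" assume "b \<in> Arr Ab"
  then have b': "b \<in> Hom Ab (Dom Ab b) (Cod Ab b)" by (rule Ab_arr_hom)
  {
    assume "Cod Ab a = Dom Ab b"
    then have b: "b \<in> Hom Ab (Cod Ab a) (Cod Ab b)" using b' by simp
    show "b \<cdot>\<^bsub>Ab\<^esub> a \<in> Hom Ab (Dom Ab a) (Cod Ab b)" by (rule Ab_comp_in[OF a b])
  }
  fix c :: "'u ab_arr" assume "c \<in> Arr Ab"
  then have c': "c \<in> Hom Ab (Dom Ab c) (Cod Ab c)" by (rule Ab_arr_hom)
  assume "Cod Ab a = Dom Ab b \<and> Cod Ab b = Dom Ab c"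
  then have b: "b \<in> Hom Ab (Cod Ab a) (Cod Ab b)" and c: "c \<in> Hom Ab (Cod Ab b) (Cod Ab c)"
    using b' c' by simp_all
  note ab = Ab_comp_in[OF a b] and bc = Ab_comp_in[OF b c]
  show "c \<cdot>\<^bsub>Ab\<^esub> (b \<cdot>\<^bsub>Ab\<^esub> a) = c \<cdot>\<^bsub>Ab\<^esub> b \<cdot>\<^bsub>Ab\<^esub> a"
    by (rule Ab_hom_eq[OF Ab_comp_in[OF ab c] Ab_comp_in[OF a bc]])
      (simp add: ab_fun_comp[OF ab c] ab_fun_comp[OF a bc] ab_fun_comp[OF a b] ab_fun_comp[OF b c]
        Ab_hom_fun(2)[OF a])
qed (use Ab_id_in in blast)

interpretation Ab: precat Ab
  by unfold_locales (rule Ab_category)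

text \<open>
  The groups that occur below, such as \<open>Hom(X, M)\<close>, live on other types than the objects of \<open>Ab\<close>.
  A group whose carrier is small is copied along an injection of its carrier into the universe.
\<close>

definition enc :: "'x monoid \<Rightarrow> 'x \<Rightarrow> 'u" where
  "enc G = (SOME e. inj_on e (carrier G))"

definition dec :: "'x monoid \<Rightarrow> 'u \<Rightarrow> 'x" where
  "dec G = inv_into (carrier G) (enc G)"

definition tr :: "'x monoid \<Rightarrow> 'u monoid" where
  "tr G = \<lparr>carrier = enc G ` carrier G, mult = (\<lambda>a b. enc G (dec G a \<otimes>\<^bsub>G\<^esub> dec G b)), one = enc G \<one>\<^bsub>G\<^esub>\<rparr>"

lemma enc_inj:
  fixes G :: "'x monoid"
  assumes "small TYPE('u) (carrier G)"
  shows "inj_on (enc G :: 'x \<Rightarrow> 'u) (carrier G)"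
proof -
  obtain e :: "'x \<Rightarrow> 'u" where "inj_on e (carrier G)" by (rule small_enc[OF assms])
  then show ?thesis unfolding enc_def by (rule someI[of "\<lambda>e. inj_on e (carrier G)"])
qed

lemma dec_enc:
  fixes G :: "'x monoid"
  assumes "small TYPE('u) (carrier G)" "x \<in> carrier G"
  shows "dec G (enc G x :: 'u) = x"
  unfolding dec_def using enc_inj[OF assms(1)] assms(2) by (rule inv_into_f_f)

lemma dec_in:
  fixes G :: "'x monoid" and a :: 'u
  assumes "a \<in> carrier (tr G)"
  shows "dec G a \<in> carrier G"
  using assms unfolding dec_def tr_def by (simp add: inv_into_into)

lemma enc_dec:
  fixes G :: "'x monoid" and a :: 'u
  assumes "a \<in> carrier (tr G)"
  shows "enc G (dec G a) = a"
  using assms unfolding dec_def tr_def by (simp add: f_inv_into_f)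

lemma enc_in: "x \<in> carrier G \<Longrightarrow> enc G x \<in> carrier (tr G)"
  by (simp add: tr_def)

lemma tr_mult: "a \<otimes>\<^bsub>tr G\<^esub> b = enc G (dec G a \<otimes>\<^bsub>G\<^esub> dec G b)"
  by (simp add: tr_def)

lemma enc_mult:
  fixes G :: "'x monoid"
  assumes "small TYPE('u) (carrier G)" "x \<in> carrier G" "y \<in> carrier G"
  shows "enc G (x \<otimes>\<^bsub>G\<^esub> y) = (enc G x \<otimes>\<^bsub>tr G\<^esub> enc G y :: 'u)"
  using assms by (simp add: tr_mult dec_enc)

lemma dec_mult:
  fixes G :: "'x monoid" and a :: 'u
  assumes "small TYPE('u) (carrier G)" "comm_group G" "a \<in> carrier (tr G)" "b \<in> carrier (tr G)"
  shows "dec G (a \<otimes>\<^bsub>tr G\<^esub> b) = dec G a \<otimes>\<^bsub>G\<^esub> dec G b"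
proof -
  interpret comm_group G by (rule assms)
  show ?thesis using assms(1,3,4) by (simp add: tr_mult dec_enc dec_in)
qed

lemma tr_small: "small U (carrier G) \<Longrightarrow> small U (carrier (tr G))"
  by (simp add: tr_def small_image)

lemma tr_comm_group:
  fixes G :: "'x monoid"
  assumes s: "small TYPE('u) (carrier G)" and G: "comm_group G"
  shows "comm_group (tr G :: 'u monoid)"
proof -
  interpret comm_group G by (rule G)
  note [simp] = dec_enc[OF s] enc_dec dec_in
  show ?thesis
  proof (rule comm_groupI)
    fix x y z :: 'u assume x: "x \<in> carrier (tr G)" and y: "y \<in> carrier (tr G)" and z: "z \<in> carrier (tr G)"
    show "x \<otimes>\<^bsub>tr G\<^esub> y \<in> carrier (tr G)" using x y by (simp add: tr_mult enc_in)
    show "x \<otimes>\<^bsub>tr G\<^esub> y \<otimes>\<^bsub>tr G\<^esub> z = x \<otimes>\<^bsub>tr G\<^esub> (y \<otimes>\<^bsub>tr G\<^esub> z)"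
      using x y z by (simp add: tr_mult m_assoc)
    show "x \<otimes>\<^bsub>tr G\<^esub> y = y \<otimes>\<^bsub>tr G\<^esub> x" using x y by (simp add: tr_mult m_comm)
  next
    show o: "\<one>\<^bsub>tr G\<^esub> \<in> carrier (tr G)" by (simp add: tr_def)
    fix x :: 'u assume x: "x \<in> carrier (tr G)"
    have d: "dec G (\<one>\<^bsub>tr G\<^esub> :: 'u) = \<one>\<^bsub>G\<^esub>" by (simp add: tr_def)
    show "\<one>\<^bsub>tr G\<^esub> \<otimes>\<^bsub>tr G\<^esub> x = x" using x by (simp add: tr_mult d)
    have "enc G (inv\<^bsub>G\<^esub> (dec G x)) \<otimes>\<^bsub>tr G\<^esub> x = \<one>\<^bsub>tr G\<^esub>"
      using x by (simp add: tr_mult) (simp add: tr_def)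
    then show "\<exists>y\<in>carrier (tr G). y \<otimes>\<^bsub>tr G\<^esub> x = \<one>\<^bsub>tr G\<^esub>" using x by (meson dec_in enc_in inv_closed)
  qed
qed


text \<open>
  Products of groups are products of sets.  To read off the elements of a given product one would
  usually map the integers to it, but these do not form a small group if the universe is
  countable.  The product is compared with the group of all families instead, which is small
  because the index set is.
\<close>

lemma Ab_product_iff:
  fixes X :: "'u \<Rightarrow> 'u monoid"
  assumes univ: "universe TYPE('u)" and I: "small TYPE('u) I"
    and P: "P \<in> Obj Ab" and \<pi>: "\<And>i. i \<in> I \<Longrightarrow> \<pi> i \<in> Hom Ab P (X i)"
  shows "is_product Ab I X P \<pi> \<longleftrightarrow>
    (\<forall>x. (\<forall>i\<in>I. x i \<in> carrier (X i)) \<longrightarrow> (\<exists>!y. y \<in> carrier P \<and> (\<forall>i\<in>I. ab_fun (\<pi> i) y = x i)))"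
    (is "_ \<longleftrightarrow> ?glue")
proof
  assume glue: ?glue
  show "is_product Ab I X P \<pi>"
    unfolding is_product_def
  proof (intro conjI ballI allI impI P \<pi>)
    fix i assume "i \<in> I" then show "X i \<in> Obj Ab" using Ab_hom_obj(2)[OF \<pi>] by blast
  next
    fix Q :: "'u monoid" and \<sigma> assume Q: "Q \<in> Obj Ab" and "\<forall>i\<in>I. \<sigma> i \<in> Hom Ab Q (X i)"
    then have \<sigma>: "\<And>i. i \<in> I \<Longrightarrow> \<sigma> i \<in> Hom Ab Q (X i)" by blast
    define h where "h q = (THE y. y \<in> carrier P \<and> (\<forall>i\<in>I. ab_fun (\<pi> i) y = ab_fun (\<sigma> i) q))" for q
    have h: "h q \<in> carrier P \<and> (\<forall>i\<in>I. ab_fun (\<pi> i) (h q) = ab_fun (\<sigma> i) q)" if "q \<in> carrier Q" for q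
      unfolding h_def
      by (rule theI'[OF glue[rule_format, of "\<lambda>i. ab_fun (\<sigma> i) q"]]) (rule Ab_hom_fun(2)[OF \<sigma> that])
    have uniq: "y = z" if "y \<in> carrier P" "z \<in> carrier P" "\<forall>i\<in>I. ab_fun (\<pi> i) y = ab_fun (\<pi> i) z" for y z
      using glue[rule_format, of "\<lambda>i. ab_fun (\<pi> i) z"] Ab_hom_fun(2)[OF \<pi> that(2)] that by blast
    interpret P: comm_group P using P by simp
    interpret Q: comm_group Q using Q by simp
    have "h \<in> hom Q P"
    proof (rule homI)
      fix x y assume x: "x \<in> carrier Q" and y: "y \<in> carrier Q"
      show "h (x \<otimes>\<^bsub>Q\<^esub> y) = h x \<otimes>\<^bsub>P\<^esub> h y"
      proof (rule uniq)
        show "\<forall>i\<in>I. ab_fun (\<pi> i) (h (x \<otimes>\<^bsub>Q\<^esub> y)) = ab_fun (\<pi> i) (h x \<otimes>\<^bsub>P\<^esub> h y)"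
          using h x y Ab_hom_fun(3)[OF \<pi>] Ab_hom_fun(3)[OF \<sigma>] by simp
      qed (use h x y in auto)
    qed (use h in blast)
    then have H: "(Q, restrict h (carrier Q), P) \<in> Hom Ab Q P" (is "?H \<in> _")
      using P Q by (intro Ab_homI) auto
    have Hq: "ab_fun ?H q = h q" if "q \<in> carrier Q" for q using that by (simp add: ab_fun_def)
    show "\<exists>!k. k \<in> Hom Ab Q P \<and> (\<forall>i\<in>I. \<pi> i \<cdot>\<^bsub>Ab\<^esub> k = \<sigma> i)"
    proof (rule ex1I[of _ ?H])
      have "\<pi> i \<cdot>\<^bsub>Ab\<^esub> ?H = \<sigma> i" if i: "i \<in> I" for i
        by (rule Ab_hom_eq[OF Ab_comp_in[OF H \<pi>[OF i]] \<sigma>[OF i]])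
          (simp add: ab_fun_comp[OF H \<pi>[OF i]] Hq h i)
      then show "?H \<in> Hom Ab Q P \<and> (\<forall>i\<in>I. \<pi> i \<cdot>\<^bsub>Ab\<^esub> ?H = \<sigma> i)" using H by blast
    next
      fix k assume k: "k \<in> Hom Ab Q P \<and> (\<forall>i\<in>I. \<pi> i \<cdot>\<^bsub>Ab\<^esub> k = \<sigma> i)"
      then have kh: "k \<in> Hom Ab Q P" by blast
      show "k = ?H"
      proof (rule Ab_hom_eq[OF kh H])
        fix q assume q: "q \<in> carrier Q"
        have "ab_fun (\<pi> i) (ab_fun k q) = ab_fun (\<sigma> i) q" if "i \<in> I" for i
          using k ab_fun_comp[OF kh \<pi>[OF that] q] that by auto
        then show "ab_fun k q = ab_fun ?H q"
          using Hq[OF q] h[OF q] Ab_hom_fun(2)[OF kh q] by (intro uniq) auto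
      qed
    qed
  qed
next
  assume prod: "is_product Ab I X P \<pi>"
  have X: "comm_group (X i)" "small TYPE('u) (carrier (X i))" if "i \<in> I" for i
    using Ab_hom_obj(2)[OF \<pi>[OF that]] by auto
  define R where "R = product_group I X"
  have Rs: "small TYPE('u) (carrier R)"
    unfolding R_def by (simp add: small_PiE[OF univ I] X)
  have Rg: "comm_group R"
  proof -
    have "group R" unfolding R_def using X comm_group.axioms(2) by (intro product_group) blast
    moreover have "x \<otimes>\<^bsub>R\<^esub> y = y \<otimes>\<^bsub>R\<^esub> x" if "x \<in> carrier R" "y \<in> carrier R" for x y
      using that comm_monoid.m_comm[OF comm_group.axioms(1)[OF X(1)]]
      by (auto simp: R_def PiE_iff intro!: restrict_ext)
    ultimately show ?thesis by (simp add: group.group_comm_groupI)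
  qed
  define Q where "Q = (tr R :: 'u monoid)"
  have Q: "Q \<in> Obj Ab" unfolding Q_def using tr_comm_group[OF Rs Rg] tr_small[OF Rs] by simp
  define \<sigma> where "\<sigma> i = (Q, restrict (\<lambda>q. dec R q i) (carrier Q), X i)" for i
  have \<sigma>: "\<sigma> i \<in> Hom Ab Q (X i)" if i: "i \<in> I" for i
  proof -
    have "(\<lambda>q. dec R q i) \<in> hom Q (X i)"
    proof (rule homI)
      fix x assume x: "x \<in> carrier Q"
      show "dec R x i \<in> carrier (X i)" using dec_in[of x R] x i unfolding Q_def by (auto simp: R_def)
      fix y assume y: "y \<in> carrier Q"
      show "dec R (x \<otimes>\<^bsub>Q\<^esub> y) i = dec R x i \<otimes>\<^bsub>X i\<^esub> dec R y i"
        using dec_mult[OF Rs Rg] x y i unfolding Q_def by (simp add: R_def)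
    qed
    then show ?thesis unfolding \<sigma>_def using Q X[OF i] by (intro Ab_homI) auto
  qed
  have \<sigma>f: "ab_fun (\<sigma> i) q = dec R q i" if "q \<in> carrier Q" for i q
    using that by (simp add: \<sigma>_def ab_fun_def)
  have univp: "\<forall>Q\<in>Obj Ab. \<forall>\<sigma>. (\<forall>i\<in>I. \<sigma> i \<in> Hom Ab Q (X i)) \<longrightarrow>
      (\<exists>!h. h \<in> Hom Ab Q P \<and> (\<forall>i\<in>I. \<pi> i \<cdot>\<^bsub>Ab\<^esub> h = \<sigma> i))"
    using prod unfolding is_product_def by (elim conjE)
  obtain h where h: "h \<in> Hom Ab Q P" "\<And>i. i \<in> I \<Longrightarrow> \<pi> i \<cdot>\<^bsub>Ab\<^esub> h = \<sigma> i"
    using univp[rule_format, OF Q, of \<sigma>] \<sigma> by blast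
  have enc_Q: "enc R x \<in> carrier Q" if "x \<in> carrier R" for x
    unfolding Q_def using that by (rule enc_in)
  have ex: "ab_fun (\<pi> i) (ab_fun h (enc R x)) = x i" if "x \<in> carrier R" "i \<in> I" for x i
    using h(2)[OF that(2)] ab_fun_comp[OF h(1) \<pi>[OF that(2)] enc_Q[OF that(1)]] \<sigma>f[OF enc_Q[OF that(1)]]
      dec_enc[OF Rs that(1)] by simp
  define k0 where "k0 y = (\<lambda>i\<in>I. ab_fun (\<pi> i) y)" for y
  have k0: "k0 y \<in> carrier R" if "y \<in> carrier P" for y
    using Ab_hom_fun(2)[OF \<pi> that] by (simp add: k0_def R_def)
  have "(\<lambda>y. enc R (k0 y)) \<in> hom P Q"
  proof (rule homI)
    fix x assume x: "x \<in> carrier P"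
    show "enc R (k0 x) \<in> carrier Q" using k0[OF x] enc_Q by blast
    fix y assume y: "y \<in> carrier P"
    have "k0 (x \<otimes>\<^bsub>P\<^esub> y) = k0 x \<otimes>\<^bsub>R\<^esub> k0 y"
      using Ab_hom_fun(3)[OF \<pi> x y] by (auto simp: k0_def R_def)
    then show "enc R (k0 (x \<otimes>\<^bsub>P\<^esub> y)) = enc R (k0 x) \<otimes>\<^bsub>Q\<^esub> enc R (k0 y)"
      unfolding Q_def using enc_mult[OF Rs k0[OF x] k0[OF y]] by simp
  qed
  then have k: "(P, restrict (\<lambda>y. enc R (k0 y)) (carrier P), Q) \<in> Hom Ab P Q" (is "?k \<in> _")
    using P Q by (intro Ab_homI) auto
  have kf: "ab_fun ?k y = enc R (k0 y)" if "y \<in> carrier P" for y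
    using that by (simp add: ab_fun_def)
  have hk: "h \<cdot>\<^bsub>Ab\<^esub> ?k = Id Ab P"
  proof -
    have hkh: "h \<cdot>\<^bsub>Ab\<^esub> ?k \<in> Hom Ab P P" by (rule Ab_comp_in[OF k h(1)])
    have "\<pi> i \<cdot>\<^bsub>Ab\<^esub> (h \<cdot>\<^bsub>Ab\<^esub> ?k) = \<pi> i" if i: "i \<in> I" for i
      by (rule Ab_hom_eq[OF Ab_comp_in[OF hkh \<pi>[OF i]] \<pi>[OF i]])
        (simp add: ab_fun_comp[OF hkh \<pi>[OF i]] ab_fun_comp[OF k h(1)] kf ex k0 i, simp add: k0_def i)
    moreover have "\<pi> i \<cdot>\<^bsub>Ab\<^esub> Id Ab P = \<pi> i" if i: "i \<in> I" for i
      using \<pi>[OF i] by (simp add: in_Hom)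
    ultimately show ?thesis
      using univp[rule_format, OF P, of \<pi>] \<pi> hkh Ab_id_in[OF P] by blast
  qed
  show ?glue
  proof (intro allI impI)
    fix x assume x: "\<forall>i\<in>I. x i \<in> carrier (X i)"
    then have xR: "restrict x I \<in> carrier R" by (simp add: R_def)
    show "\<exists>!y. y \<in> carrier P \<and> (\<forall>i\<in>I. ab_fun (\<pi> i) y = x i)"
    proof (rule ex1I[of _ "ab_fun h (enc R (restrict x I))"])
      show "ab_fun h (enc R (restrict x I)) \<in> carrier P \<and>
          (\<forall>i\<in>I. ab_fun (\<pi> i) (ab_fun h (enc R (restrict x I))) = x i)"
        using ex[OF xR] Ab_hom_fun(2)[OF h(1) enc_Q[OF xR]] by simp
    next
      fix y assume y: "y \<in> carrier P \<and> (\<forall>i\<in>I. ab_fun (\<pi> i) y = x i)"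
      have "y = ab_fun (h \<cdot>\<^bsub>Ab\<^esub> ?k) y" using hk y by (simp add: ab_fun_id)
      also have "\<dots> = ab_fun h (enc R (k0 y))" using ab_fun_comp[OF k h(1)] kf y by simp
      also have "k0 y = restrict x I" using y by (auto simp: k0_def)
      finally show "y = ab_fun h (enc R (restrict x I))" .
    qed
  qed
qed


section \<open>Additive presheaves\<close>

text \<open>
  A contravariant additive functor to abelian groups on the full subcategory with object class
  \<open>D\<close>.  The carriers may have any type, so that groups of arrows and groups of natural
  transformations are covered directly.
\<close>

locale presheaf = preadd C for C :: "('o, 'm, 'z) preadditive_scheme" (structure) +
  fixes D :: "'o set" and N :: "'o \<Rightarrow> 'x monoid" and act :: "'m \<Rightarrow> 'x \<Rightarrow> 'x"
  assumes D_obj: "D \<subseteq> Obj C"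
    and grp: "X \<in> D \<Longrightarrow> comm_group (N X)"
    and act_in: "X \<in> D \<Longrightarrow> Y \<in> D \<Longrightarrow> f \<in> Hom C X Y \<Longrightarrow> x \<in> carrier (N Y) \<Longrightarrow> act f x \<in> carrier (N X)"
    and act_mult: "X \<in> D \<Longrightarrow> Y \<in> D \<Longrightarrow> f \<in> Hom C X Y \<Longrightarrow> x \<in> carrier (N Y) \<Longrightarrow> y \<in> carrier (N Y) \<Longrightarrow>
      act f (x \<otimes>\<^bsub>N Y\<^esub> y) = act f x \<otimes>\<^bsub>N X\<^esub> act f y"
    and act_id: "X \<in> D \<Longrightarrow> x \<in> carrier (N X) \<Longrightarrow> act (Id C X) x = x"
    and act_comp: "X \<in> D \<Longrightarrow> Y \<in> D \<Longrightarrow> Z \<in> D \<Longrightarrow> f \<in> Hom C X Y \<Longrightarrow> g \<in> Hom C Y Z \<Longrightarrow> x \<in> carrier (N Z) \<Longrightarrow>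
      act (g \<cdot> f) x = act f (act g x)"
    and act_add: "X \<in> D \<Longrightarrow> Y \<in> D \<Longrightarrow> f \<in> Hom C X Y \<Longrightarrow> g \<in> Hom C X Y \<Longrightarrow> x \<in> carrier (N Y) \<Longrightarrow>
      act (f \<boxplus> g) x = act f x \<otimes>\<^bsub>N X\<^esub> act g x"
begin

lemma act_hom: "X \<in> D \<Longrightarrow> Y \<in> D \<Longrightarrow> f \<in> Hom C X Y \<Longrightarrow> act f \<in> hom (N Y) (N X)"
  using act_in act_mult by (auto intro: homI)

lemma act_group_hom: "X \<in> D \<Longrightarrow> Y \<in> D \<Longrightarrow> f \<in> Hom C X Y \<Longrightarrow> group_hom (N Y) (N X) (act f)"
  using act_hom[of X Y f] comm_group.axioms(2)[OF grp[of X]] comm_group.axioms(2)[OF grp[of Y]]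
  by (simp add: group_hom_def group_hom_axioms_def)

lemma act_one: "X \<in> D \<Longrightarrow> Y \<in> D \<Longrightarrow> f \<in> Hom C X Y \<Longrightarrow> act f \<one>\<^bsub>N Y\<^esub> = \<one>\<^bsub>N X\<^esub>"
  using group_hom.hom_one[OF act_group_hom] .

lemma act_inv: "X \<in> D \<Longrightarrow> Y \<in> D \<Longrightarrow> f \<in> Hom C X Y \<Longrightarrow> x \<in> carrier (N Y) \<Longrightarrow>
    act f (inv\<^bsub>N Y\<^esub> x) = inv\<^bsub>N X\<^esub> act f x"
  using group_hom.hom_inv[OF act_group_hom] .

lemma act_zero:
  assumes "X \<in> D" "Y \<in> D" "x \<in> carrier (N Y)"
  shows "act (Zero C X Y) x = \<one>\<^bsub>N X\<^esub>"
proof -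
  interpret comm_group "N X" using assms grp by blast
  have o: "X \<in> Obj C" "Y \<in> Obj C" using assms D_obj by auto
  have z: "Zero C X Y \<in> Hom C X Y" using o by simp
  have "act (Zero C X Y) x \<otimes>\<^bsub>N X\<^esub> act (Zero C X Y) x = act (Zero C X Y) x"
    using act_add[OF assms(1,2) z z assms(3)] o by simp
  then show ?thesis using act_in[OF assms(1,2) z assms(3)] by simp
qed

lemma act_neg:
  assumes "X \<in> D" "Y \<in> D" "f \<in> Hom C X Y" "x \<in> carrier (N Y)"
  shows "act (neg_arr C f) x = inv\<^bsub>N X\<^esub> act f x"
proof -
  interpret comm_group "N X" using assms grp by blast
  have "act (neg_arr C f) x \<otimes>\<^bsub>N X\<^esub> act f x = \<one>\<^bsub>N X\<^esub>"
    using act_add[OF assms(1,2) neg_in[OF assms(3)] assms(3,4)] act_zero[OF assms(1,2,4)] assms(3)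
    by (simp add: in_Hom)
  then show ?thesis
    using act_in[OF assms(1,2) neg_in[OF assms(3)] assms(4)] act_in[OF assms] inv_equality by simp
qed

lemma act_diff:
  assumes "X \<in> D" "Y \<in> D" "f \<in> Hom C X Y" "g \<in> Hom C X Y" "x \<in> carrier (N Y)"
  shows "act (diff_arr C f g) x = act f x \<otimes>\<^bsub>N X\<^esub> inv\<^bsub>N X\<^esub> act g x"
  unfolding diff_arr_def using act_add[OF assms(1,2,3) neg_in[OF assms(4)] assms(5)]
    act_neg[OF assms(1,2,4,5)] by simp

end

text \<open>
  Unique gluing says that \<open>N P\<close> maps bijectively to the product of the \<open>N (X i)\<close>.  In \<open>exact_on\<close>
  the other half of exactness is automatic, since an additive functor preserves zero arrows.
\<close>

definition takes_coproducts ::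
  "'u itself \<Rightarrow> ('o, 'm, 'z) category_scheme \<Rightarrow> 'o set \<Rightarrow> ('o \<Rightarrow> 'x monoid) \<Rightarrow> ('m \<Rightarrow> 'x \<Rightarrow> 'x) \<Rightarrow> bool" where
  "takes_coproducts U C D N act \<longleftrightarrow> (\<forall>(I :: 'u set) X P \<iota>.
     small U I \<and> (\<forall>i\<in>I. X i \<in> D) \<and> P \<in> D \<and> is_coproduct C I X P \<iota> \<longrightarrow>
     (\<forall>x. (\<forall>i\<in>I. x i \<in> carrier (N (X i))) \<longrightarrow> (\<exists>!y. y \<in> carrier (N P) \<and> (\<forall>i\<in>I. act (\<iota> i) y = x i))))"

definition exact_on ::
  "('o, 'm, 'z) tricat_scheme \<Rightarrow> 'o set \<Rightarrow> ('o \<Rightarrow> 'x monoid) \<Rightarrow> ('m \<Rightarrow> 'x \<Rightarrow> 'x) \<Rightarrow> bool" where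
  "exact_on C D N act \<longleftrightarrow> (\<forall>(f, g, h) \<in> Tri C. Dom C f \<in> D \<and> Cod C f \<in> D \<and> Cod C g \<in> D \<longrightarrow>
     (\<forall>x \<in> carrier (N (Cod C f)). act f x = \<one>\<^bsub>N (Dom C f)\<^esub> \<longrightarrow> (\<exists>y \<in> carrier (N (Cod C g)). act g y = x)))"

lemma exact_onD:
  assumes "exact_on C D N act" "(f, g, h) \<in> Tri C" "Dom C f \<in> D" "Cod C f \<in> D" "Cod C g \<in> D"
    "x \<in> carrier (N (Cod C f))" "act f x = \<one>\<^bsub>N (Dom C f)\<^esub>"
  obtains y where "y \<in> carrier (N (Cod C g))" "act g y = x"
  using assms unfolding exact_on_def by fastforce

lemma takes_coproducts_ex:
  fixes U :: "'u itself" and I :: "'u set"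
  assumes "takes_coproducts U C D N act" "small U I" "\<And>i. i \<in> I \<Longrightarrow> X i \<in> D" "P \<in> D"
    "is_coproduct C I X P \<iota>" "\<And>i. i \<in> I \<Longrightarrow> x i \<in> carrier (N (X i))"
  obtains y where "y \<in> carrier (N P)" "\<And>i. i \<in> I \<Longrightarrow> act (\<iota> i) y = x i"
proof -
  have "\<exists>!y. y \<in> carrier (N P) \<and> (\<forall>i\<in>I. act (\<iota> i) y = x i)"
    using assms(1)[unfolded takes_coproducts_def, rule_format, of I X P \<iota> x] assms(2-) by simp
  then show thesis using that by blast
qed

lemma takes_coproducts_unique:
  fixes U :: "'u itself" and I :: "'u set"
  assumes "takes_coproducts U C D N act" "small U I" "\<And>i. i \<in> I \<Longrightarrow> X i \<in> D" "P \<in> D"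
    "is_coproduct C I X P \<iota>" "\<And>i. i \<in> I \<Longrightarrow> act (\<iota> i) z \<in> carrier (N (X i))"
    "y \<in> carrier (N P)" "z \<in> carrier (N P)" "\<And>i. i \<in> I \<Longrightarrow> act (\<iota> i) y = act (\<iota> i) z"
  shows "y = z"
proof -
  have "\<exists>!y. y \<in> carrier (N P) \<and> (\<forall>i\<in>I. act (\<iota> i) y = act (\<iota> i) z)"
    using assms(1)[unfolded takes_coproducts_def, rule_format, of I X P \<iota> "\<lambda>i. act (\<iota> i) z"] assms(2-6)
    by simp
  then show ?thesis using assms(7-) by blast
qed

lemma op_cat_simps [simp]:
  "Obj (op_cat C) = Obj C" "Arr (op_cat C) = Arr C" "Dom (op_cat C) = Cod C" "Cod (op_cat C) = Dom C"
  "Id (op_cat C) = Id C" "g \<cdot>\<^bsub>op_cat C\<^esub> f = f \<cdot>\<^bsub>C\<^esub> g" "Add (op_cat C) = Add C"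
  by (simp_all add: op_cat_def)

lemma Hom_op_cat [simp]: "Hom (op_cat C) X Y = Hom C Y X"
  by (auto simp: in_Hom)

lemma is_product_op_cat [simp]: "is_product (op_cat C) I X P \<iota> = is_coproduct C I X P \<iota>"
  by (simp add: is_product_def is_coproduct_def)

text \<open>
  An isomorphic copy in \<open>Ab\<close> of a presheaf whose groups have small carriers.
\<close>

definition small_ftor ::
  "('o, 'm, 'z) preadditive_scheme \<Rightarrow> ('o \<Rightarrow> 'x monoid) \<Rightarrow> ('m \<Rightarrow> 'x \<Rightarrow> 'x) \<Rightarrow> ('o, 'm, 'u monoid, 'u ab_arr) ftor" where
  "small_ftor A N act =
     \<lparr>FO = (\<lambda>X\<in>Obj A. tr (N X)),
      FA = (\<lambda>f\<in>Arr A. (tr (N (Cod A f)),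
        \<lambda>x\<in>carrier (tr (N (Cod A f))). enc (N (Dom A f)) (act f (dec (N (Cod A f)) x)),
        tr (N (Dom A f))))\<rparr>"

lemma small_ftor_FO: "X \<in> Obj A \<Longrightarrow> FO (small_ftor A N act) X = tr (N X)"
  by (simp add: small_ftor_def)

lemma small_ftor_FA:
  assumes "f \<in> Hom A X Y" "x \<in> carrier (tr (N Y))"
  shows "ab_fun (FA (small_ftor A N act) f) x = enc (N X) (act f (dec (N Y) x))"
  using assms by (simp add: small_ftor_def in_Hom ab_fun_def)

context presheaf
begin

lemma small_ftor_in:
  assumes s: "\<And>X. X \<in> Obj C \<Longrightarrow> small TYPE('u) (carrier (N X))" and D: "D = Obj C"
    and f: "f \<in> Hom C X Y"
  shows "FA (small_ftor C N act) f \<in> Hom (Ab :: ('u monoid, 'u ab_arr) preadditive) (tr (N Y)) (tr (N X))"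
proof -
  have o: "X \<in> D" "Y \<in> D" using hom_obj[OF f] D by auto
  have sX: "small TYPE('u) (carrier (N X))" and sY: "small TYPE('u) (carrier (N Y))" using s o D by auto
  have eq: "FA (small_ftor C N act) f =
      (tr (N Y), restrict (\<lambda>x. enc (N X) (act f (dec (N Y) x))) (carrier (tr (N Y))), tr (N X))"
    using f by (simp add: small_ftor_def in_Hom)
  have "(\<lambda>x :: 'u. enc (N X) (act f (dec (N Y) x))) \<in> hom (tr (N Y)) (tr (N X) :: 'u monoid)"
  proof (rule homI)
    fix x :: 'u assume x: "x \<in> carrier (tr (N Y))"
    show "enc (N X) (act f (dec (N Y) x)) \<in> carrier (tr (N X))"
      using act_in[OF o f dec_in[OF x]] by (rule enc_in)
    fix y :: 'u assume y: "y \<in> carrier (tr (N Y))"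
    show "(enc (N X) (act f (dec (N Y) (x \<otimes>\<^bsub>tr (N Y)\<^esub> y))) :: 'u) =
        enc (N X) (act f (dec (N Y) x)) \<otimes>\<^bsub>tr (N X)\<^esub> enc (N X) (act f (dec (N Y) y))"
      using dec_mult[OF sY grp[OF o(2)] x y] act_mult[OF o f dec_in[OF x] dec_in[OF y]]
        enc_mult[OF sX act_in[OF o f dec_in[OF x]] act_in[OF o f dec_in[OF y]]] by simp
  qed
  then show ?thesis
    unfolding eq using tr_comm_group[OF sX grp[OF o(1)]] tr_comm_group[OF sY grp[OF o(2)]] tr_small[OF sX] tr_small[OF sY]
    by (intro Ab_homI)
qed

lemma small_ftor_additive:
  assumes s: "\<And>X. X \<in> Obj C \<Longrightarrow> small TYPE('u) (carrier (N X))" and D: "D = Obj C"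
  shows "additive_functor (op_cat C) (Ab :: ('u monoid, 'u ab_arr) preadditive) (small_ftor C N act)"
    (is "additive_functor _ _ ?F")
proof -
  have inn: "FA ?F f \<in> Hom Ab (tr (N Y)) (tr (N X))" if "f \<in> Hom C X Y" for f X Y
    by (rule small_ftor_in[OF _ D that]) (rule s)
  have FO: "FO ?F X = tr (N X)" if "X \<in> Obj C" for X using that by (simp add: small_ftor_FO)
  have FOo: "FO ?F X \<in> Obj Ab" if "X \<in> Obj C" for X
    using that tr_comm_group[OF s grp] tr_small[OF s] D by (simp add: FO)
  have FA: "ab_fun (FA ?F f) x = enc (N X) (act f (dec (N Y) x))"
    if "f \<in> Hom C X Y" "x \<in> carrier (tr (N Y))" for f X Y and x :: 'u
    using small_ftor_FA[where N = N and act = act, OF that] .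
  have "is_functor (op_cat C) Ab ?F"
    unfolding is_functor_def op_cat_simps
  proof (intro conjI ballI impI)
    fix X assume X: "X \<in> Obj C"
    show "FO ?F X \<in> Obj Ab" by (rule FOo[OF X])
    show "FA ?F (Id C X) = Id Ab (FO ?F X)"
    proof (rule Ab_hom_eq)
      show "FA ?F (Id C X) \<in> Hom Ab (tr (N X)) (tr (N X))" by (rule inn[OF id_in[OF X]])
      show "Id Ab (FO ?F X) \<in> Hom Ab (tr (N X)) (tr (N X))" using Ab_id_in[OF FOo[OF X]] FO[OF X] by simp
      fix x :: 'u assume x: "x \<in> carrier (tr (N X))"
      then show "ab_fun (FA ?F (Id C X)) x = ab_fun (Id Ab (FO ?F X)) x"
        using FA[OF id_in[OF X] x] act_id[of X "dec (N X) x"] dec_in[OF x] enc_dec[OF x] X D FO[OF X]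
        by (simp add: ab_fun_id)
    qed
  next
    fix f assume "f \<in> Arr C"
    then have f: "f \<in> Hom C (Dom C f) (Cod C f)" by (simp add: in_Hom)
    show "FA ?F f \<in> Hom Ab (FO ?F (Cod C f)) (FO ?F (Dom C f))"
      using inn[OF f] hom_obj[OF f] by (simp add: FO)
    fix g assume "g \<in> Arr C" "Dom C f = Cod C g"
    then have g: "g \<in> Hom C (Dom C g) (Dom C f)" by (simp add: in_Hom)
    have gf: "f \<cdot> g \<in> Hom C (Dom C g) (Cod C f)" using f g by blast
    have o: "Dom C g \<in> D" "Dom C f \<in> D" "Cod C f \<in> D" using hom_obj[OF f] hom_obj[OF g] D by auto
    show "FA ?F (f \<cdot> g) = FA ?F g \<cdot>\<^bsub>Ab\<^esub> FA ?F f"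
    proof (rule Ab_hom_eq[OF inn[OF gf] Ab_comp_in[OF inn[OF f] inn[OF g]]])
      fix x :: 'u assume x: "x \<in> carrier (tr (N (Cod C f)))"
      have y: "act f (dec (N (Cod C f)) x) \<in> carrier (N (Dom C f))" using act_in[OF o(2,3) f dec_in[OF x]] .
      show "ab_fun (FA ?F (f \<cdot> g)) x = ab_fun (FA ?F g \<cdot>\<^bsub>Ab\<^esub> FA ?F f) x"
        using FA[OF gf x] ab_fun_comp[OF inn[OF f] inn[OF g] x] FA[OF f x]
          FA[OF g enc_in[OF y]] act_comp[OF o g f dec_in[OF x]] dec_enc[OF s y] o D by simp
    qed
  qed
  moreover have "FA ?F (f \<boxplus> g) = FA ?F f \<boxplus>\<^bsub>Ab\<^esub> FA ?F g"
    if f: "f \<in> Hom C X Y" and g: "g \<in> Hom C X Y" for X Y f g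
  proof (rule Ab_hom_eq[OF inn[OF add_in[OF f g]] Ab_add_in[OF inn[OF f] inn[OF g]]])
    have o: "X \<in> D" "Y \<in> D" using hom_obj[OF f] D by auto
    fix x :: 'u assume x: "x \<in> carrier (tr (N Y))"
    show "ab_fun (FA ?F (f \<boxplus> g)) x = ab_fun (FA ?F f \<boxplus>\<^bsub>Ab\<^esub> FA ?F g) x"
      using FA[OF add_in[OF f g] x] ab_fun_add[OF inn[OF f] inn[OF g] x] FA[OF f x] FA[OF g x]
        act_add[OF o f g dec_in[OF x]] enc_mult[OF s act_in[OF o f dec_in[OF x]] act_in[OF o g dec_in[OF x]]] o D
      by simp
  qed
  ultimately show ?thesis unfolding additive_functor_def by simp
qed

lemma small_ftor_products:
  assumes univ: "universe TYPE('u)"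
    and s: "\<And>X. X \<in> Obj C \<Longrightarrow> small TYPE('u) (carrier (N X))" and D: "D = Obj C"
    and cop: "takes_coproducts TYPE('u) C D N act"
  shows "preserves_products TYPE('u) (op_cat C) (Ab :: ('u monoid, 'u ab_arr) preadditive) (small_ftor C N act)"
    (is "preserves_products _ _ _ ?F")
  unfolding preserves_products_def is_product_op_cat
proof (intro allI impI, elim conjE)
  fix I :: "'u set" and X P \<iota> assume I: "small TYPE('u) I" and P: "is_coproduct C I X P \<iota>"
  note \<iota> = coproductD(3)[OF P] and Po = coproductD(1)[OF P] and Xo = coproductD(2)[OF P]
  have FOP: "FO ?F P = tr (N P)" and FOX: "\<And>i. i \<in> I \<Longrightarrow> FO ?F (X i) = tr (N (X i))"
    using Po Xo by (simp_all add: small_ftor_FO)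
  show "is_product Ab I (\<lambda>i. FO ?F (X i)) (FO ?F P) (\<lambda>i. FA ?F (\<iota> i))"
  proof (subst Ab_product_iff[OF univ I])
    show "FO ?F P \<in> Obj Ab" using tr_comm_group[OF s[OF Po] grp] tr_small[OF s[OF Po]] Po D by (simp add: FOP)
    show "FA ?F (\<iota> i) \<in> Hom Ab (FO ?F P) (FO ?F (X i))" if "i \<in> I" for i
      unfolding FOP FOX[OF that] by (rule small_ftor_in[OF _ D \<iota>[OF that]]) (rule s)
    show "\<forall>x. (\<forall>i\<in>I. x i \<in> carrier (FO ?F (X i))) \<longrightarrow>
        (\<exists>!y. y \<in> carrier (FO ?F P) \<and> (\<forall>i\<in>I. ab_fun (FA ?F (\<iota> i)) y = x i))"
    proof (intro allI impI)
      fix x :: "'u \<Rightarrow> 'u" assume "\<forall>i\<in>I. x i \<in> carrier (FO ?F (X i))"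
      then have x: "x i \<in> carrier (tr (N (X i)))" if "i \<in> I" for i using that FOX by auto
      have act: "act (\<iota> i) y \<in> carrier (N (X i))" if "i \<in> I" "y \<in> carrier (N P)" for i y
        using act_in[OF _ _ \<iota>[OF that(1)] that(2)] Xo[OF that(1)] Po D by simp
      obtain y where y: "y \<in> carrier (N P)" "\<And>i. i \<in> I \<Longrightarrow> act (\<iota> i) y = dec (N (X i)) (x i)"
        using takes_coproducts_ex[OF cop I _ _ P, of "\<lambda>i. dec (N (X i)) (x i)"] Xo Po D dec_in[OF x] by metis
      show "\<exists>!y. y \<in> carrier (FO ?F P) \<and> (\<forall>i\<in>I. ab_fun (FA ?F (\<iota> i)) y = x i)"
      proof (rule ex1I[of _ "enc (N P) y"])
        have e: "(enc (N P) y :: 'u) \<in> carrier (tr (N P))" by (rule enc_in[OF y(1)])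
        show "enc (N P) y \<in> carrier (FO ?F P) \<and> (\<forall>i\<in>I. ab_fun (FA ?F (\<iota> i)) (enc (N P) y) = x i)"
          using y e small_ftor_FA[where N = N and act = act, OF \<iota> e] dec_enc[OF s[OF Po] y(1)] enc_dec[OF x]
          by (simp add: FOP)
      next
        fix z assume z: "z \<in> carrier (FO ?F P) \<and> (\<forall>i\<in>I. ab_fun (FA ?F (\<iota> i)) z = x i)"
        then have z': "z \<in> carrier (tr (N P))" by (simp add: FOP)
        have "dec (N P) z = y"
        proof (rule takes_coproducts_unique[OF cop I _ _ P])
          fix i assume i: "i \<in> I"
          have "enc (N (X i)) (act (\<iota> i) (dec (N P) z)) = x i"
            using z i small_ftor_FA[where N = N and act = act, OF \<iota>[OF i] z'] by simp
          then have "act (\<iota> i) (dec (N P) z) = dec (N (X i)) (x i)"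
            using dec_enc[OF s[OF Xo[OF i]] act[OF i dec_in[OF z']]] by simp
          then show "act (\<iota> i) (dec (N P) z) = act (\<iota> i) y" using y(2)[OF i] by simp
        qed (use y act Xo Po D dec_in[OF z'] dec_in[OF x] in auto)
        then show "z = enc (N P) y" using enc_dec[OF z'] by simp
      qed
    qed
  qed
qed

end

lemma ftor_presheaf:
  assumes A: "is_preadditive A" and F: "additive_functor (op_cat A) Ab F"
  shows "presheaf A (Obj A) (FO F) (\<lambda>f. ab_fun (FA F f))"
proof -
  interpret preadd A by unfold_locales (rule A)
  have fn: "is_functor (op_cat A) Ab F" using F by (simp add: additive_functor_def)
  have inn: "FA F f \<in> Hom Ab (FO F Y) (FO F X)" if "f \<in> Hom A X Y" for f X Y
    using fn that unfolding is_functor_def by (auto simp: in_Hom)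
  show ?thesis
  proof (intro presheaf.intro presheaf_axioms.intro preadd_axioms)
    fix X assume X: "X \<in> Obj A"
    then have "FO F X \<in> Obj Ab" using fn unfolding is_functor_def by simp
    then show "comm_group (FO F X)" by simp
    fix x assume "x \<in> carrier (FO F X)"
    moreover have "FA F (Id A X) = Id Ab (FO F X)" using fn X unfolding is_functor_def by simp
    ultimately show "ab_fun (FA F (Id A X)) x = x" by (simp add: ab_fun_id)
  next
    fix X Y f x assume f: "f \<in> Hom A X Y" and x: "x \<in> carrier (FO F Y)"
    show "ab_fun (FA F f) x \<in> carrier (FO F X)" using Ab_hom_fun(2)[OF inn[OF f] x] .
    fix y assume y: "y \<in> carrier (FO F Y)"
    show "ab_fun (FA F f) (x \<otimes>\<^bsub>FO F Y\<^esub> y) = ab_fun (FA F f) x \<otimes>\<^bsub>FO F X\<^esub> ab_fun (FA F f) y"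
      using Ab_hom_fun(3)[OF inn[OF f] x y] .
  next
    fix X Y Z f g x assume f: "f \<in> Hom A X Y" and g: "g \<in> Hom A Y Z" and x: "x \<in> carrier (FO F Z)"
    have "FA F (g \<cdot>\<^bsub>A\<^esub> f) = FA F f \<cdot>\<^bsub>Ab\<^esub> FA F g"
      using fn f g unfolding is_functor_def by (simp add: in_Hom)
    then show "ab_fun (FA F (g \<cdot>\<^bsub>A\<^esub> f)) x = ab_fun (FA F f) (ab_fun (FA F g) x)"
      using ab_fun_comp[OF inn[OF g] inn[OF f] x] by simp
  next
    fix X Y f g x assume o: "X \<in> Obj A" "Y \<in> Obj A" and f: "f \<in> Hom A X Y" and g: "g \<in> Hom A X Y"
      and x: "x \<in> carrier (FO F Y)"
    have "FA F (f \<boxplus>\<^bsub>A\<^esub> g) = FA F f \<boxplus>\<^bsub>Ab\<^esub> FA F g"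
      using F o f g unfolding additive_functor_def by simp
    then show "ab_fun (FA F (f \<boxplus>\<^bsub>A\<^esub> g)) x = ab_fun (FA F f) x \<otimes>\<^bsub>FO F X\<^esub> ab_fun (FA F g) x"
      using ab_fun_add[OF inn[OF f] inn[OF g] x] by simp
  qed simp
qed

lemma ftor_takes_coproducts:
  fixes F :: "('o, 'm, 'u monoid, 'u ab_arr) ftor"
  assumes univ: "universe TYPE('u)" and A: "is_preadditive A"
    and F: "additive_functor (op_cat A) Ab F" and pp: "preserves_products TYPE('u) (op_cat A) Ab F"
  shows "takes_coproducts TYPE('u) A (Obj A) (FO F) (\<lambda>f. ab_fun (FA F f))"
  unfolding takes_coproducts_def
proof (intro allI impI, elim conjE)
  fix I :: "'u set" and X P \<iota> x
  assume I: "small TYPE('u) I" and P: "is_coproduct A I X P \<iota>" and x: "\<forall>i\<in>I. x i \<in> carrier (FO F (X i))"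
  interpret preadd A by unfold_locales (rule A)
  have fn: "is_functor (op_cat A) Ab F" using F by (simp add: additive_functor_def)
  have "is_product Ab I (\<lambda>i. FO F (X i)) (FO F P) (\<lambda>i. FA F (\<iota> i))"
    using pp P I unfolding preserves_products_def is_product_op_cat by blast
  moreover have "FO F P \<in> Obj Ab" using fn coproductD(1)[OF P] unfolding is_functor_def by simp
  moreover have "FA F (\<iota> i) \<in> Hom Ab (FO F P) (FO F (X i))" if "i \<in> I" for i
    using fn coproductD(3)[OF P that] unfolding is_functor_def by (auto simp: in_Hom)
  ultimately show "\<exists>!y. y \<in> carrier (FO F P) \<and> (\<forall>i\<in>I. ab_fun (FA F (\<iota> i)) y = x i)"
    using Ab_product_iff[OF univ I, of "FO F P" "\<lambda>i. FA F (\<iota> i)" "\<lambda>i. FO F (X i)"] x by blast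
qed

text \<open>
  The representability hypothesis speaks about functors to \<open>Ab\<close>; it applies to the copy of \<open>N\<close> in
  the universe, and decoding the resulting isomorphism gives one with \<open>N\<close> itself.
\<close>

lemma (in tri_cat) brown:
  fixes N :: "'o \<Rightarrow> 'x monoid"
  assumes univ: "universe TYPE('u)" and br: "brown_representability TYPE('u) C"
    and N: "presheaf C (Obj C) N act" and ex: "exact_on C (Obj C) N act"
    and cop: "takes_coproducts TYPE('u) C (Obj C) N act"
    and s: "\<And>X. X \<in> Obj C \<Longrightarrow> small TYPE('u) (carrier (N X))"
  shows "\<exists>M\<in>Obj C. \<exists>\<phi>. (\<forall>X\<in>Obj C. \<phi> X \<in> Group.iso (hom_group C X M) (N X)) \<and>
    (\<forall>X Y f g. f \<in> Hom C X Y \<longrightarrow> g \<in> Hom C Y M \<longrightarrow> \<phi> X (g \<cdot> f) = act f (\<phi> Y g))"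
proof -
  interpret N: presheaf C "Obj C" N act by (rule N)
  define F where "F = (small_ftor C N act :: ('o, 'm, 'u monoid, 'u ab_arr) ftor)"
  have FO: "FO F X = tr (N X)" if "X \<in> Obj C" for X using that by (simp add: small_ftor_FO F_def)
  have FA: "ab_fun (FA F f) x = enc (N X) (act f (dec (N Y) x))"
    if "f \<in> Hom C X Y" "x \<in> carrier (tr (N Y))" for f X Y x
    using small_ftor_FA[where N = N and act = act, OF that] F_def by simp
  have "cohomological C F"
    unfolding cohomological_def
  proof (intro conjI ballI)
    show "additive_functor (op_cat C) Ab F" unfolding F_def by (rule N.small_ftor_additive[OF s]) auto
    fix t assume "t \<in> Tri C"
    then obtain f g h where t: "t = (f, g, h)" "(f, g, h) \<in> Tri C" by (cases t) auto
    note a = tri_in[OF t(2)]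
    have ker: "ab_fun (FA F g) ` carrier (FO F (Cod C g)) = kernel (FO F (Cod C f)) (FO F (Dom C f)) (ab_fun (FA F f))"
      unfolding FO[OF a(4)] FO[OF a(5)] FO[OF a(6)]
    proof (intro equalityI subsetI)
      fix y assume "y \<in> ab_fun (FA F g) ` carrier (tr (N (Cod C g)))"
      then obtain x where x: "x \<in> carrier (tr (N (Cod C g)))" "y = ab_fun (FA F g) x" by blast
      then have x: "x \<in> carrier (tr (N (Cod C g)))" "y = enc (N (Cod C f)) (act g (dec (N (Cod C g)) x))"
        using FA[OF a(2)] by simp_all
      define z where "z = dec (N (Cod C g)) x"
      have z: "z \<in> carrier (N (Cod C g))" unfolding z_def by (rule dec_in[OF x(1)])
      have gz: "act g z \<in> carrier (N (Cod C f))" using N.act_in[OF a(5,6,2) z] .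
      have "act f (act g z) = \<one>\<^bsub>N (Dom C f)\<^esub>"
        using N.act_comp[OF a(4,5,6,1,2) z] tri_comp_zero[OF t(2)] N.act_zero[OF a(4,6) z] by simp
      then have "ab_fun (FA F f) y = \<one>\<^bsub>tr (N (Dom C f))\<^esub>"
        using FA[OF a(1) enc_in[OF gz]] dec_enc[OF s[OF a(5)] gz] x(2) z_def by (simp add: tr_def)
      then show "y \<in> kernel (tr (N (Cod C f))) (tr (N (Dom C f))) (ab_fun (FA F f))"
        using enc_in[OF gz] x(2) z_def by (simp add: kernel_def)
    next
      fix y assume "y \<in> kernel (tr (N (Cod C f))) (tr (N (Dom C f))) (ab_fun (FA F f))"
      then have y: "y \<in> carrier (tr (N (Cod C f)))" "ab_fun (FA F f) y = \<one>\<^bsub>tr (N (Dom C f))\<^esub>"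
        by (auto simp: kernel_def)
      define z where "z = dec (N (Cod C f)) y"
      have z: "z \<in> carrier (N (Cod C f))" unfolding z_def by (rule dec_in[OF y(1)])
      have one: "\<one>\<^bsub>N (Dom C f)\<^esub> \<in> carrier (N (Dom C f))"
        using comm_group.axioms(2)[OF N.grp[OF a(4)]] by (simp add: group.is_monoid monoid.one_closed)
      have "enc (N (Dom C f)) (act f z) = (enc (N (Dom C f)) \<one>\<^bsub>N (Dom C f)\<^esub> :: 'u)"
        using FA[OF a(1) y(1)] y(2) z_def by (simp add: tr_def)
      then have "act f z = \<one>\<^bsub>N (Dom C f)\<^esub>"
        using enc_inj[OF s[OF a(4)]] N.act_in[OF a(4,5,1) z] one by (simp add: inj_on_def)
      then obtain x where x: "x \<in> carrier (N (Cod C g))" "act g x = z"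
        using exact_onD[OF ex t(2) a(4,5,6) z] by blast
      have "ab_fun (FA F g) (enc (N (Cod C g)) x) = y"
        using FA[OF a(2) enc_in[OF x(1)]] dec_enc[OF s[OF a(6)] x(1)] x(2) enc_dec[OF y(1)] z_def by simp
      then show "y \<in> ab_fun (FA F g) ` carrier (tr (N (Cod C g)))" using enc_in[OF x(1)] by blast
    qed
    show "case t of (f, g, h) \<Rightarrow> ab_fun (FA F g) ` carrier (FO F (Cod C g)) =
        kernel (FO F (Cod C f)) (FO F (Dom C f)) (ab_fun (FA F f))"
      using ker t by simp
  qed
  moreover have "preserves_products TYPE('u) (op_cat C) Ab F"
    unfolding F_def by (rule N.small_ftor_products[OF univ s _ cop]) auto
  ultimately have "representable C F" using br unfolding brown_representability_def by blast
  then obtain M \<phi> where M: "M \<in> Obj C" "\<And>X. X \<in> Obj C \<Longrightarrow> \<phi> X \<in> Group.iso (hom_group C X M) (FO F X)"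
      "\<And>f g. f \<in> Arr C \<Longrightarrow> g \<in> Hom C (Cod C f) M \<Longrightarrow> \<phi> (Dom C f) (g \<cdot> f) = ab_fun (FA F f) (\<phi> (Cod C f) g)"
    unfolding representable_def by blast
  define \<psi> where "\<psi> X g = dec (N X) (\<phi> X g)" for X g
  have "\<psi> X \<in> Group.iso (hom_group C X M) (N X)" if X: "X \<in> Obj C" for X
  proof -
    have ph: "\<phi> X \<in> hom (hom_group C X M) (tr (N X))" "bij_betw (\<phi> X) (Hom C X M) (carrier (tr (N X)))"
      using M(2)[OF X] FO[OF X] by (auto simp: Group.iso_def)
    have "\<psi> X \<in> hom (hom_group C X M) (N X)"
      using ph(1) dec_mult[OF s[OF X] N.grp[OF X]] unfolding \<psi>_def by (auto simp: hom_def Pi_iff dec_in)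
    moreover have "bij_betw (\<psi> X) (Hom C X M) (carrier (N X))"
    proof -
      have "bij_betw (dec (N X)) (carrier (tr (N X) :: 'u monoid)) (carrier (N X))"
        unfolding dec_def tr_def using enc_inj[OF s[OF X]]
        by (simp add: bij_betw_inv_into inj_on_imp_bij_betw)
      then have "bij_betw (dec (N X) \<circ> \<phi> X) (Hom C X M) (carrier (N X))" by (rule bij_betw_trans[OF ph(2)])
      moreover have "dec (N X) \<circ> \<phi> X = \<psi> X" by (simp add: \<psi>_def fun_eq_iff)
      ultimately show ?thesis by simp
    qed
    ultimately show ?thesis by (simp add: Group.iso_def)
  qed
  moreover have "\<psi> X (g \<cdot> f) = act f (\<psi> Y g)" if f: "f \<in> Hom C X Y" and g: "g \<in> Hom C Y M" for X Y f g
  proof -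
    have o: "X \<in> Obj C" "Y \<in> Obj C" using hom_obj[OF f] by auto
    have ph: "\<phi> Y g \<in> carrier (tr (N Y))"
      using M(2)[OF o(2)] FO[OF o(2)] g by (auto simp: Group.iso_def hom_def)
    have "\<phi> X (g \<cdot> f) = enc (N X) (act f (dec (N Y) (\<phi> Y g)))"
      using M(3)[of f g] f g FA[OF f ph] by (simp add: in_Hom)
    then show ?thesis
      unfolding \<psi>_def using dec_enc[OF s[OF o(1)] N.act_in[OF o f dec_in[OF ph]]] by simp
  qed
  ultimately show ?thesis using M(1) by blast
qed


section \<open>Brown representability for the positive part of a weight structure\<close>

lemma smashing_coproduct:
  fixes U :: "'u itself" and I :: "'u set"
  assumes "smashing U C" "small U I" "\<And>i. i \<in> I \<Longrightarrow> X i \<in> Obj C"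
  obtains P \<iota> where "is_coproduct C I X P \<iota>"
  using assms(1)[unfolded smashing_def, rule_format, of I X] assms(2,3) by auto

lemma closed_coproduct:
  fixes U :: "'u itself" and I :: "'u set"
  assumes "closed_under_coproducts U C D" "small U I" "is_coproduct C I X P \<iota>" "\<And>i. i \<in> I \<Longrightarrow> X i \<in> D"
  shows "P \<in> D"
  using assms(1)[unfolded closed_under_coproducts_def, rule_format, of I X P \<iota>] assms(2-4) by simp

context weighted
begin

text \<open>
  A chosen arrow \<open>unit X : X \<rightarrow> cov X\<close> as in \<open>weak_reflection\<close>.  It is only weakly universal, so
  that \<open>cov\<close> is not a functor.
\<close>

definition wrefl :: "'o \<Rightarrow> 'o \<times> 'm" where
  "wrefl X = (SOME r. fst r \<in> wge \<and> snd r \<in> Hom C X (fst r) \<and>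
     (\<forall>T\<in>wge. \<forall>e\<in>Hom C X T. \<exists>h\<in>Hom C (fst r) T. h \<cdot> snd r = e))"

definition cov :: "'o \<Rightarrow> 'o" where "cov X = fst (wrefl X)"

definition unit :: "'o \<Rightarrow> 'm" where "unit X = snd (wrefl X)"

lemma cov_unit:
  assumes "X \<in> Obj C"
  shows cov_in: "cov X \<in> wge" and unit_in: "unit X \<in> Hom C X (cov X)"
    and unit_factor: "\<forall>T\<in>wge. \<forall>e\<in>Hom C X T. \<exists>h\<in>Hom C (cov X) T. h \<cdot> unit X = e"
proof -
  obtain X0 a where "X0 \<in> wge \<and> a \<in> Hom C X X0 \<and> (\<forall>T\<in>wge. \<forall>e\<in>Hom C X T. \<exists>h\<in>Hom C X0 T. h \<cdot> a = e)"
    using weak_reflection[OF assms] by blast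
  then have "\<exists>r. fst r \<in> wge \<and> snd r \<in> Hom C X (fst r) \<and>
      (\<forall>T\<in>wge. \<forall>e\<in>Hom C X T. \<exists>h\<in>Hom C (fst r) T. h \<cdot> snd r = e)"
    by (intro exI[of _ "(X0, a)"]) simp
  from someI_ex[OF this]
  show "cov X \<in> wge" "unit X \<in> Hom C X (cov X)"
    "\<forall>T\<in>wge. \<forall>e\<in>Hom C X T. \<exists>h\<in>Hom C (cov X) T. h \<cdot> unit X = e"
    unfolding cov_def unit_def wrefl_def by auto
qed

end

locale wge_presheaf = weighted C wle wge + N: presheaf C wge N act
  for C :: "('o, 'm, 'z) tricat_scheme" (structure) and wle wge :: "'o set"
    and N :: "'o \<Rightarrow> 'x monoid" and act :: "'m \<Rightarrow> 'x \<Rightarrow> 'x" +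
  assumes exact: "exact_on C wge N act"
begin

text \<open>
  The left Kan extension of \<open>N\<close> to \<open>C\<close>.  An element over \<open>X\<close> is a germ: an arrow
  \<open>e : X \<rightarrow> T\<close> with \<open>T\<close> in \<open>wge\<close> together with an element of \<open>N T\<close>, where \<open>(g \<cdot> e, \<psi>)\<close> and
  \<open>(e, act g \<psi>)\<close> are identified.  As every \<open>e\<close> factors through \<open>unit X\<close>, germs form a
  quotient of \<open>N (cov X)\<close>.
\<close>

definition rel :: "'o \<Rightarrow> 'x set" where
  "rel X = {act g \<psi> | g T \<psi>. T \<in> wge \<and> g \<in> Hom C (cov X) T \<and> \<psi> \<in> carrier (N T) \<and>
     g \<cdot> unit X = Zero C X T}"

definition ext :: "'o \<Rightarrow> 'x set monoid" where
  "ext X = N (cov X) Mod rel X"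

definition germ :: "'m \<Rightarrow> 'x \<Rightarrow> 'x set" where
  "germ e \<psi> = rel (Dom C e) #>\<^bsub>N (cov (Dom C e))\<^esub>
     act (SOME h. h \<in> Hom C (cov (Dom C e)) (Cod C e) \<and> h \<cdot> unit (Dom C e) = e) \<psi>"

definition ext_act :: "'m \<Rightarrow> 'x set \<Rightarrow> 'x set" where
  "ext_act f K = germ (unit (Cod C f) \<cdot> f)
     (SOME \<phi>. \<phi> \<in> carrier (N (cov (Cod C f))) \<and> germ (unit (Cod C f)) \<phi> = K)"

lemma relI:
  "T \<in> wge \<Longrightarrow> g \<in> Hom C (cov X) T \<Longrightarrow> \<psi> \<in> carrier (N T) \<Longrightarrow> g \<cdot> unit X = Zero C X T \<Longrightarrow> act g \<psi> \<in> rel X"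
  unfolding rel_def by blast

lemma relE:
  assumes "x \<in> rel X"
  obtains g T \<psi> where "T \<in> wge" "g \<in> Hom C (cov X) T" "\<psi> \<in> carrier (N T)" "g \<cdot> unit X = Zero C X T" "x = act g \<psi>"
  using assms unfolding rel_def by blast

text \<open>
  Two relations, given by \<open>g\<close> and \<open>g'\<close>, add up to the relation given by the arrow with components
  \<open>g\<close> and \<open>g'\<close> to the direct sum of their targets.
\<close>

lemma rel_subgroup:
  assumes X: "X \<in> Obj C"
  shows "subgroup (rel X) (N (cov X))"
proof -
  note c = cov_in[OF X] and u = unit_in[OF X]
  have co: "cov X \<in> Obj C" using c wge_obj by blast
  interpret G: comm_group "N (cov X)" using N.grp[OF c] .
  show ?thesis
  proof (rule G.subgroupI)
    show "rel X \<subseteq> carrier (N (cov X))" using N.act_in c by (auto elim!: relE)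
    have "act (Zero C (cov X) (cov X)) \<one>\<^bsub>N (cov X)\<^esub> \<in> rel X"
      using u co X by (intro relI[OF c]) (auto simp: in_Hom)
    then show "rel X \<noteq> {}" by blast
  next
    fix x assume "x \<in> rel X"
    then obtain g T \<psi> where g: "T \<in> wge" "g \<in> Hom C (cov X) T" "\<psi> \<in> carrier (N T)"
        "g \<cdot> unit X = Zero C X T" "x = act g \<psi>" by (rule relE)
    interpret T: comm_group "N T" using N.grp[OF g(1)] .
    have "act g (inv\<^bsub>N T\<^esub> \<psi>) \<in> rel X" using g by (intro relI[OF g(1,2)]) auto
    then show "inv\<^bsub>N (cov X)\<^esub> x \<in> rel X" using N.act_inv[OF c g(1-3)] g(5) by simp
  next
    fix x y assume "x \<in> rel X" "y \<in> rel X"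
    obtain g T \<psi> where g: "T \<in> wge" "g \<in> Hom C (cov X) T" "\<psi> \<in> carrier (N T)"
        "g \<cdot> unit X = Zero C X T" "x = act g \<psi>" by (rule relE[OF \<open>x \<in> rel X\<close>])
    obtain g' T' \<psi>' where g': "T' \<in> wge" "g' \<in> Hom C (cov X) T'" "\<psi>' \<in> carrier (N T')"
        "g' \<cdot> unit X = Zero C X T'" "y = act g' \<psi>'" by (rule relE[OF \<open>y \<in> rel X\<close>])
    obtain S i j p q where S: "S \<in> wge" "i \<in> Hom C T S" "j \<in> Hom C T' S" "p \<in> Hom C S T" "q \<in> Hom C S T'"
        "p \<cdot> i = Id C T" "q \<cdot> j = Id C T'" "q \<cdot> i = Zero C T T'" "p \<cdot> j = Zero C T' T"
      using wge_biproduct[OF g(1) g'(1)] by metis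
    interpret S: comm_group "N S" using N.grp[OF S(1)] .
    have ob: "T \<in> Obj C" "T' \<in> Obj C" "S \<in> Obj C" using g(1) g'(1) S(1) wge_obj by auto
    have ig: "i \<cdot> g \<in> Hom C (cov X) S" and jg: "j \<cdot> g' \<in> Hom C (cov X) S" using S g g' by blast+
    define k where "k = (i \<cdot> g) \<boxplus> (j \<cdot> g')"
    have k: "k \<in> Hom C (cov X) S" unfolding k_def using ig jg by blast
    have "p \<cdot> (i \<cdot> g) = g" "p \<cdot> (j \<cdot> g') = Zero C (cov X) T" "q \<cdot> (i \<cdot> g) = Zero C (cov X) T'" "q \<cdot> (j \<cdot> g') = g'"
      using S g g' ob co by (simp_all add: assoc[symmetric] in_Hom)
    then have pk: "p \<cdot> k = g" "q \<cdot> k = g'"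
      unfolding k_def using comp_add[OF ig jg S(4)] comp_add[OF ig jg S(5)] g(2) g'(2) by (auto simp: in_Hom)
    have ku: "k \<cdot> unit X = Zero C X S"
    proof -
      have "(i \<cdot> g) \<cdot> unit X = Zero C X S" "(j \<cdot> g') \<cdot> unit X = Zero C X S"
        using g g' S u X ob by (simp_all add: assoc in_Hom)
      then show ?thesis unfolding k_def using add_comp[OF u ig jg] X ob by simp
    qed
    have pin: "act p \<psi> \<in> carrier (N S)" "act q \<psi>' \<in> carrier (N S)"
      using N.act_in[OF S(1) g(1) S(4) g(3)] N.act_in[OF S(1) g'(1) S(5) g'(3)] by auto
    have "act k (act p \<psi> \<otimes>\<^bsub>N S\<^esub> act q \<psi>') \<in> rel X"
      using pin by (intro relI[OF S(1) k _ ku]) simp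
    moreover have "act k (act p \<psi> \<otimes>\<^bsub>N S\<^esub> act q \<psi>') = x \<otimes>\<^bsub>N (cov X)\<^esub> y"
      using N.act_mult[OF c S(1) k pin] N.act_comp[OF c S(1) g(1) k S(4) g(3)]
        N.act_comp[OF c S(1) g'(1) k S(5) g'(3)] pk g(5) g'(5) by simp
    ultimately show "x \<otimes>\<^bsub>N (cov X)\<^esub> y \<in> rel X" by simp
  qed
qed

lemma rel_normal: "X \<in> Obj C \<Longrightarrow> normal (rel X) (N (cov X))"
  using comm_group.subgroup_imp_normal[OF N.grp[OF cov_in] rel_subgroup] .

lemma ext_group: "X \<in> Obj C \<Longrightarrow> comm_group (ext X)"
  unfolding ext_def using comm_group.abelian_FactGroup[OF N.grp[OF cov_in] rel_subgroup] .

lemma rel_coset_eq: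
  assumes X: "X \<in> Obj C" and x: "x \<in> carrier (N (cov X))" and y: "y \<in> carrier (N (cov X))"
    and d: "x \<otimes>\<^bsub>N (cov X)\<^esub> inv\<^bsub>N (cov X)\<^esub> y \<in> rel X"
  shows "rel X #>\<^bsub>N (cov X)\<^esub> x = rel X #>\<^bsub>N (cov X)\<^esub> y"
proof -
  interpret G: comm_group "N (cov X)" using N.grp[OF cov_in[OF X]] .
  have "x \<in> rel X #>\<^bsub>N (cov X)\<^esub> y"
    using subgroup.rcos_module_rev[OF rel_subgroup[OF X] G.is_group y x d] .
  then show ?thesis using G.repr_independence[OF _ y rel_subgroup[OF X]] by blast
qed

lemma rel_coset_one:
  assumes X: "X \<in> Obj C" and x: "x \<in> carrier (N (cov X))"
  shows "rel X #>\<^bsub>N (cov X)\<^esub> x = rel X \<longleftrightarrow> x \<in> rel X"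
proof -
  interpret G: comm_group "N (cov X)" using N.grp[OF cov_in[OF X]] .
  show ?thesis
    using G.rcos_self[OF x rel_subgroup[OF X]] subgroup.rcos_const[OF rel_subgroup[OF X] G.is_group, of x] by blast
qed

text \<open>
  Two factorizations of \<open>e\<close> through \<open>unit X\<close> differ by an arrow that vanishes on \<open>X\<close>, hence by a
  relation.  This is why germs do not depend on choices, and why \<open>germ\<close> is additive in \<open>e\<close>.
\<close>

lemma germ_eq:
  assumes X: "X \<in> Obj C" and T: "T \<in> wge" and e: "e \<in> Hom C X T" and \<psi>: "\<psi> \<in> carrier (N T)"
    and h: "h \<in> Hom C (cov X) T" "h \<cdot> unit X = e"
  shows "germ e \<psi> = rel X #>\<^bsub>N (cov X)\<^esub> act h \<psi>"
proof -
  note c = cov_in[OF X] and u = unit_in[OF X]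
  have D: "Dom C e = X" "Cod C e = T" using e by (auto simp: in_Hom)
  define k where "k = (SOME h. h \<in> Hom C (cov X) T \<and> h \<cdot> unit X = e)"
  have k: "k \<in> Hom C (cov X) T \<and> k \<cdot> unit X = e"
    unfolding k_def by (rule someI[of _ h]) (use h in blast)
  have "diff_arr C k h \<cdot> unit X = Zero C X T"
    using eq_comp_iff[OF u _ h(1), of k] k h by auto
  then have "act (diff_arr C k h) \<psi> \<in> rel X" using k h by (intro relI[OF T _ \<psi>]) auto
  then have "act k \<psi> \<otimes>\<^bsub>N (cov X)\<^esub> inv\<^bsub>N (cov X)\<^esub> act h \<psi> \<in> rel X"
    using N.act_diff[OF c T _ h(1) \<psi>] k by simp
  then show ?thesis
    unfolding germ_def D k_def[symmetric]
    using rel_coset_eq[OF X] N.act_in[OF c T _ \<psi>] k h by blast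
qed

lemma unit_lift:
  assumes "X \<in> Obj C" "T \<in> wge" "e \<in> Hom C X T"
  obtains h where "h \<in> Hom C (cov X) T" "h \<cdot> unit X = e"
  using unit_factor assms by blast

lemma germ_in:
  assumes X: "X \<in> Obj C" and T: "T \<in> wge" and e: "e \<in> Hom C X T" and \<psi>: "\<psi> \<in> carrier (N T)"
  shows "germ e \<psi> \<in> carrier (ext X)"
proof -
  obtain h where h: "h \<in> Hom C (cov X) T" "h \<cdot> unit X = e" using unit_lift[OF X T e] .
  show ?thesis
    unfolding germ_eq[OF X T e \<psi> h] ext_def carrier_FactGroup using N.act_in[OF cov_in[OF X] T h(1) \<psi>] by blast
qed

lemma germ_unit:
  assumes X: "X \<in> Obj C" and \<phi>: "\<phi> \<in> carrier (N (cov X))"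
  shows "germ (unit X) \<phi> = rel X #>\<^bsub>N (cov X)\<^esub> \<phi>"
proof -
  note c = cov_in[OF X] and u = unit_in[OF X]
  have i: "Id C (cov X) \<in> Hom C (cov X) (cov X)" using c wge_obj by simp
  show ?thesis
    using germ_eq[OF X c u \<phi> i] u N.act_id[OF c \<phi>] by (simp add: in_Hom)
qed

lemma germ_surj:
  assumes X: "X \<in> Obj C" and K: "K \<in> carrier (ext X)"
  obtains \<phi> where "\<phi> \<in> carrier (N (cov X))" "K = germ (unit X) \<phi>"
  using K germ_unit[OF X] unfolding ext_def carrier_FactGroup by auto

lemma germ_comp:
  assumes X: "X \<in> Obj C" and T: "T \<in> wge" "T' \<in> wge" and e: "e \<in> Hom C X T" and g: "g \<in> Hom C T T'"
    and \<psi>: "\<psi> \<in> carrier (N T')"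
  shows "germ (g \<cdot> e) \<psi> = germ e (act g \<psi>)"
proof -
  note c = cov_in[OF X] and u = unit_in[OF X]
  obtain h where h: "h \<in> Hom C (cov X) T" "h \<cdot> unit X = e" using unit_lift[OF X T(1) e] .
  have gh: "g \<cdot> h \<in> Hom C (cov X) T'" "(g \<cdot> h) \<cdot> unit X = g \<cdot> e" using g h u by (auto simp: assoc in_Hom)
  show ?thesis
    using germ_eq[OF X T(2) comp_in[OF e g] \<psi> gh] germ_eq[OF X T(1) e N.act_in[OF T g \<psi>] h]
      N.act_comp[OF c T h(1) g \<psi>] by simp
qed

lemma germ_mult:
  assumes X: "X \<in> Obj C" and T: "T \<in> wge" and e: "e \<in> Hom C X T"
    and \<psi>: "\<psi> \<in> carrier (N T)" and \<psi>': "\<psi>' \<in> carrier (N T)"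
  shows "germ e (\<psi> \<otimes>\<^bsub>N T\<^esub> \<psi>') = germ e \<psi> \<otimes>\<^bsub>ext X\<^esub> germ e \<psi>'"
proof -
  note c = cov_in[OF X] and u = unit_in[OF X]
  interpret T: comm_group "N T" using N.grp[OF T] .
  obtain h where h: "h \<in> Hom C (cov X) T" "h \<cdot> unit X = e" using unit_lift[OF X T e] .
  show ?thesis
    using germ_eq[OF X T e _ h] \<psi> \<psi>' N.act_mult[OF c T h(1) \<psi> \<psi>']
      normal.rcos_sum[OF rel_normal[OF X] N.act_in[OF c T h(1) \<psi>] N.act_in[OF c T h(1) \<psi>']]
    by (simp add: ext_def)
qed

lemma germ_add:
  assumes X: "X \<in> Obj C" and T: "T \<in> wge" and e: "e \<in> Hom C X T" and e': "e' \<in> Hom C X T"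
    and \<psi>: "\<psi> \<in> carrier (N T)"
  shows "germ (e \<boxplus> e') \<psi> = germ e \<psi> \<otimes>\<^bsub>ext X\<^esub> germ e' \<psi>"
proof -
  note c = cov_in[OF X] and u = unit_in[OF X]
  obtain h where h: "h \<in> Hom C (cov X) T" "h \<cdot> unit X = e" using unit_lift[OF X T e] .
  obtain h' where h': "h' \<in> Hom C (cov X) T" "h' \<cdot> unit X = e'" using unit_lift[OF X T e'] .
  have hh: "h \<boxplus> h' \<in> Hom C (cov X) T" "(h \<boxplus> h') \<cdot> unit X = e \<boxplus> e'"
    using add_comp[OF u h(1) h'(1)] h h' by auto
  show ?thesis
    using germ_eq[OF X T e \<psi> h] germ_eq[OF X T e' \<psi> h'] germ_eq[OF X T add_in[OF e e'] \<psi> hh]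
      N.act_add[OF c T h(1) h'(1) \<psi>]
      normal.rcos_sum[OF rel_normal[OF X] N.act_in[OF c T h(1) \<psi>] N.act_in[OF c T h'(1) \<psi>]]
    by (simp add: ext_def)
qed

lemma ext_one: "\<one>\<^bsub>ext X\<^esub> = rel X"
  by (simp add: ext_def)

lemma germ_zero:
  assumes X: "X \<in> Obj C" and T: "T \<in> wge" and \<psi>: "\<psi> \<in> carrier (N T)"
  shows "germ (Zero C X T) \<psi> = \<one>\<^bsub>ext X\<^esub>"
proof -
  interpret E: comm_group "ext X" using ext_group[OF X] .
  have z: "Zero C X T \<in> Hom C X T" using X T wge_obj by simp
  have "germ (Zero C X T) \<psi> \<otimes>\<^bsub>ext X\<^esub> germ (Zero C X T) \<psi> = germ (Zero C X T) \<psi>"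
    using germ_add[OF X T z z \<psi>] z by (simp add: in_Hom)
  then show ?thesis using germ_in[OF X T z \<psi>] by simp
qed

lemma germ_unit_one:
  assumes X: "X \<in> Obj C" and \<phi>: "\<phi> \<in> carrier (N (cov X))"
  shows "germ (unit X) \<phi> = \<one>\<^bsub>ext X\<^esub> \<longleftrightarrow> \<phi> \<in> rel X"
  unfolding germ_unit[OF X \<phi>] ext_one using rel_coset_one[OF X \<phi>] .

text \<open>
  Restriction along \<open>f\<close> is defined with an arbitrary representative over \<open>cov Y\<close>.  Another one
  differs from it by some \<open>act g \<chi>\<close> with \<open>g \<cdot> unit Y = 0\<close>, whose germ along \<open>unit Y \<cdot> f\<close> is trivial.
\<close>

lemma ext_act_germ:
  assumes X: "X \<in> Obj C" and Y: "Y \<in> Obj C" and f: "f \<in> Hom C X Y" and T: "T \<in> wge"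
    and e: "e \<in> Hom C Y T" and \<psi>: "\<psi> \<in> carrier (N T)"
  shows "ext_act f (germ e \<psi>) = germ (e \<cdot> f) \<psi>"
proof -
  note c = cov_in[OF Y] and u = unit_in[OF Y]
  interpret G: comm_group "N (cov Y)" using N.grp[OF c] .
  interpret E: comm_group "ext X" using ext_group[OF X] .
  have D: "Cod C f = Y" using f by (simp add: in_Hom)
  obtain h where h: "h \<in> Hom C (cov Y) T" "h \<cdot> unit Y = e" using unit_lift[OF Y T e] .
  have h\<psi>: "act h \<psi> \<in> carrier (N (cov Y))" using N.act_in[OF c T h(1) \<psi>] .
  have eq: "germ (unit Y) (act h \<psi>) = germ e \<psi>" using germ_comp[OF Y c T u h(1) \<psi>] h(2) by simp
  define \<phi> where "\<phi> = (SOME \<phi>. \<phi> \<in> carrier (N (cov Y)) \<and> germ (unit Y) \<phi> = germ e \<psi>)"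
  have \<phi>: "\<phi> \<in> carrier (N (cov Y)) \<and> germ (unit Y) \<phi> = germ e \<psi>"
    unfolding \<phi>_def by (rule someI[of _ "act h \<psi>"]) (use h\<psi> eq in blast)
  then have \<phi>c: "\<phi> \<in> carrier (N (cov Y))" by blast
  have "rel Y #>\<^bsub>N (cov Y)\<^esub> \<phi> = rel Y #>\<^bsub>N (cov Y)\<^esub> act h \<psi>"
    using \<phi> eq germ_unit[OF Y \<phi>c] germ_unit[OF Y h\<psi>] by simp
  then have "\<phi> \<in> rel Y #>\<^bsub>N (cov Y)\<^esub> act h \<psi>"
    using G.rcos_self[OF \<phi>c rel_subgroup[OF Y]] by simp
  then have "\<phi> \<otimes>\<^bsub>N (cov Y)\<^esub> inv\<^bsub>N (cov Y)\<^esub> act h \<psi> \<in> rel Y"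
    using subgroup.rcos_module_imp[OF rel_subgroup[OF Y] G.is_group h\<psi>] by simp
  then obtain g S \<chi> where g: "S \<in> wge" "g \<in> Hom C (cov Y) S" "\<chi> \<in> carrier (N S)"
      "g \<cdot> unit Y = Zero C Y S" "\<phi> \<otimes>\<^bsub>N (cov Y)\<^esub> inv\<^bsub>N (cov Y)\<^esub> act h \<psi> = act g \<chi>"
    by (rule relE)
  have g\<chi>: "act g \<chi> \<in> carrier (N (cov Y))" using N.act_in[OF c g(1,2,3)] .
  have "\<phi> = act g \<chi> \<otimes>\<^bsub>N (cov Y)\<^esub> act h \<psi>"
    using g(5) \<phi>c h\<psi> G.inv_solve_right' by (metis G.inv_closed G.m_assoc G.l_inv G.r_one)
  moreover have uf: "unit Y \<cdot> f \<in> Hom C X (cov Y)" using u f by blast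
  moreover have "germ (unit Y \<cdot> f) (act g \<chi>) = \<one>\<^bsub>ext X\<^esub>"
  proof -
    have "g \<cdot> (unit Y \<cdot> f) = Zero C X S"
      using g(2,4) u f wge_obj[OF g(1)] by (simp add: assoc[symmetric] in_Hom)
    then show ?thesis using germ_comp[OF X c g(1) uf g(2,3)] germ_zero[OF X g(1,3)] by simp
  qed
  moreover have "germ (unit Y \<cdot> f) (act h \<psi>) = germ (e \<cdot> f) \<psi>"
  proof -
    have "h \<cdot> (unit Y \<cdot> f) = e \<cdot> f" using h u f by (auto simp: assoc in_Hom)
    then show ?thesis using germ_comp[OF X c T uf h(1) \<psi>] by simp
  qed
  ultimately have "germ (unit Y \<cdot> f) \<phi> = germ (e \<cdot> f) \<psi>"
    using germ_mult[OF X c uf g\<chi> h\<psi>] germ_in[OF X T comp_in[OF f e] \<psi>] by simp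
  then show ?thesis unfolding ext_act_def D \<phi>_def .
qed

lemma ext_presheaf: "presheaf C (Obj C) ext ext_act"
proof (intro presheaf.intro presheaf_axioms.intro preadd_axioms)
  show "Obj C \<subseteq> Obj C" ..
next
  fix X assume X: "X \<in> Obj C"
  show "comm_group (ext X)" by (rule ext_group[OF X])
  fix K assume "K \<in> carrier (ext X)"
  then obtain \<phi> where \<phi>: "\<phi> \<in> carrier (N (cov X))" "K = germ (unit X) \<phi>" by (rule germ_surj[OF X])
  show "ext_act (Id C X) K = K"
    using ext_act_germ[OF X X id_in[OF X] cov_in[OF X] unit_in[OF X] \<phi>(1)] \<phi>(2) unit_in[OF X]
    by (simp add: in_Hom)
next
  fix X Y f K assume X: "X \<in> Obj C" and Y: "Y \<in> Obj C" and f: "f \<in> Hom C X Y" and K: "K \<in> carrier (ext Y)"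
  note c = cov_in[OF Y] and u = unit_in[OF Y]
  obtain \<phi> where \<phi>: "\<phi> \<in> carrier (N (cov Y))" "K = germ (unit Y) \<phi>" by (rule germ_surj[OF Y K])
  have eq: "ext_act f K = germ (unit Y \<cdot> f) \<phi>" using ext_act_germ[OF X Y f c u \<phi>(1)] \<phi>(2) by simp
  show "ext_act f K \<in> carrier (ext X)"
    unfolding eq by (rule germ_in[OF X c comp_in[OF f u] \<phi>(1)])
  {
    fix L assume L: "L \<in> carrier (ext Y)"
    obtain \<psi> where \<psi>: "\<psi> \<in> carrier (N (cov Y))" "L = germ (unit Y) \<psi>" by (rule germ_surj[OF Y L])
    interpret G: comm_group "N (cov Y)" using N.grp[OF c] .
    have "K \<otimes>\<^bsub>ext Y\<^esub> L = germ (unit Y) (\<phi> \<otimes>\<^bsub>N (cov Y)\<^esub> \<psi>)" using germ_mult[OF Y c u \<phi>(1) \<psi>(1)] \<phi> \<psi> by simp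
    then show "ext_act f (K \<otimes>\<^bsub>ext Y\<^esub> L) = ext_act f K \<otimes>\<^bsub>ext X\<^esub> ext_act f L"
      using ext_act_germ[OF X Y f c u] \<phi> \<psi> germ_mult[OF X c comp_in[OF f u] \<phi>(1) \<psi>(1)] by simp
  }
  fix g assume g: "g \<in> Hom C X Y"
  show "ext_act (f \<boxplus> g) K = ext_act f K \<otimes>\<^bsub>ext X\<^esub> ext_act g K"
    using ext_act_germ[OF X Y add_in[OF f g] c u \<phi>(1)] ext_act_germ[OF X Y f c u \<phi>(1)] ext_act_germ[OF X Y g c u \<phi>(1)]
      comp_add[OF f g u] germ_add[OF X c comp_in[OF f u] comp_in[OF g u] \<phi>(1)] \<phi>(2) by simp
next
  fix X Y Z f g K assume X: "X \<in> Obj C" and Y: "Y \<in> Obj C" and Z: "Z \<in> Obj C"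
    and f: "f \<in> Hom C X Y" and g: "g \<in> Hom C Y Z" and K: "K \<in> carrier (ext Z)"
  note c = cov_in[OF Z] and u = unit_in[OF Z]
  obtain \<phi> where \<phi>: "\<phi> \<in> carrier (N (cov Z))" "K = germ (unit Z) \<phi>" by (rule germ_surj[OF Z K])
  show "ext_act (g \<cdot> f) K = ext_act f (ext_act g K)"
    using ext_act_germ[OF X Z comp_in[OF f g] c u \<phi>(1)] ext_act_germ[OF Y Z g c u \<phi>(1)]
      ext_act_germ[OF X Y f c comp_in[OF g u] \<phi>(1)] \<phi>(2) f g u by (simp add: assoc in_Hom)
qed

text \<open>
  A germ over \<open>Y\<close> that vanishes on \<open>X\<close> does so because of some \<open>g : cov X \<rightarrow> T\<close>.  The cone of
  \<open>cov X \<rightarrow> cov Y \<oplus> T\<close> is again in \<open>wge\<close> and receives the third vertex \<open>Z\<close>, so exactness of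
  \<open>N\<close> on \<open>wge\<close> provides a germ over \<open>Z\<close>.
\<close>

lemma ext_exact: "exact_on C (Obj C) ext ext_act"
  unfolding exact_on_def
proof (intro ballI, clarify)
  fix u v w' K assume t: "(u, v, w') \<in> Tri C" and K: "K \<in> carrier (ext (Cod C u))"
    and zero: "ext_act u K = \<one>\<^bsub>ext (Dom C u)\<^esub>"
  define X Y Z where "X = Dom C u" and "Y = Cod C u" and "Z = Cod C v"
  have X: "X \<in> Obj C" and Y: "Y \<in> Obj C" and Z: "Z \<in> Obj C" and u: "u \<in> Hom C X Y" and v: "v \<in> Hom C Y Z"
    using tri_in[OF t] X_def Y_def Z_def by auto
  note cX = cov_in[OF X] and cY = cov_in[OF Y] and aX = unit_in[OF X] and aY = unit_in[OF Y]
  obtain \<phi> where \<phi>: "\<phi> \<in> carrier (N (cov Y))" "K = germ (unit Y) \<phi>" using germ_surj[OF Y] K Y_def by blast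
  obtain u0 where u0: "u0 \<in> Hom C (cov X) (cov Y)" "u0 \<cdot> unit X = unit Y \<cdot> u"
    using unit_lift[OF X cY comp_in[OF u aY]] .
  have "germ (unit X) (act u0 \<phi>) = \<one>\<^bsub>ext X\<^esub>"
    using zero ext_act_germ[OF X Y u cY aY \<phi>(1)] \<phi>(2) germ_comp[OF X cX cY aX u0(1) \<phi>(1)] u0(2) X_def by simp
  then have "act u0 \<phi> \<in> rel X" using germ_unit_one[OF X N.act_in[OF cX cY u0(1) \<phi>(1)]] by simp
  then obtain g T \<psi> where g: "T \<in> wge" "g \<in> Hom C (cov X) T" "\<psi> \<in> carrier (N T)"
      "g \<cdot> unit X = Zero C X T" "act u0 \<phi> = act g \<psi>" by (rule relE)
  obtain S i j p q where S: "S \<in> wge" "i \<in> Hom C (cov Y) S" "j \<in> Hom C T S" "p \<in> Hom C S (cov Y)" "q \<in> Hom C S T"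
      "p \<cdot> i = Id C (cov Y)" "q \<cdot> j = Id C T" "q \<cdot> i = Zero C (cov Y) T" "p \<cdot> j = Zero C T (cov Y)"
    using wge_biproduct[OF cY g(1)] by metis
  have ob: "T \<in> Obj C" "S \<in> Obj C" "cov X \<in> Obj C" "cov Y \<in> Obj C" using g(1) S(1) cX cY wge_obj by auto
  interpret S: comm_group "N S" using N.grp[OF S(1)] .
  interpret GX: comm_group "N (cov X)" using N.grp[OF cX] .
  interpret GY: comm_group "N (cov Y)" using N.grp[OF cY] .
  have iu: "i \<cdot> u0 \<in> Hom C (cov X) S" and jg: "j \<cdot> g \<in> Hom C (cov X) S" using S u0 g by blast+
  define k where "k = (i \<cdot> u0) \<boxplus> (j \<cdot> g)"
  have k: "k \<in> Hom C (cov X) S" unfolding k_def using iu jg by blast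
  have "p \<cdot> (i \<cdot> u0) = u0" "p \<cdot> (j \<cdot> g) = Zero C (cov X) (cov Y)" "q \<cdot> (i \<cdot> u0) = Zero C (cov X) T" "q \<cdot> (j \<cdot> g) = g"
    using S u0 g ob by (simp_all add: assoc[symmetric] in_Hom)
  then have pk: "p \<cdot> k = u0" "q \<cdot> k = g"
    unfolding k_def using comp_add[OF iu jg S(4)] comp_add[OF iu jg S(5)] u0(1) g(2) by (auto simp: in_Hom)
  (* The element (phi, -psi) over cov Y + T; it restricts to zero on cov X by the choice of psi. *)
  define \<chi> where "\<chi> = act p \<phi> \<otimes>\<^bsub>N S\<^esub> inv\<^bsub>N S\<^esub> act q \<psi>"
  have pin: "act p \<phi> \<in> carrier (N S)" "act q \<psi> \<in> carrier (N S)"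
    using N.act_in[OF S(1) cY S(4) \<phi>(1)] N.act_in[OF S(1) g(1) S(5) g(3)] by auto
  have \<chi>: "\<chi> \<in> carrier (N S)" unfolding \<chi>_def using pin by simp
  have act_\<chi>: "act l \<chi> = act (p \<cdot> l) \<phi> \<otimes>\<^bsub>N V\<^esub> inv\<^bsub>N V\<^esub> act (q \<cdot> l) \<psi>" if V: "V \<in> wge" and l: "l \<in> Hom C V S" for V l
    unfolding \<chi>_def
    using N.act_mult[OF V S(1) l pin(1), of "inv\<^bsub>N S\<^esub> act q \<psi>"] N.act_inv[OF V S(1) l pin(2)] pin
      N.act_comp[OF V S(1) cY l S(4) \<phi>(1)] N.act_comp[OF V S(1) g(1) l S(5) g(3)] by simp
  have k\<chi>: "act k \<chi> = \<one>\<^bsub>N (cov X)\<^esub>"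
    using act_\<chi>[OF cX k] pk g(5) N.act_in[OF cX g(1) g(2,3)] by simp
  have "k \<in> Arr C" using k by (simp add: in_Hom)
  then obtain w h where tw: "(k, w, h) \<in> Tri C" using tri_cone by blast
  define W where "W = Cod C w"
  have Dk: "Dom C k = cov X" "Cod C k = S" using k by (auto simp: in_Hom)
  have W: "W \<in> wge" using wge_cone[OF tw] Dk cX S(1) W_def by simp
  have w: "w \<in> Hom C S W" using tri_in(2)[OF tw] Dk W_def by simp
  obtain \<omega> where \<omega>: "\<omega> \<in> carrier (N W)" "act w \<omega> = \<chi>"
    using exact_onD[OF exact tw, of \<chi>] Dk cX S(1) W \<chi> k\<chi> W_def by metis
  have "k \<cdot> unit X = (i \<cdot> unit Y) \<cdot> u"
  proof -
    have "(j \<cdot> g) \<cdot> unit X = Zero C X S" using S g aX X ob by (simp add: assoc in_Hom)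
    moreover have "(i \<cdot> u0) \<cdot> unit X = (i \<cdot> unit Y) \<cdot> u" using S u0 aX aY u by (simp add: assoc in_Hom)
    moreover have "(i \<cdot> unit Y) \<cdot> u \<in> Hom C X S" using S aY u by blast
    ultimately show ?thesis unfolding k_def using add_comp[OF aX iu jg] by (simp add: in_Hom)
  qed
  then obtain z where z: "z \<in> Hom C Z W" "z \<cdot> v = w \<cdot> (i \<cdot> unit Y)"
    using tri_fill[OF t tw, of "unit X" "i \<cdot> unit Y"] aX comp_in[OF aY S(2)] Dk X_def Y_def Z_def W_def
    by metis
  have wi: "w \<cdot> i \<in> Hom C (cov Y) W" using w S by blast
  have "ext_act v (germ z \<omega>) = germ ((w \<cdot> i) \<cdot> unit Y) \<omega>"
    using ext_act_germ[OF Y Z v W z(1) \<omega>(1)] z(2) w S aY by (simp add: assoc in_Hom)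
  also have "\<dots> = germ (unit Y) (act i \<chi>)"
    using germ_comp[OF Y cY W aY wi \<omega>(1)] N.act_comp[OF cY S(1) W S(2) w \<omega>(1)] \<omega>(2) by simp
  also have "act i \<chi> = \<phi>"
    using act_\<chi>[OF cY S(2)] S(6,8) N.act_id[OF cY \<phi>(1)] N.act_zero[OF cY g(1,3)] \<phi>(1) by simp
  finally have "ext_act v (germ z \<omega>) = K" using \<phi>(2) by simp
  then show "\<exists>y\<in>carrier (ext (Cod C v)). ext_act v y = K"
    using germ_in[OF Z W z(1) \<omega>(1)] Z_def by blast
qed

text \<open>
  Let \<open>A\<close> be the coproduct of the \<open>cov (X i)\<close>; it lies in \<open>wge\<close>, and every germ over the coproduct
  \<open>P\<close> of the \<open>X i\<close> comes from \<open>N A\<close>.  If such a germ is trivial over every \<open>X i\<close>, then the relations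
  that show this have targets \<open>T i\<close>, and they combine to one relation with target the coproduct of
  the \<open>T i\<close>.  Both steps need \<open>wge\<close> to be closed under coproducts.
\<close>

lemma ext_coproducts:
  fixes U :: "'u itself"
  assumes sm: "smashing U C" and clo: "closed_under_coproducts U C wge"
    and cop: "takes_coproducts U C wge N act"
  shows "takes_coproducts U C (Obj C) ext ext_act"
  unfolding takes_coproducts_def
proof (intro allI impI, elim conjE)
  fix I :: "'u set" and X P \<iota> x
  assume I: "small U I" and Po: "P \<in> Obj C" and P: "is_coproduct C I X P \<iota>"
    and "\<forall>i\<in>I. x i \<in> carrier (ext (X i))"
  then have x: "\<And>i. i \<in> I \<Longrightarrow> x i \<in> carrier (ext (X i))" by blast
  note Xo = coproductD(2)[OF P] and \<iota> = coproductD(3)[OF P]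
  have c: "cov (X i) \<in> wge" and u: "unit (X i) \<in> Hom C (X i) (cov (X i))" if "i \<in> I" for i
    using cov_in unit_in Xo[OF that] by auto
  obtain A \<kappa> where A: "is_coproduct C I (\<lambda>i. cov (X i)) A \<kappa>"
    by (rule smashing_coproduct[OF sm I wge_obj[OF c]])
  have Aw: "A \<in> wge" by (rule closed_coproduct[OF clo I A c])
  note \<kappa> = coproductD(3)[OF A]
  obtain a where a: "a \<in> Hom C P A" "\<And>i. i \<in> I \<Longrightarrow> a \<cdot> \<iota> i = \<kappa> i \<cdot> unit (X i)"
    using coproduct_ex[OF P wge_obj[OF Aw], of "\<lambda>i. \<kappa> i \<cdot> unit (X i)"] \<kappa> u by blast
  have factor: "\<exists>\<phi>\<in>carrier (N A). K = germ a \<phi>" if K: "K \<in> carrier (ext P)" for K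
  proof -
    obtain \<phi> where \<phi>: "\<phi> \<in> carrier (N (cov P))" "K = germ (unit P) \<phi>" using germ_surj[OF Po K] .
    note cP = cov_in[OF Po] and uP = unit_in[OF Po]
    have "\<exists>h. h \<in> Hom C (cov (X i)) (cov P) \<and> h \<cdot> unit (X i) = unit P \<cdot> \<iota> i" if "i \<in> I" for i
      using unit_factor[OF Xo[OF that]] cP comp_in[OF \<iota>[OF that] uP] by blast
    then obtain h where h: "\<And>i. i \<in> I \<Longrightarrow> h i \<in> Hom C (cov (X i)) (cov P)"
        "\<And>i. i \<in> I \<Longrightarrow> h i \<cdot> unit (X i) = unit P \<cdot> \<iota> i" by metis
    obtain k where k: "k \<in> Hom C A (cov P)" "\<And>i. i \<in> I \<Longrightarrow> k \<cdot> \<kappa> i = h i"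
      using coproduct_ex[OF A wge_obj[OF cP], of h] h by blast
    have "k \<cdot> a = unit P"
    proof (rule coproduct_unique[OF P comp_in[OF a(1) k(1)] uP])
      fix i assume i: "i \<in> I"
      have "(k \<cdot> a) \<cdot> \<iota> i = (k \<cdot> \<kappa> i) \<cdot> unit (X i)"
        using k(1) a(1) a(2)[OF i] \<iota>[OF i] \<kappa>[OF i] u[OF i] by (simp add: assoc in_Hom)
      then show "(k \<cdot> a) \<cdot> \<iota> i = unit P \<cdot> \<iota> i" using k(2)[OF i] h(2)[OF i] by simp
    qed
    then have "K = germ a (act k \<phi>)" using germ_comp[OF Po Aw cP a(1) k(1) \<phi>(1)] \<phi>(2) by simp
    then show ?thesis using N.act_in[OF Aw cP k(1) \<phi>(1)] by blast
  qed
  have restr: "ext_act (\<iota> i) (germ a \<phi>) = germ (unit (X i)) (act (\<kappa> i) \<phi>)" if i: "i \<in> I" and \<phi>: "\<phi> \<in> carrier (N A)" for i \<phi>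
    using ext_act_germ[OF Xo[OF i] Po \<iota>[OF i] Aw a(1) \<phi>] a(2)[OF i] germ_comp[OF Xo[OF i] c[OF i] Aw u[OF i] \<kappa>[OF i] \<phi>]
    by simp
  have inj: "K = \<one>\<^bsub>ext P\<^esub>" if K: "K \<in> carrier (ext P)" and one: "\<forall>i\<in>I. ext_act (\<iota> i) K = \<one>\<^bsub>ext (X i)\<^esub>" for K
  proof -
    obtain \<phi> where \<phi>: "\<phi> \<in> carrier (N A)" "K = germ a \<phi>" using factor[OF K] by blast
    have \<kappa>\<phi>: "act (\<kappa> i) \<phi> \<in> carrier (N (cov (X i)))" if "i \<in> I" for i
      using N.act_in[OF c[OF that] Aw \<kappa>[OF that] \<phi>(1)] .
    have "act (\<kappa> i) \<phi> \<in> rel (X i)" if i: "i \<in> I" for i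
      using germ_unit_one[OF Xo[OF i] \<kappa>\<phi>[OF i]] restr[OF i \<phi>(1)] one i \<phi>(2) by simp
    (* A relation over each summand, as a triple of its target, its arrow and its element. *)
    then have "\<forall>i\<in>I. \<exists>r. fst r \<in> wge \<and> fst (snd r) \<in> Hom C (cov (X i)) (fst r) \<and>
        snd (snd r) \<in> carrier (N (fst r)) \<and> fst (snd r) \<cdot> unit (X i) = Zero C (X i) (fst r) \<and>
        act (\<kappa> i) \<phi> = act (fst (snd r)) (snd (snd r))"
      unfolding rel_def by fastforce
    from bchoice[OF this] obtain r where r: "\<forall>i\<in>I. fst (r i) \<in> wge \<and> fst (snd (r i)) \<in> Hom C (cov (X i)) (fst (r i)) \<and>
        snd (snd (r i)) \<in> carrier (N (fst (r i))) \<and> fst (snd (r i)) \<cdot> unit (X i) = Zero C (X i) (fst (r i)) \<and>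
        act (\<kappa> i) \<phi> = act (fst (snd (r i))) (snd (snd (r i)))" ..
    define T g \<psi> where "T i = fst (r i)" and "g i = fst (snd (r i))" and "\<psi> i = snd (snd (r i))" for i
    have T: "T i \<in> wge" and g: "g i \<in> Hom C (cov (X i)) (T i)" and \<psi>: "\<psi> i \<in> carrier (N (T i))"
      and gu: "g i \<cdot> unit (X i) = Zero C (X i) (T i)" and g\<psi>: "act (\<kappa> i) \<phi> = act (g i) (\<psi> i)" if "i \<in> I" for i
      using r that unfolding T_def g_def \<psi>_def by auto
    obtain B \<mu> where B: "is_coproduct C I T B \<mu>"
      by (rule smashing_coproduct[OF sm I wge_obj[OF T]])
    have Bw: "B \<in> wge" by (rule closed_coproduct[OF clo I B T])
    note \<mu> = coproductD(3)[OF B]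
    obtain b where b: "b \<in> Hom C A B" "\<And>i. i \<in> I \<Longrightarrow> b \<cdot> \<kappa> i = \<mu> i \<cdot> g i"
      using coproduct_ex[OF A wge_obj[OF Bw], of "\<lambda>i. \<mu> i \<cdot> g i"] \<mu> g by blast
    obtain \<omega> where \<omega>: "\<omega> \<in> carrier (N B)" "\<And>i. i \<in> I \<Longrightarrow> act (\<mu> i) \<omega> = \<psi> i"
      using takes_coproducts_ex[where x = \<psi>, OF cop I T Bw B \<psi>] by blast
    have b\<phi>: "act b \<omega> \<in> carrier (N A)" using N.act_in[OF Aw Bw b(1) \<omega>(1)] .
    have "\<phi> = act b \<omega>"
    proof (rule takes_coproducts_unique[OF cop I c Aw A _ \<phi>(1) b\<phi>])
      fix i assume i: "i \<in> I"
      show "act (\<kappa> i) (act b \<omega>) \<in> carrier (N (cov (X i)))" using N.act_in[OF c[OF i] Aw \<kappa>[OF i] b\<phi>] .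
      have "act (\<kappa> i) (act b \<omega>) = act (\<mu> i \<cdot> g i) \<omega>"
        using N.act_comp[OF c[OF i] Aw Bw \<kappa>[OF i] b(1) \<omega>(1)] b(2)[OF i] by simp
      also have "\<dots> = act (g i) (\<psi> i)"
        using N.act_comp[OF c[OF i] T[OF i] Bw g[OF i] \<mu>[OF i] \<omega>(1)] \<omega>(2)[OF i] by simp
      finally show "act (\<kappa> i) \<phi> = act (\<kappa> i) (act b \<omega>)" using g\<psi>[OF i] by simp
    qed
    moreover have "b \<cdot> a = Zero C P B"
    proof (rule coproduct_unique[OF P comp_in[OF a(1) b(1)] zero_in[OF Po wge_obj[OF Bw]]])
      fix i assume i: "i \<in> I"
      have "(b \<cdot> a) \<cdot> \<iota> i = (b \<cdot> \<kappa> i) \<cdot> unit (X i)"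
        using b(1) a(1) a(2)[OF i] \<iota>[OF i] \<kappa>[OF i] u[OF i] by (simp add: assoc in_Hom)
      also have "\<dots> = Zero C (X i) B"
        using b(2)[OF i] gu[OF i] \<mu>[OF i] g[OF i] u[OF i] Xo[OF i] by (simp add: assoc in_Hom)
      finally show "(b \<cdot> a) \<cdot> \<iota> i = Zero C P B \<cdot> \<iota> i" using \<iota>[OF i] wge_obj[OF Bw] by (simp add: in_Hom)
    qed
    ultimately show "K = \<one>\<^bsub>ext P\<^esub>"
      using \<phi>(2) germ_comp[OF Po Aw Bw a(1) b(1) \<omega>(1)] germ_zero[OF Po Bw \<omega>(1)] by simp
  qed
  interpret E: presheaf C "Obj C" ext ext_act by (rule ext_presheaf)
  have "\<exists>\<phi>. \<phi> \<in> carrier (N (cov (X i))) \<and> x i = germ (unit (X i)) \<phi>" if "i \<in> I" for i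
    using germ_surj[OF Xo[OF that] x[OF that]] by blast
  then obtain \<phi> where \<phi>: "\<And>i. i \<in> I \<Longrightarrow> \<phi> i \<in> carrier (N (cov (X i)))" "\<And>i. i \<in> I \<Longrightarrow> x i = germ (unit (X i)) (\<phi> i)"
    by metis
  obtain \<omega> where \<omega>: "\<omega> \<in> carrier (N A)" "\<And>i. i \<in> I \<Longrightarrow> act (\<kappa> i) \<omega> = \<phi> i"
    using takes_coproducts_ex[where x = \<phi>, OF cop I c Aw A \<phi>(1)] by blast
  show "\<exists>!y. y \<in> carrier (ext P) \<and> (\<forall>i\<in>I. ext_act (\<iota> i) y = x i)"
  proof (rule ex1I[of _ "germ a \<omega>"])
    show sol: "germ a \<omega> \<in> carrier (ext P) \<and> (\<forall>i\<in>I. ext_act (\<iota> i) (germ a \<omega>) = x i)"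
      using germ_in[OF Po Aw a(1) \<omega>(1)] restr[OF _ \<omega>(1)] \<omega>(2) \<phi>(2) by simp
    fix y assume y: "y \<in> carrier (ext P) \<and> (\<forall>i\<in>I. ext_act (\<iota> i) y = x i)"
    interpret EP: comm_group "ext P" using ext_group[OF Po] .
    have "y \<otimes>\<^bsub>ext P\<^esub> inv\<^bsub>ext P\<^esub> germ a \<omega> = \<one>\<^bsub>ext P\<^esub>"
    proof (rule inj)
      show "y \<otimes>\<^bsub>ext P\<^esub> inv\<^bsub>ext P\<^esub> germ a \<omega> \<in> carrier (ext P)" using y sol by simp
      show "\<forall>i\<in>I. ext_act (\<iota> i) (y \<otimes>\<^bsub>ext P\<^esub> inv\<^bsub>ext P\<^esub> germ a \<omega>) = \<one>\<^bsub>ext (X i)\<^esub>"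
      proof
        fix i assume i: "i \<in> I"
        interpret EX: comm_group "ext (X i)" using ext_group[OF Xo[OF i]] .
        show "ext_act (\<iota> i) (y \<otimes>\<^bsub>ext P\<^esub> inv\<^bsub>ext P\<^esub> germ a \<omega>) = \<one>\<^bsub>ext (X i)\<^esub>"
          using E.act_mult[OF Xo[OF i] Po \<iota>[OF i], of y "inv\<^bsub>ext P\<^esub> germ a \<omega>"]
            E.act_inv[OF Xo[OF i] Po \<iota>[OF i], of "germ a \<omega>"] y sol i x[OF i] by simp
      qed
    qed
    then show "y = germ a \<omega>" using y sol EP.inv_solve_right' EP.inv_inv EP.inv_equality by (metis EP.inv_closed)
  qed
qed

lemma ext_small: "X \<in> Obj C \<Longrightarrow> small U (carrier (N (cov X))) \<Longrightarrow> small U (carrier (ext X))"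
  unfolding ext_def carrier_FactGroup by (rule small_image)

text \<open>
  Representing the extension by an object \<open>M\<close>, the vanishing of \<open>ext\<close> on \<open>wle[-1]\<close> places
  \<open>M\<close> in \<open>wge\<close>, where \<open>ext\<close> agrees with \<open>N\<close>.
\<close>

theorem wge_representable:
  assumes univ: "universe TYPE('u)" and br: "brown_representability TYPE('u) C"
    and sm: "smashing TYPE('u) C" and clo: "closed_under_coproducts TYPE('u) C wge"
    and cop: "takes_coproducts TYPE('u) C wge N act"
    and s: "\<And>T. T \<in> wge \<Longrightarrow> small TYPE('u) (carrier (N T))"
  shows "\<exists>M\<in>wge. \<exists>v\<in>carrier (N M). \<forall>Y\<in>wge. bij_betw (\<lambda>f. act f v) (Hom C Y M) (carrier (N Y))"
proof -
  have "\<exists>M\<in>Obj C. \<exists>\<phi>. (\<forall>X\<in>Obj C. \<phi> X \<in> Group.iso (hom_group C X M) (ext X)) \<and>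
    (\<forall>X Y f g. f \<in> Hom C X Y \<longrightarrow> g \<in> Hom C Y M \<longrightarrow> \<phi> X (g \<cdot> f) = ext_act f (\<phi> Y g))"
    by (rule brown[OF univ br ext_presheaf ext_exact ext_coproducts[OF sm clo cop]])
      (rule ext_small[OF _ s[OF cov_in]])
  then obtain M \<phi> where M: "M \<in> Obj C" and \<phi>: "\<And>X. X \<in> Obj C \<Longrightarrow> \<phi> X \<in> Group.iso (hom_group C X M) (ext X)"
    and nat: "\<And>X Y f g. f \<in> Hom C X Y \<Longrightarrow> g \<in> Hom C Y M \<Longrightarrow> \<phi> X (g \<cdot> f) = ext_act f (\<phi> Y g)"
    by blast
  have bij: "bij_betw (\<phi> X) (Hom C X M) (carrier (ext X))" if "X \<in> Obj C" for X
    using \<phi>[OF that] by (simp add: Group.iso_def)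
  have Mw: "M \<in> wge"
  proof (rule wgeI[OF M])
    fix X f assume X: "X \<in> Obj C" "shO C X \<in> wle" and f: "f \<in> Hom C X M"
    have z: "Zero C X M \<in> Hom C X M" using X M by simp
    have "unit X = Zero C X (cov X)" using wgeD[OF X cov_in[OF X(1)] unit_in[OF X(1)]] .
    then have "K = \<one>\<^bsub>ext X\<^esub>" if "K \<in> carrier (ext X)" for K
      using germ_surj[OF X(1) that] germ_zero[OF X(1) cov_in[OF X(1)]] by metis
    then have "\<phi> X f = \<phi> X (Zero C X M)" using bij_betwE[OF bij[OF X(1)]] f z by metis
    then show "f = Zero C X M" using bij[OF X(1)] f z by (simp add: bij_betw_def inj_on_def)
  qed
  have germ_id: "bij_betw (germ (Id C Y)) (carrier (N Y)) (carrier (ext Y))" if Y: "Y \<in> wge" for Y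
  proof -
    have Yo: "Y \<in> Obj C" using Y wge_obj by blast
    note c = cov_in[OF Yo] and u = unit_in[OF Yo] and i = id_in[OF Yo]
    interpret G: comm_group "N Y" using N.grp[OF Y] .
    interpret E: comm_group "ext Y" using ext_group[OF Yo] .
    (* For injectivity, x is recovered with a retraction r of unit Y, which exists as Y lies in wge. *)
    interpret h: group_hom "N Y" "ext Y" "germ (Id C Y)"
      using germ_mult[OF Yo Y i] germ_in[OF Yo Y i] by unfold_locales (auto simp: hom_def)
    have "inj_on (germ (Id C Y)) (carrier (N Y))"
    proof (rule h.inj_on_one_iff[THEN iffD2, rule_format])
      fix x assume x: "x \<in> carrier (N Y)" and one: "germ (Id C Y) x = \<one>\<^bsub>ext Y\<^esub>"
      obtain r where r: "r \<in> Hom C (cov Y) Y" "r \<cdot> unit Y = Id C Y" using unit_lift[OF Yo Y i] .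
      have rx: "act r x \<in> carrier (N (cov Y))" using N.act_in[OF c Y r(1) x] .
      have "germ (unit Y) (act r x) = \<one>\<^bsub>ext Y\<^esub>" using germ_comp[OF Yo c Y u r(1) x] r(2) one by simp
      then have "act r x \<in> rel Y" using germ_unit_one[OF Yo rx] by simp
      then obtain g T \<psi> where g: "T \<in> wge" "g \<in> Hom C (cov Y) T" "\<psi> \<in> carrier (N T)"
          "g \<cdot> unit Y = Zero C Y T" "act r x = act g \<psi>" by (rule relE)
      have "x = act (r \<cdot> unit Y) x" using r(2) N.act_id[OF Y x] by simp
      also have "\<dots> = act (g \<cdot> unit Y) \<psi>"
        using N.act_comp[OF Y c Y u r(1) x] N.act_comp[OF Y c g(1) u g(2,3)] g(5) by simp
      finally show "x = \<one>\<^bsub>N Y\<^esub>" using g(4) N.act_zero[OF Y g(1,3)] by simp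
    qed
    moreover have "germ (Id C Y) ` carrier (N Y) = carrier (ext Y)"
    proof (intro equalityI subsetI)
      fix K assume "K \<in> carrier (ext Y)"
      then obtain \<psi> where \<psi>: "\<psi> \<in> carrier (N (cov Y))" "K = germ (unit Y) \<psi>" by (rule germ_surj[OF Yo])
      have "K = germ (Id C Y) (act (unit Y) \<psi>)" using germ_comp[OF Yo Y c i u \<psi>(1)] \<psi>(2) u by (simp add: in_Hom)
      then show "K \<in> germ (Id C Y) ` carrier (N Y)" using N.act_in[OF Y c u \<psi>(1)] by blast
    qed (use germ_in[OF Yo Y i] in blast)
    ultimately show ?thesis by (simp add: bij_betw_def)
  qed
  have iM: "Id C M \<in> Hom C M M" using M by simp
  obtain v where v: "v \<in> carrier (N M)" "germ (Id C M) v = \<phi> M (Id C M)"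
    using germ_id[OF Mw] bij_betwE[OF bij[OF M]] iM unfolding bij_betw_def by (metis imageE)
  have "bij_betw (\<lambda>f. act f v) (Hom C Y M) (carrier (N Y))" if Y: "Y \<in> wge" for Y
  proof -
    have Yo: "Y \<in> Obj C" using Y wge_obj by blast
    have eq: "germ (Id C Y) (act f v) = \<phi> Y f" if f: "f \<in> Hom C Y M" for f
    proof -
      have "\<phi> Y f = ext_act f (germ (Id C M) v)" using nat[OF f iM] v(2) f by (simp add: in_Hom)
      also have "\<dots> = germ f v" using ext_act_germ[OF Yo M f Mw iM v(1)] f by (simp add: in_Hom)
      also have "\<dots> = germ (f \<cdot> Id C Y) v" using f by (simp add: in_Hom)
      also have "\<dots> = germ (Id C Y) (act f v)" by (rule germ_comp[OF Yo Y Mw id_in[OF Yo] f v(1)])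
      finally show ?thesis by simp
    qed
    have "bij_betw (germ (Id C Y) \<circ> (\<lambda>f. act f v)) (Hom C Y M) (carrier (ext Y))"
      using bij[OF Yo] eq by (simp cong: bij_betw_cong)
    moreover have "(\<lambda>f. act f v) ` Hom C Y M \<subseteq> carrier (N Y)" using N.act_in[OF Y Mw _ v(1)] by blast
    ultimately show ?thesis using bij_betw_comp_iff2[OF germ_id[OF Y]] by blast
  qed
  then show ?thesis using Mw v(1) by blast
qed

end


section \<open>Existence of the adjacent t-structure and of products\<close>

lemma (in preadd) hom_presheaf:
  assumes D: "D \<subseteq> Obj C" and M: "M \<in> Obj C"
  shows "presheaf C D (\<lambda>X. hom_group C X M) (\<lambda>f g. g \<cdot> f)"
proof (intro presheaf.intro presheaf_axioms.intro preadd_axioms D)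
  fix X assume "X \<in> D" then show "comm_group (hom_group C X M)" using D M by auto
next
  fix X Y f x assume f: "f \<in> Hom C X Y" and x: "x \<in> carrier (hom_group C Y M)"
  then show "x \<cdot> f \<in> carrier (hom_group C X M)" by auto
  fix y assume y: "y \<in> carrier (hom_group C Y M)"
  show "(x \<otimes>\<^bsub>hom_group C Y M\<^esub> y) \<cdot> f = (x \<cdot> f) \<otimes>\<^bsub>hom_group C X M\<^esub> (y \<cdot> f)"
    using add_comp[OF f] x y by simp
next
  fix X x assume "X \<in> D" "x \<in> carrier (hom_group C X M)"
  then show "x \<cdot> Id C X = x" by (simp add: in_Hom)
next
  fix X Y Z f g x assume "f \<in> Hom C X Y" "g \<in> Hom C Y Z" "x \<in> carrier (hom_group C Z M)"
  then show "x \<cdot> (g \<cdot> f) = (x \<cdot> g) \<cdot> f" by (simp add: in_Hom assoc)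
next
  fix X Y f g x assume "f \<in> Hom C X Y" "g \<in> Hom C X Y" "x \<in> carrier (hom_group C Y M)"
  then show "x \<cdot> (f \<boxplus> g) = (x \<cdot> f) \<otimes>\<^bsub>hom_group C X M\<^esub> (x \<cdot> g)" using comp_add by simp
qed

lemma (in preadd) hom_takes_coproducts:
  assumes M: "M \<in> Obj C"
  shows "takes_coproducts U C D (\<lambda>X. hom_group C X M) (\<lambda>f g. g \<cdot> f)"
  unfolding takes_coproducts_def hom_group_simps
  using coproduct_ex1[OF _ M] by blast

lemma (in tri_cat) hom_exact:
  shows "exact_on C D (\<lambda>X. hom_group C X M) (\<lambda>f g. g \<cdot> f)"
  unfolding exact_on_def
proof (intro ballI, clarify)
  fix f g h x assume t: "(f, g, h) \<in> Tri C" and x: "x \<in> carrier (hom_group C (Cod C f) M)"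
    and z: "x \<cdot> f = \<one>\<^bsub>hom_group C (Dom C f) M\<^esub>"
  obtain q where "q \<in> Hom C (Cod C g) M" "q \<cdot> g = x" using tri_extend[OF t, of x M] x z by auto
  then show "\<exists>y\<in>carrier (hom_group C (Cod C g) M). y \<cdot> g = x" by auto
qed

text \<open>
  The obstruction to extending \<open>p\<close> along \<open>f\<close> is its composite with the arrow into the first vertex
  from the third vertex shifted by \<open>-1\<close>, stated here one shift higher.
\<close>

lemma (in tri_cat) tri_extend_back:
  assumes t: "(f, g, h) \<in> Tri C" and p: "p \<in> Hom C (Dom C f) W"
    and ph: "shA C p \<cdot> h = Zero C (Cod C g) (shO C W)"
  obtains q where "q \<in> Hom C (Cod C f) W" "q \<cdot> f = p"
proof -
  note a = tri_in[OF t]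
  have W: "W \<in> Obj C" using p hom_obj by blast
  obtain q where q: "q \<in> Hom C (shO C (Cod C f)) (shO C W)" "q \<cdot> shA C f = shA C p"
    using tri_extend3[OF t sh_in[OF p] ph] .
  obtain s where s: "s \<in> Hom C (Cod C f) W" "shA C s = q" using unsh_arr[OF q(1) a(5) W] .
  have "shA C (s \<cdot> f) = shA C p" using sh_comp[OF a(1) s(1)] s q by simp
  then have "s \<cdot> f = p" using sh_arr_inj[of "s \<cdot> f" p] s p a by (simp add: in_Hom)
  then show thesis using that s by blast
qed

text \<open>
  The presheaf \<open>Hom(-, M)\<close> restricted to \<open>wge\<close> is representable in \<open>wge\<close>, so \<open>wge\<close> is
  coreflective.  As it is closed under extensions, the cone of the coreflection is right
  orthogonal to it: an arrow \<open>Y \<rightarrow> L[1]\<close> that dies in \<open>M[1]\<close> classifies an extension of \<open>Y\<close> by \<open>L\<close>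
  which is split by the universal property of \<open>L\<close>.
\<close>

lemma (in weighted) coreflection:
  assumes univ: "universe TYPE('u)" and ls: "locally_small TYPE('u) C" and br: "brown_representability TYPE('u) C"
    and sm: "smashing TYPE('u) C" and clo: "closed_under_coproducts TYPE('u) C wge"
    and M: "M \<in> Obj C"
  shows "\<exists>(f, g, h) \<in> Tri C. Cod C f = M \<and> Dom C f \<in> wge \<and>
    (\<forall>Y\<in>wge. \<forall>k\<in>Hom C Y (Cod C g). k = Zero C Y (Cod C g))"
proof -
  interpret P: presheaf C wge "\<lambda>X. hom_group C X M" "\<lambda>f g. g \<cdot> f" by (rule hom_presheaf[OF wge_sub M])
  interpret E: wge_presheaf C wle wge "\<lambda>X. hom_group C X M" "\<lambda>f g. g \<cdot> f" by unfold_locales (rule hom_exact)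
  have "\<exists>L\<in>wge. \<exists>v\<in>carrier (hom_group C L M). \<forall>Y\<in>wge.
      bij_betw (\<lambda>f. v \<cdot> f) (Hom C Y L) (carrier (hom_group C Y M))"
  proof (rule E.wge_representable[OF univ br sm clo hom_takes_coproducts[OF M]])
    show "small TYPE('u) (carrier (hom_group C T M))" if "T \<in> wge" for T
      using ls M wge_obj[OF that] by (simp add: locally_small_def)
  qed
  then obtain L v where L: "L \<in> wge" "v \<in> Hom C L M"
      and bij: "\<And>Y. Y \<in> wge \<Longrightarrow> bij_betw (\<lambda>f. v \<cdot> f) (Hom C Y L) (Hom C Y M)"
    by auto
  have v_surj: "\<exists>r\<in>Hom C Y L. v \<cdot> r = s" if Y: "Y \<in> wge" and s: "s \<in> Hom C Y M" for Y s
  proof -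
    have "s \<in> (\<lambda>f. v \<cdot> f) ` Hom C Y L" using bij_betw_imp_surj_on[OF bij[OF Y]] s by simp
    then show ?thesis by auto
  qed
  have "v \<in> Arr C" using L by (simp add: in_Hom)
  then obtain g h where t: "(v, g, h) \<in> Tri C" using tri_cone by blast
  have D: "Dom C v = L" "Cod C v = M" using L by (auto simp: in_Hom)
  note a = tri_in[OF t, unfolded D]
  have "k = Zero C Y (Cod C g)" if Y: "Y \<in> wge" and k: "k \<in> Hom C Y (Cod C g)" for Y k
  proof -
    have Yo: "Y \<in> Obj C" using Y wge_obj by blast
    have hk: "h \<cdot> k \<in> Hom C Y (shO C L)" using k a(3) by blast
    then have "h \<cdot> k \<in> Arr C" "Cod C (h \<cdot> k) = shO C L" by (auto simp: in_Hom)
    obtain b c where t1: "(h \<cdot> k, b, c) \<in> Tri C" using tri_cone[OF \<open>h \<cdot> k \<in> Arr C\<close>] by blast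
    have D1: "Dom C (h \<cdot> k) = Y" "Cod C (h \<cdot> k) = shO C L" using hk by (auto simp: in_Hom)
    (* W is the extension of Y by L that h k classifies: L -i-> W -p-> Y -h k-> L[1]. *)
    obtain W where W: "W \<in> Obj C" "shO C W = Cod C b" using unsh_obj[OF tri_in(6)[OF t1]] .
    obtain p where p: "p \<in> Hom C W Y" "(p, h \<cdot> k, b) \<in> Tri C" using tri_unrot[OF t1 _ W(1)] W(2) D1 by metis
    have Dp: "Dom C p = W" "Cod C p = Y" using p(1) by (auto simp: in_Hom)
    obtain i where i: "i \<in> Hom C L W" "(i, p, h \<cdot> k) \<in> Tri C"
      using tri_unrot[OF p(2) _ a(4)] D1 Dp by metis
    have Di: "Dom C i = L" "Cod C i = W" using i(1) by (auto simp: in_Hom)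
    have Ww: "W \<in> wge" using wge_extension[OF i(2)] Di Dp L(1) Y by simp
    have "shA C v \<cdot> (h \<cdot> k) = Zero C Y (shO C M)"
      using tri_comp_zero3[OF t] D a k sh_in[OF a(1)] by (simp add: assoc[symmetric] in_Hom)
    then obtain s where s: "s \<in> Hom C W M" "s \<cdot> i = v"
      using tri_extend_back[OF i(2), of v M] a(1) Di Dp by auto
    obtain r where r: "r \<in> Hom C W L" "v \<cdot> r = s" using v_surj[OF Ww s(1)] by blast
    have "v \<cdot> (r \<cdot> i) = v \<cdot> Id C L" using r s i L by (simp add: assoc[symmetric] in_Hom)
    then have ri: "r \<cdot> i = Id C L"
      using inj_onD[OF bij_betw_imp_inj_on[OF bij[OF L(1)]] _ comp_in[OF i(1) r(1)] id_in[OF a(4)]] by simp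
    have "shA C i \<cdot> (h \<cdot> k) = Zero C Y (shO C W)" using tri_comp_zero3[OF i(2)] Di Dp by simp
    then have "shA C r \<cdot> (shA C i \<cdot> (h \<cdot> k)) = Zero C Y (shO C L)"
      using sh_in[OF r(1)] Yo by (simp add: in_Hom)
    moreover have "shA C r \<cdot> (shA C i \<cdot> (h \<cdot> k)) = (shA C r \<cdot> shA C i) \<cdot> (h \<cdot> k)"
      using assoc[of "h \<cdot> k" "shA C i" "shA C r"] sh_in[OF r(1)] sh_in[OF i(1)] hk by (simp add: in_Hom)
    moreover have "shA C r \<cdot> shA C i = Id C (shO C L)" using sh_comp[OF i(1) r(1)] ri a(4) by simp
    then have "(shA C r \<cdot> shA C i) \<cdot> (h \<cdot> k) = h \<cdot> k" using hk by (simp add: in_Hom)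
    ultimately have "h \<cdot> k = Zero C Y (shO C L)" by simp
    then obtain m where m: "m \<in> Hom C Y M" "g \<cdot> m = k" using tri_lift2[OF t k] D by auto
    obtain l where l: "l \<in> Hom C Y L" "v \<cdot> l = m" using v_surj[OF Y m(1)] by blast
    have "k = (g \<cdot> v) \<cdot> l" using m l a by (auto simp: assoc in_Hom)
    then show ?thesis using tri_comp_zero[OF t] D l a by (simp add: in_Hom)
  qed
  then show ?thesis using t D L(1) by (intro bexI[OF _ t]) auto
qed


text \<open>
  The coreflection triangles are the t-decompositions; the orthogonality axioms hold because
  \<open>tle_of\<close> is defined as an orthogonal.
\<close>

lemma (in weighted) adjacent_exists:
  assumes univ: "universe TYPE('u)" and ls: "locally_small TYPE('u) C" and br: "brown_representability TYPE('u) C"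
    and sm: "smashing TYPE('u) C" and clo: "closed_under_coproducts TYPE('u) C wge"
  shows "t_structure C tle_of wge" "left_adjacent C tle_of wge wle wge"
proof -
  have unsh: "f = Zero C X Y" if Y: "Y \<in> Obj C" "shO C Y \<in> tle_of" and X: "X \<in> wge" and f: "f \<in> Hom C X Y" for X Y f
    using Y X sh_in[OF f] sh_zero_iff[OF f] unfolding tle_of_def by blast
  have torth: "orthogonal C (shO C ` wge) tle_of"
    unfolding orthogonal_iff[OF sh_image_obj[OF wge_sub] tle_of_sub] by (auto simp: tle_of_def)
  show "t_structure C tle_of wge"
    unfolding t_structure_def shift_class_1 shift_class_minus_1
  proof (intro conjI torth tle_of_sub wge_sub)
    have iso_retract: "is_retract C X Y" if XY: "isomorphic C X Y" for X Y
    proof -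
      obtain f where f: "f \<in> Hom C X Y" "is_iso_arr C f" using XY unfolding isomorphic_def by blast
      obtain g where g: "g \<in> Hom C Y X" "g \<cdot> f = Id C X" by (rule isoE[OF f(2,1)])
      show ?thesis unfolding is_retract_def using f g hom_obj[OF f(1)] by blast
    qed
    show "closed_under_isos C wge"
      unfolding closed_under_isos_def
    proof (intro allI impI, elim conjE)
      fix X Y assume XY: "isomorphic C X Y" and Y: "Y \<in> wge"
      have "closed_under_retracts C wge" using w unfolding weight_structure_def by (elim conjE)
      then show "X \<in> wge" using iso_retract[OF XY] Y unfolding closed_under_retracts_def by blast
    qed
    show "closed_under_isos C tle_of"
      unfolding closed_under_isos_def
    proof (intro allI impI, elim conjE)
      fix X Y assume "isomorphic C X Y" and Y: "Y \<in> tle_of"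
      then have "is_retract C X Y" using iso_retract by blast
      then obtain i p where ip: "i \<in> Hom C X Y" "p \<in> Hom C Y X" "p \<cdot> i = Id C X" and X: "X \<in> Obj C"
        unfolding is_retract_def by blast
      have "f = Zero C (shO C T) X" if T: "T \<in> wge" and f: "f \<in> Hom C (shO C T) X" for T f
      proof -
        have T': "shO C T \<in> Obj C" using T wge_obj by simp
        have "i \<cdot> f = Zero C (shO C T) Y" using Y T comp_in[OF f ip(1)] unfolding tle_of_def by blast
        then have "p \<cdot> (i \<cdot> f) = Zero C (shO C T) X" using ip T' by (simp add: in_Hom)
        moreover have "p \<cdot> (i \<cdot> f) = f" using ip f by (simp add: assoc[symmetric] in_Hom)
        ultimately show ?thesis by simp
      qed
      then show "X \<in> tle_of" using X unfolding tle_of_def by blast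
    qed
    show "tle_of \<subseteq> shO C ` tle_of"
    proof
      fix Y assume Y: "Y \<in> tle_of"
      then have "Y \<in> Obj C" by (simp add: tle_of_def)
      then obtain Y' where Y': "Y' \<in> Obj C" "shO C Y' = Y" using unsh_obj by blast
      have "Y' \<in> tle_of" using unsh[OF Y'(1)] Y' Y wge_sh unfolding tle_of_def by simp
      then show "Y \<in> shO C ` tle_of" using Y' by blast
    qed
    show "shO C ` wge \<subseteq> wge" using wge_sh by blast
    show "\<forall>M\<in>Obj C. \<exists>(f, g, h)\<in>Tri C. Cod C f = M \<and> Dom C f \<in> wge \<and> Cod C g \<in> {X \<in> Obj C. shO C X \<in> tle_of}"
    proof
      fix M assume M: "M \<in> Obj C"
      obtain f g h where t: "(f, g, h) \<in> Tri C" "Cod C f = M" "Dom C f \<in> wge"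
          "\<forall>Y\<in>wge. \<forall>k\<in>Hom C Y (Cod C g). k = Zero C Y (Cod C g)"
        using coreflection[OF univ ls br sm clo M] by blast
      have R: "Cod C g \<in> Obj C" using tri_in(6)[OF t(1)] .
      have "shO C (Cod C g) \<in> tle_of"
        unfolding tle_of_def
      proof (intro CollectI conjI ballI)
        show "shO C (Cod C g) \<in> Obj C" using R by simp
        fix Y f assume Y: "Y \<in> wge" and f: "f \<in> Hom C (shO C Y) (shO C (Cod C g))"
        obtain k where k: "k \<in> Hom C Y (Cod C g)" "shA C k = f" using unsh_arr[OF f wge_obj[OF Y] R] .
        have "k = Zero C Y (Cod C g)" using t(4) Y k(1) by blast
        then show "f = Zero C (shO C Y) (shO C (Cod C g))" using sh_zero_iff[OF k(1)] k(2) by simp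
      qed
      then show "\<exists>(f, g, h)\<in>Tri C. Cod C f = M \<and> Dom C f \<in> wge \<and> Cod C g \<in> {X \<in> Obj C. shO C X \<in> tle_of}"
        using t R by (intro bexI[OF _ t(1)]) auto
    qed
  qed
  show "left_adjacent C tle_of wge wle wge"
    unfolding left_adjacent_def shift_class_1 shift_class_minus_1
  proof
    show "orthogonal C wle (shO C ` wge)"
      using w unfolding weight_structure_def shift_class_1 by (elim conjE)
    have "{X \<in> Obj C. shO C X \<in> tle_of} \<subseteq> Obj C" by blast
    then show "orthogonal C wge {X \<in> Obj C. shO C X \<in> tle_of}"
      unfolding orthogonal_iff[OF wge_sub \<open>{X \<in> Obj C. shO C X \<in> tle_of} \<subseteq> Obj C\<close>] using unsh by blast
  qed
qed

text \<open>A product of objects represents the product of the presheaves that they represent.\<close>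

lemma (in tri_cat) brown_cosmashing:
  assumes univ: "universe TYPE('u)" and ls: "locally_small TYPE('u) C" and br: "brown_representability TYPE('u) C"
  shows "cosmashing TYPE('u) C"
  unfolding cosmashing_def
proof (intro allI impI, elim conjE)
  fix I :: "'u set" and M assume I: "small TYPE('u) I" and "\<forall>i\<in>I. M i \<in> Obj C"
  then have M: "M i \<in> Obj C" if "i \<in> I" for i using that by blast
  define N where "N X = product_group I (\<lambda>i. hom_group C X (M i))" for X
  define act where "act f x = (\<lambda>i\<in>I. x i \<cdot> f)" for f and x :: "'u \<Rightarrow> 'm"
  have carr: "carrier (N X) = (\<Pi>\<^sub>E i\<in>I. Hom C X (M i))" for X by (simp add: N_def)
  have mlt: "x \<otimes>\<^bsub>N X\<^esub> y = (\<lambda>i\<in>I. x i \<boxplus> y i)" for X x y by (simp add: N_def)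
  have one: "\<one>\<^bsub>N X\<^esub> = (\<lambda>i\<in>I. Zero C X (M i))" for X by (simp add: N_def)
  have N: "presheaf C (Obj C) N act"
  proof (intro presheaf.intro presheaf_axioms.intro preadd_axioms order_refl)
    fix X assume X: "X \<in> Obj C"
    have "group (N X)"
      unfolding N_def using X M comm_group.axioms(2)[OF hom_group[OF X]] by (intro product_group) blast
    then show "comm_group (N X)"
      by (rule group.group_comm_groupI) (auto simp: carr mlt PiE_iff intro!: restrict_ext add_comm)
  next
    fix X Y f x assume f: "f \<in> Hom C X Y" and x: "x \<in> carrier (N Y)"
    show "act f x \<in> carrier (N X)" using f x by (auto simp: carr act_def PiE_iff)
    fix y assume "y \<in> carrier (N Y)"
    then show "act f (x \<otimes>\<^bsub>N Y\<^esub> y) = act f x \<otimes>\<^bsub>N X\<^esub> act f y"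
      using f x add_comp[OF f] by (auto simp: carr act_def mlt PiE_iff intro!: restrict_ext)
  next
    fix X x assume "X \<in> Obj C" "x \<in> carrier (N X)"
    then show "act (Id C X) x = x"
      by (auto simp: carr act_def PiE_iff in_Hom extensional_def fun_eq_iff)
  next
    fix X Y Z f g x assume "f \<in> Hom C X Y" "g \<in> Hom C Y Z" "x \<in> carrier (N Z)"
    then show "act (g \<cdot> f) x = act f (act g x)"
      by (auto simp: carr act_def PiE_iff in_Hom assoc intro!: restrict_ext)
  next
    fix X Y f g x assume f: "f \<in> Hom C X Y" and g: "g \<in> Hom C X Y" and "x \<in> carrier (N Y)"
    then show "act (f \<boxplus> g) x = act f x \<otimes>\<^bsub>N X\<^esub> act g x"
      using comp_add[OF f g] by (auto simp: carr act_def mlt PiE_iff intro!: restrict_ext)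
  qed
  have ex: "exact_on C (Obj C) N act"
    unfolding exact_on_def
  proof (intro ballI, clarify)
    fix f g h x assume t: "(f, g, h) \<in> Tri C" and x: "x \<in> carrier (N (Cod C f))"
      and z: "act f x = \<one>\<^bsub>N (Dom C f)\<^esub>"
    have "\<exists>q. q \<in> Hom C (Cod C g) (M i) \<and> q \<cdot> g = x i" if i: "i \<in> I" for i
    proof -
      have xi: "x i \<in> Hom C (Cod C f) (M i)" using x i by (auto simp: carr)
      have "x i \<cdot> f = Zero C (Dom C f) (M i)" using fun_cong[OF z, of i] i by (simp add: act_def one)
      then show ?thesis using tri_extend[OF t xi] by blast
    qed
    then obtain q where q: "\<And>i. i \<in> I \<Longrightarrow> q i \<in> Hom C (Cod C g) (M i)" "\<And>i. i \<in> I \<Longrightarrow> q i \<cdot> g = x i" by metis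
    have "act g (restrict q I) = x"
      using q(2) x by (auto simp: act_def carr PiE_iff extensional_def fun_eq_iff)
    moreover have "restrict q I \<in> carrier (N (Cod C g))" using q(1) by (auto simp: carr)
    ultimately show "\<exists>y\<in>carrier (N (Cod C g)). act g y = x" by blast
  qed
  have cop: "takes_coproducts TYPE('u) C (Obj C) N act"
    unfolding takes_coproducts_def
  proof (intro allI impI, elim conjE)
    fix J :: "'u set" and X P \<iota> x
    assume P: "is_coproduct C J X P \<iota>" and x: "\<forall>j\<in>J. x j \<in> carrier (N (X j))"
    have xij: "x j i \<in> Hom C (X j) (M i)" if "j \<in> J" "i \<in> I" for i j using x that by (auto simp: carr)
    have "\<exists>h. h \<in> Hom C P (M i) \<and> (\<forall>j\<in>J. h \<cdot> \<iota> j = x j i)" if i: "i \<in> I" for i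
      using coproduct_ex1[OF P M[OF i], of "\<lambda>j. x j i"] xij[OF _ i] by blast
    then obtain y where y: "\<And>i. i \<in> I \<Longrightarrow> y i \<in> Hom C P (M i)" "\<And>i. i \<in> I \<Longrightarrow> \<forall>j\<in>J. y i \<cdot> \<iota> j = x j i" by metis
    show "\<exists>!y. y \<in> carrier (N P) \<and> (\<forall>j\<in>J. act (\<iota> j) y = x j)"
    proof (rule ex1I[of _ "restrict y I"])
      have "act (\<iota> j) (restrict y I) = x j" if "j \<in> J" for j
        using y(2) that x by (auto simp: act_def carr PiE_iff extensional_def fun_eq_iff)
      then show "restrict y I \<in> carrier (N P) \<and> (\<forall>j\<in>J. act (\<iota> j) (restrict y I) = x j)"
        using y(1) by (auto simp: carr)
    next
      fix z assume z: "z \<in> carrier (N P) \<and> (\<forall>j\<in>J. act (\<iota> j) z = x j)"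
      show "z = restrict y I"
      proof (rule PiE_ext[of _ I "\<lambda>i. Hom C P (M i)"])
        show "z \<in> (\<Pi>\<^sub>E i\<in>I. Hom C P (M i))" "restrict y I \<in> (\<Pi>\<^sub>E i\<in>I. Hom C P (M i))" using z y(1) by (auto simp: carr)
        fix i assume i: "i \<in> I"
        have "z i = y i"
        proof (rule coproduct_unique[OF P _ y(1)[OF i]])
          show "z i \<in> Hom C P (M i)" using z i by (auto simp: carr)
          fix j assume j: "j \<in> J"
          have "act (\<iota> j) z i = x j i" using z j by simp
          then show "z i \<cdot> \<iota> j = y i \<cdot> \<iota> j" using y(2)[OF i] i j by (simp add: act_def)
        qed
        then show "z i = restrict y I i" using i by simp
      qed
    qed
  qed
  have "small TYPE('u) (carrier (N X))" if "X \<in> Obj C" for X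
    unfolding carr using ls that M by (intro small_PiE[OF univ I]) (simp add: locally_small_def)
  then obtain P \<phi> where P: "P \<in> Obj C" and \<phi>: "\<And>X. X \<in> Obj C \<Longrightarrow> \<phi> X \<in> Group.iso (hom_group C X P) (N X)"
    and nat: "\<And>X Y f g. f \<in> Hom C X Y \<Longrightarrow> g \<in> Hom C Y P \<Longrightarrow> \<phi> X (g \<cdot> f) = act f (\<phi> Y g)"
    using brown[OF univ br N ex cop] by blast
  have bij: "bij_betw (\<phi> X) (Hom C X P) (carrier (N X))" if "X \<in> Obj C" for X
    using \<phi>[OF that] by (simp add: Group.iso_def)
  define \<pi> where "\<pi> = \<phi> P (Id C P)"
  have i: "Id C P \<in> Hom C P P" using P by simp
  have \<pi>: "\<pi> \<in> carrier (N P)" unfolding \<pi>_def using bij_betwE[OF bij[OF P]] i by blast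
  have \<phi>\<pi>: "\<phi> Q h = (\<lambda>i\<in>I. \<pi> i \<cdot> h)" if h: "h \<in> Hom C Q P" for Q h
    using nat[OF h i] h by (simp add: \<pi>_def act_def in_Hom)
  have "is_product C I M P \<pi>"
    unfolding is_product_def
  proof (intro conjI ballI allI impI P)
    fix i assume i: "i \<in> I"
    show "M i \<in> Obj C" by (rule M[OF i])
    show "\<pi> i \<in> Hom C P (M i)" using \<pi> i by (auto simp: carr)
  next
    fix Q \<sigma> assume Q: "Q \<in> Obj C" and \<sigma>: "\<forall>i\<in>I. \<sigma> i \<in> Hom C Q (M i)"
    then have "restrict \<sigma> I \<in> carrier (N Q)" by (auto simp: carr)
    then obtain h where h: "h \<in> Hom C Q P" "\<phi> Q h = restrict \<sigma> I"
      using bij_betw_imp_surj_on[OF bij[OF Q]] by (metis imageE)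
    show "\<exists>!h. h \<in> Hom C Q P \<and> (\<forall>i\<in>I. \<pi> i \<cdot> h = \<sigma> i)"
    proof (rule ex1I[of _ h])
      show "h \<in> Hom C Q P \<and> (\<forall>i\<in>I. \<pi> i \<cdot> h = \<sigma> i)"
        using h \<phi>\<pi>[OF h(1)] by (metis restrict_apply')
      fix k assume k: "k \<in> Hom C Q P \<and> (\<forall>i\<in>I. \<pi> i \<cdot> k = \<sigma> i)"
      then have "\<phi> Q k = restrict \<sigma> I" using \<phi>\<pi>[of k Q] by (auto intro: restrict_ext)
      then show "k = h" using h k bij[OF Q] unfolding bij_betw_def inj_on_def by simp
    qed
  qed
  then show "\<exists>P \<pi>. is_product C I M P \<pi>" by blast
qed


section \<open>Presheaves on the heart\<close>

locale heart_presheaf = weighted C wle wge + A: presheaf C "wle \<inter> wge" A aact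
  for C :: "('o, 'm, 'z) tricat_scheme" (structure) and wle wge :: "'o set"
    and A :: "'o \<Rightarrow> 'x monoid" and aact :: "'m \<Rightarrow> 'x \<Rightarrow> 'x"
begin

abbreviation Hw :: "'o set" where "Hw \<equiv> wle \<inter> wge"

definition probes :: "'o \<Rightarrow> 'm set" where
  "probes T = {q \<in> Arr C. Dom C q \<in> Hw \<and> Cod C q = T}"

text \<open>
  The additive natural transformations from \<open>Hom(-, T)\<close> to \<open>A\<close> on the heart.  They are the
  arrows from \<open>T\<close> to an object that represents \<open>A\<close>, before such an object is known.
\<close>

definition nats :: "'o \<Rightarrow> ('m \<Rightarrow> 'x) set" where
  "nats T = {\<phi> \<in> extensional (probes T).
     (\<forall>Q\<in>Hw. \<forall>q\<in>Hom C Q T. \<phi> q \<in> carrier (A Q)) \<and>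
     (\<forall>Q\<in>Hw. \<forall>R\<in>Hw. \<forall>q\<in>Hom C Q T. \<forall>r\<in>Hom C R Q. \<phi> (q \<cdot> r) = aact r (\<phi> q)) \<and>
     (\<forall>Q\<in>Hw. \<forall>q\<in>Hom C Q T. \<forall>q'\<in>Hom C Q T. \<phi> (q \<boxplus> q') = \<phi> q \<otimes>\<^bsub>A Q\<^esub> \<phi> q')}"

definition nat_group :: "'o \<Rightarrow> ('m \<Rightarrow> 'x) monoid" where
  "nat_group T = \<lparr>carrier = nats T, mult = (\<lambda>\<phi> \<psi>. \<lambda>q\<in>probes T. \<phi> q \<otimes>\<^bsub>A (Dom C q)\<^esub> \<psi> q),
     one = (\<lambda>q\<in>probes T. \<one>\<^bsub>A (Dom C q)\<^esub>)\<rparr>"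

definition nat_act :: "'m \<Rightarrow> ('m \<Rightarrow> 'x) \<Rightarrow> 'm \<Rightarrow> 'x" where
  "nat_act f \<phi> = (\<lambda>q\<in>probes (Dom C f). \<phi> (f \<cdot> q))"

lemma Hw_obj: "Q \<in> Hw \<Longrightarrow> Q \<in> Obj C"
  using wge_obj by blast

lemma probes_iff: "q \<in> probes T \<longleftrightarrow> (\<exists>Q\<in>Hw. q \<in> Hom C Q T)"
  by (auto simp: probes_def in_Hom)

lemma probe: "Q \<in> Hw \<Longrightarrow> q \<in> Hom C Q T \<Longrightarrow> q \<in> probes T"
  unfolding probes_iff by blast

lemma probe_dom: "q \<in> Hom C Q T \<Longrightarrow> Dom C q = Q"
  by (simp add: in_Hom)

lemma nats_in: "\<phi> \<in> nats T \<Longrightarrow> Q \<in> Hw \<Longrightarrow> q \<in> Hom C Q T \<Longrightarrow> \<phi> q \<in> carrier (A Q)"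
  unfolding nats_def by blast

lemma nats_comp: "\<phi> \<in> nats T \<Longrightarrow> Q \<in> Hw \<Longrightarrow> R \<in> Hw \<Longrightarrow> q \<in> Hom C Q T \<Longrightarrow> r \<in> Hom C R Q \<Longrightarrow>
    \<phi> (q \<cdot> r) = aact r (\<phi> q)"
  unfolding nats_def by blast

lemma nats_add: "\<phi> \<in> nats T \<Longrightarrow> Q \<in> Hw \<Longrightarrow> q \<in> Hom C Q T \<Longrightarrow> q' \<in> Hom C Q T \<Longrightarrow>
    \<phi> (q \<boxplus> q') = \<phi> q \<otimes>\<^bsub>A Q\<^esub> \<phi> q'"
  unfolding nats_def by blast

lemma nats_ext: "\<phi> \<in> nats T \<Longrightarrow> \<phi> \<in> extensional (probes T)"
  unfolding nats_def by blast

lemma natsI: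
  assumes "\<phi> \<in> extensional (probes T)"
    and "\<And>Q q. Q \<in> Hw \<Longrightarrow> q \<in> Hom C Q T \<Longrightarrow> \<phi> q \<in> carrier (A Q)"
    and "\<And>Q R q r. Q \<in> Hw \<Longrightarrow> R \<in> Hw \<Longrightarrow> q \<in> Hom C Q T \<Longrightarrow> r \<in> Hom C R Q \<Longrightarrow> \<phi> (q \<cdot> r) = aact r (\<phi> q)"
    and "\<And>Q q q'. Q \<in> Hw \<Longrightarrow> q \<in> Hom C Q T \<Longrightarrow> q' \<in> Hom C Q T \<Longrightarrow> \<phi> (q \<boxplus> q') = \<phi> q \<otimes>\<^bsub>A Q\<^esub> \<phi> q'"
  shows "\<phi> \<in> nats T"
  unfolding nats_def mem_Collect_eq using assms by (intro conjI ballI)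

lemma nats_eqI:
  assumes "\<phi> \<in> extensional (probes T)" "\<psi> \<in> extensional (probes T)"
    "\<And>Q q. Q \<in> Hw \<Longrightarrow> q \<in> Hom C Q T \<Longrightarrow> \<phi> q = \<psi> q"
  shows "\<phi> = \<psi>"
proof (rule extensionalityI[OF assms(1,2)])
  fix q assume "q \<in> probes T"
  then obtain Q where "Q \<in> Hw" "q \<in> Hom C Q T" unfolding probes_iff by blast
  then show "\<phi> q = \<psi> q" by (rule assms(3))
qed

lemma nats_zero:
  assumes \<phi>: "\<phi> \<in> nats T" and Q: "Q \<in> Hw" and T: "T \<in> Obj C"
  shows "\<phi> (Zero C Q T) = \<one>\<^bsub>A Q\<^esub>"
proof -
  interpret G: comm_group "A Q" using A.grp[OF Q] .
  have z: "Zero C Q T \<in> Hom C Q T" using Hw_obj[OF Q] T by simp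
  have "\<phi> (Zero C Q T) \<otimes>\<^bsub>A Q\<^esub> \<phi> (Zero C Q T) = \<phi> (Zero C Q T)"
    using nats_add[OF \<phi> Q z z] z by (simp add: in_Hom)
  then show ?thesis using nats_in[OF \<phi> Q z] by simp
qed

lemma nat_group_simps [simp]:
  "carrier (nat_group T) = nats T"
  by (simp add: nat_group_def)

lemma nat_mult_app: "Q \<in> Hw \<Longrightarrow> q \<in> Hom C Q T \<Longrightarrow> (\<phi> \<otimes>\<^bsub>nat_group T\<^esub> \<psi>) q = \<phi> q \<otimes>\<^bsub>A Q\<^esub> \<psi> q"
  using probe[of Q q T] by (simp add: nat_group_def probe_dom)

lemma nat_one_app: "Q \<in> Hw \<Longrightarrow> q \<in> Hom C Q T \<Longrightarrow> \<one>\<^bsub>nat_group T\<^esub> q = \<one>\<^bsub>A Q\<^esub>"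
  using probe[of Q q T] by (simp add: nat_group_def probe_dom)

lemma nat_act_app: "Q \<in> Hw \<Longrightarrow> q \<in> Hom C Q T \<Longrightarrow> f \<in> Hom C T T' \<Longrightarrow> nat_act f \<phi> q = \<phi> (f \<cdot> q)"
  using probe[of Q q T] by (simp add: nat_act_def probe_dom)

lemma nat_mult_ext: "\<phi> \<otimes>\<^bsub>nat_group T\<^esub> \<psi> \<in> extensional (probes T)"
  by (simp add: nat_group_def)

lemma nat_one_ext: "\<one>\<^bsub>nat_group T\<^esub> \<in> extensional (probes T)"
  by (simp add: nat_group_def)

lemma nat_act_ext: "f \<in> Hom C T T' \<Longrightarrow> nat_act f \<phi> \<in> extensional (probes T)"
  by (simp add: nat_act_def in_Hom)

lemma nat_mult_in:
  assumes \<phi>: "\<phi> \<in> nats T" and \<psi>: "\<psi> \<in> nats T"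
  shows "\<phi> \<otimes>\<^bsub>nat_group T\<^esub> \<psi> \<in> nats T"
proof (rule natsI[OF nat_mult_ext])
  fix Q q assume Q: "Q \<in> Hw" and q: "q \<in> Hom C Q T"
  interpret G: comm_group "A Q" using A.grp[OF Q] .
  show "(\<phi> \<otimes>\<^bsub>nat_group T\<^esub> \<psi>) q \<in> carrier (A Q)"
    unfolding nat_mult_app[OF Q q] using nats_in[OF \<phi> Q q] nats_in[OF \<psi> Q q] by simp
  {
    fix R r assume R: "R \<in> Hw" and r: "r \<in> Hom C R Q"
    show "(\<phi> \<otimes>\<^bsub>nat_group T\<^esub> \<psi>) (q \<cdot> r) = aact r ((\<phi> \<otimes>\<^bsub>nat_group T\<^esub> \<psi>) q)"
      unfolding nat_mult_app[OF Q q] nat_mult_app[OF R comp_in[OF r q]] nats_comp[OF \<phi> Q R q r] nats_comp[OF \<psi> Q R q r]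
      using A.act_mult[OF R Q r nats_in[OF \<phi> Q q] nats_in[OF \<psi> Q q]] by simp
  }
  fix q' assume q': "q' \<in> Hom C Q T"
  show "(\<phi> \<otimes>\<^bsub>nat_group T\<^esub> \<psi>) (q \<boxplus> q') = (\<phi> \<otimes>\<^bsub>nat_group T\<^esub> \<psi>) q \<otimes>\<^bsub>A Q\<^esub> (\<phi> \<otimes>\<^bsub>nat_group T\<^esub> \<psi>) q'"
    unfolding nat_mult_app[OF Q q] nat_mult_app[OF Q q'] nat_mult_app[OF Q add_in[OF q q']] nats_add[OF \<phi> Q q q'] nats_add[OF \<psi> Q q q']
    using nats_in[OF \<phi> Q q] nats_in[OF \<psi> Q q] nats_in[OF \<phi> Q q'] nats_in[OF \<psi> Q q'] by (simp add: G.m_ac)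
qed

lemma nat_one_in: "T \<in> Obj C \<Longrightarrow> \<one>\<^bsub>nat_group T\<^esub> \<in> nats T"
proof (rule natsI[OF nat_one_ext])
  fix Q q assume Q: "Q \<in> Hw" and q: "q \<in> Hom C Q T"
  interpret G: comm_group "A Q" using A.grp[OF Q] .
  show "\<one>\<^bsub>nat_group T\<^esub> q \<in> carrier (A Q)" unfolding nat_one_app[OF Q q] by simp
  {
    fix R r assume R: "R \<in> Hw" and r: "r \<in> Hom C R Q"
    show "\<one>\<^bsub>nat_group T\<^esub> (q \<cdot> r) = aact r (\<one>\<^bsub>nat_group T\<^esub> q)"
      unfolding nat_one_app[OF Q q] nat_one_app[OF R comp_in[OF r q]] A.act_one[OF R Q r] ..
  }
  fix q' assume q': "q' \<in> Hom C Q T"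
  show "\<one>\<^bsub>nat_group T\<^esub> (q \<boxplus> q') = \<one>\<^bsub>nat_group T\<^esub> q \<otimes>\<^bsub>A Q\<^esub> \<one>\<^bsub>nat_group T\<^esub> q'"
    unfolding nat_one_app[OF Q q] nat_one_app[OF Q q'] nat_one_app[OF Q add_in[OF q q']] by simp
qed

lemma nat_comm_group:
  assumes T: "T \<in> Obj C"
  shows "comm_group (nat_group T)"
proof (rule comm_groupI)
  fix \<phi> \<psi> \<chi> assume \<phi>: "\<phi> \<in> carrier (nat_group T)" and \<psi>: "\<psi> \<in> carrier (nat_group T)" and \<chi>: "\<chi> \<in> carrier (nat_group T)"
  then have ins: "\<phi> \<in> nats T" "\<psi> \<in> nats T" "\<chi> \<in> nats T" by auto
  show "\<phi> \<otimes>\<^bsub>nat_group T\<^esub> \<psi> \<in> carrier (nat_group T)" using nat_mult_in ins by simp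
  show "\<phi> \<otimes>\<^bsub>nat_group T\<^esub> \<psi> \<otimes>\<^bsub>nat_group T\<^esub> \<chi> = \<phi> \<otimes>\<^bsub>nat_group T\<^esub> (\<psi> \<otimes>\<^bsub>nat_group T\<^esub> \<chi>)"
  proof (rule nats_eqI[OF nat_mult_ext nat_mult_ext])
    fix Q q assume Q: "Q \<in> Hw" and q: "q \<in> Hom C Q T"
    interpret G: comm_group "A Q" using A.grp[OF Q] .
    show "(\<phi> \<otimes>\<^bsub>nat_group T\<^esub> \<psi> \<otimes>\<^bsub>nat_group T\<^esub> \<chi>) q = (\<phi> \<otimes>\<^bsub>nat_group T\<^esub> (\<psi> \<otimes>\<^bsub>nat_group T\<^esub> \<chi>)) q"
      unfolding nat_mult_app[OF Q q] using nats_in[OF _ Q q] ins by (simp add: G.m_assoc)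
  qed
  show "\<phi> \<otimes>\<^bsub>nat_group T\<^esub> \<psi> = \<psi> \<otimes>\<^bsub>nat_group T\<^esub> \<phi>"
  proof (rule nats_eqI[OF nat_mult_ext nat_mult_ext])
    fix Q q assume Q: "Q \<in> Hw" and q: "q \<in> Hom C Q T"
    interpret G: comm_group "A Q" using A.grp[OF Q] .
    show "(\<phi> \<otimes>\<^bsub>nat_group T\<^esub> \<psi>) q = (\<psi> \<otimes>\<^bsub>nat_group T\<^esub> \<phi>) q"
      unfolding nat_mult_app[OF Q q] using nats_in[OF _ Q q] ins by (simp add: G.m_comm)
  qed
next
  show "\<one>\<^bsub>nat_group T\<^esub> \<in> carrier (nat_group T)" using nat_one_in[OF T] by simp
  fix \<phi> assume "\<phi> \<in> carrier (nat_group T)"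
  then have \<phi>: "\<phi> \<in> nats T" by simp
  show "\<one>\<^bsub>nat_group T\<^esub> \<otimes>\<^bsub>nat_group T\<^esub> \<phi> = \<phi>"
  proof (rule nats_eqI[OF nat_mult_ext nats_ext[OF \<phi>]])
    fix Q q assume Q: "Q \<in> Hw" and q: "q \<in> Hom C Q T"
    interpret G: comm_group "A Q" using A.grp[OF Q] .
    show "(\<one>\<^bsub>nat_group T\<^esub> \<otimes>\<^bsub>nat_group T\<^esub> \<phi>) q = \<phi> q"
      unfolding nat_mult_app[OF Q q] nat_one_app[OF Q q] using nats_in[OF \<phi> Q q] by simp
  qed
  define \<psi> where "\<psi> = (\<lambda>q\<in>probes T. inv\<^bsub>A (Dom C q)\<^esub> \<phi> q)"
  have app: "\<psi> q = inv\<^bsub>A Q\<^esub> \<phi> q" if "Q \<in> Hw" "q \<in> Hom C Q T" for Q q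
    using probe[OF that] probe_dom[OF that(2)] by (simp add: \<psi>_def)
  have "\<psi> \<in> nats T"
  proof (rule natsI)
    show "\<psi> \<in> extensional (probes T)" by (simp add: \<psi>_def)
    fix Q q assume Q: "Q \<in> Hw" and q: "q \<in> Hom C Q T"
    interpret G: comm_group "A Q" using A.grp[OF Q] .
    show "\<psi> q \<in> carrier (A Q)" unfolding app[OF Q q] using nats_in[OF \<phi> Q q] by simp
    {
      fix R r assume R: "R \<in> Hw" and r: "r \<in> Hom C R Q"
      show "\<psi> (q \<cdot> r) = aact r (\<psi> q)"
        unfolding app[OF Q q] app[OF R comp_in[OF r q]] nats_comp[OF \<phi> Q R q r]
        using A.act_inv[OF R Q r nats_in[OF \<phi> Q q]] by simp
    }
    fix q' assume q': "q' \<in> Hom C Q T"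
    show "\<psi> (q \<boxplus> q') = \<psi> q \<otimes>\<^bsub>A Q\<^esub> \<psi> q'"
      unfolding app[OF Q q] app[OF Q q'] app[OF Q add_in[OF q q']] nats_add[OF \<phi> Q q q']
      using nats_in[OF \<phi> Q q] nats_in[OF \<phi> Q q'] by (simp add: G.inv_mult)
  qed
  moreover have "\<psi> \<otimes>\<^bsub>nat_group T\<^esub> \<phi> = \<one>\<^bsub>nat_group T\<^esub>"
  proof (rule nats_eqI[OF nat_mult_ext nat_one_ext])
    fix Q q assume Q: "Q \<in> Hw" and q: "q \<in> Hom C Q T"
    interpret G: comm_group "A Q" using A.grp[OF Q] .
    show "(\<psi> \<otimes>\<^bsub>nat_group T\<^esub> \<phi>) q = \<one>\<^bsub>nat_group T\<^esub> q"
      unfolding nat_mult_app[OF Q q] nat_one_app[OF Q q] app[OF Q q] using nats_in[OF \<phi> Q q] by simp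
  qed
  ultimately show "\<exists>\<psi>\<in>carrier (nat_group T). \<psi> \<otimes>\<^bsub>nat_group T\<^esub> \<phi> = \<one>\<^bsub>nat_group T\<^esub>" by auto
qed

lemma nat_act_in:
  assumes f: "f \<in> Hom C X Y" and \<phi>: "\<phi> \<in> nats Y"
  shows "nat_act f \<phi> \<in> nats X"
proof (rule natsI[OF nat_act_ext[OF f]])
  fix Q q assume Q: "Q \<in> Hw" and q: "q \<in> Hom C Q X"
  note fq = comp_in[OF q f]
  show "nat_act f \<phi> q \<in> carrier (A Q)" unfolding nat_act_app[OF Q q f] by (rule nats_in[OF \<phi> Q fq])
  {
    fix R r assume R: "R \<in> Hw" and r: "r \<in> Hom C R Q"
    have "f \<cdot> (q \<cdot> r) = (f \<cdot> q) \<cdot> r" using f q r by (simp add: assoc in_Hom)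
    then show "nat_act f \<phi> (q \<cdot> r) = aact r (nat_act f \<phi> q)"
      unfolding nat_act_app[OF Q q f] nat_act_app[OF R comp_in[OF r q] f] using nats_comp[OF \<phi> Q R fq r] by simp
  }
  fix q' assume q': "q' \<in> Hom C Q X"
  show "nat_act f \<phi> (q \<boxplus> q') = nat_act f \<phi> q \<otimes>\<^bsub>A Q\<^esub> nat_act f \<phi> q'"
    unfolding nat_act_app[OF Q q f] nat_act_app[OF Q q' f] nat_act_app[OF Q add_in[OF q q'] f]
    using comp_add[OF q q' f] nats_add[OF \<phi> Q fq comp_in[OF q' f]] by simp
qed

lemma nat_presheaf: "presheaf C wge nat_group nat_act"
proof (intro presheaf.intro presheaf_axioms.intro preadd_axioms wge_sub)
  fix X assume X: "X \<in> wge"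
  show "comm_group (nat_group X)" by (rule nat_comm_group[OF wge_obj[OF X]])
  fix \<phi> assume "\<phi> \<in> carrier (nat_group X)"
  then have \<phi>: "\<phi> \<in> nats X" by simp
  have i: "Id C X \<in> Hom C X X" using wge_obj[OF X] by simp
  show "nat_act (Id C X) \<phi> = \<phi>"
  proof (rule nats_eqI[OF nat_act_ext[OF i] nats_ext[OF \<phi>]])
    fix Q q assume Q: "Q \<in> Hw" and q: "q \<in> Hom C Q X"
    show "nat_act (Id C X) \<phi> q = \<phi> q" unfolding nat_act_app[OF Q q i] using q by (simp add: in_Hom)
  qed
next
  fix X Y f \<phi> assume f: "f \<in> Hom C X Y" and "\<phi> \<in> carrier (nat_group Y)"
  then have \<phi>: "\<phi> \<in> nats Y" by simp
  show "nat_act f \<phi> \<in> carrier (nat_group X)" using nat_act_in[OF f \<phi>] by simp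
  {
    fix \<psi> assume "\<psi> \<in> carrier (nat_group Y)"
    show "nat_act f (\<phi> \<otimes>\<^bsub>nat_group Y\<^esub> \<psi>) = nat_act f \<phi> \<otimes>\<^bsub>nat_group X\<^esub> nat_act f \<psi>"
    proof (rule nats_eqI[OF nat_act_ext[OF f] nat_mult_ext])
      fix Q q assume Q: "Q \<in> Hw" and q: "q \<in> Hom C Q X"
      show "nat_act f (\<phi> \<otimes>\<^bsub>nat_group Y\<^esub> \<psi>) q = (nat_act f \<phi> \<otimes>\<^bsub>nat_group X\<^esub> nat_act f \<psi>) q"
        unfolding nat_mult_app[OF Q q] nat_act_app[OF Q q f] nat_mult_app[OF Q comp_in[OF q f]] ..
    qed
  }
  fix g assume g: "g \<in> Hom C X Y"
  note fg = add_in[OF f g]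
  show "nat_act (f \<boxplus> g) \<phi> = nat_act f \<phi> \<otimes>\<^bsub>nat_group X\<^esub> nat_act g \<phi>"
  proof (rule nats_eqI[OF nat_act_ext[OF fg] nat_mult_ext])
    fix Q q assume Q: "Q \<in> Hw" and q: "q \<in> Hom C Q X"
    show "nat_act (f \<boxplus> g) \<phi> q = (nat_act f \<phi> \<otimes>\<^bsub>nat_group X\<^esub> nat_act g \<phi>) q"
      unfolding nat_mult_app[OF Q q] nat_act_app[OF Q q f] nat_act_app[OF Q q g] nat_act_app[OF Q q fg]
      using add_comp[OF q f g] nats_add[OF \<phi> Q comp_in[OF q f] comp_in[OF q g]] by simp
  qed
next
  fix X Y Z f g \<phi> assume f: "f \<in> Hom C X Y" and g: "g \<in> Hom C Y Z" and "\<phi> \<in> carrier (nat_group Z)"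
  note gf = comp_in[OF f g]
  show "nat_act (g \<cdot> f) \<phi> = nat_act f (nat_act g \<phi>)"
  proof (rule nats_eqI[OF nat_act_ext[OF gf] nat_act_ext[OF f]])
    fix Q q assume Q: "Q \<in> Hw" and q: "q \<in> Hom C Q X"
    show "nat_act (g \<cdot> f) \<phi> q = nat_act f (nat_act g \<phi>) q"
      unfolding nat_act_app[OF Q q f] nat_act_app[OF Q q gf] nat_act_app[OF Q comp_in[OF q f] g]
      using f g q by (simp add: assoc in_Hom)
  qed
qed

text \<open>
  For \<open>X\<close> in \<open>wge\<close> every arrow from the heart to the cone of \<open>u : X \<rightarrow> Y\<close> lifts to \<open>Y\<close>, since
  the heart is orthogonal to \<open>X[1]\<close>; so transformations that vanish on \<open>X\<close> descend.
\<close>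

lemma nat_exact: "exact_on C wge nat_group nat_act"
  unfolding exact_on_def
proof (intro ballI, clarify)
  fix u v w' \<phi> assume t: "(u, v, w') \<in> Tri C" and X: "Dom C u \<in> wge" and Y: "Cod C u \<in> wge" and Z: "Cod C v \<in> wge"
    and \<phi>0: "\<phi> \<in> carrier (nat_group (Cod C u))" and zero: "nat_act u \<phi> = \<one>\<^bsub>nat_group (Dom C u)\<^esub>"
  have \<phi>: "\<phi> \<in> nats (Cod C u)" using \<phi>0 by simp
  note a = tri_in[OF t]
  have lift: "\<exists>q'. q' \<in> Hom C Q (Cod C u) \<and> v \<cdot> q' = q" if "Q \<in> Hw" "q \<in> Hom C Q (Cod C v)" for Q q
    using heart_lifts[OF t X _ that(2)] that(1) by blast
  have wd: "\<phi> q = \<phi> q'" if Q: "Q \<in> Hw" and q: "q \<in> Hom C Q (Cod C u)" and q': "q' \<in> Hom C Q (Cod C u)"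
    and eq: "v \<cdot> q = v \<cdot> q'" for Q q q'
  proof -
    interpret G: comm_group "A Q" using A.grp[OF Q] .
    have "v \<cdot> diff_arr C q q' = Zero C Q (Cod C v)" using comp_eq_iff[OF q q' a(2)] eq by simp
    then obtain p where p: "p \<in> Hom C Q (Dom C u)" "u \<cdot> p = diff_arr C q q'"
      using tri_lift[OF t diff_in[OF q q']] by blast
    have "\<phi> (diff_arr C q q') = \<one>\<^bsub>A Q\<^esub>"
      using nat_act_app[OF Q p(1) a(1), of \<phi>] p(2) zero nat_one_app[OF Q p(1)] by simp
    then have "\<phi> (diff_arr C q q' \<boxplus> q') = \<phi> q'"
      using nats_add[OF \<phi> Q diff_in[OF q q'] q'] nats_in[OF \<phi> Q q'] by simp
    then show ?thesis using diff_add[OF q q'] by simp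
  qed
  define \<psi> where "\<psi> = (\<lambda>q\<in>probes (Cod C v). \<phi> (SOME q'. q' \<in> Hom C (Dom C q) (Cod C u) \<and> v \<cdot> q' = q))"
  have app: "\<psi> (v \<cdot> q) = \<phi> q" if Q: "Q \<in> Hw" and q: "q \<in> Hom C Q (Cod C u)" for Q q
  proof -
    have vq: "v \<cdot> q \<in> Hom C Q (Cod C v)" using q a by blast
    define q' where "q' = (SOME q'. q' \<in> Hom C Q (Cod C u) \<and> v \<cdot> q' = v \<cdot> q)"
    have "q' \<in> Hom C Q (Cod C u) \<and> v \<cdot> q' = v \<cdot> q" unfolding q'_def by (rule someI[of _ q]) (use q in blast)
    then have "\<phi> q' = \<phi> q" using wd[OF Q] q by blast
    then show ?thesis using probe[OF Q vq] probe_dom[OF vq] by (simp add: \<psi>_def q'_def)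
  qed
  have "\<psi> \<in> nats (Cod C v)"
  proof (rule natsI)
    show "\<psi> \<in> extensional (probes (Cod C v))" by (simp add: \<psi>_def)
    fix Q q assume Q: "Q \<in> Hw" and q: "q \<in> Hom C Q (Cod C v)"
    obtain q1 where q1: "q1 \<in> Hom C Q (Cod C u)" "v \<cdot> q1 = q" using lift[OF Q q] by blast
    show "\<psi> q \<in> carrier (A Q)" using app[OF Q q1(1)] q1(2) nats_in[OF \<phi> Q q1(1)] by simp
    {
      fix R r assume R: "R \<in> Hw" and r: "r \<in> Hom C R Q"
      have "q \<cdot> r = v \<cdot> (q1 \<cdot> r)" using q1 r a by (auto simp: assoc in_Hom)
      then show "\<psi> (q \<cdot> r) = aact r (\<psi> q)"
        using app[OF R comp_in[OF r q1(1)]] nats_comp[OF \<phi> Q R q1(1) r] app[OF Q q1(1)] q1(2) by simp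
    }
    fix p assume p: "p \<in> Hom C Q (Cod C v)"
    obtain p1 where p1: "p1 \<in> Hom C Q (Cod C u)" "v \<cdot> p1 = p" using lift[OF Q p] by blast
    have "q \<boxplus> p = v \<cdot> (q1 \<boxplus> p1)" using comp_add[OF q1(1) p1(1) a(2)] q1 p1 by simp
    then show "\<psi> (q \<boxplus> p) = \<psi> q \<otimes>\<^bsub>A Q\<^esub> \<psi> p"
      using app[OF Q add_in[OF q1(1) p1(1)]] nats_add[OF \<phi> Q q1(1) p1(1)] app[OF Q q1(1)] app[OF Q p1(1)] q1 p1 by simp
  qed
  moreover have "nat_act v \<psi> = \<phi>"
  proof (rule nats_eqI[OF nat_act_ext[OF a(2)] nats_ext[OF \<phi>]])
    fix Q q assume Q: "Q \<in> Hw" and q: "q \<in> Hom C Q (Cod C u)"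
    show "nat_act v \<psi> q = \<phi> q" unfolding nat_act_app[OF Q q a(2)] by (rule app[OF Q q])
  qed
  ultimately show "\<exists>\<psi>\<in>carrier (nat_group (Cod C v)). nat_act v \<psi> = \<phi>" by auto
qed

definition yoneda :: "'o \<Rightarrow> 'x \<Rightarrow> 'm \<Rightarrow> 'x" where
  "yoneda E a = (\<lambda>q\<in>probes E. aact q a)"

lemma yoneda_app: "Q \<in> Hw \<Longrightarrow> q \<in> Hom C Q E \<Longrightarrow> yoneda E a q = aact q a"
  using probe[of Q q E] by (simp add: yoneda_def)

lemma yoneda_in:
  assumes E: "E \<in> Hw" and a: "a \<in> carrier (A E)"
  shows "yoneda E a \<in> nats E"
proof (rule natsI)
  show "yoneda E a \<in> extensional (probes E)" by (simp add: yoneda_def)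
  fix Q q assume Q: "Q \<in> Hw" and q: "q \<in> Hom C Q E"
  show "yoneda E a q \<in> carrier (A Q)" unfolding yoneda_app[OF Q q] by (rule A.act_in[OF Q E q a])
  {
    fix R r assume R: "R \<in> Hw" and r: "r \<in> Hom C R Q"
    show "yoneda E a (q \<cdot> r) = aact r (yoneda E a q)"
      unfolding yoneda_app[OF Q q] yoneda_app[OF R comp_in[OF r q]] by (rule A.act_comp[OF R Q E r q a])
  }
  fix q' assume q': "q' \<in> Hom C Q E"
  show "yoneda E a (q \<boxplus> q') = yoneda E a q \<otimes>\<^bsub>A Q\<^esub> yoneda E a q'"
    unfolding yoneda_app[OF Q q] yoneda_app[OF Q q'] yoneda_app[OF Q add_in[OF q q']]
    by (rule A.act_add[OF Q E q q' a])
qed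

text \<open>
  Each \<open>X i\<close> is the cone of an arrow \<open>d i\<close> from \<open>wge\<close> to the heart.  The coproduct of the \<open>d i\<close> is of
  the same kind, and its cone is the coproduct of the cones.
\<close>

lemma coproduct_presentation:
  fixes U :: "'u itself" and I :: "'u set"
  assumes sm: "smashing U C" and clo: "closed_under_coproducts U C wge"
    and I: "small U I" and X: "\<And>i. i \<in> I \<Longrightarrow> X i \<in> wge" and P: "is_coproduct C I X P \<iota>"
  obtains D E d e D' \<delta> E' \<epsilon> d' e' c' where
    "\<And>i. i \<in> I \<Longrightarrow> D i \<in> wge" "\<And>i. i \<in> I \<Longrightarrow> E i \<in> Hw"
    "\<And>i. i \<in> I \<Longrightarrow> d i \<in> Hom C (D i) (E i)" "\<And>i. i \<in> I \<Longrightarrow> e i \<in> Hom C (E i) (X i)"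
    "\<And>i. i \<in> I \<Longrightarrow> \<exists>c. (d i, e i, c) \<in> Tri C"
    "is_coproduct C I D D' \<delta>" "is_coproduct C I E E' \<epsilon>" "D' \<in> wge" "E' \<in> Hw"
    "d' \<in> Hom C D' E'" "e' \<in> Hom C E' P" "(d', e', c') \<in> Tri C"
    "\<And>i. i \<in> I \<Longrightarrow> d' \<cdot> \<delta> i = \<epsilon> i \<cdot> d i" "\<And>i. i \<in> I \<Longrightarrow> e' \<cdot> \<epsilon> i = \<iota> i \<cdot> e i"
proof -
  have "\<forall>i\<in>I. \<exists>p. fst p \<in> wge \<and> fst (snd p) \<in> Hw \<and>
      (fst (snd (snd p)), fst (snd (snd (snd p))), snd (snd (snd (snd p)))) \<in> Tri C \<and>
      fst (snd (snd p)) \<in> Hom C (fst p) (fst (snd p)) \<and> fst (snd (snd (snd p))) \<in> Hom C (fst (snd p)) (X i)"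
  proof
    fix i assume "i \<in> I"
    then obtain D E d l r where "D \<in> wge" "E \<in> Hw" "(d, l, r) \<in> Tri C" "d \<in> Hom C D E" "l \<in> Hom C E (X i)"
      using heart_presentation[OF X] by blast
    then show "\<exists>p. fst p \<in> wge \<and> fst (snd p) \<in> Hw \<and>
        (fst (snd (snd p)), fst (snd (snd (snd p))), snd (snd (snd (snd p)))) \<in> Tri C \<and>
        fst (snd (snd p)) \<in> Hom C (fst p) (fst (snd p)) \<and> fst (snd (snd (snd p))) \<in> Hom C (fst (snd p)) (X i)"
      by (intro exI[of _ "(D, E, d, l, r)"]) simp
  qed
  from bchoice[OF this] obtain p where p: "\<forall>i\<in>I. fst (p i) \<in> wge \<and> fst (snd (p i)) \<in> Hw \<and>
      (fst (snd (snd (p i))), fst (snd (snd (snd (p i)))), snd (snd (snd (snd (p i))))) \<in> Tri C \<and>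
      fst (snd (snd (p i))) \<in> Hom C (fst (p i)) (fst (snd (p i))) \<and>
      fst (snd (snd (snd (p i)))) \<in> Hom C (fst (snd (p i))) (X i)" ..
  define D E d e c where "D i = fst (p i)" and "E i = fst (snd (p i))" and "d i = fst (snd (snd (p i)))"
    and "e i = fst (snd (snd (snd (p i))))" and "c i = snd (snd (snd (snd (p i))))" for i
  have D: "D i \<in> wge" and E: "E i \<in> Hw" and t: "(d i, e i, c i) \<in> Tri C" and d: "d i \<in> Hom C (D i) (E i)"
    and e: "e i \<in> Hom C (E i) (X i)" if "i \<in> I" for i
    using bspec[OF p that] unfolding D_def E_def d_def e_def c_def by auto
  have El: "E i \<in> wle" and Eg: "E i \<in> wge" if "i \<in> I" for i using E[OF that] by auto
  obtain D' \<delta> where D': "is_coproduct C I D D' \<delta>" by (rule smashing_coproduct[OF sm I wge_obj[OF D]])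
  obtain E' \<epsilon> where E': "is_coproduct C I E E' \<epsilon>" by (rule smashing_coproduct[OF sm I wge_obj[OF Eg]])
  have D'w: "D' \<in> wge" by (rule closed_coproduct[OF clo I D' D])
  have E'w: "E' \<in> Hw" using closed_coproduct[OF clo I E' Eg] wle_coproduct[OF El E'] by blast
  note \<delta> = coproductD(3)[OF D'] and \<epsilon> = coproductD(3)[OF E'] and \<iota> = coproductD(3)[OF P]
  have "\<epsilon> i \<cdot> d i \<in> Hom C (D i) E'" if "i \<in> I" for i using \<epsilon> d that by blast
  then obtain d' where d': "d' \<in> Hom C D' E'" "\<And>i. i \<in> I \<Longrightarrow> d' \<cdot> \<delta> i = \<epsilon> i \<cdot> d i"
    using coproduct_ex[OF D' coproductD(1)[OF E'], of "\<lambda>i. \<epsilon> i \<cdot> d i"] by blast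
  have "\<iota> i \<cdot> e i \<in> Hom C (E i) P" if "i \<in> I" for i using \<iota> e that by blast
  then obtain e' where e': "e' \<in> Hom C E' P" "\<And>i. i \<in> I \<Longrightarrow> e' \<cdot> \<epsilon> i = \<iota> i \<cdot> e i"
    using coproduct_ex[OF E' coproductD(1)[OF P], of "\<lambda>i. \<iota> i \<cdot> e i"] by blast
  obtain c' where "(d', e', c') \<in> Tri C"
    using coproduct_of_triangles[OF t d e D' E' P d' e'] by blast
  then show thesis using that[of D E d e D' \<delta> E' \<epsilon> d' e' c'] D E t d e D' E' D'w E'w d' e' by blast
qed

text \<open>
  A transformation on an object of \<open>wge\<close> with presentation \<open>D \<rightarrow> E \<rightarrow> T\<close> is an element of \<open>A E\<close> that
  vanishes on \<open>D\<close>.  For a coproduct, \<open>A E\<close> is a product since \<open>E\<close> lies in the heart, and vanishing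
  on \<open>D\<close> can be tested on the summands: first transformations on a coproduct are shown to be
  detected by the summands, and this is then applied to \<open>D\<close> as well.
\<close>

lemma nat_coproducts:
  fixes U :: "'u itself"
  assumes sm: "smashing U C" and clo: "closed_under_coproducts U C wge"
    and cop: "takes_coproducts U C Hw A aact"
  shows "takes_coproducts U C wge nat_group nat_act"
proof -
  have detect: "\<phi> = \<psi>" if I: "small U I" and X: "\<And>i. i \<in> I \<Longrightarrow> X i \<in> wge" and P: "is_coproduct C I X P \<iota>"
    and \<phi>: "\<phi> \<in> nats P" and \<psi>: "\<psi> \<in> nats P" and eq: "\<And>i. i \<in> I \<Longrightarrow> nat_act (\<iota> i) \<phi> = nat_act (\<iota> i) \<psi>"
    for I :: "'u set" and X P \<iota> \<phi> \<psi>
  proof -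
    obtain D E d e D' \<delta> E' \<epsilon> d' e' c' where E: "\<And>i. i \<in> I \<Longrightarrow> E i \<in> Hw"
      and e: "\<And>i. i \<in> I \<Longrightarrow> e i \<in> Hom C (E i) (X i)"
      and E': "is_coproduct C I E E' \<epsilon>" and D'w: "D' \<in> wge" and E'w: "E' \<in> Hw" and d': "d' \<in> Hom C D' E'"
      and e': "e' \<in> Hom C E' P" and t: "(d', e', c') \<in> Tri C" and e'\<epsilon>: "\<And>i. i \<in> I \<Longrightarrow> e' \<cdot> \<epsilon> i = \<iota> i \<cdot> e i"
      using coproduct_presentation[OF sm clo I X P] by metis
    note \<epsilon> = coproductD(3)[OF E'] and \<iota> = coproductD(3)[OF P]
    have comp: "aact (\<epsilon> i) (\<chi> e') = nat_act (\<iota> i) \<chi> (e i)" if "i \<in> I" "\<chi> \<in> nats P" for i \<chi>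
      using nats_comp[OF that(2) E'w E[OF that(1)] e' \<epsilon>[OF that(1)]] e'\<epsilon>[OF that(1)]
        nat_act_app[OF E[OF that(1)] e[OF that(1)] \<iota>[OF that(1)], of \<chi>] by simp
    have "\<phi> e' = \<psi> e'"
    proof (rule takes_coproducts_unique[OF cop I E E'w E'])
      show "\<phi> e' \<in> carrier (A E')" "\<psi> e' \<in> carrier (A E')" using nats_in[OF _ E'w e'] \<phi> \<psi> by auto
      fix i assume i: "i \<in> I"
      show "aact (\<epsilon> i) (\<psi> e') \<in> carrier (A (E i))" using A.act_in[OF E[OF i] E'w \<epsilon>[OF i] nats_in[OF \<psi> E'w e']] .
      show "aact (\<epsilon> i) (\<phi> e') = aact (\<epsilon> i) (\<psi> e')" using comp[OF i \<phi>] comp[OF i \<psi>] eq[OF i] by simp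
    qed
    have D: "Dom C d' \<in> wge" "Cod C d' = E'" "Cod C e' = P" using d' e' D'w by (auto simp: in_Hom)
    show "\<phi> = \<psi>"
    proof (rule nats_eqI[OF nats_ext[OF \<phi>] nats_ext[OF \<psi>]])
      fix Q q assume Q: "Q \<in> Hw" and q: "q \<in> Hom C Q P"
      have "Q \<in> wle" using Q by blast
      then obtain q' where q': "q' \<in> Hom C Q E'" "e' \<cdot> q' = q"
        using heart_lifts[OF t D(1), of Q q] q D by metis
      then show "\<phi> q = \<psi> q"
        using nats_comp[OF \<phi> E'w Q e' q'(1)] nats_comp[OF \<psi> E'w Q e' q'(1)] \<open>\<phi> e' = \<psi> e'\<close> by simp
    qed
  qed
  show ?thesis
    unfolding takes_coproducts_def
  proof (intro allI impI, elim conjE)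
    fix I :: "'u set" and X P \<iota> \<phi>
    assume I: "small U I" and "\<forall>i\<in>I. X i \<in> wge" and Pw: "P \<in> wge" and P: "is_coproduct C I X P \<iota>"
      and "\<forall>i\<in>I. \<phi> i \<in> carrier (nat_group (X i))"
    then have X: "\<And>i. i \<in> I \<Longrightarrow> X i \<in> wge" and \<phi>: "\<And>i. i \<in> I \<Longrightarrow> \<phi> i \<in> nats (X i)" by auto
    obtain D E d e D' \<delta> E' \<epsilon> d' e' c' where Dw: "\<And>i. i \<in> I \<Longrightarrow> D i \<in> wge" and E: "\<And>i. i \<in> I \<Longrightarrow> E i \<in> Hw"
      and d: "\<And>i. i \<in> I \<Longrightarrow> d i \<in> Hom C (D i) (E i)" and e: "\<And>i. i \<in> I \<Longrightarrow> e i \<in> Hom C (E i) (X i)"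
      and ti: "\<And>i. i \<in> I \<Longrightarrow> \<exists>c. (d i, e i, c) \<in> Tri C" and D': "is_coproduct C I D D' \<delta>"
      and E': "is_coproduct C I E E' \<epsilon>" and D'w: "D' \<in> wge" and E'w: "E' \<in> Hw" and d': "d' \<in> Hom C D' E'"
      and e': "e' \<in> Hom C E' P" and t: "(d', e', c') \<in> Tri C"
      and d'\<delta>: "\<And>i. i \<in> I \<Longrightarrow> d' \<cdot> \<delta> i = \<epsilon> i \<cdot> d i" and e'\<epsilon>: "\<And>i. i \<in> I \<Longrightarrow> e' \<cdot> \<epsilon> i = \<iota> i \<cdot> e i"
      using coproduct_presentation[OF sm clo I X P] by blast
    note \<delta> = coproductD(3)[OF D'] and \<epsilon> = coproductD(3)[OF E'] and \<iota> = coproductD(3)[OF P]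
    obtain a where a: "a \<in> carrier (A E')" "\<And>i. i \<in> I \<Longrightarrow> aact (\<epsilon> i) a = \<phi> i (e i)"
      using takes_coproducts_ex[where x = "\<lambda>i. \<phi> i (e i)", OF cop I E E'w E'] nats_in[OF \<phi> E e] by blast
    have y: "yoneda E' a \<in> nats E'" by (rule yoneda_in[OF E'w a(1)])
    have y\<epsilon>: "aact (\<epsilon> i \<cdot> q) a = \<phi> i (e i \<cdot> q)" if i: "i \<in> I" and Q: "Q \<in> Hw" and q: "q \<in> Hom C Q (E i)" for i Q q
      using A.act_comp[OF Q E[OF i] E'w q \<epsilon>[OF i] a(1)] a(2)[OF i] nats_comp[OF \<phi>[OF i] E[OF i] Q e[OF i] q] by simp
    have "nat_act d' (yoneda E' a) = \<one>\<^bsub>nat_group D'\<^esub>"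
    proof (rule detect[OF I Dw D'])
      have D'o: "D' \<in> Obj C" using D'w wge_obj by blast
      show "nat_act d' (yoneda E' a) \<in> nats D'" by (rule nat_act_in[OF d' y])
      show "\<one>\<^bsub>nat_group D'\<^esub> \<in> nats D'" by (rule nat_one_in[OF D'o])
      fix i assume i: "i \<in> I"
      show "nat_act (\<delta> i) (nat_act d' (yoneda E' a)) = nat_act (\<delta> i) \<one>\<^bsub>nat_group D'\<^esub>"
      proof (rule nats_eqI[OF nat_act_ext[OF \<delta>[OF i]] nat_act_ext[OF \<delta>[OF i]]])
        fix Q q assume Q: "Q \<in> Hw" and q: "q \<in> Hom C Q (D i)"
        have \<delta>q: "\<delta> i \<cdot> q \<in> Hom C Q D'" and dq: "d i \<cdot> q \<in> Hom C Q (E i)" using \<delta>[OF i] d[OF i] q by blast+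
        have eq: "d' \<cdot> (\<delta> i \<cdot> q) = \<epsilon> i \<cdot> (d i \<cdot> q)"
        proof -
          have "d' \<cdot> (\<delta> i \<cdot> q) = (d' \<cdot> \<delta> i) \<cdot> q" using d' \<delta>[OF i] q by (simp add: assoc in_Hom)
          also have "\<dots> = \<epsilon> i \<cdot> (d i \<cdot> q)" using d'\<delta>[OF i] \<epsilon>[OF i] d[OF i] q by (simp add: assoc in_Hom)
          finally show ?thesis .
        qed
        have "e i \<cdot> d i = Zero C (D i) (X i)" using ti[OF i] tri_comp_zero d[OF i] e[OF i] by (auto simp: in_Hom)
        then have edq: "e i \<cdot> (d i \<cdot> q) = Zero C Q (X i)"
          using d[OF i] e[OF i] q wge_obj[OF X[OF i]] by (simp add: assoc[symmetric] in_Hom)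
        have "nat_act (\<delta> i) (nat_act d' (yoneda E' a)) q = aact (\<epsilon> i \<cdot> (d i \<cdot> q)) a"
          unfolding nat_act_app[OF Q q \<delta>[OF i]] nat_act_app[OF Q \<delta>q d'] eq
          using yoneda_app[OF Q comp_in[OF dq \<epsilon>[OF i]]] by simp
        also have "\<dots> = \<one>\<^bsub>A Q\<^esub>" using y\<epsilon>[OF i Q dq] edq nats_zero[OF \<phi>[OF i] Q wge_obj[OF X[OF i]]] by simp
        finally show "nat_act (\<delta> i) (nat_act d' (yoneda E' a)) q = nat_act (\<delta> i) \<one>\<^bsub>nat_group D'\<^esub> q"
          unfolding nat_act_app[OF Q q \<delta>[OF i]] nat_one_app[OF Q \<delta>q] by simp
      qed
    qed
    moreover have D: "Dom C d' = D'" "Cod C d' = E'" "Cod C e' = P" using d' e' by (auto simp: in_Hom)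
    ultimately obtain \<omega> where "\<omega> \<in> carrier (nat_group P)" and e\<omega>: "nat_act e' \<omega> = yoneda E' a"
      using exact_onD[OF nat_exact t, of "yoneda E' a"] y D'w E'w Pw by auto
    then have \<omega>: "\<omega> \<in> nats P" by simp
    have sol: "nat_act (\<iota> i) \<omega> = \<phi> i" if i: "i \<in> I" for i
    proof (rule nats_eqI[OF nat_act_ext[OF \<iota>[OF i]] nats_ext[OF \<phi>[OF i]]])
      fix Q q assume Q: "Q \<in> Hw" and q: "q \<in> Hom C Q (X i)"
      obtain c where tc: "(d i, e i, c) \<in> Tri C" using ti[OF i] by blast
      have Di: "Dom C (d i) \<in> wge" "Cod C (d i) = E i" "Cod C (e i) = X i" using d[OF i] e[OF i] Dw[OF i] by (auto simp: in_Hom)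
      have "Q \<in> wle" using Q by blast
      then obtain q' where q': "q' \<in> Hom C Q (E i)" "e i \<cdot> q' = q"
        using heart_lifts[OF tc Di(1), of Q q] q Di by metis
      have \<epsilon>q: "\<epsilon> i \<cdot> q' \<in> Hom C Q E'" using \<epsilon>[OF i] q' by blast
      have "\<iota> i \<cdot> q = e' \<cdot> (\<epsilon> i \<cdot> q')"
      proof -
        have "\<iota> i \<cdot> q = (\<iota> i \<cdot> e i) \<cdot> q'" using q' \<iota>[OF i] e[OF i] by (auto simp: assoc in_Hom)
        also have "\<dots> = e' \<cdot> (\<epsilon> i \<cdot> q')" using e'\<epsilon>[OF i, symmetric] e' \<epsilon>[OF i] q' by (simp add: assoc in_Hom)
        finally show ?thesis .
      qed
      then have "nat_act (\<iota> i) \<omega> q = yoneda E' a (\<epsilon> i \<cdot> q')"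
        using nat_act_app[OF Q q \<iota>[OF i]] nat_act_app[OF Q \<epsilon>q e', of \<omega>] e\<omega> by simp
      also have "\<dots> = \<phi> i q" using yoneda_app[OF Q \<epsilon>q] y\<epsilon>[OF i Q q'(1)] q'(2) by simp
      finally show "nat_act (\<iota> i) \<omega> q = \<phi> i q" .
    qed
    show "\<exists>!y. y \<in> carrier (nat_group P) \<and> (\<forall>i\<in>I. nat_act (\<iota> i) y = \<phi> i)"
    proof (rule ex1I[of _ \<omega>])
      show "\<omega> \<in> carrier (nat_group P) \<and> (\<forall>i\<in>I. nat_act (\<iota> i) \<omega> = \<phi> i)" using \<omega> sol by simp
      fix z assume "z \<in> carrier (nat_group P) \<and> (\<forall>i\<in>I. nat_act (\<iota> i) z = \<phi> i)"
      then show "z = \<omega>" using detect[OF I X P _ \<omega>, of z] sol by simp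
    qed
  qed
qed

text \<open>
  A transformation is determined by its value at the arrow \<open>E \<rightarrow> T\<close> of a presentation.
\<close>

lemma nat_small:
  assumes s: "\<And>E. E \<in> Hw \<Longrightarrow> small U (carrier (A E))" and T: "T \<in> wge"
  shows "small U (carrier (nat_group T))"
proof -
  obtain D E d e c where p: "D \<in> wge" "E \<in> Hw" "(d, e, c) \<in> Tri C" "d \<in> Hom C D E" "e \<in> Hom C E T"
    using heart_presentation[OF T] by blast
  have D: "Dom C d \<in> wge" "Cod C d = E" "Cod C e = T" using p by (auto simp: in_Hom)
  have "inj_on (\<lambda>\<phi>. \<phi> e) (nats T)"
  proof (rule inj_onI)
    fix \<phi> \<psi> assume \<phi>: "\<phi> \<in> nats T" and \<psi>: "\<psi> \<in> nats T" and eq: "\<phi> e = \<psi> e"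
    show "\<phi> = \<psi>"
    proof (rule nats_eqI[OF nats_ext[OF \<phi>] nats_ext[OF \<psi>]])
      fix Q q assume Q: "Q \<in> Hw" and q: "q \<in> Hom C Q T"
      have "Q \<in> wle" using Q by blast
      then obtain q' where q': "q' \<in> Hom C Q E" "e \<cdot> q' = q"
        using heart_lifts[OF p(3) D(1), of Q q] q D by metis
      then show "\<phi> q = \<psi> q"
        using nats_comp[OF \<phi> p(2) Q p(5) q'(1)] nats_comp[OF \<psi> p(2) Q p(5) q'(1)] eq by simp
    qed
  qed
  moreover have "(\<lambda>\<phi>. \<phi> e) ` nats T \<subseteq> carrier (A E)" using nats_in[OF _ p(2,5)] by blast
  ultimately show ?thesis using small_inj s[OF p(2)] by simp blast
qed

text \<open>
  The object of \<open>wge\<close> that represents \<open>nat_group\<close> lies in the heart of the adjacent t-structure: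
  no transformation starts from \<open>X[1]\<close> with \<open>X\<close> in \<open>wge\<close>, as the heart is orthogonal to it.
\<close>

theorem heart_representable:
  assumes univ: "universe TYPE('u)" and br: "brown_representability TYPE('u) C"
    and sm: "smashing TYPE('u) C" and clo: "closed_under_coproducts TYPE('u) C wge"
    and cop: "takes_coproducts TYPE('u) C Hw A aact"
    and s: "\<And>E. E \<in> Hw \<Longrightarrow> small TYPE('u) (carrier (A E))"
  shows "\<exists>P\<in>tle_of \<inter> wge. \<exists>v. (\<forall>Q\<in>Hw. v \<in> Group.iso (hom_group C Q P) (A Q)) \<and>
    (\<forall>Q\<in>Hw. \<forall>R\<in>Hw. \<forall>q\<in>Hom C Q P. \<forall>r\<in>Hom C R Q. v (q \<cdot> r) = aact r (v q))"
proof -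
  interpret N: presheaf C wge nat_group nat_act by (rule nat_presheaf)
  interpret E: wge_presheaf C wle wge nat_group nat_act by unfold_locales (rule nat_exact)
  obtain P v where P: "P \<in> wge" and v0: "v \<in> carrier (nat_group P)"
    and bij: "\<And>Y. Y \<in> wge \<Longrightarrow> bij_betw (\<lambda>f. nat_act f v) (Hom C Y P) (carrier (nat_group Y))"
    using E.wge_representable[OF univ br sm clo nat_coproducts[OF sm clo cop] nat_small[OF s]] by blast
  have v: "v \<in> nats P" using v0 by simp
  have Po: "P \<in> Obj C" using P wge_obj by blast
  have "f = Zero C (shO C X) P" if X: "X \<in> wge" and f: "f \<in> Hom C (shO C X) P" for X f
  proof -
    have X1: "shO C X \<in> wge" by (rule wge_sh[OF X])
    have z: "Zero C (shO C X) P \<in> Hom C (shO C X) P" using wge_obj[OF X1] Po by simp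
    have "nat_act f v = nat_act (Zero C (shO C X) P) v"
    proof (rule nats_eqI[OF nat_act_ext[OF f] nat_act_ext[OF z]])
      fix Q q assume Q: "Q \<in> Hw" and q: "q \<in> Hom C Q (shO C X)"
      have "q = Zero C Q (shO C X)" using w_orth[OF _ X q] Q by blast
      then have "f \<cdot> q = Zero C (shO C X) P \<cdot> q" using f z Hw_obj[OF Q] wge_obj[OF X1] Po by (simp add: in_Hom)
      then show "nat_act f v q = nat_act (Zero C (shO C X) P) v q"
        unfolding nat_act_app[OF Q q f] nat_act_app[OF Q q z] by simp
    qed
    then show ?thesis using inj_onD[OF bij_betw_imp_inj_on[OF bij[OF X1]] _ f z] by simp
  qed
  then have "P \<in> tle_of \<inter> wge" using P Po by (simp add: tle_of_def)
  moreover have "v \<in> Group.iso (hom_group C Q P) (A Q)" if Q: "Q \<in> Hw" for Q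
  proof -
    have Qw: "Q \<in> wge" and i: "Id C Q \<in> Hom C Q Q" using Q Hw_obj[OF Q] by auto
    have ev: "nat_act f v (Id C Q) = v f" if f: "f \<in> Hom C Q P" for f
      unfolding nat_act_app[OF Q i f] using f by (simp add: in_Hom)
    have "v \<in> hom (hom_group C Q P) (A Q)"
      by (rule homI) (use nats_in[OF v Q] nats_add[OF v Q] in auto)
    moreover have "bij_betw v (Hom C Q P) (carrier (A Q))"
    proof (rule bij_betwI')
      fix f g assume f: "f \<in> Hom C Q P" and g: "g \<in> Hom C Q P"
      show "v f = v g \<longleftrightarrow> f = g"
      proof
        assume eq: "v f = v g"
        have "nat_act f v = nat_act g v"
        proof (rule nats_eqI[OF nat_act_ext[OF f] nat_act_ext[OF g]])
          fix R q assume R: "R \<in> Hw" and q: "q \<in> Hom C R Q"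
          show "nat_act f v q = nat_act g v q"
            unfolding nat_act_app[OF R q f] nat_act_app[OF R q g] nats_comp[OF v Q R f q] nats_comp[OF v Q R g q] eq ..
        qed
        then show "f = g" using inj_onD[OF bij_betw_imp_inj_on[OF bij[OF Qw]] _ f g] by simp
      qed simp
    next
      fix f assume "f \<in> Hom C Q P" then show "v f \<in> carrier (A Q)" using nats_in[OF v Q] by blast
    next
      fix a assume a: "a \<in> carrier (A Q)"
      have "yoneda Q a \<in> (\<lambda>f. nat_act f v) ` Hom C Q P"
        using bij_betw_imp_surj_on[OF bij[OF Qw]] yoneda_in[OF Q a] by simp
      then obtain f where f: "f \<in> Hom C Q P" "yoneda Q a = nat_act f v" by blast
      have "a = v f" using ev[OF f(1)] f(2)[symmetric] yoneda_app[OF Q i, of a] A.act_id[OF Q a] by simp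
      then show "\<exists>f\<in>Hom C Q P. a = v f" using f(1) by blast
    qed
    ultimately show ?thesis by (simp add: Group.iso_def)
  qed
  moreover have "v (q \<cdot> r) = aact r (v q)" if "Q \<in> Hw" "R \<in> Hw" "q \<in> Hom C Q P" "r \<in> Hom C R Q" for Q R q r
    using nats_comp[OF v that] .
  ultimately show ?thesis by blast
qed

end


section \<open>Equivalences and functor categories\<close>

text \<open>
  The inverse functor sends \<open>Y\<close> to a chosen \<open>g Y\<close> with an isomorphism \<open>e Y : F (g Y) \<rightarrow> Y\<close>, and an arrow
  \<open>f\<close> to the unique arrow that \<open>F\<close> maps to the conjugate of \<open>f\<close> by these isomorphisms.
\<close>

lemma equivalence_criterion:
  assumes A: "is_category A" and B: "is_category B" and F: "is_functor A B F"
    and ff: "\<And>X Y. X \<in> Obj A \<Longrightarrow> Y \<in> Obj A \<Longrightarrow> bij_betw (FA F) (Hom A X Y) (Hom B (FO F X) (FO F Y))"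
    and es: "\<And>Y. Y \<in> Obj B \<Longrightarrow> \<exists>X\<in>Obj A. isomorphic B (FO F X) Y"
  shows "equivalent_categories A B"
proof -
  interpret A: precat A by unfold_locales (rule A)
  interpret B: precat B by unfold_locales (rule B)
  have FO: "FO F X \<in> Obj B" if "X \<in> Obj A" for X using F that by (simp add: is_functor_def)
  have FA: "FA F f \<in> Hom B (FO F X) (FO F Y)" if "f \<in> Hom A X Y" for f X Y
    using F that by (auto simp: is_functor_def in_Hom)
  have Fid: "FA F (Id A X) = Id B (FO F X)" if "X \<in> Obj A" for X using F that by (simp add: is_functor_def)
  have Fcomp: "FA F (g \<cdot>\<^bsub>A\<^esub> f) = FA F g \<cdot>\<^bsub>B\<^esub> FA F f" if "f \<in> Hom A X Y" "g \<in> Hom A Y Z" for f g X Y Z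
    using F that by (simp add: is_functor_def in_Hom)
  have Finj: "f = g" if "f \<in> Hom A X Y" "g \<in> Hom A X Y" "FA F f = FA F g" for f g X Y
    using inj_onD[OF bij_betw_imp_inj_on[OF ff] that(3,1,2)] A.hom_obj[OF that(1)] by blast
  define L where "L X Y b = inv_into (Hom A X Y) (FA F) b" for X Y b
  have L: "L X Y b \<in> Hom A X Y" "FA F (L X Y b) = b"
    if "X \<in> Obj A" "Y \<in> Obj A" "b \<in> Hom B (FO F X) (FO F Y)" for X Y b
  proof -
    have "b \<in> FA F ` Hom A X Y" using bij_betw_imp_surj_on[OF ff[OF that(1,2)]] that(3) by simp
    then show "L X Y b \<in> Hom A X Y" "FA F (L X Y b) = b"
      unfolding L_def by (rule inv_into_into, rule f_inv_into_f)
  qed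
  have "\<exists>X e e'. X \<in> Obj A \<and> e \<in> Hom B (FO F X) Y \<and> e' \<in> Hom B Y (FO F X) \<and>
      e' \<cdot>\<^bsub>B\<^esub> e = Id B (FO F X) \<and> e \<cdot>\<^bsub>B\<^esub> e' = Id B Y" if Y: "Y \<in> Obj B" for Y
  proof -
    obtain X e where X: "X \<in> Obj A" "e \<in> Hom B (FO F X) Y" "is_iso_arr B e"
      using es[OF Y] unfolding isomorphic_def by blast
    obtain e' where "e' \<in> Hom B Y (FO F X)" "e' \<cdot>\<^bsub>B\<^esub> e = Id B (FO F X)" "e \<cdot>\<^bsub>B\<^esub> e' = Id B Y"
      by (rule B.isoE[OF X(3,2)])
    then show ?thesis using X by blast
  qed
  then have "\<forall>Y. \<exists>p. Y \<in> Obj B \<longrightarrow> fst p \<in> Obj A \<and> fst (snd p) \<in> Hom B (FO F (fst p)) Y \<and>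
      snd (snd p) \<in> Hom B Y (FO F (fst p)) \<and>
      snd (snd p) \<cdot>\<^bsub>B\<^esub> fst (snd p) = Id B (FO F (fst p)) \<and> fst (snd p) \<cdot>\<^bsub>B\<^esub> snd (snd p) = Id B Y"
    by (metis fst_conv snd_conv)
  from choice[OF this] obtain p where p: "\<forall>Y. Y \<in> Obj B \<longrightarrow> fst (p Y) \<in> Obj A \<and>
      fst (snd (p Y)) \<in> Hom B (FO F (fst (p Y))) Y \<and> snd (snd (p Y)) \<in> Hom B Y (FO F (fst (p Y))) \<and>
      snd (snd (p Y)) \<cdot>\<^bsub>B\<^esub> fst (snd (p Y)) = Id B (FO F (fst (p Y))) \<and>
      fst (snd (p Y)) \<cdot>\<^bsub>B\<^esub> snd (snd (p Y)) = Id B Y" ..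
  define g e e' where "g Y = fst (p Y)" and "e Y = fst (snd (p Y))" and "e' Y = snd (snd (p Y))" for Y
  have g: "g Y \<in> Obj A" and e: "e Y \<in> Hom B (FO F (g Y)) Y" and e': "e' Y \<in> Hom B Y (FO F (g Y))"
    and e'e: "e' Y \<cdot>\<^bsub>B\<^esub> e Y = Id B (FO F (g Y))" and ee': "e Y \<cdot>\<^bsub>B\<^esub> e' Y = Id B Y" if "Y \<in> Obj B" for Y
    using p that unfolding g_def e_def e'_def by auto
  define k where "k f = e' (Cod B f) \<cdot>\<^bsub>B\<^esub> (f \<cdot>\<^bsub>B\<^esub> e (Dom B f))" for f
  define G where "G = \<lparr>FO = g, FA = (\<lambda>f. L (g (Dom B f)) (g (Cod B f)) (k f))\<rparr>"
  have k: "k f \<in> Hom B (FO F (g X)) (FO F (g Y))" "k f = e' Y \<cdot>\<^bsub>B\<^esub> (f \<cdot>\<^bsub>B\<^esub> e X)" "e Y \<cdot>\<^bsub>B\<^esub> k f = f \<cdot>\<^bsub>B\<^esub> e X"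
    if f: "f \<in> Hom B X Y" for f X Y
  proof -
    have o: "X \<in> Obj B" "Y \<in> Obj B" using B.hom_obj[OF f] by auto
    have fe: "f \<cdot>\<^bsub>B\<^esub> e X \<in> Hom B (FO F (g X)) Y" using e[OF o(1)] f by blast
    show eq: "k f = e' Y \<cdot>\<^bsub>B\<^esub> (f \<cdot>\<^bsub>B\<^esub> e X)" using f by (simp add: k_def in_Hom)
    show "k f \<in> Hom B (FO F (g X)) (FO F (g Y))" unfolding eq by (rule B.comp_in[OF fe e'[OF o(2)]])
    have "e Y \<cdot>\<^bsub>B\<^esub> k f = (e Y \<cdot>\<^bsub>B\<^esub> e' Y) \<cdot>\<^bsub>B\<^esub> (f \<cdot>\<^bsub>B\<^esub> e X)"
      unfolding eq using e[OF o(2)] e'[OF o(2)] fe B.assoc[of "f \<cdot>\<^bsub>B\<^esub> e X" "e' Y" "e Y"] by (simp add: in_Hom)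
    then show "e Y \<cdot>\<^bsub>B\<^esub> k f = f \<cdot>\<^bsub>B\<^esub> e X" using ee'[OF o(2)] fe by (simp add: in_Hom)
  qed
  have GA: "FA G f \<in> Hom A (g X) (g Y)" "FA F (FA G f) = k f" if f: "f \<in> Hom B X Y" for f X Y
    using L[OF g g k(1)[OF f]] B.hom_obj[OF f] f by (auto simp: G_def in_Hom)
  have e_cancel: "b = c" if "Y \<in> Obj B" "b \<in> Hom B Z (FO F (g Y))" "c \<in> Hom B Z (FO F (g Y))"
    "e Y \<cdot>\<^bsub>B\<^esub> b = e Y \<cdot>\<^bsub>B\<^esub> c" for Y Z b c
  proof -
    have "b = (e' Y \<cdot>\<^bsub>B\<^esub> e Y) \<cdot>\<^bsub>B\<^esub> b" "c = (e' Y \<cdot>\<^bsub>B\<^esub> e Y) \<cdot>\<^bsub>B\<^esub> c"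
      using e'e[OF that(1)] that(2,3) by (simp_all add: in_Hom)
    then show ?thesis using e[OF that(1)] e'[OF that(1)] that(2,3,4) by (simp add: B.assoc in_Hom)
  qed
  have GF: "is_functor B A G"
    unfolding is_functor_def
  proof (intro conjI ballI impI)
    fix X assume X: "X \<in> Obj B"
    show "FO G X \<in> Obj A" using g[OF X] by (simp add: G_def)
    have i: "Id B X \<in> Hom B X X" using X by simp
    have ig: "Id A (g X) \<in> Hom A (g X) (g X)" using g[OF X] by simp
    have "k (Id B X) = Id B (FO F (g X))"
      using k(2)[OF i] e[OF X] e'e[OF X] by (simp add: in_Hom)
    then have "FA G (Id B X) = Id A (g X)"
      using Finj[OF GA(1)[OF i] ig] GA(2)[OF i] Fid[OF g[OF X]] by simp
    then show "FA G (Id B X) = Id A (FO G X)" by (simp add: G_def)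
  next
    fix f assume "f \<in> Arr B"
    then have f: "f \<in> Hom B (Dom B f) (Cod B f)" by (simp add: in_Hom)
    show "FA G f \<in> Hom A (FO G (Dom B f)) (FO G (Cod B f))" using GA(1)[OF f] by (simp add: G_def)
    fix h assume "h \<in> Arr B" "Cod B f = Dom B h"
    then have h: "h \<in> Hom B (Cod B f) (Cod B h)" by (simp add: in_Hom)
    have o: "Dom B f \<in> Obj B" "Cod B f \<in> Obj B" "Cod B h \<in> Obj B" using B.hom_obj[OF f] B.hom_obj[OF h] by auto
    note hf = B.comp_in[OF f h]
    have "k (h \<cdot>\<^bsub>B\<^esub> f) = k h \<cdot>\<^bsub>B\<^esub> k f"
    proof (rule e_cancel[OF o(3) k(1)[OF hf] B.comp_in[OF k(1)[OF f] k(1)[OF h]]])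
      have "e (Cod B h) \<cdot>\<^bsub>B\<^esub> (k h \<cdot>\<^bsub>B\<^esub> k f) = (h \<cdot>\<^bsub>B\<^esub> e (Cod B f)) \<cdot>\<^bsub>B\<^esub> k f"
        using k(3)[OF h, symmetric] k(1)[OF f] k(1)[OF h] e[OF o(3)] by (simp add: B.assoc in_Hom)
      also have "\<dots> = h \<cdot>\<^bsub>B\<^esub> (f \<cdot>\<^bsub>B\<^esub> e (Dom B f))"
        using k(3)[OF f] k(1)[OF f] h e[OF o(2)] by (simp add: B.assoc in_Hom)
      also have "\<dots> = (h \<cdot>\<^bsub>B\<^esub> f) \<cdot>\<^bsub>B\<^esub> e (Dom B f)" using f h e[OF o(1)] by (simp add: B.assoc in_Hom)
      finally show "e (Cod B h) \<cdot>\<^bsub>B\<^esub> k (h \<cdot>\<^bsub>B\<^esub> f) = e (Cod B h) \<cdot>\<^bsub>B\<^esub> (k h \<cdot>\<^bsub>B\<^esub> k f)" using k(3)[OF hf] by simp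
    qed
    then show "FA G (h \<cdot>\<^bsub>B\<^esub> f) = FA G h \<cdot>\<^bsub>A\<^esub> FA G f"
      using Finj[OF GA(1)[OF hf] A.comp_in[OF GA(1)[OF f] GA(1)[OF h]]] GA(2)[OF hf] GA(2)[OF f] GA(2)[OF h]
        Fcomp[OF GA(1)[OF f] GA(1)[OF h]] by simp
  qed
  have "nat_isomorphic B B (comp_functor F G) id_functor"
    unfolding nat_isomorphic_def
  proof (intro exI conjI ballI)
    show "nat_trans B B (comp_functor F G) id_functor e"
      unfolding nat_trans_def
    proof (intro conjI ballI)
      fix X assume "X \<in> Obj B"
      then show "e X \<in> Hom B (FO (comp_functor F G) X) (FO id_functor X)"
        using e by (simp add: comp_functor_def id_functor_def G_def)
    next
      fix f assume "f \<in> Arr B"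
      then have f: "f \<in> Hom B (Dom B f) (Cod B f)" by (simp add: in_Hom)
      show "e (Cod B f) \<cdot>\<^bsub>B\<^esub> FA (comp_functor F G) f = FA id_functor f \<cdot>\<^bsub>B\<^esub> e (Dom B f)"
        using GA(2)[OF f] k(3)[OF f] by (simp add: comp_functor_def id_functor_def)
    qed
    fix X assume X: "X \<in> Obj B"
    show "is_iso_arr B (e X)" by (rule B.isoI[OF e[OF X] e'[OF X] e'e[OF X] ee'[OF X]])
  qed
  moreover have "nat_isomorphic A A (comp_functor G F) id_functor"
  proof -
    define \<eta> where "\<eta> X = L (g (FO F X)) X (e (FO F X))" for X
    have \<eta>: "\<eta> X \<in> Hom A (g (FO F X)) X" "FA F (\<eta> X) = e (FO F X)" if X: "X \<in> Obj A" for X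
      unfolding \<eta>_def using L[OF g[OF FO[OF X]] X e[OF FO[OF X]]] by auto
    have "is_iso_arr A (\<eta> X)" if X: "X \<in> Obj A" for X
    proof -
      note Y = FO[OF X]
      define \<theta> where "\<theta> = L X (g (FO F X)) (e' (FO F X))"
      have \<theta>: "\<theta> \<in> Hom A X (g (FO F X))" "FA F \<theta> = e' (FO F X)"
        unfolding \<theta>_def using L[OF X g[OF Y] e'[OF Y]] by auto
      show ?thesis
      proof (rule A.isoI[OF \<eta>(1)[OF X] \<theta>(1)])
        have i: "Id A (g (FO F X)) \<in> Hom A (g (FO F X)) (g (FO F X))" using g[OF Y] by simp
        show "\<theta> \<cdot>\<^bsub>A\<^esub> \<eta> X = Id A (g (FO F X))"
          using Finj[OF A.comp_in[OF \<eta>(1)[OF X] \<theta>(1)] i] Fcomp[OF \<eta>(1)[OF X] \<theta>(1)] \<eta>(2)[OF X] \<theta>(2) e'e[OF Y] Fid[OF g[OF Y]]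
          by simp
        have j: "Id A X \<in> Hom A X X" using X by simp
        show "\<eta> X \<cdot>\<^bsub>A\<^esub> \<theta> = Id A X"
          using Finj[OF A.comp_in[OF \<theta>(1) \<eta>(1)[OF X]] j] Fcomp[OF \<theta>(1) \<eta>(1)[OF X]] \<eta>(2)[OF X] \<theta>(2) ee'[OF Y] Fid[OF X]
          by simp
      qed
    qed
    moreover have "nat_trans A A (comp_functor G F) id_functor \<eta>"
      unfolding nat_trans_def
    proof (intro conjI ballI)
      fix X assume "X \<in> Obj A"
      then show "\<eta> X \<in> Hom A (FO (comp_functor G F) X) (FO id_functor X)"
        using \<eta>(1) by (simp add: comp_functor_def id_functor_def G_def)
    next
      fix f assume "f \<in> Arr A"
      then have f: "f \<in> Hom A (Dom A f) (Cod A f)" by (simp add: in_Hom)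
      have o: "Dom A f \<in> Obj A" "Cod A f \<in> Obj A" using A.hom_obj[OF f] by auto
      note Ff = FA[OF f]
      have "\<eta> (Cod A f) \<cdot>\<^bsub>A\<^esub> FA G (FA F f) = f \<cdot>\<^bsub>A\<^esub> \<eta> (Dom A f)"
      proof (rule Finj[OF A.comp_in[OF GA(1)[OF Ff] \<eta>(1)[OF o(2)]] A.comp_in[OF \<eta>(1)[OF o(1)] f]])
        show "FA F (\<eta> (Cod A f) \<cdot>\<^bsub>A\<^esub> FA G (FA F f)) = FA F (f \<cdot>\<^bsub>A\<^esub> \<eta> (Dom A f))"
          using Fcomp[OF GA(1)[OF Ff] \<eta>(1)[OF o(2)]] Fcomp[OF \<eta>(1)[OF o(1)] f] GA(2)[OF Ff] \<eta>(2)[OF o(1)] \<eta>(2)[OF o(2)] k(3)[OF Ff]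
          by simp
      qed
      then show "\<eta> (Cod A f) \<cdot>\<^bsub>A\<^esub> FA (comp_functor G F) f = FA id_functor f \<cdot>\<^bsub>A\<^esub> \<eta> (Dom A f)"
        by (simp add: comp_functor_def id_functor_def)
    qed
    ultimately show ?thesis unfolding nat_isomorphic_def by blast
  qed
  ultimately show ?thesis unfolding equivalent_categories_def using F GF by blast
qed

lemma functor_category_simps [simp]:
  "Obj (functor_category A B S) =
     {F \<in> S. is_functor A B F \<and> FO F \<in> extensional (Obj A) \<and> FA F \<in> extensional (Arr A)}"
  "Dom (functor_category A B S) (F, \<eta>, G) = F" "Cod (functor_category A B S) (F, \<eta>, G) = G"
  "Id (functor_category A B S) F = (F, \<lambda>X\<in>Obj A. Id B (FO F X), F)"
  "(G', \<theta>, K) \<cdot>\<^bsub>functor_category A B S\<^esub> (F, \<eta>, G) = (F, \<lambda>X\<in>Obj A. \<theta> X \<cdot>\<^bsub>B\<^esub> \<eta> X, K)"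
  by (simp_all add: functor_category_def)

lemma functor_category_hom:
  "(F', \<eta>, G') \<in> Hom (functor_category A B S) F G \<longleftrightarrow> F' = F \<and> G' = G \<and>
     F \<in> Obj (functor_category A B S) \<and> G \<in> Obj (functor_category A B S) \<and>
     nat_trans A B F G \<eta> \<and> \<eta> \<in> extensional (Obj A)"
  by (auto simp: functor_category_def Hom_def)

lemma functor_category_homE:
  assumes "t \<in> Hom (functor_category A B S) F G"
  obtains \<eta> where "t = (F, \<eta>, G)" "F \<in> Obj (functor_category A B S)" "G \<in> Obj (functor_category A B S)"
    "nat_trans A B F G \<eta>" "\<eta> \<in> extensional (Obj A)"
proof -
  obtain F' \<eta> G' where t: "t = (F', \<eta>, G')" by (cases t) auto
  show thesis using that[of \<eta>] assms unfolding t functor_category_hom by blast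
qed

lemma nat_trans_comp:
  assumes A: "is_category A" and B: "is_category B"
    and F: "is_functor A B F" and G: "is_functor A B G" and K: "is_functor A B K"
    and \<eta>: "nat_trans A B F G \<eta>" and \<theta>: "nat_trans A B G K \<theta>"
  shows "nat_trans A B F K (\<lambda>X\<in>Obj A. \<theta> X \<cdot>\<^bsub>B\<^esub> \<eta> X)"
proof -
  interpret A: precat A by unfold_locales (rule A)
  interpret B: precat B by unfold_locales (rule B)
  show ?thesis
    unfolding nat_trans_def
  proof (intro conjI ballI)
    fix X assume X: "X \<in> Obj A"
    then show "(\<lambda>X\<in>Obj A. \<theta> X \<cdot>\<^bsub>B\<^esub> \<eta> X) X \<in> Hom B (FO F X) (FO K X)" using \<eta> \<theta> unfolding nat_trans_def by auto
  next
    fix f assume f: "f \<in> Arr A"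
    define X Y where "X = Dom A f" and "Y = Cod A f"
    have o: "X \<in> Obj A" "Y \<in> Obj A" using f X_def Y_def by auto
    have h: "\<eta> X \<in> Hom B (FO F X) (FO G X)" "\<eta> Y \<in> Hom B (FO F Y) (FO G Y)"
      "\<theta> X \<in> Hom B (FO G X) (FO K X)" "\<theta> Y \<in> Hom B (FO G Y) (FO K Y)"
      using \<eta> \<theta> o unfolding nat_trans_def by auto
    have Ff: "FA F f \<in> Hom B (FO F X) (FO F Y)" "FA G f \<in> Hom B (FO G X) (FO G Y)" "FA K f \<in> Hom B (FO K X) (FO K Y)"
      using F G K f X_def Y_def unfolding is_functor_def by auto
    have n: "\<eta> Y \<cdot>\<^bsub>B\<^esub> FA F f = FA G f \<cdot>\<^bsub>B\<^esub> \<eta> X" "\<theta> Y \<cdot>\<^bsub>B\<^esub> FA G f = FA K f \<cdot>\<^bsub>B\<^esub> \<theta> X"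
      using \<eta> \<theta> f X_def Y_def unfolding nat_trans_def by auto
    have "(\<theta> Y \<cdot>\<^bsub>B\<^esub> \<eta> Y) \<cdot>\<^bsub>B\<^esub> FA F f = \<theta> Y \<cdot>\<^bsub>B\<^esub> (FA G f \<cdot>\<^bsub>B\<^esub> \<eta> X)" using h Ff n by (simp add: B.assoc in_Hom)
    also have "\<dots> = (\<theta> Y \<cdot>\<^bsub>B\<^esub> FA G f) \<cdot>\<^bsub>B\<^esub> \<eta> X" using h Ff by (simp add: B.assoc in_Hom)
    also have "\<dots> = FA K f \<cdot>\<^bsub>B\<^esub> (\<theta> X \<cdot>\<^bsub>B\<^esub> \<eta> X)" using h Ff n by (simp add: B.assoc in_Hom)
    finally show "(\<lambda>X\<in>Obj A. \<theta> X \<cdot>\<^bsub>B\<^esub> \<eta> X) (Cod A f) \<cdot>\<^bsub>B\<^esub> FA F f = FA K f \<cdot>\<^bsub>B\<^esub> (\<lambda>X\<in>Obj A. \<theta> X \<cdot>\<^bsub>B\<^esub> \<eta> X) (Dom A f)"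
      using o unfolding X_def[symmetric] Y_def[symmetric] by simp
  qed
qed

lemma functor_category_category:
  assumes A: "is_category A" and B: "is_category B"
  shows "is_category (functor_category A B S)"
proof -
  interpret A: precat A by unfold_locales (rule A)
  interpret B: precat B by unfold_locales (rule B)
  let ?FC = "functor_category A B S"
  have idt: "nat_trans A B F F (\<lambda>X\<in>Obj A. Id B (FO F X))" if F: "is_functor A B F" for F
    unfolding nat_trans_def
  proof (intro conjI ballI)
    fix X assume X: "X \<in> Obj A"
    then have "FO F X \<in> Obj B" using F by (simp add: is_functor_def)
    then show "(\<lambda>X\<in>Obj A. Id B (FO F X)) X \<in> Hom B (FO F X) (FO F X)" using X by simp
  next
    fix f assume f: "f \<in> Arr A"
    then have "FA F f \<in> Hom B (FO F (Dom A f)) (FO F (Cod A f))" using F by (simp add: is_functor_def)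
    then show "(\<lambda>X\<in>Obj A. Id B (FO F X)) (Cod A f) \<cdot>\<^bsub>B\<^esub> FA F f = FA F f \<cdot>\<^bsub>B\<^esub> (\<lambda>X\<in>Obj A. Id B (FO F X)) (Dom A f)"
      using f by (simp add: in_Hom)
  qed
  have arrE: "\<exists>F \<eta> G. t = (F, \<eta>, G) \<and> F \<in> Obj ?FC \<and> G \<in> Obj ?FC \<and> nat_trans A B F G \<eta> \<and> \<eta> \<in> extensional (Obj A)"
    if "t \<in> Arr ?FC" for t
  proof -
    have "t \<in> Hom ?FC (Dom ?FC t) (Cod ?FC t)" using that by (simp add: in_Hom)
    then show ?thesis by (rule functor_category_homE) blast
  qed
  have inn: "(F, \<eta>, G) \<in> Hom ?FC F G"
    if "F \<in> Obj ?FC" "G \<in> Obj ?FC" "nat_trans A B F G \<eta>" "\<eta> \<in> extensional (Obj A)" for F \<eta> G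
    unfolding functor_category_hom using that by blast
  have comps: "\<eta> X \<in> Hom B (FO F X) (FO G X)" if "nat_trans A B F G \<eta>" "X \<in> Obj A" for F G \<eta> X
    using that by (simp add: nat_trans_def)
  show ?thesis
    unfolding is_category_def
  proof (intro conjI ballI impI)
    fix F assume "F \<in> Obj ?FC"
    then show "Id ?FC F \<in> Hom ?FC F F"
      unfolding functor_category_simps(4) by (intro inn idt) auto
  next
    fix t assume t: "t \<in> Arr ?FC"
    then obtain F \<eta> G where t': "t = (F, \<eta>, G)" "F \<in> Obj ?FC" "G \<in> Obj ?FC" "nat_trans A B F G \<eta>" "\<eta> \<in> extensional (Obj A)"
      using arrE by blast
    show "Dom ?FC t \<in> Obj ?FC" "Cod ?FC t \<in> Obj ?FC" using t' by auto
    have "(\<lambda>X\<in>Obj A. \<eta> X \<cdot>\<^bsub>B\<^esub> (\<lambda>X\<in>Obj A. Id B (FO F X)) X) = \<eta>"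
      using comps[OF t'(4)] t'(5) by (intro extensionalityI[of _ "Obj A"]) (auto simp: in_Hom)
    then show "t \<cdot>\<^bsub>?FC\<^esub> Id ?FC (Dom ?FC t) = t" using t'(1) by simp
    have "(\<lambda>X\<in>Obj A. (\<lambda>X\<in>Obj A. Id B (FO G X)) X \<cdot>\<^bsub>B\<^esub> \<eta> X) = \<eta>"
      using comps[OF t'(4)] t'(5) by (intro extensionalityI[of _ "Obj A"]) (auto simp: in_Hom)
    then show "Id ?FC (Cod ?FC t) \<cdot>\<^bsub>?FC\<^esub> t = t" using t'(1) by simp
    fix s assume s: "s \<in> Arr ?FC"
    then obtain G' \<theta> K where s': "s = (G', \<theta>, K)" "G' \<in> Obj ?FC" "K \<in> Obj ?FC" "nat_trans A B G' K \<theta>" "\<theta> \<in> extensional (Obj A)"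
      using arrE by blast
    {
      assume "Cod ?FC t = Dom ?FC s"
      then have G': "G' = G" using t'(1) s'(1) by simp
      have "nat_trans A B F K (\<lambda>X\<in>Obj A. \<theta> X \<cdot>\<^bsub>B\<^esub> \<eta> X)"
        using nat_trans_comp[OF A B _ _ _ t'(4), of K \<theta>] t'(2,3) s'(3,4) G' by simp
      then show "s \<cdot>\<^bsub>?FC\<^esub> t \<in> Hom ?FC (Dom ?FC t) (Cod ?FC s)"
        unfolding t'(1) s'(1) functor_category_simps(2,3,5) using inn[OF t'(2) s'(3)] by simp
    }
    fix r assume r: "r \<in> Arr ?FC"
    then obtain K' \<zeta> M where r': "r = (K', \<zeta>, M)" "K' \<in> Obj ?FC" "M \<in> Obj ?FC" "nat_trans A B K' M \<zeta>" "\<zeta> \<in> extensional (Obj A)"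
      using arrE by blast
    assume "Cod ?FC t = Dom ?FC s \<and> Cod ?FC s = Dom ?FC r"
    then have eqs: "G' = G" "K' = K" using t'(1) s'(1) r'(1) by auto
    have "(\<lambda>X\<in>Obj A. \<zeta> X \<cdot>\<^bsub>B\<^esub> (\<lambda>X\<in>Obj A. \<theta> X \<cdot>\<^bsub>B\<^esub> \<eta> X) X) = (\<lambda>X\<in>Obj A. (\<lambda>X\<in>Obj A. \<zeta> X \<cdot>\<^bsub>B\<^esub> \<theta> X) X \<cdot>\<^bsub>B\<^esub> \<eta> X)"
    proof (rule restrict_ext)
      fix X assume X: "X \<in> Obj A"
      show "\<zeta> X \<cdot>\<^bsub>B\<^esub> (\<lambda>X\<in>Obj A. \<theta> X \<cdot>\<^bsub>B\<^esub> \<eta> X) X = (\<lambda>X\<in>Obj A. \<zeta> X \<cdot>\<^bsub>B\<^esub> \<theta> X) X \<cdot>\<^bsub>B\<^esub> \<eta> X"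
        using comps[OF t'(4) X] comps[OF s'(4) X] comps[OF r'(4) X] eqs X by (simp add: B.assoc in_Hom)
    qed
    then show "r \<cdot>\<^bsub>?FC\<^esub> (s \<cdot>\<^bsub>?FC\<^esub> t) = r \<cdot>\<^bsub>?FC\<^esub> s \<cdot>\<^bsub>?FC\<^esub> t" by (simp add: t'(1) s'(1) r'(1))
  qed
qed

text \<open>
  The componentwise inverses of a natural transformation are again natural.
\<close>

lemma functor_category_iso:
  assumes A: "is_category A" and B: "is_category B"
    and t: "(F, \<eta>, G) \<in> Hom (functor_category A B S) F G"
    and iso: "\<And>X. X \<in> Obj A \<Longrightarrow> is_iso_arr B (\<eta> X)"
  shows "is_iso_arr (functor_category A B S) (F, \<eta>, G)"
proof -
  interpret A: precat A by unfold_locales (rule A)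
  interpret B: precat B by unfold_locales (rule B)
  let ?FC = "functor_category A B S"
  interpret FC: precat ?FC by unfold_locales (rule functor_category_category[OF A B])
  have F: "is_functor A B F" and G: "is_functor A B G" and o: "F \<in> Obj ?FC" "G \<in> Obj ?FC"
    and n: "nat_trans A B F G \<eta>"
    using t unfolding functor_category_hom by auto
  have \<eta>: "\<eta> X \<in> Hom B (FO F X) (FO G X)" if "X \<in> Obj A" for X using n that by (simp add: nat_trans_def)
  have "\<exists>z. z \<in> Hom B (FO G X) (FO F X) \<and> z \<cdot>\<^bsub>B\<^esub> \<eta> X = Id B (FO F X) \<and> \<eta> X \<cdot>\<^bsub>B\<^esub> z = Id B (FO G X)" if "X \<in> Obj A" for X
    using B.isoE[OF iso[OF that] \<eta>[OF that]] by blast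
  then obtain z where z: "\<And>X. X \<in> Obj A \<Longrightarrow> z X \<in> Hom B (FO G X) (FO F X)"
      "\<And>X. X \<in> Obj A \<Longrightarrow> z X \<cdot>\<^bsub>B\<^esub> \<eta> X = Id B (FO F X)" "\<And>X. X \<in> Obj A \<Longrightarrow> \<eta> X \<cdot>\<^bsub>B\<^esub> z X = Id B (FO G X)"
    by metis
  define \<zeta> where "\<zeta> = restrict z (Obj A)"
  have "nat_trans A B G F \<zeta>"
    unfolding nat_trans_def
  proof (intro conjI ballI)
    fix X assume "X \<in> Obj A" then show "\<zeta> X \<in> Hom B (FO G X) (FO F X)" using z by (simp add: \<zeta>_def)
  next
    fix f assume f: "f \<in> Arr A"
    define X Y where "X = Dom A f" and "Y = Cod A f"
    have XY: "X \<in> Obj A" "Y \<in> Obj A" using f X_def Y_def by auto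
    have Ff: "FA F f \<in> Hom B (FO F X) (FO F Y)" "FA G f \<in> Hom B (FO G X) (FO G Y)"
      using F G f X_def Y_def unfolding is_functor_def by auto
    have nf: "\<eta> Y \<cdot>\<^bsub>B\<^esub> FA F f = FA G f \<cdot>\<^bsub>B\<^esub> \<eta> X" using n f X_def Y_def unfolding nat_trans_def by auto
    have "z Y \<cdot>\<^bsub>B\<^esub> FA G f = z Y \<cdot>\<^bsub>B\<^esub> (FA G f \<cdot>\<^bsub>B\<^esub> (\<eta> X \<cdot>\<^bsub>B\<^esub> z X))" using z(3)[OF XY(1)] Ff by (simp add: in_Hom)
    also have "\<dots> = z Y \<cdot>\<^bsub>B\<^esub> ((FA G f \<cdot>\<^bsub>B\<^esub> \<eta> X) \<cdot>\<^bsub>B\<^esub> z X)" using z(1)[OF XY(1)] \<eta>[OF XY(1)] Ff by (simp add: B.assoc in_Hom)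
    also have "\<dots> = z Y \<cdot>\<^bsub>B\<^esub> ((\<eta> Y \<cdot>\<^bsub>B\<^esub> FA F f) \<cdot>\<^bsub>B\<^esub> z X)" using nf by simp
    also have "\<dots> = (z Y \<cdot>\<^bsub>B\<^esub> \<eta> Y) \<cdot>\<^bsub>B\<^esub> (FA F f \<cdot>\<^bsub>B\<^esub> z X)"
      using z(1)[OF XY(1)] z(1)[OF XY(2)] \<eta>[OF XY(2)] Ff by (simp add: B.assoc in_Hom)
    also have "\<dots> = FA F f \<cdot>\<^bsub>B\<^esub> z X" using z(2)[OF XY(2)] z(1)[OF XY(1)] Ff by (simp add: in_Hom)
    finally show "\<zeta> (Cod A f) \<cdot>\<^bsub>B\<^esub> FA G f = FA F f \<cdot>\<^bsub>B\<^esub> \<zeta> (Dom A f)"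
      using XY unfolding \<zeta>_def X_def[symmetric] Y_def[symmetric] by simp
  qed
  then have s: "(G, \<zeta>, F) \<in> Hom ?FC G F" unfolding functor_category_hom using o by (simp add: \<zeta>_def)
  have "(\<lambda>X\<in>Obj A. \<zeta> X \<cdot>\<^bsub>B\<^esub> \<eta> X) = (\<lambda>X\<in>Obj A. Id B (FO F X))" "(\<lambda>X\<in>Obj A. \<eta> X \<cdot>\<^bsub>B\<^esub> \<zeta> X) = (\<lambda>X\<in>Obj A. Id B (FO G X))"
    using z by (auto simp: \<zeta>_def intro!: restrict_ext)
  then show ?thesis by (intro FC.isoI[OF t s]) simp_all
qed

lemma Ab_iso:
  assumes a: "a \<in> Hom (Ab :: ('u monoid, 'u ab_arr) preadditive) G H" and bij: "bij_betw (ab_fun a) (carrier G) (carrier H)"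
  shows "is_iso_arr Ab a"
proof -
  have o: "G \<in> Obj Ab" "H \<in> Obj Ab" using Ab_hom_obj[OF a] by auto
  have af: "ab_fun a \<in> Group.iso G H" using Ab_hom_fun(1)[OF a] bij by (simp add: Group.iso_def)
  interpret G: comm_group G using o by simp
  have inv: "inv_into (carrier G) (ab_fun a) \<in> hom H G" using G.iso_set_sym[OF af] by (simp add: Group.iso_def)
  have b: "(H, restrict (inv_into (carrier G) (ab_fun a)) (carrier H), G) \<in> Hom Ab H G" (is "?b \<in> _")
    using o inv by (intro Ab_homI) auto
  have bf: "ab_fun ?b y = inv_into (carrier G) (ab_fun a) y" if "y \<in> carrier H" for y
    using that by (simp add: ab_fun_def)
  show ?thesis
  proof (rule Ab.isoI[OF a b])
    show "?b \<cdot>\<^bsub>Ab\<^esub> a = Id Ab G"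
    proof (rule Ab_hom_eq[OF Ab_comp_in[OF a b] Ab_id_in[OF o(1)]])
      fix x assume x: "x \<in> carrier G"
      show "ab_fun (?b \<cdot>\<^bsub>Ab\<^esub> a) x = ab_fun (Id Ab G) x"
        unfolding ab_fun_comp[OF a b x] bf[OF Ab_hom_fun(2)[OF a x]] ab_fun_id[OF x]
        using bij x by (simp add: bij_betw_def)
    qed
    show "a \<cdot>\<^bsub>Ab\<^esub> ?b = Id Ab H"
    proof (rule Ab_hom_eq[OF Ab_comp_in[OF b a] Ab_id_in[OF o(2)]])
      fix y assume y: "y \<in> carrier H"
      show "ab_fun (a \<cdot>\<^bsub>Ab\<^esub> ?b) y = ab_fun (Id Ab H) y"
        unfolding ab_fun_comp[OF b a y] bf[OF y] ab_fun_id[OF y]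
        using bij y by (simp add: bij_betw_def f_inv_into_f)
    qed
  qed
qed


section \<open>Full subcategories\<close>

lemma full_subcat_simps [simp]:
  "Obj (full_subcat C D) = Obj C \<inter> D" "Dom (full_subcat C D) = Dom C" "Cod (full_subcat C D) = Cod C"
  "Id (full_subcat C D) = Id C" "g \<cdot>\<^bsub>full_subcat C D\<^esub> f = g \<cdot>\<^bsub>C\<^esub> f" "f \<boxplus>\<^bsub>full_subcat C D\<^esub> g = f \<boxplus>\<^bsub>C\<^esub> g"
  "Zero (full_subcat C D) = Zero C"
  by (simp_all add: full_subcat_def)

lemma full_subcat_arr: "f \<in> Arr (full_subcat C D) \<longleftrightarrow> f \<in> Arr C \<and> Dom C f \<in> D \<and> Cod C f \<in> D"
  by (simp add: full_subcat_def)

lemma full_subcat_hom: "X \<in> D \<Longrightarrow> Y \<in> D \<Longrightarrow> Hom (full_subcat C D) X Y = Hom C X Y"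
  by (auto simp: Hom_def full_subcat_arr)

lemma full_subcat_hom_iff: "f \<in> Hom (full_subcat C D) X Y \<longleftrightarrow> X \<in> D \<and> Y \<in> D \<and> f \<in> Hom C X Y"
  by (auto simp: Hom_def full_subcat_arr)

lemma full_subcat_hom_group: "X \<in> D \<Longrightarrow> Y \<in> D \<Longrightarrow> hom_group (full_subcat C D) X Y = hom_group C X Y"
  unfolding hom_group_def by (simp add: full_subcat_hom) (simp add: full_subcat_def)

context preadd
begin

lemma full_subcat_preadditive: "is_preadditive (full_subcat C D)"
  unfolding is_preadditive_def
proof (intro conjI ballI)
  show "is_category (full_subcat C D)"
    unfolding is_category_def full_subcat_simps full_subcat_hom_iff
    by (auto simp: full_subcat_arr in_Hom assoc)
  fix X Y assume "X \<in> Obj (full_subcat C D)" "Y \<in> Obj (full_subcat C D)"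
  then show "comm_group (hom_group (full_subcat C D) X Y)" by (simp add: full_subcat_hom_group)
next
  fix X Y Z f f' g g' assume "f \<in> Hom (full_subcat C D) X Y" "f' \<in> Hom (full_subcat C D) X Y"
    "g \<in> Hom (full_subcat C D) Y Z" "g' \<in> Hom (full_subcat C D) Y Z"
  then have "f \<in> Hom C X Y" "f' \<in> Hom C X Y" "g \<in> Hom C Y Z" "g' \<in> Hom C Y Z" by (auto simp: full_subcat_hom_iff)
  then show "g \<cdot>\<^bsub>full_subcat C D\<^esub> (f \<boxplus>\<^bsub>full_subcat C D\<^esub> f') = g \<cdot>\<^bsub>full_subcat C D\<^esub> f \<boxplus>\<^bsub>full_subcat C D\<^esub> g \<cdot>\<^bsub>full_subcat C D\<^esub> f'"
    "(g \<boxplus>\<^bsub>full_subcat C D\<^esub> g') \<cdot>\<^bsub>full_subcat C D\<^esub> f = g \<cdot>\<^bsub>full_subcat C D\<^esub> f \<boxplus>\<^bsub>full_subcat C D\<^esub> g' \<cdot>\<^bsub>full_subcat C D\<^esub> f"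
    by (simp_all add: comp_add add_comp)
qed

lemma presheaf_full_subcat:
  assumes D: "D \<subseteq> Obj C"
  shows "presheaf (full_subcat C D) (Obj (full_subcat C D)) N act \<longleftrightarrow> presheaf C D N act"
proof -
  have o: "Obj (full_subcat C D) = D" using D by auto
  have p: "preadd (full_subcat C D)" by unfold_locales (rule full_subcat_preadditive)
  show ?thesis
    unfolding presheaf_def presheaf_axioms_def o using p preadd_axioms D
    by (simp add: full_subcat_hom_iff)
qed

lemma coproduct_full_subcat:
  assumes D: "D \<subseteq> Obj C" and P: "is_coproduct C I X P \<iota>" and XD: "\<And>i. i \<in> I \<Longrightarrow> X i \<in> D" and PD: "P \<in> D"
  shows "is_coproduct (full_subcat C D) I X P \<iota>"
  unfolding is_coproduct_def
proof (intro conjI ballI allI impI)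
  show "P \<in> Obj (full_subcat C D)" using PD D by auto
  fix i assume i: "i \<in> I"
  show "X i \<in> Obj (full_subcat C D)" using XD[OF i] D by auto
  show "\<iota> i \<in> Hom (full_subcat C D) (X i) P" using coproductD(3)[OF P i] XD[OF i] PD by (simp add: full_subcat_hom)
next
  fix Q \<sigma> assume Q: "Q \<in> Obj (full_subcat C D)" and "\<forall>i\<in>I. \<sigma> i \<in> Hom (full_subcat C D) (X i) Q"
  then have "\<forall>i\<in>I. \<sigma> i \<in> Hom C (X i) Q" by (simp add: full_subcat_hom_iff)
  then show "\<exists>!h. h \<in> Hom (full_subcat C D) P Q \<and> (\<forall>i\<in>I. h \<cdot>\<^bsub>full_subcat C D\<^esub> \<iota> i = \<sigma> i)"
    using coproduct_ex1[OF P, of Q \<sigma>] Q PD by (simp add: full_subcat_hom)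
qed

text \<open>
  The coproduct formed in \<open>C\<close> lies in \<open>D\<close>, so it is a coproduct in the subcategory as well, and any
  other one is isomorphic to it.
\<close>

lemma full_subcat_coproduct:
  fixes U :: "'u itself" and I :: "'u set"
  assumes sm: "smashing U C" and D: "D \<subseteq> Obj C" and clo: "closed_under_coproducts U C D" and I: "small U I"
    and P: "is_coproduct (full_subcat C D) I X P \<iota>"
  shows "is_coproduct C I X P \<iota>" "P \<in> D" "\<And>i. i \<in> I \<Longrightarrow> X i \<in> D"
proof -
  interpret F: preadd "full_subcat C D" by unfold_locales (rule full_subcat_preadditive)
  show PD: "P \<in> D" and XD: "\<And>i. i \<in> I \<Longrightarrow> X i \<in> D" using F.coproductD(1,2)[OF P] by auto
  have Xo: "X i \<in> Obj C" if "i \<in> I" for i using XD[OF that] D by blast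
  obtain Q \<kappa> where Q: "is_coproduct C I X Q \<kappa>" by (rule smashing_coproduct[OF sm I Xo])
  have QD: "Q \<in> D" by (rule closed_coproduct[OF clo I Q XD])
  obtain h where h: "h \<in> Hom (full_subcat C D) Q P" "is_iso_arr (full_subcat C D) h" "\<And>i. i \<in> I \<Longrightarrow> h \<cdot>\<^bsub>full_subcat C D\<^esub> \<kappa> i = \<iota> i"
    using F.coproduct_iso[OF coproduct_full_subcat[OF D Q XD QD] P] by blast
  obtain k where k: "k \<in> Hom (full_subcat C D) P Q" "k \<cdot>\<^bsub>full_subcat C D\<^esub> h = Id (full_subcat C D) Q" "h \<cdot>\<^bsub>full_subcat C D\<^esub> k = Id (full_subcat C D) P"
    by (rule F.isoE[OF h(2,1)])
  have h': "h \<in> Hom C Q P" "k \<in> Hom C P Q" using h(1) k(1) by (auto simp: full_subcat_hom_iff)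
  show "is_coproduct C I X P \<iota>"
  proof (rule coproduct_via_iso[OF Q h'(1)])
    show "is_iso_arr C h" using isoI[OF h'] k by simp
    show "h \<cdot> \<kappa> i = \<iota> i" if "i \<in> I" for i using h(3)[OF that] by simp
  qed
qed

end


section \<open>The heart of the adjacent t-structure\<close>

lemma op_category:
  assumes "is_category A"
  shows "is_category (op_cat A)"
proof -
  interpret precat A by unfold_locales (rule assms)
  show ?thesis
    unfolding is_category_def op_cat_simps Hom_op_cat by (auto simp: in_Hom assoc)
qed

lemma (in preadd) takes_coproducts_full_subcat:
  fixes U :: "'u itself"
  assumes sm: "smashing U C" and D: "D \<subseteq> Obj C" and clo: "closed_under_coproducts U C D"
  shows "takes_coproducts U (full_subcat C D) (Obj (full_subcat C D)) N act \<longleftrightarrow> takes_coproducts U C D N act"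
proof -
  have o: "Obj (full_subcat C D) = D" using D by auto
  have "(small U I \<and> (\<forall>i\<in>I. X i \<in> D) \<and> P \<in> D \<and> is_coproduct (full_subcat C D) I X P \<iota>) \<longleftrightarrow>
      (small U I \<and> (\<forall>i\<in>I. X i \<in> D) \<and> P \<in> D \<and> is_coproduct C I X P \<iota>)" for I :: "'u set" and X P \<iota>
    using coproduct_full_subcat[OF D] full_subcat_coproduct(1)[OF sm D clo] by blast
  then show ?thesis unfolding takes_coproducts_def o by (simp only:)
qed

context weighted
begin

text \<open>
  Let \<open>D \<rightarrow> E \<rightarrow> M\<close> present \<open>M\<close>, with \<open>E\<close> in the heart of the weight structure.  The arrow \<open>\<theta> e\<close> from
  \<open>E\<close> to \<open>M'\<close> vanishes on \<open>D\<close>: by naturality it vanishes on the heart object \<open>E2\<close> of a presentation of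
  \<open>D\<close>, so its restriction to \<open>D\<close> factors
  through an object of \<open>wge[1]\<close>, and these are orthogonal to \<open>M'\<close>.  Hence it
  descends to \<open>M\<close>.
\<close>

lemma heart_dense:
  assumes M: "M \<in> wge" and M': "M' \<in> tle_of"
    and \<theta>: "\<And>Q q. Q \<in> wle \<inter> wge \<Longrightarrow> q \<in> Hom C Q M \<Longrightarrow> \<theta> q \<in> Hom C Q M'"
    and nat: "\<And>Q R q r. Q \<in> wle \<inter> wge \<Longrightarrow> R \<in> wle \<inter> wge \<Longrightarrow> q \<in> Hom C Q M \<Longrightarrow> r \<in> Hom C R Q \<Longrightarrow> \<theta> (q \<cdot> r) = \<theta> q \<cdot> r"
  shows "\<exists>f\<in>Hom C M M'. \<forall>Q\<in>wle \<inter> wge. \<forall>q\<in>Hom C Q M. f \<cdot> q = \<theta> q"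
proof -
  have M'o: "M' \<in> Obj C" and Mo: "M \<in> Obj C" using M M' wge_obj tle_of_sub by auto
  have orth: "k = Zero C (shO C X) M'" if "X \<in> wge" "k \<in> Hom C (shO C X) M'" for X k
    using M' that unfolding tle_of_def by blast
  obtain D E d e c where p: "D \<in> wge" "E \<in> wle \<inter> wge" "(d, e, c) \<in> Tri C" "d \<in> Hom C D E" "e \<in> Hom C E M"
    using heart_presentation[OF M] by blast
  obtain D2 E2 d2 e2 c2 where p2: "D2 \<in> wge" "E2 \<in> wle \<inter> wge" "(d2, e2, c2) \<in> Tri C" "d2 \<in> Hom C D2 E2" "e2 \<in> Hom C E2 D"
    using heart_presentation[OF p(1)] by blast
  have ob: "D \<in> Obj C" "E \<in> Obj C" "E2 \<in> Obj C" "D2 \<in> Obj C" using p p2 wge_obj by auto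
  have dm: "Dom C d = D" "Cod C d = E" "Cod C e = M" "Dom C d2 = D2" "Cod C d2 = E2" "Cod C e2 = D"
    using p p2 by (auto simp: in_Hom)
  have x: "\<theta> e \<in> Hom C E M'" using \<theta>[OF p(2,5)] .
  have xd: "\<theta> e \<cdot> d \<in> Hom C D M'" using x p(4) by blast
  have de2: "d \<cdot> e2 \<in> Hom C E2 E" using p(4) p2(5) by blast
  have z: "Zero C E2 E \<in> Hom C E2 E" using ob by simp
  have "e \<cdot> (d \<cdot> e2) = e \<cdot> Zero C E2 E"
    using tri_comp_zero[OF p(3)] p p2 dm ob Mo by (simp add: assoc[symmetric] in_Hom)
  then have "\<theta> e \<cdot> (d \<cdot> e2) = \<theta> e \<cdot> Zero C E2 E"
    using nat[OF p(2) p2(2) p(5) de2] nat[OF p(2) p2(2) p(5) z] by simp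
  then have "(\<theta> e \<cdot> d) \<cdot> e2 = Zero C E2 M'" using x p(4) p2(5) ob by (simp add: assoc in_Hom)
  then obtain y where y: "y \<in> Hom C (shO C D2) M'" "y \<cdot> c2 = \<theta> e \<cdot> d"
    using tri_extend2[OF p2(3), of "\<theta> e \<cdot> d" M'] xd dm by metis
  have "y = Zero C (shO C D2) M'" using orth[OF p2(1) y(1)] .
  then have "\<theta> e \<cdot> d = Zero C D M'" using y(2) tri_in(3)[OF p2(3)] dm M'o by (simp add: in_Hom)
  then obtain f where f: "f \<in> Hom C M M'" "f \<cdot> e = \<theta> e"
    using tri_extend[OF p(3), of "\<theta> e" M'] x dm by metis
  have "f \<cdot> q = \<theta> q" if Q: "Q \<in> wle \<inter> wge" and q: "q \<in> Hom C Q M" for Q q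
  proof -
    have "Q \<in> wle" using Q by blast
    then obtain q' where q': "q' \<in> Hom C Q E" "e \<cdot> q' = q"
      using heart_lifts[OF p(3), of Q q] p(1) q dm by metis
    have "(f \<cdot> e) \<cdot> q' = f \<cdot> q" using assoc[of q' e f] q' f(1) p(5) by (simp add: in_Hom)
    then show ?thesis using f(2) nat[OF p(2) Q p(5) q'(1)] q'(2) by simp
  qed
  then show ?thesis using f(1) by blast
qed

text \<open>
  The difference of two such arrows vanishes on \<open>E\<close>, hence factors through \<open>D[1]\<close>, which is orthogonal
  to \<open>M'\<close>.
\<close>

lemma heart_detects:
  assumes M: "M \<in> wge" and M': "M' \<in> tle_of" and f: "f \<in> Hom C M M'" and g: "g \<in> Hom C M M'"
    and eq: "\<And>Q q. Q \<in> wle \<inter> wge \<Longrightarrow> q \<in> Hom C Q M \<Longrightarrow> f \<cdot> q = g \<cdot> q"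
  shows "f = g"
proof -
  have M'o: "M' \<in> Obj C" using M' tle_of_sub by auto
  obtain D E d e c where p: "D \<in> wge" "E \<in> wle \<inter> wge" "(d, e, c) \<in> Tri C" "d \<in> Hom C D E" "e \<in> Hom C E M"
    using heart_presentation[OF M] by blast
  have dm: "Dom C d = D" "Cod C d = E" "Cod C e = M" using p by (auto simp: in_Hom)
  have "diff_arr C f g \<cdot> e = Zero C E M'" using eq_comp_iff[OF p(5) f g] eq[OF p(2,5)] by simp
  then obtain y where y: "y \<in> Hom C (shO C D) M'" "y \<cdot> c = diff_arr C f g"
    using tri_extend2[OF p(3), of "diff_arr C f g" M'] diff_in[OF f g] dm by metis
  have "y = Zero C (shO C D) M'" using M' p(1) y(1) unfolding tle_of_def by blast
  then have "diff_arr C f g = Zero C M M'" using y(2) tri_in(3)[OF p(3)] dm M'o by (simp add: in_Hom)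
  then show ?thesis using diff_zero_iff[OF f g] by simp
qed

abbreviation Hcat :: "('o, 'm) preadditive" where "Hcat \<equiv> full_subcat C (wle \<inter> wge)"

abbreviation Tcat :: "('o, 'm) preadditive" where "Tcat \<equiv> full_subcat C (tle_of \<inter> wge)"

text \<open>The restricted Yoneda functor, with values transported into the universe.\<close>

definition yo_obj :: "'o \<Rightarrow> ('o, 'm, 'u monoid, 'u ab_arr) ftor" where
  "yo_obj M = small_ftor Hcat (\<lambda>Q. hom_group C Q M) (\<lambda>r q. q \<cdot> r)"

definition yo_comp :: "'m \<Rightarrow> 'o \<Rightarrow> 'u ab_arr" where
  "yo_comp f Q = (tr (hom_group C Q (Dom C f)),
     \<lambda>x\<in>carrier (tr (hom_group C Q (Dom C f))). enc (hom_group C Q (Cod C f)) (f \<cdot> dec (hom_group C Q (Dom C f)) x),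
     tr (hom_group C Q (Cod C f)))"

definition yo_arr :: "'m \<Rightarrow> ('o, 'm, 'u monoid, 'u ab_arr) ftor \<times> ('o \<Rightarrow> 'u ab_arr) \<times> ('o, 'm, 'u monoid, 'u ab_arr) ftor" where
  "yo_arr f = (yo_obj (Dom C f), \<lambda>Q\<in>Obj Hcat. yo_comp f Q, yo_obj (Cod C f))"

definition yo :: "('o, 'm, ('o, 'm, 'u monoid, 'u ab_arr) ftor,
    ('o, 'm, 'u monoid, 'u ab_arr) ftor \<times> ('o \<Rightarrow> 'u ab_arr) \<times> ('o, 'm, 'u monoid, 'u ab_arr) ftor) ftor" where
  "yo = \<lparr>FO = yo_obj, FA = yo_arr\<rparr>"

lemma Hw_sub: "wle \<inter> wge \<subseteq> Obj C"
  using wge_sub by blast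

lemma Hcat_obj: "Obj Hcat = wle \<inter> wge"
  using Hw_sub by auto

lemma Tcat_obj: "Obj Tcat = tle_of \<inter> wge"
  using wge_sub by auto

lemma Hcat_preadditive: "is_preadditive Hcat" and Tcat_preadditive: "is_preadditive Tcat"
  by (rule full_subcat_preadditive)+

text \<open>
  The restricted Yoneda functor is full by \<open>heart_dense\<close> and faithful by \<open>heart_detects\<close>.  It is
  essentially surjective by \<open>heart_representable\<close>.  The coproducts of the heart of \<open>w\<close> agree with those of \<open>C\<close>,
  since both classes of the weight structure are closed under coproducts; this translates between
  functors that respect products and \<open>takes_coproducts\<close>.
\<close>

theorem heart_equivalence:
  assumes univ: "universe TYPE('u)" and ls: "locally_small TYPE('u) C"
    and br: "brown_representability TYPE('u) C"
    and sm: "smashing TYPE('u) C" and clo: "closed_under_coproducts TYPE('u) C wge"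
  shows "equivalent_categories (heart C tle_of wge) (additive_product_functors TYPE('u) (op_cat (heart C wle wge)))"
proof -
  let ?S = "{F. additive_functor (op_cat Hcat) Ab F \<and> preserves_products TYPE('u) (op_cat Hcat) Ab F}"
  let ?FC = "functor_category (op_cat Hcat) (Ab :: ('u monoid, 'u ab_arr) preadditive) ?S"
  let ?yo = "yo :: ('o, 'm, ('o, 'm, 'u monoid, 'u ab_arr) ftor,
    ('o, 'm, 'u monoid, 'u ab_arr) ftor \<times> ('o \<Rightarrow> 'u ab_arr) \<times> ('o, 'm, 'u monoid, 'u ab_arr) ftor) ftor"
  let ?yo_obj = "yo_obj :: 'o \<Rightarrow> ('o, 'm, 'u monoid, 'u ab_arr) ftor"
  let ?yo_comp = "yo_comp :: 'm \<Rightarrow> 'o \<Rightarrow> 'u ab_arr"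
  interpret H: preadd Hcat by unfold_locales (rule Hcat_preadditive)
  interpret T: preadd Tcat by unfold_locales (rule Tcat_preadditive)
  have opH: "is_category (op_cat Hcat)" by (rule op_category[OF H.cat])
  interpret FC: precat ?FC by unfold_locales (rule functor_category_category[OF opH Ab_category])
  have s: "small TYPE('u) (carrier (hom_group C Q M))" if "Q \<in> Obj C" "M \<in> Obj C" for Q M
    using ls that by (simp add: locally_small_def)
  have cloH: "closed_under_coproducts TYPE('u) C (wle \<inter> wge)"
    unfolding closed_under_coproducts_def
  proof (intro allI impI, elim conjE)
    fix I :: "'u set" and X P \<iota>
    assume I: "small TYPE('u) I" and X: "\<forall>i\<in>I. X i \<in> wle \<inter> wge" and P: "is_coproduct C I X P \<iota>"
    have "P \<in> wle" by (rule wle_coproduct[OF _ P]) (use X in blast)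
    moreover have "P \<in> wge" by (rule closed_coproduct[OF clo I P]) (use X in blast)
    ultimately show "P \<in> wle \<inter> wge" by blast
  qed
  have Ho: "Q \<in> Obj C" if "Q \<in> wle \<inter> wge" for Q using that Hw_sub by blast
  have To: "M \<in> Obj C" if "M \<in> tle_of \<inter> wge" for M using that wge_obj by blast
  have FO: "FO (?yo_obj M) Q = tr (hom_group C Q M)" if "Q \<in> wle \<inter> wge" for Q M
    using that Ho by (simp add: yo_obj_def small_ftor_FO)
  have FA: "ab_fun (FA (?yo_obj M) r) (enc (hom_group C Q M) q) = enc (hom_group C R M) (q \<cdot> r)"
    if Q: "Q \<in> wle \<inter> wge" and R: "R \<in> wle \<inter> wge" and M: "M \<in> Obj C" and q: "q \<in> Hom C Q M" and r: "r \<in> Hom C R Q"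
    for Q R M q r
  proof -
    have r': "r \<in> Hom Hcat R Q" using Q R r by (simp add: full_subcat_hom_iff)
    have q': "(enc (hom_group C Q M) q :: 'u) \<in> carrier (tr (hom_group C Q M))" using q by (intro enc_in) simp
    show ?thesis
      using small_ftor_FA[where N = "\<lambda>Q. hom_group C Q M" and act = "\<lambda>r q. q \<cdot> r", OF r' q']
        dec_enc[OF s[OF Ho[OF Q] M], of q] q by (simp add: yo_obj_def)
  qed
  have yo_obj: "?yo_obj M \<in> Obj ?FC" if M: "M \<in> Obj C" for M
  proof -
    have "presheaf Hcat (Obj Hcat) (\<lambda>Q. hom_group C Q M) (\<lambda>r q. q \<cdot> r)"
      unfolding presheaf_full_subcat[OF Hw_sub] by (rule hom_presheaf[OF Hw_sub M])
    then interpret P: presheaf Hcat "Obj Hcat" "\<lambda>Q. hom_group C Q M" "\<lambda>r q. q \<cdot> r" .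
    have sH: "small TYPE('u) (carrier (hom_group C Q M))" if "Q \<in> Obj Hcat" for Q using s M that by simp
    have cop: "takes_coproducts TYPE('u) Hcat (Obj Hcat) (\<lambda>Q. hom_group C Q M) (\<lambda>r q. q \<cdot> r)"
      unfolding takes_coproducts_full_subcat[OF sm Hw_sub cloH] by (rule hom_takes_coproducts[OF M])
    have add: "additive_functor (op_cat Hcat) Ab (?yo_obj M)"
      unfolding yo_obj_def by (rule P.small_ftor_additive[OF sH]) auto
    moreover have "preserves_products TYPE('u) (op_cat Hcat) Ab (?yo_obj M)"
      unfolding yo_obj_def by (rule P.small_ftor_products[OF univ sH _ cop]) auto
    moreover have "FO (?yo_obj M) \<in> extensional (Obj Hcat)" "FA (?yo_obj M) \<in> extensional (Arr Hcat)"
      unfolding yo_obj_def small_ftor_def by simp_all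
    ultimately show ?thesis unfolding functor_category_simps(1) op_cat_simps by (simp add: additive_functor_def)
  qed
  have FAin: "FA (?yo_obj M) r \<in> Hom Ab (tr (hom_group C Q M)) (tr (hom_group C R M))"
    if M: "M \<in> Obj C" and Q: "Q \<in> wle \<inter> wge" and R: "R \<in> wle \<inter> wge" and r: "r \<in> Hom C R Q" for M Q R r
  proof -
    have "is_functor (op_cat Hcat) Ab (?yo_obj M)" using yo_obj[OF M] by simp
    moreover have "r \<in> Arr Hcat" "Dom C r = R" "Cod C r = Q" using Q R r by (auto simp: full_subcat_arr in_Hom)
    ultimately show ?thesis unfolding is_functor_def op_cat_simps full_subcat_simps using FO Q R by auto
  qed
  have tr_elem: "\<exists>q\<in>Hom C Q M. x = enc (hom_group C Q M) q" if "x \<in> carrier (tr (hom_group C Q M) :: 'u monoid)" for x Q M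
    using that by (auto simp: tr_def)
  have comp: "?yo_comp f Q \<in> Hom Ab (tr (hom_group C Q M)) (tr (hom_group C Q M'))"
    "\<And>q. q \<in> Hom C Q M \<Longrightarrow> ab_fun (?yo_comp f Q) (enc (hom_group C Q M) q) = enc (hom_group C Q M') (f \<cdot> q)"
    if Q: "Q \<in> wle \<inter> wge" and f: "f \<in> Hom C M M'" for f Q M M'
  proof -
    have o: "Q \<in> Obj C" "M \<in> Obj C" "M' \<in> Obj C" using Ho[OF Q] hom_obj[OF f] by auto
    have eq: "?yo_comp f Q = (tr (hom_group C Q M), restrict (\<lambda>x. enc (hom_group C Q M') (f \<cdot> dec (hom_group C Q M) x))
        (carrier (tr (hom_group C Q M))), tr (hom_group C Q M'))"
      using f by (simp add: yo_comp_def in_Hom)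
    have d: "dec (hom_group C Q M) (enc (hom_group C Q M) q :: 'u) = q" if "q \<in> Hom C Q M" for q
      using dec_enc[OF s[OF o(1,2)], of q] that by simp
    have G: "comm_group (hom_group C Q M)" "comm_group (hom_group C Q M')" using o by auto
    have "(\<lambda>x :: 'u. enc (hom_group C Q M') (f \<cdot> dec (hom_group C Q M) x)) \<in>
        hom (tr (hom_group C Q M)) (tr (hom_group C Q M') :: 'u monoid)"
    proof (rule homI)
      fix x :: 'u assume x: "x \<in> carrier (tr (hom_group C Q M))"
      have dx: "dec (hom_group C Q M) x \<in> Hom C Q M" using dec_in[OF x] by simp
      have fx: "f \<cdot> dec (hom_group C Q M) x \<in> carrier (hom_group C Q M')" using dx f by auto
      then show "enc (hom_group C Q M') (f \<cdot> dec (hom_group C Q M) x) \<in> carrier (tr (hom_group C Q M'))" by (rule enc_in)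
      fix y :: 'u assume y: "y \<in> carrier (tr (hom_group C Q M))"
      have dy: "dec (hom_group C Q M) y \<in> Hom C Q M" using dec_in[OF y] by simp
      have fy: "f \<cdot> dec (hom_group C Q M) y \<in> carrier (hom_group C Q M')" using dy f by auto
      show "enc (hom_group C Q M') (f \<cdot> dec (hom_group C Q M) (x \<otimes>\<^bsub>tr (hom_group C Q M)\<^esub> y)) =
          (enc (hom_group C Q M') (f \<cdot> dec (hom_group C Q M) x) \<otimes>\<^bsub>tr (hom_group C Q M')\<^esub>
          enc (hom_group C Q M') (f \<cdot> dec (hom_group C Q M) y) :: 'u)"
        using dec_mult[OF s[OF o(1,2)] G(1) x y] comp_add[OF dx dy f] enc_mult[OF s[OF o(1,3)] fx fy] by simp
    qed
    then show "?yo_comp f Q \<in> Hom Ab (tr (hom_group C Q M)) (tr (hom_group C Q M'))"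
      unfolding eq
      using tr_comm_group[OF s[OF o(1,2)] G(1)] tr_comm_group[OF s[OF o(1,3)] G(2)]
        tr_small[OF s[OF o(1,2)]] tr_small[OF s[OF o(1,3)]] by (intro Ab_homI)
    fix q assume q: "q \<in> Hom C Q M"
    then have "(enc (hom_group C Q M) q :: 'u) \<in> carrier (tr (hom_group C Q M))" by (intro enc_in) simp
    then show "ab_fun (?yo_comp f Q) (enc (hom_group C Q M) q) = enc (hom_group C Q M') (f \<cdot> q)"
      unfolding eq using d[OF q] by (simp add: ab_fun_def)
  qed
  have enc_q: "(enc (hom_group C Q M) q :: 'u) \<in> carrier (tr (hom_group C Q M))" if "q \<in> Hom C Q M" for q Q M
    using that by (intro enc_in) simp
  have yo_arr: "yo_arr f \<in> Hom ?FC (yo_obj M) (yo_obj M')" if f: "f \<in> Hom C M M'" for f M M'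
  proof -
    have o: "M \<in> Obj C" "M' \<in> Obj C" using hom_obj[OF f] by auto
    have D: "Dom C f = M" "Cod C f = M'" using f by (auto simp: in_Hom)
    have "nat_trans (op_cat Hcat) Ab (yo_obj M) (yo_obj M') (\<lambda>Q\<in>Obj Hcat. ?yo_comp f Q)"
      unfolding nat_trans_def op_cat_simps Hcat_obj
    proof (intro conjI ballI)
      fix Q assume Q: "Q \<in> wle \<inter> wge"
      show "(\<lambda>Q\<in>wle \<inter> wge. ?yo_comp f Q) Q \<in> Hom Ab (FO (yo_obj M) Q) (FO (yo_obj M') Q)"
        using comp(1)[OF Q f] FO[OF Q] Q by simp
    next
      fix r assume "r \<in> Arr Hcat"
      then have QR: "Cod C r \<in> wle \<inter> wge" "Dom C r \<in> wle \<inter> wge" and r: "r \<in> Hom C (Dom C r) (Cod C r)"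
        by (auto simp: full_subcat_arr in_Hom)
      note Fr = FAin[OF o(1) QR r] and Fr' = FAin[OF o(2) QR r] and cQ = comp(1)[OF QR(1) f] and cR = comp(1)[OF QR(2) f]
      have "?yo_comp f (Dom C r) \<cdot>\<^bsub>Ab\<^esub> FA (yo_obj M) r = FA (yo_obj M') r \<cdot>\<^bsub>Ab\<^esub> ?yo_comp f (Cod C r)"
      proof (rule Ab_hom_eq[OF Ab_comp_in[OF Fr cR] Ab_comp_in[OF cQ Fr']])
        fix x :: 'u assume x: "x \<in> carrier (tr (hom_group C (Cod C r) M))"
        then obtain q where q: "q \<in> Hom C (Cod C r) M" "x = enc (hom_group C (Cod C r) M) q" using tr_elem by blast
        have fq: "f \<cdot> q \<in> Hom C (Cod C r) M'" "q \<cdot> r \<in> Hom C (Dom C r) M" using f q r by blast+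
        show "ab_fun (?yo_comp f (Dom C r) \<cdot>\<^bsub>Ab\<^esub> FA (yo_obj M) r) x = ab_fun (FA (yo_obj M') r \<cdot>\<^bsub>Ab\<^esub> ?yo_comp f (Cod C r)) x"
          unfolding ab_fun_comp[OF Fr cR x] ab_fun_comp[OF cQ Fr' x]
          unfolding q(2) FA[OF QR o(1) q(1) r]
            comp(2)[OF QR(1) f q(1)] FA[OF QR o(2) fq(1) r] comp(2)[OF QR(2) f fq(2)]
          using f q(1) r by (simp add: assoc in_Hom)
      qed
      then show "(\<lambda>Q\<in>wle \<inter> wge. ?yo_comp f Q) (Dom Hcat r) \<cdot>\<^bsub>Ab\<^esub> FA (yo_obj M) r =
          FA (yo_obj M') r \<cdot>\<^bsub>Ab\<^esub> (\<lambda>Q\<in>wle \<inter> wge. ?yo_comp f Q) (Cod Hcat r)"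
        using QR by simp
    qed
    then show ?thesis unfolding yo_arr_def D functor_category_hom using yo_obj o by simp
  qed
  have yo_functor: "is_functor Tcat ?FC ?yo"
    unfolding is_functor_def
  proof (intro conjI ballI impI)
    fix M assume M0: "M \<in> Obj Tcat"
    then have M: "M \<in> Obj C" by simp
    show "FO ?yo M \<in> Obj ?FC" using yo_obj[OF M] by (simp add: yo_def)
    have i: "Id C M \<in> Hom C M M" using M by simp
    have "?yo_comp (Id C M) Q = Id Ab (tr (hom_group C Q M))" if Q: "Q \<in> wle \<inter> wge" for Q
    proof (rule Ab_hom_eq[OF comp(1)[OF Q i] Ab_id_in])
      show "(tr (hom_group C Q M) :: 'u monoid) \<in> Obj Ab" using Ab_hom_obj[OF comp(1)[OF Q i]] by blast
      fix x :: 'u assume x: "x \<in> carrier (tr (hom_group C Q M))"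
      then obtain q where q: "q \<in> Hom C Q M" "x = enc (hom_group C Q M) q" using tr_elem by blast
      show "ab_fun (?yo_comp (Id C M) Q) x = ab_fun (Id Ab (tr (hom_group C Q M))) x"
        unfolding ab_fun_id[OF x] unfolding q(2) comp(2)[OF Q i q(1)] using q(1) by (simp add: in_Hom)
    qed
    then show "FA ?yo (Id Tcat M) = Id ?FC (FO ?yo M)"
      using M FO Hcat_obj by (auto simp: yo_def yo_arr_def intro!: restrict_ext)
  next
    fix f assume "f \<in> Arr Tcat"
    then have f: "f \<in> Hom C (Dom C f) (Cod C f)" by (simp add: full_subcat_arr in_Hom)
    show "FA ?yo f \<in> Hom ?FC (FO ?yo (Dom Tcat f)) (FO ?yo (Cod Tcat f))" using yo_arr[OF f] by (simp add: yo_def)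
    fix g assume "g \<in> Arr Tcat" "Cod Tcat f = Dom Tcat g"
    then have g: "g \<in> Hom C (Cod C f) (Cod C g)" by (simp add: full_subcat_arr in_Hom)
    note gf = comp_in[OF f g]
    have "?yo_comp (g \<cdot> f) Q = ?yo_comp g Q \<cdot>\<^bsub>Ab\<^esub> ?yo_comp f Q" if Q: "Q \<in> wle \<inter> wge" for Q
    proof (rule Ab_hom_eq[OF comp(1)[OF Q gf] Ab_comp_in[OF comp(1)[OF Q f] comp(1)[OF Q g]]])
      fix x :: 'u assume x: "x \<in> carrier (tr (hom_group C Q (Dom C f)))"
      then obtain q where q: "q \<in> Hom C Q (Dom C f)" "x = enc (hom_group C Q (Dom C f)) q" using tr_elem by blast
      show "ab_fun (?yo_comp (g \<cdot> f) Q) x = ab_fun (?yo_comp g Q \<cdot>\<^bsub>Ab\<^esub> ?yo_comp f Q) x"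
        unfolding ab_fun_comp[OF comp(1)[OF Q f] comp(1)[OF Q g] x] unfolding q(2) comp(2)[OF Q gf q(1)]
          comp(2)[OF Q f q(1)] comp(2)[OF Q g comp_in[OF q(1) f]]
        using f g q(1) by (simp add: assoc in_Hom)
    qed
    then have "(\<lambda>Q\<in>Obj Hcat. ?yo_comp (g \<cdot> f) Q) =
        (\<lambda>Q\<in>Obj Hcat. (\<lambda>Q\<in>Obj Hcat. ?yo_comp g Q) Q \<cdot>\<^bsub>Ab\<^esub> (\<lambda>Q\<in>Obj Hcat. ?yo_comp f Q) Q)"
      unfolding Hcat_obj by (intro restrict_ext) simp
    then show "FA ?yo (g \<cdot>\<^bsub>Tcat\<^esub> f) = FA ?yo g \<cdot>\<^bsub>?FC\<^esub> FA ?yo f"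
      using gf g f by (simp add: yo_def yo_arr_def in_Hom)
  qed
  have ff: "bij_betw (FA ?yo) (Hom Tcat M M') (Hom ?FC (FO ?yo M) (FO ?yo M'))"
    if M0: "M \<in> Obj Tcat" and M0': "M' \<in> Obj Tcat" for M M'
  proof (rule bij_betwI')
    have M: "M \<in> tle_of \<inter> wge" and M': "M' \<in> tle_of \<inter> wge" using M0 M0' Tcat_obj by auto
    have o: "M \<in> Obj C" "M' \<in> Obj C" using To M M' by auto
    have hom: "Hom Tcat M M' = Hom C M M'" by (rule full_subcat_hom[OF M M'])
    {
      fix f g assume "f \<in> Hom Tcat M M'" "g \<in> Hom Tcat M M'"
      then have f: "f \<in> Hom C M M'" and g: "g \<in> Hom C M M'" using hom by auto
      show "FA ?yo f = FA ?yo g \<longleftrightarrow> f = g"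
      proof
        assume "FA ?yo f = FA ?yo g"
        then have eq: "(\<lambda>Q\<in>Obj Hcat. ?yo_comp f Q) = (\<lambda>Q\<in>Obj Hcat. ?yo_comp g Q)" by (simp add: yo_def yo_arr_def)
        show "f = g"
        proof (rule heart_detects[OF _ _ f g])
          fix Q q assume Q: "Q \<in> wle \<inter> wge" and q: "q \<in> Hom C Q M"
          have "?yo_comp f Q = ?yo_comp g Q" using fun_cong[OF eq, of Q] Q Ho[OF Q] by simp
          then have "(enc (hom_group C Q M') (f \<cdot> q) :: 'u) = enc (hom_group C Q M') (g \<cdot> q)"
            using comp(2)[OF Q f q] comp(2)[OF Q g q] by simp
          then show "f \<cdot> q = g \<cdot> q"
            using inj_onD[OF enc_inj[OF s[OF Ho[OF Q] o(2)]]] comp_in[OF q f] comp_in[OF q g] by simp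
        qed (use M M' in auto)
      qed simp
    next
      fix f assume "f \<in> Hom Tcat M M'"
      then show "FA ?yo f \<in> Hom ?FC (FO ?yo M) (FO ?yo M')" using yo_arr hom by (simp add: yo_def)
    next
      fix t assume "t \<in> Hom ?FC (FO ?yo M) (FO ?yo M')"
      then obtain \<eta> where t: "t = (yo_obj M, \<eta>, yo_obj M')" and n: "nat_trans (op_cat Hcat) Ab (yo_obj M) (yo_obj M') \<eta>"
        and ext: "\<eta> \<in> extensional (Obj Hcat)"
        by (rule functor_category_homE) (simp add: yo_def)
      have \<eta>: "\<eta> Q \<in> Hom Ab (tr (hom_group C Q M)) (tr (hom_group C Q M'))" if "Q \<in> wle \<inter> wge" for Q
        using n that FO unfolding nat_trans_def op_cat_simps Hcat_obj by auto
      define \<theta> where "\<theta> q = dec (hom_group C (Dom C q) M') (ab_fun (\<eta> (Dom C q)) (enc (hom_group C (Dom C q) M) q))" for q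
      have \<theta>eq: "\<theta> q = dec (hom_group C Q M') (ab_fun (\<eta> Q) (enc (hom_group C Q M) q))" if "q \<in> Hom C Q M" for Q q
        using that by (simp add: \<theta>_def in_Hom)
      have \<eta>in: "ab_fun (\<eta> Q) (enc (hom_group C Q M) q) \<in> carrier (tr (hom_group C Q M'))"
        if "Q \<in> wle \<inter> wge" "q \<in> Hom C Q M" for Q q
        using Ab_hom_fun(2)[OF \<eta>[OF that(1)] enc_q[OF that(2)]] .
      have \<theta>: "\<theta> q \<in> Hom C Q M'" if "Q \<in> wle \<inter> wge" "q \<in> Hom C Q M" for Q q
        unfolding \<theta>eq[OF that(2)] using dec_in[OF \<eta>in[OF that]] by simp
      have \<eta>\<theta>: "ab_fun (\<eta> Q) (enc (hom_group C Q M) q) = enc (hom_group C Q M') (\<theta> q)"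
        if "Q \<in> wle \<inter> wge" "q \<in> Hom C Q M" for Q q
        unfolding \<theta>eq[OF that(2)] using enc_dec[OF \<eta>in[OF that]] by simp
      have nat: "\<theta> (q \<cdot> r) = \<theta> q \<cdot> r"
        if Q: "Q \<in> wle \<inter> wge" and R: "R \<in> wle \<inter> wge" and q: "q \<in> Hom C Q M" and r: "r \<in> Hom C R Q" for Q R q r
      proof -
        have "r \<in> Arr Hcat" "Dom C r = R" "Cod C r = Q" using Q R r by (auto simp: full_subcat_arr in_Hom)
        then have nr: "\<eta> R \<cdot>\<^bsub>Ab\<^esub> FA (yo_obj M) r = FA (yo_obj M') r \<cdot>\<^bsub>Ab\<^esub> \<eta> Q"
          using n unfolding nat_trans_def op_cat_simps full_subcat_simps by auto
        note qr = comp_in[OF r q]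
        have "enc (hom_group C R M') (\<theta> (q \<cdot> r)) = ab_fun (\<eta> R \<cdot>\<^bsub>Ab\<^esub> FA (yo_obj M) r) (enc (hom_group C Q M) q)"
          unfolding ab_fun_comp[OF FAin[OF o(1) Q R r] \<eta>[OF R] enc_q[OF q]] FA[OF Q R o(1) q r] \<eta>\<theta>[OF R qr] ..
        also have "\<dots> = (enc (hom_group C R M') (\<theta> q \<cdot> r) :: 'u)"
          unfolding nr ab_fun_comp[OF \<eta>[OF Q] FAin[OF o(2) Q R r] enc_q[OF q]] \<eta>\<theta>[OF Q q] FA[OF Q R o(2) \<theta>[OF Q q] r] ..
        finally show ?thesis
          using inj_onD[OF enc_inj[OF s[OF Ho[OF R] o(2)]]] \<theta>[OF R qr] comp_in[OF r \<theta>[OF Q q]] by simp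
      qed
      have "\<exists>f\<in>Hom C M M'. \<forall>Q\<in>wle \<inter> wge. \<forall>q\<in>Hom C Q M. f \<cdot> q = \<theta> q"
        by (rule heart_dense[OF _ _ \<theta> nat]) (use M M' in auto)
      then obtain f where f: "f \<in> Hom C M M'" "\<And>Q q. Q \<in> wle \<inter> wge \<Longrightarrow> q \<in> Hom C Q M \<Longrightarrow> f \<cdot> q = \<theta> q" by blast
      have "?yo_comp f Q = \<eta> Q" if Q: "Q \<in> wle \<inter> wge" for Q
      proof (rule Ab_hom_eq[OF comp(1)[OF Q f(1)] \<eta>[OF Q]])
        fix x :: 'u assume x: "x \<in> carrier (tr (hom_group C Q M))"
        then obtain q where q: "q \<in> Hom C Q M" "x = enc (hom_group C Q M) q" using tr_elem by blast
        show "ab_fun (?yo_comp f Q) x = ab_fun (\<eta> Q) x"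
          unfolding q(2) comp(2)[OF Q f(1) q(1)] f(2)[OF Q q(1)] \<eta>\<theta>[OF Q q(1)] ..
      qed
      then have "(\<lambda>Q\<in>Obj Hcat. ?yo_comp f Q) = \<eta>"
        using ext Hcat_obj by (intro extensionalityI[of _ "Obj Hcat"]) auto
      then have "t = FA ?yo f" using f(1) by (simp add: t yo_def yo_arr_def in_Hom)
      then show "\<exists>f\<in>Hom Tcat M M'. t = FA ?yo f" using f(1) hom by blast
    }
  qed
  have es: "\<exists>M\<in>Obj Tcat. isomorphic ?FC (FO ?yo M) G" if G: "G \<in> Obj ?FC" for G
  proof -
    have add: "additive_functor (op_cat Hcat) Ab G" and pp: "preserves_products TYPE('u) (op_cat Hcat) Ab G"
      and fn: "is_functor (op_cat Hcat) Ab G"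
      using G by auto
    let ?a = "\<lambda>f. ab_fun (FA G f)"
    have "presheaf C (wle \<inter> wge) (FO G) ?a"
      using ftor_presheaf[OF Hcat_preadditive add] unfolding presheaf_full_subcat[OF Hw_sub] .
    then interpret A: presheaf C "wle \<inter> wge" "FO G" ?a .
    interpret hp: heart_presheaf C wle wge "FO G" ?a by unfold_locales
    have cop: "takes_coproducts TYPE('u) C (wle \<inter> wge) (FO G) ?a"
      using ftor_takes_coproducts[OF univ Hcat_preadditive add pp]
      unfolding takes_coproducts_full_subcat[OF sm Hw_sub cloH] .
    have Gobj: "FO G Q \<in> Obj Ab" if "Q \<in> wle \<inter> wge" for Q
      using fn that unfolding is_functor_def op_cat_simps Hcat_obj by blast
    then have sG: "small TYPE('u) (carrier (FO G Q))" if "Q \<in> wle \<inter> wge" for Q using that by simp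
    obtain P v where P: "P \<in> tle_of \<inter> wge" and v: "\<And>Q. Q \<in> wle \<inter> wge \<Longrightarrow> v \<in> Group.iso (hom_group C Q P) (FO G Q)"
      and nat: "\<And>Q R q r. Q \<in> wle \<inter> wge \<Longrightarrow> R \<in> wle \<inter> wge \<Longrightarrow> q \<in> Hom C Q P \<Longrightarrow> r \<in> Hom C R Q \<Longrightarrow> v (q \<cdot> r) = ?a r (v q)"
      using hp.heart_representable[OF univ br sm clo cop sG] by blast
    have Po: "P \<in> Obj C" by (rule To[OF P])
    define \<eta> where "\<eta> = (\<lambda>Q\<in>Obj Hcat. (tr (hom_group C Q P), restrict (\<lambda>x. v (dec (hom_group C Q P) x))
        (carrier (tr (hom_group C Q P))), FO G Q) :: 'u ab_arr)"
    have \<eta>: "\<eta> Q \<in> Hom Ab (tr (hom_group C Q P)) (FO G Q)"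
      and \<eta>f: "\<And>q. q \<in> Hom C Q P \<Longrightarrow> ab_fun (\<eta> Q) (enc (hom_group C Q P) q) = v q"
      and \<eta>b: "bij_betw (ab_fun (\<eta> Q)) (carrier (tr (hom_group C Q P))) (carrier (FO G Q))"
      if Q: "Q \<in> wle \<inter> wge" for Q
    proof -
      have Qo: "Q \<in> Obj C" by (rule Ho[OF Q])
      have Gr: "comm_group (hom_group C Q P)" using Qo Po by simp
      have vh: "v \<in> hom (hom_group C Q P) (FO G Q)" "bij_betw v (Hom C Q P) (carrier (FO G Q))"
        using v[OF Q] by (auto simp: Group.iso_def)
      have eq: "\<eta> Q = (tr (hom_group C Q P), restrict (\<lambda>x. v (dec (hom_group C Q P) x)) (carrier (tr (hom_group C Q P))), FO G Q)"
        using Q Hcat_obj by (simp add: \<eta>_def)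
      have "(\<lambda>x :: 'u. v (dec (hom_group C Q P) x)) \<in> hom (tr (hom_group C Q P)) (FO G Q)"
      proof (rule homI)
        fix x :: 'u assume x: "x \<in> carrier (tr (hom_group C Q P))"
        show "v (dec (hom_group C Q P) x) \<in> carrier (FO G Q)" using hom_in_carrier[OF vh(1) dec_in[OF x]] .
        fix y :: 'u assume y: "y \<in> carrier (tr (hom_group C Q P))"
        show "v (dec (hom_group C Q P) (x \<otimes>\<^bsub>tr (hom_group C Q P)\<^esub> y)) =
            v (dec (hom_group C Q P) x) \<otimes>\<^bsub>FO G Q\<^esub> v (dec (hom_group C Q P) y)"
          unfolding dec_mult[OF s[OF Qo Po] Gr x y] by (rule hom_mult[OF vh(1) dec_in[OF x] dec_in[OF y]])
      qed
      then show h\<eta>: "\<eta> Q \<in> Hom Ab (tr (hom_group C Q P)) (FO G Q)"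
        unfolding eq using tr_comm_group[OF s[OF Qo Po] Gr] tr_small[OF s[OF Qo Po]] Gobj[OF Q] by (intro Ab_homI) auto
      show app: "ab_fun (\<eta> Q) (enc (hom_group C Q P) q) = v q" if q: "q \<in> Hom C Q P" for q
        using enc_q[OF q] dec_enc[OF s[OF Qo Po], of q] q by (simp add: eq ab_fun_def)
      show "bij_betw (ab_fun (\<eta> Q)) (carrier (tr (hom_group C Q P))) (carrier (FO G Q))"
      proof (rule bij_betwI')
        fix x y :: 'u assume "x \<in> carrier (tr (hom_group C Q P))" "y \<in> carrier (tr (hom_group C Q P))"
        then obtain p q where "p \<in> Hom C Q P" "x = enc (hom_group C Q P) p" "q \<in> Hom C Q P" "y = enc (hom_group C Q P) q"
          using tr_elem by metis
        then show "ab_fun (\<eta> Q) x = ab_fun (\<eta> Q) y \<longleftrightarrow> x = y"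
          using app inj_onD[OF bij_betw_imp_inj_on[OF vh(2)]] by metis
      next
        fix x :: 'u assume "x \<in> carrier (tr (hom_group C Q P))"
        then show "ab_fun (\<eta> Q) x \<in> carrier (FO G Q)" by (rule Ab_hom_fun(2)[OF h\<eta>])
      next
        fix a assume "a \<in> carrier (FO G Q)"
        then obtain q where "q \<in> Hom C Q P" "a = v q" using bij_betw_imp_surj_on[OF vh(2)] by blast
        then show "\<exists>x\<in>carrier (tr (hom_group C Q P)). a = ab_fun (\<eta> Q) x" using app enc_q by metis
      qed
    qed
    have "nat_trans (op_cat Hcat) Ab (yo_obj P) G \<eta>"
      unfolding nat_trans_def op_cat_simps Hcat_obj
    proof (intro conjI ballI)
      fix Q assume Q: "Q \<in> wle \<inter> wge"
      show "\<eta> Q \<in> Hom Ab (FO (yo_obj P) Q) (FO G Q)" using \<eta>[OF Q] FO[OF Q] by simp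
    next
      fix r assume rA: "r \<in> Arr Hcat"
      then have QR: "Cod C r \<in> wle \<inter> wge" "Dom C r \<in> wle \<inter> wge" and r: "r \<in> Hom C (Dom C r) (Cod C r)"
        by (auto simp: full_subcat_arr in_Hom)
      have Gr: "FA G r \<in> Hom Ab (FO G (Cod C r)) (FO G (Dom C r))"
        using fn rA unfolding is_functor_def op_cat_simps full_subcat_simps by blast
      note Fr = FAin[OF Po QR r]
      have "\<eta> (Dom C r) \<cdot>\<^bsub>Ab\<^esub> FA (yo_obj P) r = FA G r \<cdot>\<^bsub>Ab\<^esub> \<eta> (Cod C r)"
      proof (rule Ab_hom_eq[OF Ab_comp_in[OF Fr \<eta>[OF QR(2)]] Ab_comp_in[OF \<eta>[OF QR(1)] Gr]])
        fix x :: 'u assume x: "x \<in> carrier (tr (hom_group C (Cod C r) P))"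
        then obtain q where q: "q \<in> Hom C (Cod C r) P" "x = enc (hom_group C (Cod C r) P) q" using tr_elem by blast
        show "ab_fun (\<eta> (Dom C r) \<cdot>\<^bsub>Ab\<^esub> FA (yo_obj P) r) x = ab_fun (FA G r \<cdot>\<^bsub>Ab\<^esub> \<eta> (Cod C r)) x"
          unfolding ab_fun_comp[OF Fr \<eta>[OF QR(2)] x] ab_fun_comp[OF \<eta>[OF QR(1)] Gr x]
          unfolding q(2) FA[OF QR Po q(1) r] \<eta>f[OF QR(1) q(1)] \<eta>f[OF QR(2) comp_in[OF r q(1)]]
          by (rule nat[OF QR q(1) r])
      qed
      then show "\<eta> (Dom Hcat r) \<cdot>\<^bsub>Ab\<^esub> FA (yo_obj P) r = FA G r \<cdot>\<^bsub>Ab\<^esub> \<eta> (Cod Hcat r)" by simp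
    qed
    then have h: "(yo_obj P, \<eta>, G) \<in> Hom ?FC (yo_obj P) G"
      unfolding functor_category_hom using yo_obj[OF Po] G by (simp add: \<eta>_def)
    have "is_iso_arr ?FC (yo_obj P, \<eta>, G)"
      by (rule functor_category_iso[OF opH Ab_category h]) (use Ab_iso[OF \<eta> \<eta>b] Hcat_obj in simp)
    then have "isomorphic ?FC (FO ?yo P) G" unfolding isomorphic_def using h by (auto simp: yo_def)
    then show ?thesis using P Tcat_obj by blast
  qed
  have "equivalent_categories Tcat ?FC"
    by (rule equivalence_criterion[OF T.cat FC.cat yo_functor ff es])
  then show ?thesis by (simp add: heart_def additive_product_functors_def)
qed

end

theorem theorem3p2p3:
  fixes C :: "('o, 'm) tricat" and wle wge :: "'o set"
  assumes "universe TYPE('u)"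
    and "is_triangulated C" and "locally_small TYPE('u) C"
    and "smashing TYPE('u) C" and "brown_representability TYPE('u) C"
    and "weight_structure C wle wge"
  shows "((\<exists>tle tge. t_structure C tle tge \<and> left_adjacent C tle tge wle wge) \<longleftrightarrow>
            smashing_weight_structure TYPE('u) C wle wge) \<and>
         (\<forall>tle tge. t_structure C tle tge \<and> left_adjacent C tle tge wle wge \<longrightarrow>
            cosmashing_t_structure TYPE('u) C tle tge \<and>
            equivalent_categories (heart C tle tge)
              (additive_product_functors TYPE('u) (op_cat (heart C wle wge))))"
proof -
  interpret weighted C wle wge
    using assms(2,6) by unfold_locales
  note univ = assms(1) and ls = assms(3) and sm = assms(4) and br = assms(5)
  show ?thesis
  proof (intro conjI iffI allI impI)
    assume "\<exists>tle tge. t_structure C tle tge \<and> left_adjacent C tle tge wle wge"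
    then show "smashing_weight_structure TYPE('u) C wle wge"
      unfolding smashing_weight_structure_def using w sm adjacent_coproducts by blast
  next
    assume "smashing_weight_structure TYPE('u) C wle wge"
    then have "closed_under_coproducts TYPE('u) C wge" by (simp add: smashing_weight_structure_def)
    from adjacent_exists[OF univ ls br sm this]
    show "\<exists>tle tge. t_structure C tle tge \<and> left_adjacent C tle tge wle wge" by blast
  next
    fix tle tge assume "t_structure C tle tge \<and> left_adjacent C tle tge wle wge"
    then have t: "t_structure C tle tge" and adj: "left_adjacent C tle tge wle wge" by auto
    have eq: "tge = wge" "tle = tle_of" using adjacent_unique[OF t adj] by auto
    show "cosmashing_t_structure TYPE('u) C tle tge"
      unfolding cosmashing_t_structure_def
      using t brown_cosmashing[OF univ ls br] wge_products eq(1) by blast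
    show "equivalent_categories (heart C tle tge) (additive_product_functors TYPE('u) (op_cat (heart C wle wge)))"
      unfolding eq by (rule heart_equivalence[OF univ ls br sm adjacent_coproducts[OF t adj]])
  qed
qed

end
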